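(* Let $k$ be a field and $P$ a finite connected poset. For $S,T\in\mathrm{Int}(P)$ and $p\ge0$, $$\mathrm{Ext}^p_{\Lambda_P}(\mathsf L(S),\nabla(T))\cong\begin{cases}\det(\mathrm{Max}(T\setminus S)),&(S,T)\in\Upsilon^+(P)\text{ and }p=\omega^+(S,T),\\0,&\text{otherwise.}\end{cases}$$
   Context: A subset $S\subseteq P$ is connected if any $x,y\in S$ are joined by a sequence $x=x_0,\dots,x_r=y$ in $S$ with $x_{i-1},x_i$ comparable for all $i$; convex if $x,y\in S$ and $x\le z\le y$ imply $z\in S$; an interval if it is nonempty, connected and convex. $\mathrm{Int}(P)$ is the set of intervals of $P$. Representations of $P$ are functors from $P$ to finite-dimensional $k$-vector spaces, with morphism spaces $\mathrm{Hom}_P$. For $S\in\mathrm{Int}(P)$, $\mathbb I_S$ is the representation with $\mathbb I_S(x)=k$ for $x\in S$ and $0$ otherwise, and $\mathbb I_S(x\le y)=\mathrm{id}$ if $x,y\in S$ and $0$ otherwise. Put $G_P=\bigoplus_{S\in\mathrm{Int}(P)}\mathbb I_S$ and $\Lambda_P=\mathrm{End}_P(G_P)^{\mathrm{op}}$; $e_S\in\Lambda_P$ is the idempotent of the summand $\mathbb I_S$, so $e_R\Lambda_Pe_S=\mathrm{Hom}_P(\mathbb I_R,\mathbb I_S)$. All modules are finitely generated left modules. $\mathsf L(S)$ is the simple top of $\Lambda_Pe_S$, and $\mathsf I(S)=\mathrm{Hom}_k(e_S\Lambda_P,k)$ is the indecomposable injective module. $\Lambda_P$ carries the quasi-hereditary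 order on $\mathrm{Int}(P)$ given by $R\preceq S$ iff $R=S$ or $|R|>|S|$. The costandard module $\nabla(S)$ is the largest submodule of $\mathsf I(S)$ all of whose composition factors are of the form $\mathsf L(R)$ with $R\preceq S$. For an interval $T$, a subset $S\subseteq T$ is a relative downset in $T$ if $s\in S$, $x\in T$, $x\le s$ imply $x\in S$; $\mathcal D(T)$ is the set of intervals contained in $T$ that are relative downsets in $T$. For $S\in\mathcal D(T)$ put $\partial_T^+S=\{x\in T\setminus S\mid s\lessdot_Tx\text{ for some }s\in S\}$, where $\lessdot_T$ is the covering relation in $T$. $\Upsilon^+(P)$ is the set of pairs $(S,T)$ with $T\in\mathrm{Int}(P)$, $S\in\mathcal D(T)$ and $\partial_T^+S=\mathrm{Max}(T\setminus S)$ (the set of maximal elements of $T\setminus S$); for such a pair, $\omega^+(S,T)=|\mathrm{Max}(T\setminus S)|$. In particular $(T,T)\in\Upsilon^+(P)$ with $\omega^+(T,T)=0$. For a finite set $X$, $\det(X)=\bigwedge^{|X|}k^X$ is the one-dimensional top exterior power of the free $k$-vector space on $X$. *)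

theory Defs
  imports "HOL-Algebra.AbelCoset" "HOL-Algebra.Module"
begin

text \<open>
  Conventions. HOL-Algebra's locale \<open>module\<close> requires a commutative ring, but its record type
  does not: here a left module over a (possibly noncommutative) ring is an element of that record
  type, with the components \<open>mult\<close> and \<open>one\<close> left undefined. An algebra \<open>A\<close> over a field \<open>K\<close> is
  an element of the same record type with all components in use; \<open>smult A\<close> is the action of \<open>K\<close>.
  The structure maps are only meaningful on the carriers, and functions between structures are
  extensional, so that they are determined by their values on the carrier.
\<close>

section \<open>Modules over a ring\<close>

definition lin_hom ::
  "('r, 'x) ring_scheme \<Rightarrow> ('r, 'm) module \<Rightarrow> ('r, 'n) module \<Rightarrow> ('m \<Rightarrow> 'n) set" where
  "lin_hom R M N = {f \<in> carrier M \<rightarrow>\<^sub>E carrier N.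
     (\<forall>x\<in>carrier M. \<forall>y\<in>carrier M. f (x \<oplus>\<^bsub>M\<^esub> y) = f x \<oplus>\<^bsub>N\<^esub> f y) \<and>
     (\<forall>r\<in>carrier R. \<forall>x\<in>carrier M. f (r \<odot>\<^bsub>M\<^esub> x) = r \<odot>\<^bsub>N\<^esub> f x)}"

definition mod_iso ::
  "('r, 'm) module \<Rightarrow> ('r, 'x) ring_scheme \<Rightarrow> ('r, 'n) module \<Rightarrow> bool"
  (\<open>_ \<simeq>\<^bsub>_\<^esub> _\<close> [51, 0, 51] 50) where
  "M \<simeq>\<^bsub>R\<^esub> N \<longleftrightarrow> (\<exists>f\<in>lin_hom R M N. bij_betw f (carrier M) (carrier N))"

definition regular :: "('r, 'x) ring_scheme \<Rightarrow> ('r, 'r) module" where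
  "regular R = \<lparr>carrier = carrier R, mult = undefined, one = undefined,
     zero = \<zero>\<^bsub>R\<^esub>, add = add R, smult = mult R\<rparr>"

text \<open>The direct sum of a finite family (for infinite \<open>I\<close> this would be the product).\<close>

definition dsum :: "'i set \<Rightarrow> ('i \<Rightarrow> ('r, 'm) module) \<Rightarrow> ('r, 'i \<Rightarrow> 'm) module" where
  "dsum I M = \<lparr>carrier = (\<Pi>\<^sub>E i\<in>I. carrier (M i)), mult = undefined, one = undefined,
     zero = (\<lambda>i\<in>I. \<zero>\<^bsub>M i\<^esub>), add = (\<lambda>f g. \<lambda>i\<in>I. f i \<oplus>\<^bsub>M i\<^esub> g i),
     smult = (\<lambda>r f. \<lambda>i\<in>I. r \<odot>\<^bsub>M i\<^esub> f i)\<rparr>"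

text \<open>The union in \<open>smult\<close> avoids choosing a representative of the coset \<open>X\<close>: for a submodule \<open>N\<close>
  all the cosets in it coincide.\<close>

definition quot_module :: "('r, 'm) module \<Rightarrow> 'm set \<Rightarrow> ('r, 'm set) module" where
  "quot_module M N = \<lparr>carrier = a_rcosets\<^bsub>M\<^esub> N, mult = undefined, one = undefined,
     zero = N, add = set_add M, smult = (\<lambda>r X. \<Union>x\<in>X. N +>\<^bsub>M\<^esub> (r \<odot>\<^bsub>M\<^esub> x))\<rparr>"

definition gen_submodule :: "('r, 'x) ring_scheme \<Rightarrow> ('r, 'm) module \<Rightarrow> 'm set \<Rightarrow> 'm set" where
  "gen_submodule R M X = \<Inter>{N. submodule N R M \<and> X \<subseteq> N}"

definition simple_module :: "('r, 'x) ring_scheme \<Rightarrow> ('r, 'm) module \<Rightarrow> bool" where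
  "simple_module R M \<longleftrightarrow> carrier M \<noteq> {\<zero>\<^bsub>M\<^esub>} \<and>
     (\<forall>N. submodule N R M \<longrightarrow> N = {\<zero>\<^bsub>M\<^esub>} \<or> N = carrier M)"

definition maximal_submodule :: "('r, 'x) ring_scheme \<Rightarrow> ('r, 'm) module \<Rightarrow> 'm set \<Rightarrow> bool" where
  "maximal_submodule R M N \<longleftrightarrow> submodule N R M \<and> N \<noteq> carrier M \<and>
     (\<forall>N'. submodule N' R M \<and> N \<subseteq> N' \<longrightarrow> N' = N \<or> N' = carrier M)"

definition mod_radical :: "('r, 'x) ring_scheme \<Rightarrow> ('r, 'm) module \<Rightarrow> 'm set" where
  "mod_radical R M = carrier M \<inter> \<Inter>{N. maximal_submodule R M N}"

definition mod_top :: "('r, 'x) ring_scheme \<Rightarrow> ('r, 'm) module \<Rightarrow> ('r, 'm set) module" where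
  "mod_top R M = quot_module M (mod_radical R M)"

definition subquotient :: "('r, 'm) module \<Rightarrow> 'm set \<Rightarrow> 'm set \<Rightarrow> ('r, 'm set) module" where
  "subquotient M N N' = quot_module (M\<lparr>carrier := N\<rparr>) N'"

definition composition_series ::
  "('r, 'x) ring_scheme \<Rightarrow> ('r, 'm) module \<Rightarrow> 'm set list \<Rightarrow> bool" where
  "composition_series R M Ns \<longleftrightarrow> Ns \<noteq> [] \<and> hd Ns = {\<zero>\<^bsub>M\<^esub>} \<and> last Ns = carrier M \<and>
     (\<forall>N\<in>set Ns. submodule N R M) \<and>
     (\<forall>i. Suc i < length Ns \<longrightarrow>
        Ns ! i \<subset> Ns ! Suc i \<and> simple_module R (subquotient M (Ns ! Suc i) (Ns ! i)))"

definition composition_factors ::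
  "('r, 'x) ring_scheme \<Rightarrow> ('r, 'm) module \<Rightarrow> ('r, 'm set) module set" where
  "composition_factors R M = {subquotient M (Ns ! Suc i) (Ns ! i) | Ns i.
     composition_series R M Ns \<and> Suc i < length Ns}"

section \<open>Ext over an algebra\<close>

definition free_module :: "('r, 'x) ring_scheme \<Rightarrow> nat \<Rightarrow> ('r, nat \<Rightarrow> 'r) module" where
  "free_module R n = dsum {..<n} (\<lambda>_. regular R)"

text \<open>The term of degree \<open>i\<close> is free of rank \<open>n i\<close>, the differential \<open>d i\<close> goes from degree
  \<open>Suc i\<close> to degree \<open>i\<close>, and \<open>e\<close> is the augmentation.\<close>

definition free_resolution ::
  "('r, 'x) ring_scheme \<Rightarrow> ('r, 'm) module \<Rightarrow> (nat \<Rightarrow> nat) \<Rightarrow>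
   (nat \<Rightarrow> (nat \<Rightarrow> 'r) \<Rightarrow> (nat \<Rightarrow> 'r)) \<Rightarrow> ((nat \<Rightarrow> 'r) \<Rightarrow> 'm) \<Rightarrow> bool" where
  "free_resolution R M n d e \<longleftrightarrow>
     e \<in> lin_hom R (free_module R (n 0)) M \<and>
     (\<forall>i. d i \<in> lin_hom R (free_module R (n (Suc i))) (free_module R (n i))) \<and>
     e ` carrier (free_module R (n 0)) = carrier M \<and>
     d 0 ` carrier (free_module R (n 1)) = {x \<in> carrier (free_module R (n 0)). e x = \<zero>\<^bsub>M\<^esub>} \<and>
     (\<forall>i. d (Suc i) ` carrier (free_module R (n (Suc (Suc i)))) =
        {x \<in> carrier (free_module R (n (Suc i))). d i x = \<zero>\<^bsub>free_module R (n i)\<^esub>})"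

text \<open>For a \<open>K\<close>-algebra \<open>A\<close> the scalar \<open>c\<close> acts on an \<open>A\<close>-module through the central element
  \<open>c \<odot> \<one>\<close> of \<open>A\<close>.\<close>

definition hom_space ::
  "('k, 'a) module \<Rightarrow> ('a, 'm) module \<Rightarrow> ('a, 'n) module \<Rightarrow> ('k, 'm \<Rightarrow> 'n) module" where
  "hom_space A M N = \<lparr>carrier = lin_hom A M N, mult = undefined, one = undefined,
     zero = (\<lambda>x\<in>carrier M. \<zero>\<^bsub>N\<^esub>), add = (\<lambda>f g. \<lambda>x\<in>carrier M. f x \<oplus>\<^bsub>N\<^esub> g x),
     smult = (\<lambda>c f. \<lambda>x\<in>carrier M. (c \<odot>\<^bsub>A\<^esub> \<one>\<^bsub>A\<^esub>) \<odot>\<^bsub>N\<^esub> f x)\<rparr>"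

definition cohomology ::
  "(nat \<Rightarrow> ('r, 'c) module) \<Rightarrow> (nat \<Rightarrow> 'c \<Rightarrow> 'c) \<Rightarrow> nat \<Rightarrow> ('r, 'c set) module" where
  "cohomology C \<delta> p = subquotient (C p)
     {z \<in> carrier (C p). \<delta> p z = \<zero>\<^bsub>C (Suc p)\<^esub>}
     (case p of 0 \<Rightarrow> {\<zero>\<^bsub>C 0\<^esub>} | Suc q \<Rightarrow> \<delta> q ` carrier (C q))"

text \<open>\<open>Ext\<close> is computed from an arbitrary resolution of the first argument by free modules of
  finite rank. Such a resolution exists whenever \<open>A\<close> is finite-dimensional and \<open>M\<close> finitely
  generated, and the result does not depend on it up to isomorphism.\<close>

definition Ext ::
  "('k, 'a) module \<Rightarrow> nat \<Rightarrow> ('a, 'm) module \<Rightarrow> ('a, 'n) module \<Rightarrow>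
   ('k, ((nat \<Rightarrow> 'a) \<Rightarrow> 'n) set) module" where
  "Ext A p M N =
     (let (n, d, e) = (SOME (n, d, e). free_resolution A M n d e)
      in cohomology (\<lambda>i. hom_space A (free_module A (n i)) N)
           (\<lambda>i f. compose (carrier (free_module A (n (Suc i)))) f (d i)) p)"

section \<open>Top exterior powers\<close>

definition free_space :: "('k, 'x) ring_scheme \<Rightarrow> 'b set \<Rightarrow> ('k, 'b \<Rightarrow> 'k) module" where
  "free_space K X = \<lparr>carrier = {f \<in> X \<rightarrow>\<^sub>E carrier K. finite {x \<in> X. f x \<noteq> \<zero>\<^bsub>K\<^esub>}},
     mult = undefined, one = undefined,
     zero = (\<lambda>x\<in>X. \<zero>\<^bsub>K\<^esub>), add = (\<lambda>f g. \<lambda>x\<in>X. f x \<oplus>\<^bsub>K\<^esub> g x),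
     smult = (\<lambda>c f. \<lambda>x\<in>X. c \<otimes>\<^bsub>K\<^esub> f x)\<rparr>"

definition basis_vec :: "('k, 'x) ring_scheme \<Rightarrow> 'b set \<Rightarrow> 'b \<Rightarrow> 'b \<Rightarrow> 'k" where
  "basis_vec K X x = (\<lambda>y\<in>X. if y = x then \<one>\<^bsub>K\<^esub> else \<zero>\<^bsub>K\<^esub>)"

definition tuples :: "('k, 'v) module \<Rightarrow> nat \<Rightarrow> 'v list set" where
  "tuples V n = {vs. length vs = n \<and> set vs \<subseteq> carrier V}"

text \<open>The relations say that \<open>(v\<^sub>1, \<dots>, v\<^sub>n) \<mapsto> v\<^sub>1 \<and> \<cdots> \<and> v\<^sub>n\<close> is multilinear and alternating.\<close>

definition ext_power_relations ::
  "('k, 'x) ring_scheme \<Rightarrow> ('k, 'v) module \<Rightarrow> nat \<Rightarrow> ('v list \<Rightarrow> 'k) set" where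
  "ext_power_relations K V n =
     (let F = free_space K (tuples V n); b = basis_vec K (tuples V n) in
      {b (vs[i := u \<oplus>\<^bsub>V\<^esub> w]) \<ominus>\<^bsub>F\<^esub> (b (vs[i := u]) \<oplus>\<^bsub>F\<^esub> b (vs[i := w])) | vs i u w.
         vs \<in> tuples V n \<and> i < n \<and> u \<in> carrier V \<and> w \<in> carrier V} \<union>
      {b (vs[i := c \<odot>\<^bsub>V\<^esub> u]) \<ominus>\<^bsub>F\<^esub> (c \<odot>\<^bsub>F\<^esub> b (vs[i := u])) | vs i c u.
         vs \<in> tuples V n \<and> i < n \<and> c \<in> carrier K \<and> u \<in> carrier V} \<union>
      {b vs | vs i j. vs \<in> tuples V n \<and> i < j \<and> j < n \<and> vs ! i = vs ! j})"

definition ext_power ::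
  "('k, 'x) ring_scheme \<Rightarrow> ('k, 'v) module \<Rightarrow> nat \<Rightarrow> ('k, ('v list \<Rightarrow> 'k) set) module" where
  "ext_power K V n =
     (let F = free_space K (tuples V n)
      in quot_module F (gen_submodule K F (ext_power_relations K V n)))"

definition det_space ::
  "('k, 'x) ring_scheme \<Rightarrow> 'b set \<Rightarrow> ('k, (('b \<Rightarrow> 'k) list \<Rightarrow> 'k) set) module" where
  "det_space K X = ext_power K (free_space K X) (card X)"

section \<open>Intervals of a poset\<close>

text \<open>A poset is a subset \<open>P\<close> of a type of class \<open>order\<close>, with the induced order.\<close>

definition connected_poset :: "'p::order set \<Rightarrow> bool" where
  "connected_poset S \<longleftrightarrow>
     (\<forall>x\<in>S. \<forall>y\<in>S. (x, y) \<in> {(a, b). a \<in> S \<and> b \<in> S \<and> (a \<le> b \<or> b \<le> a)}\<^sup>*)"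

definition convex_in :: "'p::order set \<Rightarrow> 'p set \<Rightarrow> bool" where
  "convex_in P S \<longleftrightarrow> (\<forall>x\<in>S. \<forall>y\<in>S. \<forall>z\<in>P. x \<le> z \<and> z \<le> y \<longrightarrow> z \<in> S)"

definition intervals :: "'p::order set \<Rightarrow> 'p set set" where
  "intervals P = {S. S \<subseteq> P \<and> S \<noteq> {} \<and> connected_poset S \<and> convex_in P S}"

definition rel_downsets :: "'p::order set \<Rightarrow> 'p set \<Rightarrow> 'p set set" where
  "rel_downsets P T = {S \<in> intervals P. S \<subseteq> T \<and> (\<forall>s\<in>S. \<forall>x\<in>T. x \<le> s \<longrightarrow> x \<in> S)}"

definition covers_in :: "'p::order set \<Rightarrow> 'p \<Rightarrow> 'p \<Rightarrow> bool" where
  "covers_in T s x \<longleftrightarrow> s \<in> T \<and> x \<in> T \<and> s < x \<and> \<not> (\<exists>z\<in>T. s < z \<and> z < x)"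

definition upper_boundary :: "'p::order set \<Rightarrow> 'p set \<Rightarrow> 'p set" where
  "upper_boundary T S = {x \<in> T - S. \<exists>s\<in>S. covers_in T s x}"

definition max_elements :: "'p::order set \<Rightarrow> 'p set" where
  "max_elements X = {x \<in> X. \<not> (\<exists>y\<in>X. x < y)}"

definition Upsilon_plus :: "'p::order set \<Rightarrow> ('p set \<times> 'p set) set" where
  "Upsilon_plus P = {(S, T). T \<in> intervals P \<and> S \<in> rel_downsets P T \<and>
     upper_boundary T S = max_elements (T - S)}"

definition omega_plus :: "'p::order set \<Rightarrow> 'p set \<Rightarrow> nat" where
  "omega_plus S T = card (max_elements (T - S))"

section \<open>Representations of a poset\<close>

text \<open>\<open>struct_map M x y\<close> is the map \<open>M(x \<le> y)\<close>, only meaningful for \<open>x \<le> y\<close>.\<close>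

record ('p, 'k, 'v) poset_rep =
  vspace :: "'p \<Rightarrow> ('k, 'v) module"
  struct_map :: "'p \<Rightarrow> 'p \<Rightarrow> 'v \<Rightarrow> 'v"

definition rep_hom ::
  "('k, 'x) ring_scheme \<Rightarrow> 'p::order set \<Rightarrow> ('p, 'k, 'v) poset_rep \<Rightarrow> ('p, 'k, 'w) poset_rep \<Rightarrow>
   ('p \<Rightarrow> 'v \<Rightarrow> 'w) set" where
  "rep_hom K P M N = {\<phi> \<in> (\<Pi>\<^sub>E x\<in>P. lin_hom K (vspace M x) (vspace N x)).
     \<forall>x\<in>P. \<forall>y\<in>P. x \<le> y \<longrightarrow> (\<forall>v\<in>carrier (vspace M x).
       \<phi> y (struct_map M x y v) = struct_map N x y (\<phi> x v))}"

definition rep_dsum ::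
  "'i set \<Rightarrow> ('i \<Rightarrow> ('p, 'k, 'v) poset_rep) \<Rightarrow> ('p, 'k, 'i \<Rightarrow> 'v) poset_rep" where
  "rep_dsum I M = \<lparr>vspace = (\<lambda>x. dsum I (\<lambda>i. vspace (M i) x)),
     struct_map = (\<lambda>x y v. \<lambda>i\<in>I. struct_map (M i) x y (v i))\<rparr>"

definition interval_rep ::
  "('k, 'x) ring_scheme \<Rightarrow> 'p::order set \<Rightarrow> ('p, 'k, 'k) poset_rep" where
  "interval_rep K S = \<lparr>
     vspace = (\<lambda>x. if x \<in> S then regular K else (regular K)\<lparr>carrier := {\<zero>\<^bsub>K\<^esub>}\<rparr>),
     struct_map = (\<lambda>x y v. if x \<in> S \<and> y \<in> S then v else \<zero>\<^bsub>K\<^esub>)\<rparr>"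

definition end_algebra ::
  "('k, 'x) ring_scheme \<Rightarrow> 'p::order set \<Rightarrow> ('p, 'k, 'v) poset_rep \<Rightarrow>
   ('k, 'p \<Rightarrow> 'v \<Rightarrow> 'v) module" where
  "end_algebra K P M = \<lparr>carrier = rep_hom K P M M,
     mult = (\<lambda>\<phi> \<psi>. \<lambda>x\<in>P. compose (carrier (vspace M x)) (\<phi> x) (\<psi> x)),
     one = (\<lambda>x\<in>P. \<lambda>v\<in>carrier (vspace M x). v),
     zero = (\<lambda>x\<in>P. \<lambda>v\<in>carrier (vspace M x). \<zero>\<^bsub>vspace M x\<^esub>),
     add = (\<lambda>\<phi> \<psi>. \<lambda>x\<in>P. \<lambda>v\<in>carrier (vspace M x). \<phi> x v \<oplus>\<^bsub>vspace M x\<^esub> \<psi> x v),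
     smult = (\<lambda>c \<phi>. \<lambda>x\<in>P. \<lambda>v\<in>carrier (vspace M x). c \<odot>\<^bsub>vspace M x\<^esub> \<phi> x v)\<rparr>"

definition op_algebra :: "('k, 'a) module \<Rightarrow> ('k, 'a) module" where
  "op_algebra A = A\<lparr>mult := (\<lambda>a b. b \<otimes>\<^bsub>A\<^esub> a)\<rparr>"

section \<open>The algebra of interval representations and its modules\<close>

definition gen_rep ::
  "('k, 'x) ring_scheme \<Rightarrow> 'p::order set \<Rightarrow> ('p, 'k, 'p set \<Rightarrow> 'k) poset_rep" where
  "gen_rep K P = rep_dsum (intervals P) (interval_rep K)"

definition Lam ::
  "('k, 'x) ring_scheme \<Rightarrow> 'p::order set \<Rightarrow>
   ('k, 'p \<Rightarrow> ('p set \<Rightarrow> 'k) \<Rightarrow> ('p set \<Rightarrow> 'k)) module" where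
  "Lam K P = op_algebra (end_algebra K P (gen_rep K P))"

definition idem ::
  "('k, 'x) ring_scheme \<Rightarrow> 'p::order set \<Rightarrow> 'p set \<Rightarrow> 'p \<Rightarrow> ('p set \<Rightarrow> 'k) \<Rightarrow> ('p set \<Rightarrow> 'k)" where
  "idem K P S = (\<lambda>x\<in>P. \<lambda>v\<in>carrier (vspace (gen_rep K P) x).
     \<lambda>R\<in>intervals P. if R = S then v R else \<zero>\<^bsub>K\<^esub>)"

definition left_ideal_of :: "('k, 'a) module \<Rightarrow> 'a \<Rightarrow> ('a, 'a) module" where
  "left_ideal_of A e = (regular A)\<lparr>carrier := (\<lambda>a. a \<otimes>\<^bsub>A\<^esub> e) ` carrier A\<rparr>"

definition simple_L ::
  "('k, 'x) ring_scheme \<Rightarrow> 'p::order set \<Rightarrow> 'p set \<Rightarrow>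
   ('p \<Rightarrow> ('p set \<Rightarrow> 'k) \<Rightarrow> ('p set \<Rightarrow> 'k),
    ('p \<Rightarrow> ('p set \<Rightarrow> 'k) \<Rightarrow> ('p set \<Rightarrow> 'k)) set) module" where
  "simple_L K P S = mod_top (Lam K P) (left_ideal_of (Lam K P) (idem K P S))"

text \<open>The dual of the right ideal \<open>e A\<close>, on which \<open>a\<close> acts by \<open>(a f)(x) = f (x a)\<close>.\<close>

definition dual_right_ideal ::
  "('k, 'x) ring_scheme \<Rightarrow> ('k, 'a) module \<Rightarrow> 'a \<Rightarrow> ('a, 'a \<Rightarrow> 'k) module" where
  "dual_right_ideal K A e = (let E = (\<lambda>a. e \<otimes>\<^bsub>A\<^esub> a) ` carrier A in
     \<lparr>carrier = lin_hom K (A\<lparr>carrier := E\<rparr>) (regular K), mult = undefined, one = undefined,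
      zero = (\<lambda>x\<in>E. \<zero>\<^bsub>K\<^esub>), add = (\<lambda>f g. \<lambda>x\<in>E. f x \<oplus>\<^bsub>K\<^esub> g x),
      smult = (\<lambda>a f. \<lambda>x\<in>E. f (x \<otimes>\<^bsub>A\<^esub> a))\<rparr>)"

definition injective_I ::
  "('k, 'x) ring_scheme \<Rightarrow> 'p::order set \<Rightarrow> 'p set \<Rightarrow>
   ('p \<Rightarrow> ('p set \<Rightarrow> 'k) \<Rightarrow> ('p set \<Rightarrow> 'k),
    ('p \<Rightarrow> ('p set \<Rightarrow> 'k) \<Rightarrow> ('p set \<Rightarrow> 'k)) \<Rightarrow> 'k) module" where
  "injective_I K P S = dual_right_ideal K (Lam K P) (idem K P S)"

definition qh_le :: "'p set \<Rightarrow> 'p set \<Rightarrow> bool" where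
  "qh_le R S \<longleftrightarrow> R = S \<or> card R > card S"

definition costandard ::
  "('k, 'x) ring_scheme \<Rightarrow> 'p::order set \<Rightarrow> 'p set \<Rightarrow>
   ('p \<Rightarrow> ('p set \<Rightarrow> 'k) \<Rightarrow> ('p set \<Rightarrow> 'k),
    ('p \<Rightarrow> ('p set \<Rightarrow> 'k) \<Rightarrow> ('p set \<Rightarrow> 'k)) \<Rightarrow> 'k) module" where
  "costandard K P S = (injective_I K P S)\<lparr>carrier :=
     (GREATEST N. submodule N (Lam K P) (injective_I K P S) \<and>
        (\<forall>X \<in> composition_factors (Lam K P) ((injective_I K P S)\<lparr>carrier := N\<rparr>).
           \<exists>R\<in>intervals P. qh_le R S \<and> X \<simeq>\<^bsub>Lam K P\<^esub> simple_L K P R))\<rparr>"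

end

theory Submission
  imports Defs "HOL-Combinatorics.Permutations"
begin

text \<open>The costandard module \<open>\<nabla>(T)\<close> consists of the functionals on \<open>e\<^sub>T \<Lambda>\<close> that vanish on all
  morphisms from \<open>\<I>\<^sub>T\<close> factoring through the quotient \<open>\<I>\<^sub>C\<close> for a proper \<open>C \<in> \<D>(T)\<close>. Hence, for a free
  module \<open>F\<close>, \<open>Hom(F, \<nabla>(T))\<close> is the dual of the quotient of \<open>e\<^sub>T F\<close> by the sum of the subspaces \<open>F\<^sub>m\<close> of
  the elements that vanish at \<open>m\<close>, for \<open>m \<in> Max T\<close>. For \<open>A \<subseteq> Max T\<close>, the intersection of the \<open>F\<^sub>m\<close> with
  \<open>m \<in> A\<close> is the direct sum of the \<open>e\<^sub>C F\<close> over the components \<open>C\<close> of \<open>T - A\<close>; evaluated on a resolution of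
  \<open>L(S)\<close> it has homology only in degree \<open>0\<close>, where it is \<open>k\<close> or \<open>0\<close> according to whether \<open>S\<close> is a component
  of \<open>T - A\<close>. The latter means that \<open>S\<close> is a downset of \<open>T\<close> with \<open>\<partial>S \<subseteq> A \<subseteq> Max (T - S)\<close>. Since the
  \<open>F\<^sub>m\<close> are cut out by commuting projections, the quotient is resolved by these intersections. The sets \<open>A\<close>
  that contribute form a Boolean interval, so everything cancels unless \<open>\<partial>S = Max (T - S)\<close>; then a single
  class remains, in degree \<open>|Max (T - S)|\<close>.\<close>

section \<open>Modules over noncommutative rings\<close>

text \<open>\<open>Ext\<close> fixes some free resolution by choice, so only exactness may be used
  of it. An element of a free module is a tuple of matrices: the entry of \<open>a\<close> at a
  point \<open>x\<close> and intervals \<open>Q\<close>, \<open>R\<close> is the value at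
  \<open>x\<close> of a morphism from the module of \<open>Q\<close> to that of \<open>R\<close>,
  and it is constant on each component of \<open>Q \<inter> R\<close>. Hence dropping the component
  of \<open>m\<close> from each \<open>T \<inter> R\<close> is a projection onto
  \<open>F\<^sub>m\<close>; such projections only select components, so they commute. This matters
  because sums and intersections of three or more arbitrary subspaces need not fit into an exact
  sequence. The projections need not commute with the differential; only their images are
  subcomplexes. So the quotient by \<open>F\<^sub>m\<close> is realised on the kernel of the
  projection, with a corrected differential, and the maximal elements are treated one at a time by
  long exact sequences. Since the spaces involved are finite-dimensional over a field, dualising at
  the end keeps exactness.\<close>

context abelian_group
begin

lemma minus_eq_zero_iff [simp]:
  assumes "x \<in> carrier G" "y \<in> carrier G"
  shows "x \<ominus> y = \<zero> \<longleftrightarrow> x = y"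
proof
  assume *: "x \<ominus> y = \<zero>"
  have "\<ominus> (\<ominus> y) = x"
    by (rule minus_equality) (use * assms in \<open>auto simp: a_minus_def\<close>)
  then show "x = y" using minus_minus[OF assms(2)] by (rule trans[OF sym])
qed (use r_neg[OF assms(2)] in \<open>simp add: a_minus_def\<close>)

lemma minus_zero_right [simp]: "x \<in> carrier G \<Longrightarrow> x \<ominus> \<zero> = x"
  using minus_equality[of \<zero> \<zero>] by (simp add: a_minus_def)

lemma minus_self [simp]: "x \<in> carrier G \<Longrightarrow> x \<ominus> x = \<zero>"
  by simp

lemma minus_add_cancel [simp]: "\<lbrakk>x \<in> carrier G; y \<in> carrier G\<rbrakk> \<Longrightarrow> (x \<ominus> y) \<oplus> y = x"
  by (simp add: a_minus_def a_assoc l_neg)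

lemma add_minus_cancel [simp]: "\<lbrakk>x \<in> carrier G; y \<in> carrier G\<rbrakk> \<Longrightarrow> (x \<oplus> y) \<ominus> y = x"
  by (simp add: a_minus_def a_assoc r_neg)

end

section \<open>Left modules and their submodules\<close>

locale lmodule = R: ring R + M: abelian_group M
  for R :: "('r, 'x) ring_scheme" and M :: "('r, 'm) module" +
  assumes smult_closed [simp, intro]:
      "\<lbrakk>a \<in> carrier R; x \<in> carrier M\<rbrakk> \<Longrightarrow> a \<odot>\<^bsub>M\<^esub> x \<in> carrier M"
    and smult_l_distr:
      "\<lbrakk>a \<in> carrier R; b \<in> carrier R; x \<in> carrier M\<rbrakk> \<Longrightarrow>
        (a \<oplus>\<^bsub>R\<^esub> b) \<odot>\<^bsub>M\<^esub> x = a \<odot>\<^bsub>M\<^esub> x \<oplus>\<^bsub>M\<^esub> b \<odot>\<^bsub>M\<^esub> x"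
    and smult_r_distr:
      "\<lbrakk>a \<in> carrier R; x \<in> carrier M; y \<in> carrier M\<rbrakk> \<Longrightarrow>
        a \<odot>\<^bsub>M\<^esub> (x \<oplus>\<^bsub>M\<^esub> y) = a \<odot>\<^bsub>M\<^esub> x \<oplus>\<^bsub>M\<^esub> a \<odot>\<^bsub>M\<^esub> y"
    and smult_assoc:
      "\<lbrakk>a \<in> carrier R; b \<in> carrier R; x \<in> carrier M\<rbrakk> \<Longrightarrow>
        (a \<otimes>\<^bsub>R\<^esub> b) \<odot>\<^bsub>M\<^esub> x = a \<odot>\<^bsub>M\<^esub> (b \<odot>\<^bsub>M\<^esub> x)"
    and smult_one [simp]: "x \<in> carrier M \<Longrightarrow> \<one>\<^bsub>R\<^esub> \<odot>\<^bsub>M\<^esub> x = x"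
begin

lemma smult_l_null [simp]: "x \<in> carrier M \<Longrightarrow> \<zero>\<^bsub>R\<^esub> \<odot>\<^bsub>M\<^esub> x = \<zero>\<^bsub>M\<^esub>"
  using smult_l_distr[of "\<zero>\<^bsub>R\<^esub>" "\<zero>\<^bsub>R\<^esub>" x] by (simp add: M.add.l_cancel_one')

lemma smult_r_null [simp]: "a \<in> carrier R \<Longrightarrow> a \<odot>\<^bsub>M\<^esub> \<zero>\<^bsub>M\<^esub> = \<zero>\<^bsub>M\<^esub>"
  using smult_r_distr[of a "\<zero>\<^bsub>M\<^esub>" "\<zero>\<^bsub>M\<^esub>"] by (simp add: M.add.l_cancel_one')

lemma smult_l_minus: "\<lbrakk>a \<in> carrier R; x \<in> carrier M\<rbrakk> \<Longrightarrow> (\<ominus>\<^bsub>R\<^esub> a) \<odot>\<^bsub>M\<^esub> x = \<ominus>\<^bsub>M\<^esub> (a \<odot>\<^bsub>M\<^esub> x)"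
  using smult_l_distr[of "\<ominus>\<^bsub>R\<^esub> a" a x] by (simp add: R.l_neg M.minus_equality)

lemma smult_r_minus: "\<lbrakk>a \<in> carrier R; x \<in> carrier M\<rbrakk> \<Longrightarrow> a \<odot>\<^bsub>M\<^esub> (\<ominus>\<^bsub>M\<^esub> x) = \<ominus>\<^bsub>M\<^esub> (a \<odot>\<^bsub>M\<^esub> x)"
  using smult_r_distr[of a "\<ominus>\<^bsub>M\<^esub> x" x] by (simp add: M.l_neg M.minus_equality)

lemma minus_one_smult: "x \<in> carrier M \<Longrightarrow> (\<ominus>\<^bsub>R\<^esub> \<one>\<^bsub>R\<^esub>) \<odot>\<^bsub>M\<^esub> x = \<ominus>\<^bsub>M\<^esub> x"
  by (simp add: smult_l_minus)

lemma finsum_smult: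
  assumes "a \<in> carrier R" "finite A" "f \<in> A \<rightarrow> carrier M"
  shows "a \<odot>\<^bsub>M\<^esub> finsum M f A = (\<Oplus>\<^bsub>M\<^esub>i\<in>A. a \<odot>\<^bsub>M\<^esub> f i)"
  using assms(2,3)
proof (induction A)
  case (insert x A)
  have 1: "f \<in> A \<rightarrow> carrier M" and 2: "f x \<in> carrier M" using insert by auto
  have 3: "(\<lambda>i. a \<odot>\<^bsub>M\<^esub> f i) \<in> A \<rightarrow> carrier M" using 1 assms(1) by auto
  show ?case using insert 1 2 3 assms(1) by (simp add: smult_r_distr)
qed (use assms(1) in simp)

lemma finsum_smult_left:
  assumes "x \<in> carrier M" "finite A" "f \<in> A \<rightarrow> carrier R"
  shows "finsum R f A \<odot>\<^bsub>M\<^esub> x = (\<Oplus>\<^bsub>M\<^esub>i\<in>A. f i \<odot>\<^bsub>M\<^esub> x)"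
  using assms(2,3)
proof (induction A)
  case (insert y A)
  have 1: "f \<in> A \<rightarrow> carrier R" and 2: "f y \<in> carrier R" using insert by auto
  have 3: "(\<lambda>i. f i \<odot>\<^bsub>M\<^esub> x) \<in> A \<rightarrow> carrier M" using 1 assms(1) by auto
  show ?case using insert 1 2 3 assms(1) by (simp add: smult_l_distr)
qed (use assms(1) in simp)

text \<open>Negation is multiplication by the scalar \<open>\<ominus> \<one>\<close>, so closure
  under it follows from the remaining conditions.\<close>

lemma submodule_iff:
  "submodule N R M \<longleftrightarrow> N \<subseteq> carrier M \<and> \<zero>\<^bsub>M\<^esub> \<in> N \<and> (\<forall>x\<in>N. \<forall>y\<in>N. x \<oplus>\<^bsub>M\<^esub> y \<in> N) \<and>
     (\<forall>r\<in>carrier R. \<forall>x\<in>N. r \<odot>\<^bsub>M\<^esub> x \<in> N)" (is "?l \<longleftrightarrow> ?r")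
proof
  assume ?l
  then interpret submodule N R M .
  show ?r using subset m_closed one_closed smult_closed by auto
next
  assume r: ?r
  have "\<ominus>\<^bsub>M\<^esub> x \<in> N" if "x \<in> N" for x
  proof -
    have "x \<in> carrier M" using r that by auto
    then have "\<ominus>\<^bsub>M\<^esub> x = (\<ominus>\<^bsub>R\<^esub> \<one>\<^bsub>R\<^esub>) \<odot>\<^bsub>M\<^esub> x" by (simp add: minus_one_smult)
    also have "\<dots> \<in> N" using r that by blast
    finally show ?thesis .
  qed
  then show ?l using r
    by (intro submodule.intro subgroup.intro submodule_axioms.intro) (auto simp flip: a_inv_def)
qed

lemma submoduleD:
  assumes "submodule N R M"
  shows "N \<subseteq> carrier M" "\<zero>\<^bsub>M\<^esub> \<in> N" "\<And>x y. \<lbrakk>x \<in> N; y \<in> N\<rbrakk> \<Longrightarrow> x \<oplus>\<^bsub>M\<^esub> y \<in> N"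
    "\<And>r x. \<lbrakk>r \<in> carrier R; x \<in> N\<rbrakk> \<Longrightarrow> r \<odot>\<^bsub>M\<^esub> x \<in> N" "\<And>x. x \<in> N \<Longrightarrow> \<ominus>\<^bsub>M\<^esub> x \<in> N"
    "\<And>x y. \<lbrakk>x \<in> N; y \<in> N\<rbrakk> \<Longrightarrow> x \<ominus>\<^bsub>M\<^esub> y \<in> N"
proof -
  show 1: "N \<subseteq> carrier M" "\<zero>\<^bsub>M\<^esub> \<in> N" and 2: "\<And>x y. \<lbrakk>x \<in> N; y \<in> N\<rbrakk> \<Longrightarrow> x \<oplus>\<^bsub>M\<^esub> y \<in> N"
    and 3: "\<And>r x. \<lbrakk>r \<in> carrier R; x \<in> N\<rbrakk> \<Longrightarrow> r \<odot>\<^bsub>M\<^esub> x \<in> N"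
    using assms unfolding submodule_iff by auto
  show 4: "\<ominus>\<^bsub>M\<^esub> x \<in> N" if "x \<in> N" for x
    using 3[of "\<ominus>\<^bsub>R\<^esub> \<one>\<^bsub>R\<^esub>" x] that 1 by (auto simp: minus_one_smult)
  show "x \<ominus>\<^bsub>M\<^esub> y \<in> N" if "x \<in> N" "y \<in> N" for x y
    using 2 4 that by (simp add: a_minus_def)
qed

lemma submodule_finsum:
  assumes "submodule N R M" "f \<in> A \<rightarrow> N"
  shows "finsum M f A \<in> N"
proof (cases "finite A")
  case True
  then show ?thesis using assms(2)
  proof (induction A)
    case (insert x A)
    have "f \<in> A \<rightarrow> carrier M" "f x \<in> carrier M" using insert submoduleD(1)[OF assms(1)] by auto
    then show ?case using insert submoduleD(3)[OF assms(1)] by simp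
  qed (use submoduleD(2)[OF assms(1)] in simp)
qed (use submoduleD(2)[OF assms(1)] in simp)

lemma carrier_submodule: "submodule (carrier M) R M"
  unfolding submodule_iff by auto

lemma zero_submodule: "submodule {\<zero>\<^bsub>M\<^esub>} R M"
  unfolding submodule_iff by auto

lemma lmodule_restrict:
  assumes "submodule N R M"
  shows "lmodule R (M\<lparr>carrier := N\<rparr>)"
proof -
  note [simp] = submoduleD(2-5)[OF assms]
  have c: "x \<in> N \<Longrightarrow> x \<in> carrier M" for x using submoduleD(1)[OF assms] by auto
  have "abelian_group (M\<lparr>carrier := N\<rparr>)"
  proof (rule abelian_groupI)
    fix x assume "x \<in> carrier (M\<lparr>carrier := N\<rparr>)"
    then show "\<exists>y\<in>carrier (M\<lparr>carrier := N\<rparr>). y \<oplus>\<^bsub>M\<lparr>carrier := N\<rparr>\<^esub> x = \<zero>\<^bsub>M\<lparr>carrier := N\<rparr>\<^esub>"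
      by (intro bexI[of _ "\<ominus>\<^bsub>M\<^esub> x"]) (auto simp: c M.l_neg)
  qed (auto simp: c M.a_ac)
  then show ?thesis
    by (intro lmodule.intro lmodule_axioms.intro R.ring_axioms)
      (auto simp: c smult_l_distr smult_r_distr smult_assoc)
qed

lemma submodule_restrict_iff:
  assumes "submodule N R M"
  shows "submodule N' R (M\<lparr>carrier := N\<rparr>) \<longleftrightarrow> submodule N' R M \<and> N' \<subseteq> N"
proof -
  interpret N: lmodule R "M\<lparr>carrier := N\<rparr>" by (rule lmodule_restrict[OF assms])
  show ?thesis
    unfolding submodule_iff N.submodule_iff using submoduleD(1)[OF assms] by auto
qed

lemma submodule_Inter:
  assumes "\<And>N. N \<in> \<N> \<Longrightarrow> submodule N R M" "\<N> \<noteq> {}"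
  shows "submodule (\<Inter>\<N>) R M"
proof -
  note N = submoduleD[OF assms(1)]
  show ?thesis
    unfolding submodule_iff
  proof (intro conjI ballI InterI)
    show "\<Inter>\<N> \<subseteq> carrier M" using assms(2) N(1) by blast
  qed (use N in auto)
qed

lemma submodule_gen: "X \<subseteq> carrier M \<Longrightarrow> submodule (gen_submodule R M X) R M"
  unfolding gen_submodule_def by (rule submodule_Inter) (use carrier_submodule in auto)

end

lemma gen_submodule_superset: "X \<subseteq> gen_submodule R M X"
  unfolding gen_submodule_def by auto

lemma gen_submodule_minimal: "\<lbrakk>submodule N R M; X \<subseteq> N\<rbrakk> \<Longrightarrow> gen_submodule R M X \<subseteq> N"
  unfolding gen_submodule_def by auto

text \<open>Additive inverses come from \<open>(\<ominus> \<one>) \<odot> x\<close> together with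
  \<open>\<zero> \<odot> x = \<zero>\<close>, which saves writing down inverses in each of the
  function spaces below.\<close>

lemma lmoduleI:
  assumes "ring R"
    and "\<And>x y. \<lbrakk>x \<in> carrier M; y \<in> carrier M\<rbrakk> \<Longrightarrow> x \<oplus>\<^bsub>M\<^esub> y \<in> carrier M"
    and "\<zero>\<^bsub>M\<^esub> \<in> carrier M"
    and "\<And>x y z. \<lbrakk>x \<in> carrier M; y \<in> carrier M; z \<in> carrier M\<rbrakk> \<Longrightarrow>
      (x \<oplus>\<^bsub>M\<^esub> y) \<oplus>\<^bsub>M\<^esub> z = x \<oplus>\<^bsub>M\<^esub> (y \<oplus>\<^bsub>M\<^esub> z)"
    and "\<And>x y. \<lbrakk>x \<in> carrier M; y \<in> carrier M\<rbrakk> \<Longrightarrow> x \<oplus>\<^bsub>M\<^esub> y = y \<oplus>\<^bsub>M\<^esub> x"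
    and "\<And>x. x \<in> carrier M \<Longrightarrow> \<zero>\<^bsub>M\<^esub> \<oplus>\<^bsub>M\<^esub> x = x"
    and "\<And>x. x \<in> carrier M \<Longrightarrow> \<zero>\<^bsub>R\<^esub> \<odot>\<^bsub>M\<^esub> x = \<zero>\<^bsub>M\<^esub>"
    and "\<And>a x. \<lbrakk>a \<in> carrier R; x \<in> carrier M\<rbrakk> \<Longrightarrow> a \<odot>\<^bsub>M\<^esub> x \<in> carrier M"
    and "\<And>a b x. \<lbrakk>a \<in> carrier R; b \<in> carrier R; x \<in> carrier M\<rbrakk> \<Longrightarrow>
      (a \<oplus>\<^bsub>R\<^esub> b) \<odot>\<^bsub>M\<^esub> x = a \<odot>\<^bsub>M\<^esub> x \<oplus>\<^bsub>M\<^esub> b \<odot>\<^bsub>M\<^esub> x"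
    and "\<And>a x y. \<lbrakk>a \<in> carrier R; x \<in> carrier M; y \<in> carrier M\<rbrakk> \<Longrightarrow>
      a \<odot>\<^bsub>M\<^esub> (x \<oplus>\<^bsub>M\<^esub> y) = a \<odot>\<^bsub>M\<^esub> x \<oplus>\<^bsub>M\<^esub> a \<odot>\<^bsub>M\<^esub> y"
    and "\<And>a b x. \<lbrakk>a \<in> carrier R; b \<in> carrier R; x \<in> carrier M\<rbrakk> \<Longrightarrow>
      (a \<otimes>\<^bsub>R\<^esub> b) \<odot>\<^bsub>M\<^esub> x = a \<odot>\<^bsub>M\<^esub> (b \<odot>\<^bsub>M\<^esub> x)"
    and "\<And>x. x \<in> carrier M \<Longrightarrow> \<one>\<^bsub>R\<^esub> \<odot>\<^bsub>M\<^esub> x = x"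
  shows "lmodule R M"
proof -
  interpret ring R by fact
  have "abelian_group M"
  proof (rule abelian_groupI)
    fix x assume x: "x \<in> carrier M"
    have "(\<ominus>\<^bsub>R\<^esub> \<one>\<^bsub>R\<^esub>) \<odot>\<^bsub>M\<^esub> x \<oplus>\<^bsub>M\<^esub> x = (\<ominus>\<^bsub>R\<^esub> \<one>\<^bsub>R\<^esub> \<oplus>\<^bsub>R\<^esub> \<one>\<^bsub>R\<^esub>) \<odot>\<^bsub>M\<^esub> x"
      using x assms(9)[of "\<ominus>\<^bsub>R\<^esub> \<one>\<^bsub>R\<^esub>" "\<one>\<^bsub>R\<^esub>" x] assms(12) by simp
    also have "\<dots> = \<zero>\<^bsub>M\<^esub>" using x assms(7) by (simp add: l_neg)
    finally show "\<exists>y\<in>carrier M. y \<oplus>\<^bsub>M\<^esub> x = \<zero>\<^bsub>M\<^esub>" using x assms(8) by blast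
  qed (use assms in auto)
  then show ?thesis
    using assms by (intro lmodule.intro lmodule_axioms.intro) auto
qed

lemma lmodule_regular: "ring R \<Longrightarrow> lmodule R (regular R)"
proof -
  assume "ring R"
  then interpret ring R .
  show ?thesis
    by (rule lmoduleI) (auto simp: regular_def a_ac l_distr r_distr m_assoc ring_axioms)
qed

lemma regular_simps [simp]:
  "carrier (regular R) = carrier R" "zero (regular R) = \<zero>\<^bsub>R\<^esub>"
  "add (regular R) = add R" "smult (regular R) = monoid.mult R"
  by (auto simp: regular_def)

subsection \<open>Linear maps\<close>

lemma lin_homD:
  assumes "f \<in> lin_hom R M N"
  shows "f \<in> extensional (carrier M)" "\<And>x. x \<in> carrier M \<Longrightarrow> f x \<in> carrier N"
    "\<And>x y. \<lbrakk>x \<in> carrier M; y \<in> carrier M\<rbrakk> \<Longrightarrow> f (x \<oplus>\<^bsub>M\<^esub> y) = f x \<oplus>\<^bsub>N\<^esub> f y"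
    "\<And>r x. \<lbrakk>r \<in> carrier R; x \<in> carrier M\<rbrakk> \<Longrightarrow> f (r \<odot>\<^bsub>M\<^esub> x) = r \<odot>\<^bsub>N\<^esub> f x"
  using assms unfolding lin_hom_def by (auto simp: PiE_def)

lemma lin_homI:
  assumes "\<And>x. x \<in> carrier M \<Longrightarrow> f x \<in> carrier N" "f \<in> extensional (carrier M)"
    "\<And>x y. \<lbrakk>x \<in> carrier M; y \<in> carrier M\<rbrakk> \<Longrightarrow> f (x \<oplus>\<^bsub>M\<^esub> y) = f x \<oplus>\<^bsub>N\<^esub> f y"
    "\<And>r x. \<lbrakk>r \<in> carrier R; x \<in> carrier M\<rbrakk> \<Longrightarrow> f (r \<odot>\<^bsub>M\<^esub> x) = r \<odot>\<^bsub>N\<^esub> f x"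
  shows "f \<in> lin_hom R M N"
  using assms unfolding lin_hom_def by (auto simp: PiE_def)

locale lmodule_hom = M: lmodule R M + N: lmodule R N
  for R :: "('r, 'x) ring_scheme" and M :: "('r, 'm) module" and N :: "('r, 'n) module" +
  fixes f :: "'m \<Rightarrow> 'n"
  assumes closed [simp, intro]: "x \<in> carrier M \<Longrightarrow> f x \<in> carrier N"
    and add: "\<lbrakk>x \<in> carrier M; y \<in> carrier M\<rbrakk> \<Longrightarrow> f (x \<oplus>\<^bsub>M\<^esub> y) = f x \<oplus>\<^bsub>N\<^esub> f y"
    and smult: "\<lbrakk>r \<in> carrier R; x \<in> carrier M\<rbrakk> \<Longrightarrow> f (r \<odot>\<^bsub>M\<^esub> x) = r \<odot>\<^bsub>N\<^esub> f x"
begin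

lemma zero [simp]: "f \<zero>\<^bsub>M\<^esub> = \<zero>\<^bsub>N\<^esub>"
  using smult[of "\<zero>\<^bsub>R\<^esub>" "\<zero>\<^bsub>M\<^esub>"] by simp

lemma neg: "x \<in> carrier M \<Longrightarrow> f (\<ominus>\<^bsub>M\<^esub> x) = \<ominus>\<^bsub>N\<^esub> f x"
  using smult[of "\<ominus>\<^bsub>R\<^esub> \<one>\<^bsub>R\<^esub>" x] by (simp add: M.minus_one_smult N.minus_one_smult)

lemma minus: "\<lbrakk>x \<in> carrier M; y \<in> carrier M\<rbrakk> \<Longrightarrow> f (x \<ominus>\<^bsub>M\<^esub> y) = f x \<ominus>\<^bsub>N\<^esub> f y"
  by (simp add: a_minus_def add neg)

lemma finsum: "\<lbrakk>finite A; g \<in> A \<rightarrow> carrier M\<rbrakk> \<Longrightarrow> f (finsum M g A) = (\<Oplus>\<^bsub>N\<^esub>i\<in>A. f (g i))"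
proof (induction A rule: finite_induct)
  case (insert x A)
  have 1: "g \<in> A \<rightarrow> carrier M" and 2: "g x \<in> carrier M" using insert by auto
  have 3: "(\<lambda>i. f (g i)) \<in> A \<rightarrow> carrier N" using 1 by auto
  show ?case using insert 1 2 3 by (simp add: add)
qed simp

lemma kernel_submodule: "submodule {x \<in> carrier M. f x = \<zero>\<^bsub>N\<^esub>} R M"
  unfolding M.submodule_iff by (auto simp: add smult)

lemma image_submodule: 
  assumes "submodule U R M"
  shows "submodule (f ` U) R N"
  unfolding N.submodule_iff
proof (intro conjI ballI)
  note U = M.submoduleD[OF assms]
  show "f ` U \<subseteq> carrier N" using U(1) by auto
  show "\<zero>\<^bsub>N\<^esub> \<in> f ` U" using U(2) zero by (metis image_eqI)
  show "x \<oplus>\<^bsub>N\<^esub> y \<in> f ` U" if "x \<in> f ` U" "y \<in> f ` U" for x y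
    using that U(1) U(3) by (auto simp flip: add simp: subset_iff)
  show "r \<odot>\<^bsub>N\<^esub> x \<in> f ` U" if "r \<in> carrier R" "x \<in> f ` U" for r x
    using that U(1) U(4) by (auto simp flip: smult simp: subset_iff)
qed

lemma vimage_submodule:
  assumes "submodule U R N"
  shows "submodule {x \<in> carrier M. f x \<in> U} R M"
  unfolding M.submodule_iff using N.submoduleD[OF assms] by (auto simp: add smult)

lemma inj_on_iff: "inj_on f (carrier M) \<longleftrightarrow> (\<forall>x\<in>carrier M. f x = \<zero>\<^bsub>N\<^esub> \<longrightarrow> x = \<zero>\<^bsub>M\<^esub>)"
proof
  assume "inj_on f (carrier M)"
  then show "\<forall>x\<in>carrier M. f x = \<zero>\<^bsub>N\<^esub> \<longrightarrow> x = \<zero>\<^bsub>M\<^esub>"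
    by (metis M.M.zero_closed inj_onD zero)
next
  assume *: "\<forall>x\<in>carrier M. f x = \<zero>\<^bsub>N\<^esub> \<longrightarrow> x = \<zero>\<^bsub>M\<^esub>"
  show "inj_on f (carrier M)"
  proof (rule inj_onI)
    fix x y assume xy: "x \<in> carrier M" "y \<in> carrier M" "f x = f y"
    then have "f (x \<ominus>\<^bsub>M\<^esub> y) = \<zero>\<^bsub>N\<^esub>" by (simp add: minus)
    then have "x \<ominus>\<^bsub>M\<^esub> y = \<zero>\<^bsub>M\<^esub>" using * xy by simp
    then show "x = y" using xy by simp
  qed
qed

end

lemma lmodule_hom_lin_hom:
  "\<lbrakk>lmodule R M; lmodule R N; f \<in> lin_hom R M N\<rbrakk> \<Longrightarrow> lmodule_hom R M N f"
  by (intro lmodule_hom.intro lmodule_hom_axioms.intro) (auto dest: lin_homD)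

lemma mod_iso_sym:
  assumes "lmodule R M" "M \<simeq>\<^bsub>R\<^esub> N"
  shows "N \<simeq>\<^bsub>R\<^esub> M"
proof -
  interpret lmodule R M by fact
  obtain f where f: "f \<in> lin_hom R M N" "bij_betw f (carrier M) (carrier N)"
    using assms(2) unfolding mod_iso_def by auto
  let ?g = "restrict (inv_into (carrier M) f) (carrier N)"
  have fg: "f (?g y) = y" "?g y \<in> carrier M" if "y \<in> carrier N" for y
    using f(2) that by (auto simp: bij_betw_inv_into_right bij_betw_def inv_into_into)
  have gf: "?g (f x) = x" if "x \<in> carrier M" for x
    using f(2) that by (simp add: bij_betw_inv_into_left bij_betwE)
  have "?g \<in> lin_hom R N M"
  proof (rule lin_homI)
    fix x y assume xy: "x \<in> carrier N" "y \<in> carrier N"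
    then have "f (?g x \<oplus>\<^bsub>M\<^esub> ?g y) = x \<oplus>\<^bsub>N\<^esub> y"
      using lin_homD(3)[OF f(1)] fg by simp
    then show "?g (x \<oplus>\<^bsub>N\<^esub> y) = ?g x \<oplus>\<^bsub>M\<^esub> ?g y" using gf fg xy by (metis M.a_closed)
  next
    fix r x assume xy: "r \<in> carrier R" "x \<in> carrier N"
    then have "f (r \<odot>\<^bsub>M\<^esub> ?g x) = r \<odot>\<^bsub>N\<^esub> x"
      using lin_homD(4)[OF f(1)] fg by simp
    then show "?g (r \<odot>\<^bsub>N\<^esub> x) = r \<odot>\<^bsub>M\<^esub> ?g x" using gf fg xy by (metis smult_closed)
  qed (use fg in auto)
  moreover have "bij_betw ?g (carrier N) (carrier M)"
    using f(2) bij_betw_inv_into[of f] by (auto cong: bij_betw_cong)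
  ultimately show ?thesis unfolding mod_iso_def by blast
qed

lemma mod_iso_trans:
  assumes "lmodule R L" "L \<simeq>\<^bsub>R\<^esub> M" "M \<simeq>\<^bsub>R\<^esub> N"
  shows "L \<simeq>\<^bsub>R\<^esub> N"
proof -
  interpret lmodule R L by fact
  obtain f g where f: "f \<in> lin_hom R L M" "bij_betw f (carrier L) (carrier M)"
    and g: "g \<in> lin_hom R M N" "bij_betw g (carrier M) (carrier N)"
    using assms(2,3) unfolding mod_iso_def by auto
  have "compose (carrier L) g f \<in> lin_hom R L N"
    by (rule lin_homI) (use lin_homD[OF f(1)] lin_homD[OF g(1)] in
      \<open>auto simp: compose_def\<close>)
  then show ?thesis unfolding mod_iso_def using bij_betw_compose[OF f(2) g(2)] by auto
qed

subsection \<open>Quotients\<close>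

lemma quot_module_simps [simp]:
  "zero (quot_module M N) = N" "add (quot_module M N) = set_add M"
  by (auto simp: quot_module_def)

locale lquotient = lmodule +
  fixes N :: "'b set"
  assumes sub: "submodule N R M"
begin

sublocale N: abelian_subgroup N M
  using sub M.abelian_group_axioms
  by (intro abelian_subgroupI3 additive_subgroupI) (auto intro: submodule.axioms)

lemma N_subset: "N \<subseteq> carrier M" using submoduleD(1)[OF sub] .

lemma carrier_quot: "carrier (quot_module M N) = (\<lambda>x. N +>\<^bsub>M\<^esub> x) ` carrier M"
  by (auto simp: quot_module_def A_RCOSETS_def')

lemma coset_in [simp]: "x \<in> carrier M \<Longrightarrow> N +>\<^bsub>M\<^esub> x \<in> carrier (quot_module M N)"
  by (simp add: carrier_quot)

lemma mem_coset_iff: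
  assumes "x \<in> carrier M" 
  shows "y \<in> N +>\<^bsub>M\<^esub> x \<longleftrightarrow> y \<in> carrier M \<and> y \<ominus>\<^bsub>M\<^esub> x \<in> N"
proof
  assume "y \<in> N +>\<^bsub>M\<^esub> x"
  then obtain n where n: "n \<in> N" "y = n \<oplus>\<^bsub>M\<^esub> x" by (auto simp: a_r_coset_def')
  moreover have "n \<in> carrier M" using n N_subset by auto
  ultimately show "y \<in> carrier M \<and> y \<ominus>\<^bsub>M\<^esub> x \<in> N"
    using assms by (simp add: a_minus_def M.a_assoc M.r_neg)
next
  assume "y \<in> carrier M \<and> y \<ominus>\<^bsub>M\<^esub> x \<in> N"
  moreover from this have "y = (y \<ominus>\<^bsub>M\<^esub> x) \<oplus>\<^bsub>M\<^esub> x"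
    using assms by (simp add: a_minus_def M.a_assoc M.l_neg)
  ultimately show "y \<in> N +>\<^bsub>M\<^esub> x" by (auto simp: a_r_coset_def')
qed

lemma coset_eq_iff:
  assumes "x \<in> carrier M" "y \<in> carrier M"
  shows "N +>\<^bsub>M\<^esub> x = N +>\<^bsub>M\<^esub> y \<longleftrightarrow> x \<ominus>\<^bsub>M\<^esub> y \<in> N"
proof
  assume "N +>\<^bsub>M\<^esub> x = N +>\<^bsub>M\<^esub> y"
  then have "x \<in> N +>\<^bsub>M\<^esub> y" using N.a_rcos_self[OF assms(1)] by simp
  then show "x \<ominus>\<^bsub>M\<^esub> y \<in> N" using mem_coset_iff[OF assms(2)] by simp
next
  assume "x \<ominus>\<^bsub>M\<^esub> y \<in> N"
  then have "x \<in> N +>\<^bsub>M\<^esub> y" using mem_coset_iff[OF assms(2)] assms by simp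
  then show "N +>\<^bsub>M\<^esub> x = N +>\<^bsub>M\<^esub> y"
    using M.a_repr_independence[OF _ assms(2)] N.a_subgroup by blast
qed

lemma coset_zero: "N +>\<^bsub>M\<^esub> \<zero>\<^bsub>M\<^esub> = N"
  using N_subset by simp

lemma coset_eq_zero_iff: "x \<in> carrier M \<Longrightarrow> N +>\<^bsub>M\<^esub> x = N \<longleftrightarrow> x \<in> N"
  using coset_eq_iff[of x "\<zero>\<^bsub>M\<^esub>"] by (simp add: coset_zero)

lemma coset_smult:
  assumes "r \<in> carrier R" "x \<in> carrier M"
  shows "r \<odot>\<^bsub>quot_module M N\<^esub> (N +>\<^bsub>M\<^esub> x) = N +>\<^bsub>M\<^esub> (r \<odot>\<^bsub>M\<^esub> x)"
proof -
  have "N +>\<^bsub>M\<^esub> (r \<odot>\<^bsub>M\<^esub> y) = N +>\<^bsub>M\<^esub> (r \<odot>\<^bsub>M\<^esub> x)" if "y \<in> N +>\<^bsub>M\<^esub> x" for y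
  proof -
    have y: "y \<in> carrier M" "y \<ominus>\<^bsub>M\<^esub> x \<in> N" using that mem_coset_iff[OF assms(2)] by auto
    then have "r \<odot>\<^bsub>M\<^esub> (y \<ominus>\<^bsub>M\<^esub> x) \<in> N" using submoduleD(4)[OF sub] assms by blast
    then have "r \<odot>\<^bsub>M\<^esub> y \<ominus>\<^bsub>M\<^esub> r \<odot>\<^bsub>M\<^esub> x \<in> N"
      using y assms by (simp add: a_minus_def smult_r_distr smult_r_minus)
    then show ?thesis using coset_eq_iff y assms by simp
  qed
  then have "(\<Union>y\<in>N +>\<^bsub>M\<^esub> x. N +>\<^bsub>M\<^esub> (r \<odot>\<^bsub>M\<^esub> y)) = (\<Union>y\<in>N +>\<^bsub>M\<^esub> x. N +>\<^bsub>M\<^esub> (r \<odot>\<^bsub>M\<^esub> x))"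
    by (rule SUP_cong[OF refl])
  also have "\<dots> = N +>\<^bsub>M\<^esub> (r \<odot>\<^bsub>M\<^esub> x)"
    using N.a_rcos_self[OF assms(2)] by (subst UN_constant) auto
  finally show ?thesis by (simp add: quot_module_def)
qed

lemma coset_add:
  assumes "x \<in> carrier M" "y \<in> carrier M"
  shows "(N +>\<^bsub>M\<^esub> x) \<oplus>\<^bsub>quot_module M N\<^esub> (N +>\<^bsub>M\<^esub> y) = N +>\<^bsub>M\<^esub> (x \<oplus>\<^bsub>M\<^esub> y)"
  using N.a_rcos_sum[OF assms] by simp

lemma lmodule_quot: "lmodule R (quot_module M N)"
proof -
  have z: "zero (quot_module M N) = N +>\<^bsub>M\<^esub> \<zero>\<^bsub>M\<^esub>" by (simp add: coset_zero)
  show ?thesis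
    by (rule lmoduleI)
      (auto simp: carrier_quot coset_add coset_smult z R.ring_axioms smult_l_distr smult_r_distr smult_assoc M.a_ac
        simp del: quot_module_simps)
qed

lemma lmodule_hom_coset: "lmodule_hom R M (quot_module M N) (\<lambda>x. N +>\<^bsub>M\<^esub> x)"
  by (intro lmodule_hom.intro lmodule_hom_axioms.intro lmodule_quot lmodule_axioms)
     (simp_all add: coset_smult coset_add[simplified])

text \<open>The first isomorphism theorem. A class is sent to the image of a chosen representative;
  equal images mean that the difference lies in \<open>N\<close>, so the choice does not matter. It
  is applied to determinants, simple tops and cohomology.\<close>

lemma quot_iso:
  assumes f: "lmodule_hom R M L f" and surj: "f ` carrier M = carrier L"
    and ker: "\<And>x. x \<in> carrier M \<Longrightarrow> f x = \<zero>\<^bsub>L\<^esub> \<longleftrightarrow> x \<in> N"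
  shows "quot_module M N \<simeq>\<^bsub>R\<^esub> L"
proof -
  interpret f: lmodule_hom R M L f by fact
  define g where "g = (\<lambda>X\<in>carrier (quot_module M N). f (SOME x. x \<in> carrier M \<and> X = N +>\<^bsub>M\<^esub> x))"
  have eq: "f x = f y \<longleftrightarrow> N +>\<^bsub>M\<^esub> x = N +>\<^bsub>M\<^esub> y" if "x \<in> carrier M" "y \<in> carrier M" for x y
    using that ker[of "x \<ominus>\<^bsub>M\<^esub> y"] coset_eq_iff[OF that] by (simp add: f.minus)
  have g: "g (N +>\<^bsub>M\<^esub> x) = f x" if "x \<in> carrier M" for x
  proof -
    define y where "y = (SOME y. y \<in> carrier M \<and> N +>\<^bsub>M\<^esub> x = N +>\<^bsub>M\<^esub> y)"
    have "y \<in> carrier M \<and> N +>\<^bsub>M\<^esub> x = N +>\<^bsub>M\<^esub> y"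
      unfolding y_def by (rule someI[of _ x]) (use that in simp)
    then have "f x = f y" using eq that by simp
    then show ?thesis using that by (simp add: y_def g_def)
  qed
  have "g \<in> lin_hom R (quot_module M N) L"
  proof (rule lin_homI)
    fix X assume "X \<in> carrier (quot_module M N)"
    then obtain x where "x \<in> carrier M" "X = N +>\<^bsub>M\<^esub> x" by (auto simp: carrier_quot)
    then show "g X \<in> carrier L" by (simp add: g)
  next
    fix X Y assume "X \<in> carrier (quot_module M N)" "Y \<in> carrier (quot_module M N)"
    then obtain x y where "x \<in> carrier M" "y \<in> carrier M" "X = N +>\<^bsub>M\<^esub> x" "Y = N +>\<^bsub>M\<^esub> y"
      by (auto simp: carrier_quot)
    then show "g (X \<oplus>\<^bsub>quot_module M N\<^esub> Y) = g X \<oplus>\<^bsub>L\<^esub> g Y"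
      by (simp add: g coset_add f.add del: quot_module_simps)
  next
    fix r X assume "r \<in> carrier R" "X \<in> carrier (quot_module M N)"
    then obtain x where "r \<in> carrier R" "x \<in> carrier M" "X = N +>\<^bsub>M\<^esub> x"
      by (auto simp: carrier_quot)
    then show "g (r \<odot>\<^bsub>quot_module M N\<^esub> X) = r \<odot>\<^bsub>L\<^esub> g X"
      by (simp add: g coset_smult f.smult)
  qed (auto simp: g_def)
  moreover have "bij_betw g (carrier (quot_module M N)) (carrier L)"
    unfolding bij_betw_def
  proof
    show "inj_on g (carrier (quot_module M N))"
      by (rule inj_onI) (auto simp: carrier_quot g eq)
    show "g ` carrier (quot_module M N) = carrier L"
      unfolding carrier_quot image_image surj[symmetric]
      by (rule image_cong) (use g in \<open>auto simp: carrier_quot\<close>)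
  qed
  ultimately show ?thesis unfolding mod_iso_def by blast
qed

end

lemma lquotientI: "\<lbrakk>lmodule R M; submodule N R M\<rbrakk> \<Longrightarrow> lquotient R M N"
  by (intro lquotient.intro lquotient_axioms.intro)

text \<open>Formulated for maps that are additive only on a part \<open>N\<close> of the source: the
  restriction maps \<open>cutF\<close> used later are known to be additive only on elements that
  vanish at given points.\<close>

lemma finsum_additive_on:
  assumes G: "abelian_monoid G" and H: "abelian_monoid H"
    and N: "N \<subseteq> carrier G" "\<zero>\<^bsub>G\<^esub> \<in> N" "\<And>x y. \<lbrakk>x \<in> N; y \<in> N\<rbrakk> \<Longrightarrow> x \<oplus>\<^bsub>G\<^esub> y \<in> N"
    and h: "\<And>x. x \<in> N \<Longrightarrow> h x \<in> carrier H" "h \<zero>\<^bsub>G\<^esub> = \<zero>\<^bsub>H\<^esub>"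
      "\<And>x y. \<lbrakk>x \<in> N; y \<in> N\<rbrakk> \<Longrightarrow> h (x \<oplus>\<^bsub>G\<^esub> y) = h x \<oplus>\<^bsub>H\<^esub> h y"
    and A: "finite A" "\<And>i. i \<in> A \<Longrightarrow> g i \<in> N"
  shows "finsum G g A \<in> N" "h (finsum G g A) = (\<Oplus>\<^bsub>H\<^esub>i\<in>A. h (g i))"
proof -
  interpret G: abelian_monoid G by fact
  interpret H: abelian_monoid H by fact
  have "finsum G g A \<in> N \<and> h (finsum G g A) = (\<Oplus>\<^bsub>H\<^esub>i\<in>A. h (g i))"
    using A
  proof (induction A)
    case (insert x A)
    then have x: "g x \<in> N" and IH: "finsum G g A \<in> N" "h (finsum G g A) = (\<Oplus>\<^bsub>H\<^esub>i\<in>A. h (g i))" by auto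
    have "g \<in> A \<rightarrow> carrier G" "g x \<in> carrier G" using insert.prems N(1) by auto
    moreover have "(\<lambda>i. h (g i)) \<in> A \<rightarrow> carrier H" "h (g x) \<in> carrier H" using insert.prems h(1) by auto
    ultimately show ?case using insert.hyps x IH N(3)[OF x IH(1)] h(3)[OF x IH(1)] by simp
  qed (use N(2) h(2) in simp)
  then show "finsum G g A \<in> N" "h (finsum G g A) = (\<Oplus>\<^bsub>H\<^esub>i\<in>A. h (g i))" by blast+
qed

subsection \<open>Finite direct sums and function spaces\<close>

lemma dsum_simps:
  "carrier (dsum I M) = (\<Pi>\<^sub>E i\<in>I. carrier (M i))" "zero (dsum I M) = (\<lambda>i\<in>I. \<zero>\<^bsub>M i\<^esub>)"
  "f \<oplus>\<^bsub>dsum I M\<^esub> g = (\<lambda>i\<in>I. f i \<oplus>\<^bsub>M i\<^esub> g i)" "r \<odot>\<^bsub>dsum I M\<^esub> f = (\<lambda>i\<in>I. r \<odot>\<^bsub>M i\<^esub> f i)"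
  by (auto simp: dsum_def)

lemma lmodule_dsum:
  assumes "ring R" "\<And>i. i \<in> I \<Longrightarrow> lmodule R (M i)"
  shows "lmodule R (dsum I M)"
proof -
  interpret ring R by fact
  have ag: "abelian_group (M i)" if "i \<in> I" for i
    using assms(2)[OF that] by (simp add: lmodule_def)
  note [simp] = abelian_group.axioms(1)[OF ag, THEN abelian_monoid.a_closed]
    abelian_group.axioms(1)[OF ag, THEN abelian_monoid.zero_closed]
    abelian_group.axioms(1)[OF ag, THEN abelian_monoid.l_zero]
    lmodule.smult_closed[OF assms(2)] lmodule.smult_l_null[OF assms(2)] 
    lmodule.smult_l_distr[OF assms(2)] lmodule.smult_r_distr[OF assms(2)]
    lmodule.smult_assoc[OF assms(2)] lmodule.smult_one[OF assms(2)]
  have [simp]: "f i \<in> carrier (M i)" if "f \<in> (\<Pi>\<^sub>E i\<in>I. carrier (M i))" "i \<in> I" for f i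
    using that by (rule PiE_mem)
  have [simp]: "f \<in> extensional I" if "f \<in> (\<Pi>\<^sub>E i\<in>I. carrier (M i))" for f
    using that by (simp add: PiE_def)
  show ?thesis
    by (rule lmoduleI)
      (auto simp: dsum_simps ring_axioms 
          abelian_group.axioms(1)[OF ag, THEN abelian_monoid.a_assoc]
          abelian_group.axioms(1)[OF ag, THEN abelian_monoid.a_lcomm]
          abelian_group.axioms(1)[OF ag, THEN abelian_monoid.r_zero]
          abelian_group.axioms(1)[OF ag, THEN abelian_monoid.a_comm] intro!: extensionalityI[where A = I])
qed

lemma free_module_simps:
  "carrier (free_module R n) = {..<n} \<rightarrow>\<^sub>E carrier R" "zero (free_module R n) = (\<lambda>i\<in>{..<n}. \<zero>\<^bsub>R\<^esub>)"
  "f \<oplus>\<^bsub>free_module R n\<^esub> g = (\<lambda>i\<in>{..<n}. f i \<oplus>\<^bsub>R\<^esub> g i)"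
  "r \<odot>\<^bsub>free_module R n\<^esub> f = (\<lambda>i\<in>{..<n}. r \<otimes>\<^bsub>R\<^esub> f i)"
  by (auto simp: free_module_def dsum_simps)

lemma lmodule_free_module: "ring R \<Longrightarrow> lmodule R (free_module R n)"
  unfolding free_module_def by (intro lmodule_dsum lmodule_regular)

lemma free_space_simps:
  "carrier (free_space K X) = {f \<in> X \<rightarrow>\<^sub>E carrier K. finite {x \<in> X. f x \<noteq> \<zero>\<^bsub>K\<^esub>}}"
  "zero (free_space K X) = (\<lambda>x\<in>X. \<zero>\<^bsub>K\<^esub>)" "f \<oplus>\<^bsub>free_space K X\<^esub> g = (\<lambda>x\<in>X. f x \<oplus>\<^bsub>K\<^esub> g x)"
  "c \<odot>\<^bsub>free_space K X\<^esub> f = (\<lambda>x\<in>X. c \<otimes>\<^bsub>K\<^esub> f x)"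
  by (auto simp: free_space_def)

lemma free_space_submodule:
  assumes "ring K"
  shows "submodule (carrier (free_space K X)) K (dsum X (\<lambda>_. regular K))"
proof -
  interpret ring K by fact
  interpret lmodule K "dsum X (\<lambda>_. regular K)" by (intro lmodule_dsum lmodule_regular assms)
  have "finite {x \<in> X. f x \<oplus>\<^bsub>K\<^esub> g x \<noteq> \<zero>\<^bsub>K\<^esub>}"
    if "f \<in> carrier (free_space K X)" "g \<in> carrier (free_space K X)" for f g
    by (rule finite_subset[of _ "{x \<in> X. f x \<noteq> \<zero>\<^bsub>K\<^esub>} \<union> {x \<in> X. g x \<noteq> \<zero>\<^bsub>K\<^esub>}"])
      (use that in \<open>auto simp: free_space_simps\<close>)
  moreover have "finite {x \<in> X. c \<otimes>\<^bsub>K\<^esub> f x \<noteq> \<zero>\<^bsub>K\<^esub>}"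
    if "f \<in> carrier (free_space K X)" "c \<in> carrier K" for f c
    by (rule finite_subset[of _ "{x \<in> X. f x \<noteq> \<zero>\<^bsub>K\<^esub>}"])
      (use that in \<open>auto simp: free_space_simps\<close>)
  ultimately show ?thesis
    unfolding submodule_iff
    by (auto simp: dsum_simps free_space_simps PiE_mem cong: conj_cong)
qed

lemma lmodule_free_space:
  assumes "ring K"
  shows "lmodule K (free_space K X)"
proof -
  have "free_space K X = dsum X (\<lambda>_. regular K)\<lparr>carrier := carrier (free_space K X)\<rparr>"
    by (simp add: free_space_def dsum_def)
  then show ?thesis
    using lmodule.lmodule_restrict[OF lmodule_dsum[OF assms lmodule_regular[OF assms]]
        free_space_submodule[OF assms]] by metis
qed

subsection \<open>Combinations of a list of elements\<close>

text \<open>The homomorphism from the free module that sends the \<open>i\<close>-th unit vector to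
  \<open>ws ! i\<close>.\<close>

definition comb :: "('r, 'x) ring_scheme \<Rightarrow> ('r, 'm) module \<Rightarrow> 'm list \<Rightarrow> (nat \<Rightarrow> 'r) \<Rightarrow> 'm" where
  "comb R M ws = (\<lambda>x\<in>carrier (free_module R (length ws)).
     \<Oplus>\<^bsub>M\<^esub>i\<in>{..<length ws}. x i \<odot>\<^bsub>M\<^esub> ws ! i)"

lemma (in lmodule) comb_lin_hom:
  assumes "set ws \<subseteq> carrier M"
  shows "comb R M ws \<in> lin_hom R (free_module R (length ws)) M"
proof -
  have w: "ws ! i \<in> carrier M" if "i < length ws" for i using assms that by auto
  interpret F: lmodule R "free_module R (length ws)" by (rule lmodule_free_module) (rule R.ring_axioms)
  have c: "x \<in> carrier (free_module R (length ws)) \<Longrightarrow> i < length ws \<Longrightarrow> x i \<in> carrier R" for x i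
    by (auto simp: free_module_simps)
  have cl: "x \<in> carrier (free_module R (length ws)) \<Longrightarrow> comb R M ws x \<in> carrier M" for x
    unfolding comb_def using c w by (auto intro!: M.finsum_closed)
  show ?thesis
  proof (rule lin_homI)
    fix x y assume xy: "x \<in> carrier (free_module R (length ws))" "y \<in> carrier (free_module R (length ws))"
    have "comb R M ws (x \<oplus>\<^bsub>free_module R (length ws)\<^esub> y) =
      (\<Oplus>\<^bsub>M\<^esub>i\<in>{..<length ws}. x i \<odot>\<^bsub>M\<^esub> ws ! i \<oplus>\<^bsub>M\<^esub> y i \<odot>\<^bsub>M\<^esub> ws ! i)"
      unfolding comb_def restrict_apply'[OF F.M.a_closed[OF xy]]
      by (rule M.finsum_cong') (use xy c w in \<open>auto simp: free_module_simps(3) smult_l_distr\<close>)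
    then show "comb R M ws (x \<oplus>\<^bsub>free_module R (length ws)\<^esub> y) = comb R M ws x \<oplus>\<^bsub>M\<^esub> comb R M ws y"
      using xy c w by (simp add: comb_def M.finsum_addf Pi_def)
  next
    fix r x assume xy: "r \<in> carrier R" "x \<in> carrier (free_module R (length ws))"
    have "comb R M ws (r \<odot>\<^bsub>free_module R (length ws)\<^esub> x) =
      (\<Oplus>\<^bsub>M\<^esub>i\<in>{..<length ws}. r \<odot>\<^bsub>M\<^esub> (x i \<odot>\<^bsub>M\<^esub> ws ! i))"
      unfolding comb_def restrict_apply'[OF F.smult_closed[OF xy]]
      by (rule M.finsum_cong') (use xy c w in \<open>auto simp: free_module_simps(4) smult_assoc\<close>)
    then show "comb R M ws (r \<odot>\<^bsub>free_module R (length ws)\<^esub> x) = r \<odot>\<^bsub>M\<^esub> comb R M ws x"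
      using xy c w by (simp add: comb_def finsum_smult Pi_def)
  qed (use cl in \<open>auto simp: comb_def\<close>)
qed

lemma (in lmodule) comb_image:
  assumes "set ws \<subseteq> carrier M"
  shows "comb R M ws ` carrier (free_module R (length ws)) = gen_submodule R M (set ws)"
proof
  let ?F = "free_module R (length ws)"
  interpret c: lmodule_hom R ?F M "comb R M ws"
    by (intro lmodule_hom_lin_hom comb_lin_hom assms lmodule_free_module R.ring_axioms lmodule_axioms)
  show "comb R M ws ` carrier ?F \<subseteq> gen_submodule R M (set ws)"
  proof (rule image_subsetI)
    fix x assume x: "x \<in> carrier ?F"
    have "(\<lambda>i. x i \<odot>\<^bsub>M\<^esub> ws ! i) \<in> {..<length ws} \<rightarrow> gen_submodule R M (set ws)"
    proof
      fix i assume i: "i \<in> {..<length ws}"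
      then have "x i \<in> carrier R" using x by (auto simp: free_module_simps)
      moreover have "ws ! i \<in> gen_submodule R M (set ws)"
        using i by (intro subsetD[OF gen_submodule_superset]) simp
      ultimately show "x i \<odot>\<^bsub>M\<^esub> ws ! i \<in> gen_submodule R M (set ws)"
        by (rule submoduleD(4)[OF submodule_gen[OF assms]])
    qed
    then show "comb R M ws x \<in> gen_submodule R M (set ws)"
      using x submodule_finsum[OF submodule_gen[OF assms]] by (simp add: comb_def)
  qed
  have "w \<in> comb R M ws ` carrier ?F" if w: "w \<in> set ws" for w
  proof -
    obtain i where i: "i < length ws" "ws ! i = w" using w by (auto simp: in_set_conv_nth)
    let ?x = "\<lambda>j\<in>{..<length ws}. if i = j then \<one>\<^bsub>R\<^esub> else \<zero>\<^bsub>R\<^esub>"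
    have x: "?x \<in> carrier ?F" by (auto simp: free_module_simps)
    have wc: "ws ! j \<in> carrier M" if "j < length ws" for j
      using subsetD[OF assms nth_mem[OF that]] .
    have "comb R M ws ?x = (\<Oplus>\<^bsub>M\<^esub>j\<in>{..<length ws}. if i = j then ws ! j else \<zero>\<^bsub>M\<^esub>)"
      unfolding comb_def restrict_apply'[OF x]
      by (rule M.finsum_cong') (use wc in auto)
    also have "\<dots> = ws ! i"
      by (rule M.finsum_singleton) (use i wc in auto)
    also note i(2)
    finally show ?thesis using x by (metis image_eqI)
  qed
  then show "gen_submodule R M (set ws) \<subseteq> comb R M ws ` carrier ?F"
    by (intro gen_submodule_minimal c.image_submodule c.M.carrier_submodule) auto
qed

section \<open>Finite-dimensional vector spaces\<close>

text \<open>A space is finite-dimensional if finitely many linear functionals separate its points; this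
  form passes to subspaces and to finite direct sums at once.\<close>

definition fin_dim :: "('k, 'x) ring_scheme \<Rightarrow> ('k, 'v) module \<Rightarrow> bool" where
  "fin_dim K V \<longleftrightarrow> (\<exists>\<Phi>. finite \<Phi> \<and> (\<forall>\<phi>\<in>\<Phi>. lmodule_hom K V (regular K) \<phi>) \<and>
     (\<forall>v\<in>carrier V. (\<forall>\<phi>\<in>\<Phi>. \<phi> v = \<zero>\<^bsub>K\<^esub>) \<longrightarrow> v = \<zero>\<^bsub>V\<^esub>))"

lemma fin_dimI:
  assumes "finite X" "\<And>x. x \<in> X \<Longrightarrow> lmodule_hom K V (regular K) (\<phi> x)"
    "\<And>v. v \<in> carrier V \<Longrightarrow> (\<And>x. x \<in> X \<Longrightarrow> \<phi> x v = \<zero>\<^bsub>K\<^esub>) \<Longrightarrow> v = \<zero>\<^bsub>V\<^esub>"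
  shows "fin_dim K V"
  unfolding fin_dim_def by (rule exI[of _ "\<phi> ` X"]) (use assms in auto)

lemma lmodule_hom_subspace:
  assumes "lmodule_hom K V W f" "submodule U K V"
  shows "lmodule_hom K (V\<lparr>carrier := U\<rparr>) W f"
proof -
  interpret lmodule_hom K V W f by fact
  show ?thesis
    using M.submoduleD(1)[OF assms(2)]
    by (intro lmodule_hom.intro M.lmodule_restrict N.lmodule_axioms assms(2) lmodule_hom_axioms.intro)
      (auto simp: add smult subset_iff)
qed

lemma fin_dim_subspace:
  assumes "fin_dim K V" "submodule U K V" "lmodule K V"
  shows "fin_dim K (V\<lparr>carrier := U\<rparr>)"
proof -
  obtain \<Phi> where \<Phi>: "finite \<Phi>" "\<forall>\<phi>\<in>\<Phi>. lmodule_hom K V (regular K) \<phi>"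
     "\<forall>v\<in>carrier V. (\<forall>\<phi>\<in>\<Phi>. \<phi> v = \<zero>\<^bsub>K\<^esub>) \<longrightarrow> v = \<zero>\<^bsub>V\<^esub>" using assms(1) unfolding fin_dim_def by blast
  show ?thesis
  proof (rule fin_dimI[where X = \<Phi> and \<phi> = "\<lambda>\<phi>. \<phi>"])
    show "lmodule_hom K (V\<lparr>carrier := U\<rparr>) (regular K) \<phi>" if "\<phi> \<in> \<Phi>" for \<phi>
      using \<Phi>(2) that assms(2) by (intro lmodule_hom_subspace) auto
    show "v = \<zero>\<^bsub>V\<lparr>carrier := U\<rparr>\<^esub>"
      if "v \<in> carrier (V\<lparr>carrier := U\<rparr>)" "\<And>\<phi>. \<phi> \<in> \<Phi> \<Longrightarrow> \<phi> v = \<zero>\<^bsub>K\<^esub>" for v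
      using that \<Phi>(3) lmodule.submoduleD(1)[OF assms(3,2)] by auto
  qed (rule \<Phi>(1))
qed

lemma (in field) inverse_exists:
  assumes "a \<in> carrier R" "a \<noteq> \<zero>"
  obtains b where "b \<in> carrier R" "b \<otimes> a = \<one>"
  using assms field_Units that unfolding Units_def by blast

locale kspace = lmodule K V + field K
  for K :: "('k, 'x) ring_scheme" and V :: "('k, 'v) module"

lemma kspaceI: "\<lbrakk>field K; lmodule K V\<rbrakk> \<Longrightarrow> kspace K V"
  by (rule kspace.intro)

context kspace
begin

lemma normalize_functional:
  assumes "lmodule_hom K V (regular K) \<phi>" "submodule U K V" "u \<in> U" "\<phi> u \<noteq> \<zero>\<^bsub>K\<^esub>"
  obtains e where "e \<in> U" "\<phi> e = \<one>\<^bsub>K\<^esub>"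
proof -
  interpret \<phi>: lmodule_hom K V "regular K" \<phi> by fact
  have u: "u \<in> carrier V" using submoduleD(1)[OF assms(2)] assms(3) by auto
  then obtain b where b: "b \<in> carrier K" "b \<otimes>\<^bsub>K\<^esub> \<phi> u = \<one>\<^bsub>K\<^esub>"
    using inverse_exists[of "\<phi> u"] \<phi>.closed assms(4) by auto
  show thesis
    by (rule that[of "b \<odot>\<^bsub>V\<^esub> u"]) (use b u \<phi>.smult submoduleD(4)[OF assms(2) b(1) assms(3)] in auto)
qed

end

text \<open>A strictly increasing map from subspaces to natural numbers is all that is needed of the
  dimension.\<close>

lemma fin_dim_strict_dimension:
  assumes "field K" "lmodule K V" "fin_dim K V"
  obtains D :: "'v set \<Rightarrow> nat" where
    "\<And>U U'. \<lbrakk>submodule U K V; submodule U' K V; U \<subset> U'\<rbrakk> \<Longrightarrow> D U < D U'"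
proof -
  have main: "\<exists>D :: 'v set \<Rightarrow> nat. \<forall>U U'. submodule U K V \<longrightarrow> submodule U' K V \<longrightarrow> U \<subset> U' \<longrightarrow> D U < D U'"
    if "finite \<Phi>" "\<forall>\<phi>\<in>\<Phi>. lmodule_hom K V (regular K) \<phi>"
     "\<forall>v\<in>carrier V. (\<forall>\<phi>\<in>\<Phi>. \<phi> v = \<zero>\<^bsub>K\<^esub>) \<longrightarrow> v = \<zero>\<^bsub>V\<^esub>" "lmodule K V" for \<Phi> and V :: "('a, 'v) module"
    using that
  proof (induction \<Phi> arbitrary: V)
    case empty
    interpret lmodule K V by fact
    have "carrier V = {\<zero>\<^bsub>V\<^esub>}"
    proof
      show "carrier V \<subseteq> {\<zero>\<^bsub>V\<^esub>}" using empty(2) by (simp add: subset_iff)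
    qed simp
    then have "\<not> U \<subset> U'" if "submodule U K V" "submodule U' K V" for U U'
      using submoduleD(1,2)[OF that(1)] submoduleD(1)[OF that(2)] by (simp add: psubset_eq) blast
    then show ?case by blast
  next
    case (insert \<phi> \<Phi>)
    interpret kspace K V using assms(1) insert.prems(3) by (rule kspaceI)
    interpret \<phi>: lmodule_hom K V "regular K" \<phi> using insert by auto
    let ?Z = "{x \<in> carrier V. \<phi> x = \<zero>\<^bsub>K\<^esub>}"
    have Z: "submodule ?Z K V" using \<phi>.kernel_submodule by simp
    have "\<exists>D :: 'v set \<Rightarrow> nat. \<forall>U U'. submodule U K (V\<lparr>carrier := ?Z\<rparr>) \<longrightarrow>
      submodule U' K (V\<lparr>carrier := ?Z\<rparr>) \<longrightarrow> U \<subset> U' \<longrightarrow> D U < D U'"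
    proof (rule insert.IH)
      show "\<forall>\<phi>\<in>\<Phi>. lmodule_hom K (V\<lparr>carrier := ?Z\<rparr>) (regular K) \<phi>"
        using insert.prems(1) by (blast intro: lmodule_hom_subspace[OF _ Z])
    qed (use insert.prems(2) lmodule_restrict[OF Z] in auto)
    then obtain D :: "'v set \<Rightarrow> nat" where D: "\<And>U U'. submodule U K V \<Longrightarrow> submodule U' K V \<Longrightarrow>
        U \<subseteq> ?Z \<Longrightarrow> U' \<subseteq> ?Z \<Longrightarrow> U \<subset> U' \<Longrightarrow> D U < D U'"
      unfolding submodule_restrict_iff[OF Z] by blast
    \<comment> \<open>The remaining functionals separate the points of the kernel \<open>?Z\<close>,
      where the induction hypothesis applies; the extra 1 is the dimension of the image of
      \<open>U\<close> under \<open>\<phi>\<close>.\<close>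
    let ?D = "\<lambda>U. D (U \<inter> ?Z) + (if \<exists>u\<in>U. \<phi> u \<noteq> \<zero>\<^bsub>K\<^esub> then 1 else 0)"
    have "?D U < ?D U'" if U: "submodule U K V" and U': "submodule U' K V" and lt: "U \<subset> U'" for U U'
    proof -
      have s: "submodule (U \<inter> ?Z) K V" "submodule (U' \<inter> ?Z) K V"
        using submodule_Inter[of "{U, ?Z}"] submodule_Inter[of "{U', ?Z}"] U U' Z by auto
      have mono: "D (U \<inter> ?Z) \<le> D (U' \<inter> ?Z)"
        using D[OF s] lt by (cases "U \<inter> ?Z = U' \<inter> ?Z") (auto intro: less_imp_le)
      show ?thesis
      proof (cases "\<exists>u\<in>U. \<phi> u \<noteq> \<zero>\<^bsub>K\<^esub>")
        case False
        then have UZ: "U \<inter> ?Z = U" using submoduleD(1)[OF U] by auto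
        show ?thesis
        proof (cases "\<exists>u\<in>U'. \<phi> u \<noteq> \<zero>\<^bsub>K\<^esub>")
          case F: False
          then have "U' \<inter> ?Z = U'" using submoduleD(1)[OF U'] by auto
          then show ?thesis using D[OF s] lt UZ False F by auto
        qed (use False mono in auto)
      next
        case True
        then obtain e where e: "e \<in> U" "\<phi> e = \<one>\<^bsub>K\<^esub>"
          using normalize_functional[OF \<phi>.lmodule_hom_axioms U] by blast
        obtain w where w: "w \<in> U'" "w \<notin> U" using lt by auto
        have ec: "e \<in> carrier V" and wc: "w \<in> carrier V"
          using submoduleD(1)[OF U] submoduleD(1)[OF U'] e w by auto
        have eU: "\<phi> w \<odot>\<^bsub>V\<^esub> e \<in> U" using submoduleD(4)[OF U] e wc \<phi>.closed by auto
        \<comment> \<open>Subtracting a multiple of \<open>e \<in> U\<close> moves \<open>w\<close>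
          into the kernel of \<open>\<phi>\<close> without moving it into \<open>U\<close>, so the
          two intersections with \<open>?Z\<close> differ.\<close>
        let ?w = "w \<ominus>\<^bsub>V\<^esub> \<phi> w \<odot>\<^bsub>V\<^esub> e"
        have \<phi>w: "\<phi> w \<in> carrier K" using \<phi>.closed wc by auto
        have "\<phi> ?w = \<phi> w \<ominus>\<^bsub>regular K\<^esub> \<phi> w"
          using wc ec e \<phi>w by (simp add: \<phi>.minus \<phi>.smult)
        also have "\<dots> = \<zero>\<^bsub>K\<^esub>" using \<phi>.N.M.minus_self \<phi>w by simp
        finally have "\<phi> ?w = \<zero>\<^bsub>K\<^esub>" .
        moreover have "?w \<in> U'" using submoduleD(6)[OF U'] w eU lt by blast
        moreover have "?w \<notin> U"
        proof
          assume "?w \<in> U"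
          then have "?w \<oplus>\<^bsub>V\<^esub> \<phi> w \<odot>\<^bsub>V\<^esub> e \<in> U" using submoduleD(3)[OF U] eU by blast
          then show False using w wc ec \<phi>w by simp
        qed
        ultimately have "U \<inter> ?Z \<subset> U' \<inter> ?Z" using lt submoduleD(1)[OF U'] by auto
        then show ?thesis using D[OF s] True lt by auto
      qed
    qed
    then show ?case by (intro exI[of _ ?D]) blast
  qed
  obtain \<Phi> where \<Phi>: "finite \<Phi>" "\<forall>\<phi>\<in>\<Phi>. lmodule_hom K V (regular K) \<phi>"
     "\<forall>v\<in>carrier V. (\<forall>\<phi>\<in>\<Phi>. \<phi> v = \<zero>\<^bsub>K\<^esub>) \<longrightarrow> v = \<zero>\<^bsub>V\<^esub>" using assms(3) unfolding fin_dim_def by blast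
  show thesis using main[OF \<Phi> assms(2)] that by blast
qed

text \<open>Existence of a complement, without bases. The induction peels off one separating
  functional \<open>\<phi>\<close>: its kernel is projected by the induction hypothesis, and one
  vector \<open>e\<close> with \<open>\<phi> e = \<one>\<close> spans the rest.\<close>

lemma fin_dim_projection:
  assumes "field K" "lmodule K V" "fin_dim K V" "submodule U K V"
  obtains p where "lmodule_hom K V V p" "\<And>v. v \<in> carrier V \<Longrightarrow> p v \<in> U" "\<And>u. u \<in> U \<Longrightarrow> p u = u"
proof -
  have main: "\<exists>p. lmodule_hom K V V p \<and> (\<forall>v\<in>carrier V. p v \<in> U) \<and> (\<forall>u\<in>U. p u = u)"
    if "finite \<Phi>" "\<forall>\<phi>\<in>\<Phi>. lmodule_hom K V (regular K) \<phi>"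
     "\<forall>v\<in>carrier V. (\<forall>\<phi>\<in>\<Phi>. \<phi> v = \<zero>\<^bsub>K\<^esub>) \<longrightarrow> v = \<zero>\<^bsub>V\<^esub>" "lmodule K V" "submodule U K V"
    for \<Phi> U and V :: "('a, 'c) module"
    using that
  proof (induction \<Phi> arbitrary: U V)
    case empty
    interpret lmodule K V by fact
    have "lmodule_hom K V V (\<lambda>x. x)"
      by (intro lmodule_hom.intro lmodule_axioms lmodule_hom_axioms.intro) simp_all
    then show ?case using submoduleD(1,2)[OF empty(4)] empty(2) by (intro exI[of _ "\<lambda>x. x"]) auto
  next
    case (insert \<phi> \<Phi>)
    interpret kspace K V using assms(1) insert.prems(3) by (rule kspaceI)
    interpret \<phi>: lmodule_hom K V "regular K" \<phi> using insert by auto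
    note U = insert.prems(4)
    let ?Z = "{x \<in> carrier V. \<phi> x = \<zero>\<^bsub>K\<^esub>}"
    have Z: "submodule ?Z K V" using \<phi>.kernel_submodule by simp
    have UZ: "submodule (U \<inter> ?Z) K V" using submodule_Inter[of "{U, ?Z}"] U Z by auto
    have "\<exists>p. lmodule_hom K (V\<lparr>carrier := ?Z\<rparr>) (V\<lparr>carrier := ?Z\<rparr>) p \<and>
       (\<forall>v\<in>carrier (V\<lparr>carrier := ?Z\<rparr>). p v \<in> U \<inter> ?Z) \<and> (\<forall>u\<in>U \<inter> ?Z. p u = u)"
    proof (rule insert.IH)
      show "\<forall>\<phi>\<in>\<Phi>. lmodule_hom K (V\<lparr>carrier := ?Z\<rparr>) (regular K) \<phi>"
        using insert.prems(1) by (blast intro: lmodule_hom_subspace[OF _ Z])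
      show "submodule (U \<inter> ?Z) K (V\<lparr>carrier := ?Z\<rparr>)" using UZ by (simp add: submodule_restrict_iff[OF Z])
    qed (use insert.prems(2) lmodule_restrict[OF Z] in auto)
    then obtain p where p: "lmodule_hom K (V\<lparr>carrier := ?Z\<rparr>) (V\<lparr>carrier := ?Z\<rparr>) p"
      "\<And>v. v \<in> ?Z \<Longrightarrow> p v \<in> U \<inter> ?Z" "\<And>u. u \<in> U \<inter> ?Z \<Longrightarrow> p u = u" by auto
    interpret p: lmodule_hom K "V\<lparr>carrier := ?Z\<rparr>" "V\<lparr>carrier := ?Z\<rparr>" p by fact
    show ?case
    proof (cases "\<exists>v\<in>carrier V. \<phi> v \<noteq> \<zero>\<^bsub>K\<^esub>")
      case False
      then have Z': "?Z = carrier V" by auto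
      moreover have "V\<lparr>carrier := carrier V\<rparr> = V" by simp
      ultimately show ?thesis using p submoduleD(1)[OF U] by (intro exI[of _ p]) (simp add: Int_absorb2)
    next
      case True
      \<comment> \<open>If \<open>\<phi>\<close> does not vanish on \<open>U\<close>, the vector has
        to be taken inside \<open>U\<close>; otherwise all of \<open>U\<close> lies in the kernel
        and any choice will do.\<close>
      have "\<exists>e\<in>carrier V. \<phi> e = \<one>\<^bsub>K\<^esub> \<and> (e \<in> U \<or> (\<forall>u\<in>U. \<phi> u = \<zero>\<^bsub>K\<^esub>))"
      proof (cases "\<exists>u\<in>U. \<phi> u \<noteq> \<zero>\<^bsub>K\<^esub>")
        case True
        then obtain e where "e \<in> U" "\<phi> e = \<one>\<^bsub>K\<^esub>"
          using normalize_functional[OF \<phi>.lmodule_hom_axioms U] by blast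
        then show ?thesis using submoduleD(1)[OF U] by auto
      next
        case False
        then show ?thesis using True normalize_functional[OF \<phi>.lmodule_hom_axioms carrier_submodule] by metis
      qed
      then obtain e where e: "e \<in> carrier V" "\<phi> e = \<one>\<^bsub>K\<^esub>" "e \<in> U \<or> (\<forall>u\<in>U. \<phi> u = \<zero>\<^bsub>K\<^esub>)" by blast
      \<comment> \<open>\<open>s\<close> is the component of a vector in the kernel of
        \<open>\<phi>\<close>, and \<open>t\<close> is what is kept of its component along
        \<open>e\<close>: all or nothing, according to whether \<open>e\<close> lies in
        \<open>U\<close>.\<close>
      define s where "s = (\<lambda>v. v \<ominus>\<^bsub>V\<^esub> \<phi> v \<odot>\<^bsub>V\<^esub> e)"
      define t where "t = (\<lambda>v. if e \<in> U then \<phi> v \<odot>\<^bsub>V\<^esub> e else \<zero>\<^bsub>V\<^esub>)"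
      have \<phi>c: "\<phi> v \<in> carrier K" if "v \<in> carrier V" for v using \<phi>.closed[OF that] by simp
      have sZ: "s v \<in> ?Z" if "v \<in> carrier V" for v
        using that e \<phi>c[OF that] \<phi>.N.M.minus_self[of "\<phi> v"] by (simp add: s_def \<phi>.minus \<phi>.smult)
      have s_add: "s (v \<oplus>\<^bsub>V\<^esub> w) = s v \<oplus>\<^bsub>V\<^esub> s w" if "v \<in> carrier V" "w \<in> carrier V" for v w
        using that e \<phi>c by (simp add: s_def \<phi>.add smult_l_distr a_minus_def M.minus_add M.a_ac)
      have s_smult: "s (c \<odot>\<^bsub>V\<^esub> v) = c \<odot>\<^bsub>V\<^esub> s v" if "c \<in> carrier K" "v \<in> carrier V" for c v
        using that e \<phi>c by (simp add: s_def \<phi>.smult smult_r_distr a_minus_def smult_r_minus smult_assoc)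
      let ?p = "\<lambda>v. p (s v) \<oplus>\<^bsub>V\<^esub> t v"
      have tU: "t v \<in> U" if "v \<in> carrier V" for v
        using submoduleD(2,4)[OF U] \<phi>c[OF that] by (simp add: t_def)
      have psU: "p (s v) \<in> U" "p (s v) \<in> carrier V" if "v \<in> carrier V" for v
        using p(2)[OF sZ[OF that]] by auto
      have tc: "t v \<in> carrier V" if "v \<in> carrier V" for v
        using tU that submoduleD(1)[OF U] by auto
      have t_add: "t (v \<oplus>\<^bsub>V\<^esub> w) = t v \<oplus>\<^bsub>V\<^esub> t w" if "v \<in> carrier V" "w \<in> carrier V" for v w
        using that e \<phi>c by (simp add: t_def \<phi>.add smult_l_distr)
      have t_smult: "t (c \<odot>\<^bsub>V\<^esub> v) = c \<odot>\<^bsub>V\<^esub> t v" if "c \<in> carrier K" "v \<in> carrier V" for c v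
        using that e \<phi>c by (simp add: t_def \<phi>.smult smult_assoc)
      have "lmodule_hom K V V ?p"
        using psU tc sZ p.add p.smult
        by (intro lmodule_hom.intro lmodule_axioms lmodule_hom_axioms.intro)
          (auto simp: s_add t_add s_smult t_smult smult_r_distr M.a_ac)
      moreover have "?p v \<in> U" if "v \<in> carrier V" for v
        using submoduleD(3)[OF U psU(1) tU] that by blast
      moreover have "?p u = u" if u: "u \<in> U" for u
      proof -
        have uc: "u \<in> carrier V" using u submoduleD(1)[OF U] by auto
        have "s u \<in> U"
        proof (cases "e \<in> U")
          case True
          then show ?thesis using submoduleD(6)[OF U u] submoduleD(4)[OF U \<phi>c[OF uc]] by (simp add: s_def)
        next
          case False
          then show ?thesis using e u uc by (simp add: s_def)
        qed
        then have ps: "p (s u) = s u" using p(3) sZ[OF uc] by auto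
        show ?thesis
        proof (cases "e \<in> U")
          case True
          then show ?thesis unfolding ps using uc e \<phi>c by (simp add: s_def t_def)
        next
          case False
          then show ?thesis unfolding ps using uc e u by (simp add: s_def t_def)
        qed
      qed
      ultimately show ?thesis by (intro exI[of _ ?p]) blast
    qed
  qed
  obtain \<Phi> where \<Phi>: "finite \<Phi>" "\<forall>\<phi>\<in>\<Phi>. lmodule_hom K V (regular K) \<phi>"
     "\<forall>v\<in>carrier V. (\<forall>\<phi>\<in>\<Phi>. \<phi> v = \<zero>\<^bsub>K\<^esub>) \<longrightarrow> v = \<zero>\<^bsub>V\<^esub>" using assms(3) unfolding fin_dim_def by blast
  show thesis using main[OF \<Phi> assms(2,4)] that by blast
qed

text \<open>Among the lists in \<open>U\<close> take one whose span has the greatest value under the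
  strictly increasing function; a vector of \<open>U\<close> outside the span could be added to
  increase that value.\<close>

lemma fin_dim_finitely_generated:
  assumes "field K" "lmodule K V" "fin_dim K V" "submodule U K V"
  obtains ws where "set ws \<subseteq> U" "gen_submodule K V (set ws) = U"
proof -
  interpret lmodule K V by fact
  obtain D :: "'c set \<Rightarrow> nat" where D:
    "\<And>U U'. \<lbrakk>submodule U K V; submodule U' K V; U \<subset> U'\<rbrakk> \<Longrightarrow> D U < D U'"
    using fin_dim_strict_dimension[OF assms(1-3)] by metis
  have gen: "submodule (gen_submodule K V (set ws)) K V" "gen_submodule K V (set ws) \<subseteq> U"
    if "set ws \<subseteq> U" for ws
    using that submoduleD(1)[OF assms(4)] submodule_gen[of "set ws"] gen_submodule_minimal[OF assms(4)]
    by (meson subset_trans)+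
  have le: "D (gen_submodule K V (set ws)) \<le> D U" if "set ws \<subseteq> U" for ws
    using D[OF gen(1)[OF that] assms(4)] gen(2)[OF that]
    by (cases "gen_submodule K V (set ws) = U") (auto simp: psubset_eq)
  have "\<exists>ws. set ws \<subseteq> U \<and> (\<forall>ws'. set ws' \<subseteq> U \<longrightarrow>
      D (gen_submodule K V (set ws')) \<le> D (gen_submodule K V (set ws)))"
    by (rule ex_has_greatest_nat[of "\<lambda>ws. set ws \<subseteq> U" "[]" _ "Suc (D U)"]) (auto simp: le less_Suc_eq_le)
  then obtain ws where ws: "set ws \<subseteq> U"
    "\<And>ws'. set ws' \<subseteq> U \<Longrightarrow> D (gen_submodule K V (set ws')) \<le> D (gen_submodule K V (set ws))" by blast
  have "u \<in> gen_submodule K V (set ws)" if u: "u \<in> U" for u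
  proof (rule ccontr)
    assume "u \<notin> gen_submodule K V (set ws)"
    moreover have "u \<in> gen_submodule K V (set (u # ws))" "set ws \<subseteq> gen_submodule K V (set (u # ws))"
      using gen_submodule_superset[of "set (u # ws)" K V] by simp_all
    moreover have uws: "set (u # ws) \<subseteq> U" using u ws(1) by simp
    ultimately have "gen_submodule K V (set ws) \<subset> gen_submodule K V (set (u # ws))"
      using gen_submodule_minimal[OF gen(1)[OF uws], of "set ws"] by blast
    then show False using D[OF gen(1)[OF ws(1)] gen(1)[OF uws]] ws(2)[OF uws] by simp
  qed
  then show thesis using that ws(1) gen(2)[OF ws(1)] by blast
qed

text \<open>Exactness of duality over a field: project onto the image of \<open>f\<close>, lift back
  along \<open>f\<close> by choice, and apply \<open>G\<close>, which does not see the ambiguity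
  because it vanishes on the kernel. This will turn a functional that vanishes on cycles into a
  coboundary.\<close>

lemma functional_factor:
  assumes "field K" "lmodule_hom K V W f" "fin_dim K W" "lmodule_hom K V (regular K) G"
    and ker: "\<And>v. \<lbrakk>v \<in> carrier V; f v = \<zero>\<^bsub>W\<^esub>\<rbrakk> \<Longrightarrow> G v = \<zero>\<^bsub>K\<^esub>"
  obtains G' where "lmodule_hom K W (regular K) G'" "\<And>v. v \<in> carrier V \<Longrightarrow> G' (f v) = G v"
proof -
  interpret f: lmodule_hom K V W f by fact
  interpret G: lmodule_hom K V "regular K" G by fact
  have U: "submodule (f ` carrier V) K W" by (intro f.image_submodule f.M.carrier_submodule)
  obtain p where p: "lmodule_hom K W W p" "\<And>v. v \<in> carrier W \<Longrightarrow> p v \<in> f ` carrier V"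
    "\<And>u. u \<in> f ` carrier V \<Longrightarrow> p u = u"
    using fin_dim_projection[OF assms(1) f.N.lmodule_axioms assms(3) U] by metis
  interpret p: lmodule_hom K W W p by fact
  define s where "s w = (SOME v. v \<in> carrier V \<and> f v = p w)" for w
  have s: "s w \<in> carrier V" "f (s w) = p w" if "w \<in> carrier W" for w
  proof -
    have "\<exists>v. v \<in> carrier V \<and> f v = p w" using p(2)[OF that] by auto
    from someI_ex[OF this] show "s w \<in> carrier V" "f (s w) = p w" unfolding s_def by auto
  qed
  have eq: "G v = G v'" if "v \<in> carrier V" "v' \<in> carrier V" "f v = f v'" for v v'
  proof -
    have "f (v \<ominus>\<^bsub>V\<^esub> v') = \<zero>\<^bsub>W\<^esub>" using that by (simp add: f.minus)
    then have "G (v \<ominus>\<^bsub>V\<^esub> v') = \<zero>\<^bsub>regular K\<^esub>" using ker that by simp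
    then show ?thesis using that G.N.M.minus_eq_zero_iff[OF G.closed G.closed, of v v'] by (simp add: G.minus)
  qed
  have "lmodule_hom K W (regular K) (\<lambda>w. G (s w))"
  proof (intro lmodule_hom.intro lmodule_hom_axioms.intro G.N.lmodule_axioms f.N.lmodule_axioms)
    fix x y assume xy: "x \<in> carrier W" "y \<in> carrier W"
    have "G (s (x \<oplus>\<^bsub>W\<^esub> y)) = G (s x \<oplus>\<^bsub>V\<^esub> s y)"
      by (rule eq) (use s xy in \<open>simp_all add: f.add p.add\<close>)
    then show "G (s (x \<oplus>\<^bsub>W\<^esub> y)) = G (s x) \<oplus>\<^bsub>regular K\<^esub> G (s y)" using s xy by (simp only: G.add)
  next
    fix c x assume xy: "c \<in> carrier K" "x \<in> carrier W"
    have "G (s (c \<odot>\<^bsub>W\<^esub> x)) = G (c \<odot>\<^bsub>V\<^esub> s x)"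
      by (rule eq) (use s xy in \<open>simp_all add: f.smult p.smult\<close>)
    then show "G (s (c \<odot>\<^bsub>W\<^esub> x)) = c \<odot>\<^bsub>regular K\<^esub> G (s x)" using s xy by (simp only: G.smult)
  qed (use s in blast)
  moreover have "G (s (f v)) = G v" if "v \<in> carrier V" for v
    by (rule eq) (use s[of "f v"] p(3)[of "f v"] that in auto)
  ultimately show thesis using that by blast
qed

text \<open>With a projection \<open>p\<close> onto \<open>U\<close>, the vector
  \<open>z \<ominus> p z\<close> is nonzero, so some functional \<open>\<phi>\<close> detects it;
  the composite of \<open>\<phi>\<close> with \<open>1 - p\<close>, rescaled, does what is
  required.\<close>

lemma functional_separate:
  assumes "field K" "lmodule K V" "fin_dim K V" "submodule U K V" "z \<in> carrier V" "z \<notin> U"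
  obtains G where "lmodule_hom K V (regular K) G" "\<And>u. u \<in> U \<Longrightarrow> G u = \<zero>\<^bsub>K\<^esub>" "G z = \<one>\<^bsub>K\<^esub>"
proof -
  interpret kspace K V using assms by (intro kspaceI)
  obtain p where p: "lmodule_hom K V V p" "\<And>v. v \<in> carrier V \<Longrightarrow> p v \<in> U" "\<And>u. u \<in> U \<Longrightarrow> p u = u"
    using fin_dim_projection[OF assms(1-4)] by metis
  interpret p: lmodule_hom K V V p by fact
  obtain \<Phi> where \<Phi>: "\<forall>\<phi>\<in>\<Phi>. lmodule_hom K V (regular K) \<phi>"
     "\<forall>v\<in>carrier V. (\<forall>\<phi>\<in>\<Phi>. \<phi> v = \<zero>\<^bsub>K\<^esub>) \<longrightarrow> v = \<zero>\<^bsub>V\<^esub>" using assms(3) unfolding fin_dim_def by blast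
  have "z \<ominus>\<^bsub>V\<^esub> p z \<noteq> \<zero>\<^bsub>V\<^esub>" using assms(5,6) p(2)[OF assms(5)] by auto
  then obtain \<phi> where \<phi>: "\<phi> \<in> \<Phi>" "\<phi> (z \<ominus>\<^bsub>V\<^esub> p z) \<noteq> \<zero>\<^bsub>K\<^esub>"
    using bspec[OF \<Phi>(2), of "z \<ominus>\<^bsub>V\<^esub> p z"] assms(5) by blast
  interpret \<phi>: lmodule_hom K V "regular K" \<phi> using \<Phi> \<phi> by auto
  have c: "\<phi> v \<in> carrier K" if "v \<in> carrier V" for v using \<phi>.closed[OF that] by simp
  obtain b where b: "b \<in> carrier K" "b \<otimes>\<^bsub>K\<^esub> \<phi> (z \<ominus>\<^bsub>V\<^esub> p z) = \<one>\<^bsub>K\<^esub>"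
    using inverse_exists[OF c \<phi>(2)] assms(5) by auto
  let ?G = "\<lambda>v. b \<otimes>\<^bsub>K\<^esub> \<phi> (v \<ominus>\<^bsub>V\<^esub> p v)"
  have "lmodule_hom K V (regular K) ?G"
  proof (intro lmodule_hom.intro lmodule_hom_axioms.intro \<phi>.N.lmodule_axioms lmodule_axioms)
    fix x y assume xy: "x \<in> carrier V" "y \<in> carrier V"
    have "x \<oplus>\<^bsub>V\<^esub> y \<ominus>\<^bsub>V\<^esub> p (x \<oplus>\<^bsub>V\<^esub> y) = (x \<ominus>\<^bsub>V\<^esub> p x) \<oplus>\<^bsub>V\<^esub> (y \<ominus>\<^bsub>V\<^esub> p y)"
      using xy by (simp add: p.add a_minus_def M.minus_add M.a_ac)
    then show "?G (x \<oplus>\<^bsub>V\<^esub> y) = ?G x \<oplus>\<^bsub>regular K\<^esub> ?G y"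
      using xy b c by (simp add: \<phi>.add R.r_distr)
  next
    fix r x assume xy: "r \<in> carrier K" "x \<in> carrier V"
    have "r \<odot>\<^bsub>V\<^esub> x \<ominus>\<^bsub>V\<^esub> p (r \<odot>\<^bsub>V\<^esub> x) = r \<odot>\<^bsub>V\<^esub> (x \<ominus>\<^bsub>V\<^esub> p x)"
      using xy by (simp add: p.smult a_minus_def smult_r_distr smult_r_minus)
    then show "?G (r \<odot>\<^bsub>V\<^esub> x) = r \<odot>\<^bsub>regular K\<^esub> ?G x"
      using xy b c by (simp add: \<phi>.smult m_lcomm)
  qed (use b c in simp)
  moreover have "?G u = \<zero>\<^bsub>K\<^esub>" if "u \<in> U" for u
    using that submoduleD(1)[OF assms(4)] p(3) b \<phi>.zero by (auto simp: subset_iff)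
  ultimately show thesis using that b(2) by blast
qed

section \<open>Top exterior powers\<close>

lemma permutation_of_permutes: "\<lbrakk>p permutes S; finite S\<rbrakk> \<Longrightarrow> permutation p"
  unfolding permutation_permutes by blast

section \<open>Free vector spaces and linear extension\<close>

lemma basis_vec_closed:
  assumes "ring K" "x \<in> X"
  shows "basis_vec K X x \<in> carrier (free_space K X)"
proof -
  interpret ring K by fact
  have "finite {y \<in> X. basis_vec K X x y \<noteq> \<zero>\<^bsub>K\<^esub>}"
    by (rule finite_subset[of _ "{x}"]) (auto simp: basis_vec_def)
  then show ?thesis by (auto simp: free_space_simps basis_vec_def)
qed

text \<open>Induction on a finite set containing the support, removing one basis term at a time. It
  reduces membership questions about the exterior power to basis vectors.\<close>

lemma free_space_spanned:
  assumes "ring K" and N: "submodule N K (free_space K X)" and b: "basis_vec K X ` X \<subseteq> N"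
  shows "N = carrier (free_space K X)"
proof
  interpret F: lmodule K "free_space K X" by (rule lmodule_free_space) fact
  show "N \<subseteq> carrier (free_space K X)" by (rule F.submoduleD(1)[OF N])
  have "f \<in> N" if "finite S" "f \<in> carrier (free_space K X)" "{x \<in> X. f x \<noteq> \<zero>\<^bsub>K\<^esub>} \<subseteq> S" for S f
    using that
  proof (induction S arbitrary: f)
    case empty
    then have "f = \<zero>\<^bsub>free_space K X\<^esub>"
      by (auto simp: free_space_simps PiE_def intro!: extensionalityI[where A = X])
    then show ?case using F.submoduleD(2)[OF N] by simp
  next
    case (insert t S)
    show ?case
    proof (cases "t \<in> X")
      case False
      then show ?thesis using insert by auto
    next
      case True
      have f: "f x \<in> carrier K" if "x \<in> X" for x using insert.prems(1) that by (auto simp: free_space_simps)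
      let ?g = "\<lambda>x\<in>X. if x = t then \<zero>\<^bsub>K\<^esub> else f x"
      have "finite {x \<in> X. ?g x \<noteq> \<zero>\<^bsub>K\<^esub>}"
        by (rule finite_subset[of _ "{x \<in> X. f x \<noteq> \<zero>\<^bsub>K\<^esub>}"])
          (use insert.prems(1) in \<open>auto simp: free_space_simps\<close>)
      then have "?g \<in> carrier (free_space K X)" using f by (auto simp: free_space_simps)
      then have "?g \<in> N" by (rule insert.IH) (use insert.prems(2) in \<open>auto split: if_splits\<close>)
      moreover have "f t \<odot>\<^bsub>free_space K X\<^esub> basis_vec K X t \<in> N"
        using F.submoduleD(4)[OF N f[OF True]] b True by auto
      ultimately have "?g \<oplus>\<^bsub>free_space K X\<^esub> f t \<odot>\<^bsub>free_space K X\<^esub> basis_vec K X t \<in> N"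
        by (rule F.submoduleD(3)[OF N])
      also have "?g \<oplus>\<^bsub>free_space K X\<^esub> f t \<odot>\<^bsub>free_space K X\<^esub> basis_vec K X t = f"
        using f True insert.prems(1)
        by (auto simp: free_space_simps basis_vec_def PiE_def intro!: extensionalityI[where A = X])
      finally show ?thesis .
    qed
  qed
  then show "carrier (free_space K X) \<subseteq> N"
    by (auto simp: free_space_simps)
qed

text \<open>The set \<open>X\<close> may be infinite, hence the restriction to the support.\<close>

definition linear_extension :: "('k, 'x) ring_scheme \<Rightarrow> 'b set \<Rightarrow> ('b \<Rightarrow> 'k) \<Rightarrow> ('b \<Rightarrow> 'k) \<Rightarrow> 'k" where
  "linear_extension K X D f = (\<Oplus>\<^bsub>K\<^esub>x\<in>{x \<in> X. f x \<noteq> \<zero>\<^bsub>K\<^esub>}. f x \<otimes>\<^bsub>K\<^esub> D x)"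

text \<open>Allows functions with different supports to be summed over a common finite set.\<close>

lemma linear_extension_superset:
  assumes "ring K" "D \<in> X \<rightarrow> carrier K" "f \<in> X \<rightarrow> carrier K" "finite S" "S \<subseteq> X" "{x \<in> X. f x \<noteq> \<zero>\<^bsub>K\<^esub>} \<subseteq> S"
  shows "linear_extension K X D f = (\<Oplus>\<^bsub>K\<^esub>x\<in>S. f x \<otimes>\<^bsub>K\<^esub> D x)"
proof -
  interpret ring K by fact
  have "D x \<in> carrier K" "f x \<in> carrier K" if "x \<in> S" for x using assms that by auto
  then show ?thesis unfolding linear_extension_def
    by (intro add.finprod_mono_neutral_cong_left) (use assms(4-6) in auto)
qed

lemma linear_extension_hom:
  assumes "cring K" "D \<in> X \<rightarrow> carrier K"
  shows "lmodule_hom K (free_space K X) (regular K) (linear_extension K X D)"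
proof -
  interpret cring K by fact
  interpret F: lmodule K "free_space K X" by (rule lmodule_free_space) (rule ring_axioms)
  have c: "f x \<in> carrier K" if "f \<in> carrier (free_space K X)" "x \<in> X" for f x
    using that by (auto simp: free_space_simps)
  have D: "D x \<in> carrier K" if "x \<in> X" for x using assms(2) that by auto
  have fin: "finite {x \<in> X. f x \<noteq> \<zero>\<^bsub>K\<^esub>}" if "f \<in> carrier (free_space K X)" for f
    using that by (simp add: free_space_simps)
  note sup = linear_extension_superset[OF ring_axioms assms(2)]
  show ?thesis
  proof (intro lmodule_hom.intro lmodule_hom_axioms.intro F.lmodule_axioms lmodule_regular ring_axioms)
    fix f assume f: "f \<in> carrier (free_space K X)"
    show "linear_extension K X D f \<in> carrier (regular K)"
      unfolding linear_extension_def using c[OF f] D by (auto intro!: finsum_closed)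
  next
    fix f g assume f: "f \<in> carrier (free_space K X)" and g: "g \<in> carrier (free_space K X)"
    let ?S = "{x \<in> X. f x \<noteq> \<zero>\<^bsub>K\<^esub>} \<union> {x \<in> X. g x \<noteq> \<zero>\<^bsub>K\<^esub>}"
    have fg: "f \<oplus>\<^bsub>free_space K X\<^esub> g \<in> carrier (free_space K X)" using f g by simp
    have "linear_extension K X D (f \<oplus>\<^bsub>free_space K X\<^esub> g) =
      (\<Oplus>\<^bsub>K\<^esub>x\<in>?S. (f \<oplus>\<^bsub>free_space K X\<^esub> g) x \<otimes>\<^bsub>K\<^esub> D x)"
      by (rule sup) (use fin f g c[OF f] c[OF g] c[OF fg] in \<open>auto simp: free_space_simps(3)\<close>)
    also have "\<dots> = (\<Oplus>\<^bsub>K\<^esub>x\<in>?S. f x \<otimes>\<^bsub>K\<^esub> D x \<oplus>\<^bsub>K\<^esub> g x \<otimes>\<^bsub>K\<^esub> D x)"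
      by (rule finsum_cong') (use c[OF f] c[OF g] D in \<open>auto simp: free_space_simps(3) l_distr\<close>)
    also have "\<dots> = (\<Oplus>\<^bsub>K\<^esub>x\<in>?S. f x \<otimes>\<^bsub>K\<^esub> D x) \<oplus>\<^bsub>K\<^esub> (\<Oplus>\<^bsub>K\<^esub>x\<in>?S. g x \<otimes>\<^bsub>K\<^esub> D x)"
      by (rule finsum_addf) (use c[OF f] c[OF g] D in auto)
    also have "(\<Oplus>\<^bsub>K\<^esub>x\<in>?S. f x \<otimes>\<^bsub>K\<^esub> D x) = linear_extension K X D f"
      by (rule sup[symmetric]) (use fin f g c[OF f] in auto)
    also have "(\<Oplus>\<^bsub>K\<^esub>x\<in>?S. g x \<otimes>\<^bsub>K\<^esub> D x) = linear_extension K X D g"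
      by (rule sup[symmetric]) (use fin f g c[OF g] in auto)
    finally show "linear_extension K X D (f \<oplus>\<^bsub>free_space K X\<^esub> g) =
      linear_extension K X D f \<oplus>\<^bsub>regular K\<^esub> linear_extension K X D g" by simp
  next
    fix r f assume r: "r \<in> carrier K" and f: "f \<in> carrier (free_space K X)"
    let ?S = "{x \<in> X. f x \<noteq> \<zero>\<^bsub>K\<^esub>}"
    have rf: "r \<odot>\<^bsub>free_space K X\<^esub> f \<in> carrier (free_space K X)" using f r by simp
    have "linear_extension K X D (r \<odot>\<^bsub>free_space K X\<^esub> f) =
      (\<Oplus>\<^bsub>K\<^esub>x\<in>?S. (r \<odot>\<^bsub>free_space K X\<^esub> f) x \<otimes>\<^bsub>K\<^esub> D x)"
      by (rule sup) (use fin f r c[OF f] c[OF rf] in \<open>auto simp: free_space_simps(4)\<close>)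
    also have "\<dots> = (\<Oplus>\<^bsub>K\<^esub>x\<in>?S. r \<otimes>\<^bsub>K\<^esub> (f x \<otimes>\<^bsub>K\<^esub> D x))"
      by (rule finsum_cong') (use c[OF f] r D in \<open>auto simp: free_space_simps(4) m_assoc\<close>)
    also have "\<dots> = r \<otimes>\<^bsub>K\<^esub> linear_extension K X D f"
      unfolding linear_extension_def
      by (rule finsum_rdistr[symmetric]) (use fin[OF f] c[OF f] r D in auto)
    finally show "linear_extension K X D (r \<odot>\<^bsub>free_space K X\<^esub> f) = r \<odot>\<^bsub>regular K\<^esub> linear_extension K X D f"
      by simp
  qed
qed

lemma linear_extension_basis:
  assumes "ring K" "D \<in> X \<rightarrow> carrier K" "x \<in> X"
  shows "linear_extension K X D (basis_vec K X x) = D x"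
proof -
  interpret ring K by fact
  have "linear_extension K X D (basis_vec K X x) = (\<Oplus>\<^bsub>K\<^esub>y\<in>{x}. basis_vec K X x y \<otimes>\<^bsub>K\<^esub> D y)"
    by (rule linear_extension_superset[OF assms(1,2)]) (use assms(3) in \<open>auto simp: basis_vec_def\<close>)
  also have "\<dots> = D x" using assms(2,3) by (auto simp: basis_vec_def Pi_def)
  finally show ?thesis .
qed

text \<open>The Leibniz formula for the matrix with rows \<open>vs\<close> and with columns in the
  order of \<open>xs\<close>.\<close>

definition det_form :: "('k, 'x) ring_scheme \<Rightarrow> 'b list \<Rightarrow> ('b \<Rightarrow> 'k) list \<Rightarrow> 'k" where
  "det_form K xs vs = (\<Oplus>\<^bsub>K\<^esub>\<pi>\<in>{\<pi>. \<pi> permutes {..<length xs}}.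
     (if evenperm \<pi> then \<one>\<^bsub>K\<^esub> else \<ominus>\<^bsub>K\<^esub> \<one>\<^bsub>K\<^esub>) \<otimes>\<^bsub>K\<^esub> (\<Otimes>\<^bsub>K\<^esub>i\<in>{..<length xs}. (vs ! i) (xs ! \<pi> i)))"

section \<open>The determinant as an isomorphism from the top exterior power\<close>

locale det_setup = field K for K :: "('k, 'x) ring_scheme" +
  fixes xs :: "'b list"
  assumes distinct: "distinct xs"
begin

abbreviation n where "n \<equiv> length xs"
abbreviation X where "X \<equiv> set xs"
abbreviation V where "V \<equiv> free_space K X"
abbreviation T where "T \<equiv> tuples V n"
abbreviation F where "F \<equiv> free_space K T"
abbreviation b where "b \<equiv> basis_vec K T"
abbreviation e where "e \<equiv> basis_vec K X"
abbreviation sg where "sg \<pi> \<equiv> if evenperm \<pi> then \<one>\<^bsub>K\<^esub> else \<ominus>\<^bsub>K\<^esub> \<one>\<^bsub>K\<^esub>"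
abbreviation Rel where "Rel \<equiv> gen_submodule K F (ext_power_relations K V n)"

sublocale V: lmodule K V by (rule lmodule_free_space) (rule ring_axioms)
sublocale F: lmodule K F by (rule lmodule_free_space) (rule ring_axioms)

lemma coord_closed: "\<lbrakk>v \<in> carrier V; x \<in> X\<rbrakk> \<Longrightarrow> v x \<in> carrier K"
  by (auto simp: free_space_simps)

lemma tuple_coord: "\<lbrakk>vs \<in> T; i < n; j < n\<rbrakk> \<Longrightarrow> (vs ! i) (xs ! j) \<in> carrier K"
  using subsetD[of "set vs" "carrier V" "vs ! i"] by (intro coord_closed) (simp_all add: tuples_def)

lemma tuple_update: "\<lbrakk>vs \<in> T; u \<in> carrier V\<rbrakk> \<Longrightarrow> vs[i := u] \<in> T"
  using set_update_subset_insert[of vs i u] by (auto simp: tuples_def)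

lemma perm_lt: "\<lbrakk>\<pi> permutes {..<n}; i < n\<rbrakk> \<Longrightarrow> \<pi> i < n"
  using permutes_in_image[of \<pi> "{..<n}" i] by simp

lemma sg_closed: "sg \<pi> \<in> carrier K" by simp

lemma det_form_closed: "vs \<in> T \<Longrightarrow> det_form K xs vs \<in> carrier K"
  unfolding det_form_def
proof (intro finsum_closed Pi_I m_closed sg_closed finprod_closed)
  fix \<pi> i assume "vs \<in> T" "\<pi> \<in> {\<pi>. \<pi> permutes {..<n}}" "i \<in> {..<n}"
  then show "(vs ! i) (xs ! \<pi> i) \<in> carrier K" using tuple_coord[of vs i "\<pi> i"] perm_lt[of \<pi> i] by simp
qed

text \<open>Isolates the one factor that depends on slot \<open>i\<close>, so that linearity in this
  slot can be read off termwise.\<close>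

lemma det_form_update:
  assumes "vs \<in> T" "i < n" "u \<in> carrier V"
  shows "det_form K xs (vs[i := u]) = (\<Oplus>\<^bsub>K\<^esub>\<pi>\<in>{\<pi>. \<pi> permutes {..<n}}.
     u (xs ! \<pi> i) \<otimes>\<^bsub>K\<^esub> (sg \<pi> \<otimes>\<^bsub>K\<^esub> (\<Otimes>\<^bsub>K\<^esub>j\<in>{..<n} - {i}. (vs ! j) (xs ! \<pi> j))))"
  unfolding det_form_def
proof (rule finsum_cong')
  have len: "length vs = n" using assms(1) by (simp add: tuples_def)
  fix \<pi> assume "\<pi> \<in> {\<pi>. \<pi> permutes {..<n}}"
  then have \<pi>: "\<pi> permutes {..<n}" by simp
  have A: "{..<n} = insert i ({..<n} - {i})" using assms(2) by auto
  have u: "u (xs ! \<pi> i) \<in> carrier K" using coord_closed[OF assms(3)] nth_mem[OF perm_lt[OF \<pi> assms(2)]] by blast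
  have P: "(\<lambda>j. (vs ! j) (xs ! \<pi> j)) \<in> {..<n} - {i} \<rightarrow> carrier K"
    using tuple_coord[OF assms(1)] perm_lt[OF \<pi>] by auto
  have "(\<Otimes>\<^bsub>K\<^esub>j\<in>{..<n}. (vs[i := u] ! j) (xs ! \<pi> j)) =
      (\<Otimes>\<^bsub>K\<^esub>j\<in>insert i ({..<n} - {i}). if j = i then u (xs ! \<pi> i) else (vs ! j) (xs ! \<pi> j))"
  proof (rule finprod_cong'[OF A])
    show "(\<lambda>j. if j = i then u (xs ! \<pi> i) else (vs ! j) (xs ! \<pi> j)) \<in> insert i ({..<n} - {i}) \<rightarrow> carrier K"
    proof (rule Pi_I)
      fix j assume "j \<in> insert i ({..<n} - {i})"
      then show "(if j = i then u (xs ! \<pi> i) else (vs ! j) (xs ! \<pi> j)) \<in> carrier K"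
        using u funcset_mem[OF P, of j] by (cases "j = i") auto
    qed
  qed (use assms(2) in \<open>auto simp: len\<close>)
  also have "\<dots> = u (xs ! \<pi> i) \<otimes>\<^bsub>K\<^esub> (\<Otimes>\<^bsub>K\<^esub>j\<in>{..<n} - {i}. if j = i then u (xs ! \<pi> i) else (vs ! j) (xs ! \<pi> j))"
  proof (subst finprod_insert)
    show "(\<lambda>j. if j = i then u (xs ! \<pi> i) else (vs ! j) (xs ! \<pi> j)) \<in> {..<n} - {i} \<rightarrow> carrier K"
      using P by (rule Pi_cong[THEN iffD1, rotated -1]) auto
  qed (use u in auto)
  also have "(\<Otimes>\<^bsub>K\<^esub>j\<in>{..<n} - {i}. if j = i then u (xs ! \<pi> i) else (vs ! j) (xs ! \<pi> j)) =
     (\<Otimes>\<^bsub>K\<^esub>j\<in>{..<n} - {i}. (vs ! j) (xs ! \<pi> j))"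
    using P by (intro finprod_cong') auto
  finally show "sg \<pi> \<otimes>\<^bsub>K\<^esub> (\<Otimes>\<^bsub>K\<^esub>j\<in>{..<n}. (vs[i := u] ! j) (xs ! \<pi> j)) =
     u (xs ! \<pi> i) \<otimes>\<^bsub>K\<^esub> (sg \<pi> \<otimes>\<^bsub>K\<^esub> (\<Otimes>\<^bsub>K\<^esub>j\<in>{..<n} - {i}. (vs ! j) (xs ! \<pi> j)))"
    using u finprod_closed[OF P] by (simp add: m_lcomm)
next
  show "(\<lambda>\<pi>. u (xs ! \<pi> i) \<otimes>\<^bsub>K\<^esub> (sg \<pi> \<otimes>\<^bsub>K\<^esub> (\<Otimes>\<^bsub>K\<^esub>j\<in>{..<n} - {i}. (vs ! j) (xs ! \<pi> j))))
     \<in> {\<pi>. \<pi> permutes {..<n}} \<rightarrow> carrier K"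
  proof (intro Pi_I m_closed sg_closed finprod_closed)
    fix \<pi> j assume \<pi>: "\<pi> \<in> {\<pi>. \<pi> permutes {..<n}}"
    then show "u (xs ! \<pi> i) \<in> carrier K"
      using perm_lt[OF _ assms(2)] by (intro coord_closed[OF assms(3)] nth_mem) simp
    assume "j \<in> {..<n} - {i}"
    then show "(vs ! j) (xs ! \<pi> j) \<in> carrier K"
      using tuple_coord[OF assms(1)] perm_lt \<pi> by simp
  qed
qed simp

lemma det_form_term_closed:
  assumes "vs \<in> T" "i < n" "\<pi> permutes {..<n}"
  shows "sg \<pi> \<otimes>\<^bsub>K\<^esub> (\<Otimes>\<^bsub>K\<^esub>j\<in>{..<n} - {i}. (vs ! j) (xs ! \<pi> j)) \<in> carrier K"
proof (rule m_closed[OF sg_closed finprod_closed], rule Pi_I)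
  fix j assume "j \<in> {..<n} - {i}"
  then show "(vs ! j) (xs ! \<pi> j) \<in> carrier K" using tuple_coord[OF assms(1)] perm_lt[OF assms(3)] by simp
qed

lemma det_form_add:
  assumes "vs \<in> T" "i < n" "u \<in> carrier V" "w \<in> carrier V"
  shows "det_form K xs (vs[i := u \<oplus>\<^bsub>V\<^esub> w]) = det_form K xs (vs[i := u]) \<oplus>\<^bsub>K\<^esub> det_form K xs (vs[i := w])"
proof -
  note t = det_form_term_closed[OF assms(1,2)]
  have u: "u (xs ! \<pi> i) \<in> carrier K" "w (xs ! \<pi> i) \<in> carrier K" if "\<pi> permutes {..<n}" for \<pi>
    using coord_closed[OF assms(3)] coord_closed[OF assms(4)] nth_mem[OF perm_lt[OF that assms(2)]] by blast+
  have uw: "u \<oplus>\<^bsub>V\<^esub> w \<in> carrier V" using assms by simp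
  show ?thesis
    unfolding det_form_update[OF assms(1,2,3)] det_form_update[OF assms(1,2,4)] det_form_update[OF assms(1,2) uw]
  proof (subst finsum_addf[symmetric])
    show "(\<Oplus>\<^bsub>K\<^esub>\<pi>\<in>{\<pi>. \<pi> permutes {..<n}}. (u \<oplus>\<^bsub>V\<^esub> w) (xs ! \<pi> i) \<otimes>\<^bsub>K\<^esub>
       (sg \<pi> \<otimes>\<^bsub>K\<^esub> (\<Otimes>\<^bsub>K\<^esub>j\<in>{..<n} - {i}. (vs ! j) (xs ! \<pi> j)))) =
      (\<Oplus>\<^bsub>K\<^esub>\<pi>\<in>{\<pi>. \<pi> permutes {..<n}}.
       u (xs ! \<pi> i) \<otimes>\<^bsub>K\<^esub> (sg \<pi> \<otimes>\<^bsub>K\<^esub> (\<Otimes>\<^bsub>K\<^esub>j\<in>{..<n} - {i}. (vs ! j) (xs ! \<pi> j))) \<oplus>\<^bsub>K\<^esub>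
       w (xs ! \<pi> i) \<otimes>\<^bsub>K\<^esub> (sg \<pi> \<otimes>\<^bsub>K\<^esub> (\<Otimes>\<^bsub>K\<^esub>j\<in>{..<n} - {i}. (vs ! j) (xs ! \<pi> j))))"
    proof (rule finsum_cong')
      fix \<pi> assume "\<pi> \<in> {\<pi>. \<pi> permutes {..<n}}"
      then have \<pi>: "\<pi> permutes {..<n}" by simp
      have "(u \<oplus>\<^bsub>V\<^esub> w) (xs ! \<pi> i) = u (xs ! \<pi> i) \<oplus>\<^bsub>K\<^esub> w (xs ! \<pi> i)"
        using nth_mem[OF perm_lt[OF \<pi> assms(2)]] by (simp add: free_space_simps(3))
      then show "(u \<oplus>\<^bsub>V\<^esub> w) (xs ! \<pi> i) \<otimes>\<^bsub>K\<^esub> (sg \<pi> \<otimes>\<^bsub>K\<^esub> (\<Otimes>\<^bsub>K\<^esub>j\<in>{..<n} - {i}. (vs ! j) (xs ! \<pi> j))) =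
        u (xs ! \<pi> i) \<otimes>\<^bsub>K\<^esub> (sg \<pi> \<otimes>\<^bsub>K\<^esub> (\<Otimes>\<^bsub>K\<^esub>j\<in>{..<n} - {i}. (vs ! j) (xs ! \<pi> j))) \<oplus>\<^bsub>K\<^esub>
        w (xs ! \<pi> i) \<otimes>\<^bsub>K\<^esub> (sg \<pi> \<otimes>\<^bsub>K\<^esub> (\<Otimes>\<^bsub>K\<^esub>j\<in>{..<n} - {i}. (vs ! j) (xs ! \<pi> j)))"
        using l_distr[OF u[OF \<pi>] t[OF \<pi>]] by simp
    next
      show "(\<lambda>\<pi>. u (xs ! \<pi> i) \<otimes>\<^bsub>K\<^esub> (sg \<pi> \<otimes>\<^bsub>K\<^esub> (\<Otimes>\<^bsub>K\<^esub>j\<in>{..<n} - {i}. (vs ! j) (xs ! \<pi> j))) \<oplus>\<^bsub>K\<^esub>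
       w (xs ! \<pi> i) \<otimes>\<^bsub>K\<^esub> (sg \<pi> \<otimes>\<^bsub>K\<^esub> (\<Otimes>\<^bsub>K\<^esub>j\<in>{..<n} - {i}. (vs ! j) (xs ! \<pi> j)))) \<in> {\<pi>. \<pi> permutes {..<n}} \<rightarrow> carrier K"
        by (intro Pi_I a_closed m_closed u t) blast+
    qed simp
  qed (intro Pi_I m_closed u t; blast)+
qed

lemma det_form_smult:
  assumes "vs \<in> T" "i < n" "u \<in> carrier V" "c \<in> carrier K"
  shows "det_form K xs (vs[i := c \<odot>\<^bsub>V\<^esub> u]) = c \<otimes>\<^bsub>K\<^esub> det_form K xs (vs[i := u])"
proof -
  note t = det_form_term_closed[OF assms(1,2)]
  have u: "u (xs ! \<pi> i) \<in> carrier K" if "\<pi> permutes {..<n}" for \<pi>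
    using coord_closed[OF assms(3)] nth_mem[OF perm_lt[OF that assms(2)]] by blast+
  have cu: "c \<odot>\<^bsub>V\<^esub> u \<in> carrier V" using assms by simp
  show ?thesis
    unfolding det_form_update[OF assms(1,2,3)] det_form_update[OF assms(1,2) cu]
  proof (subst finsum_rdistr)
    show "(\<Oplus>\<^bsub>K\<^esub>\<pi>\<in>{\<pi>. \<pi> permutes {..<n}}. (c \<odot>\<^bsub>V\<^esub> u) (xs ! \<pi> i) \<otimes>\<^bsub>K\<^esub>
       (sg \<pi> \<otimes>\<^bsub>K\<^esub> (\<Otimes>\<^bsub>K\<^esub>j\<in>{..<n} - {i}. (vs ! j) (xs ! \<pi> j)))) =
      (\<Oplus>\<^bsub>K\<^esub>\<pi>\<in>{\<pi>. \<pi> permutes {..<n}}.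
       c \<otimes>\<^bsub>K\<^esub> (u (xs ! \<pi> i) \<otimes>\<^bsub>K\<^esub> (sg \<pi> \<otimes>\<^bsub>K\<^esub> (\<Otimes>\<^bsub>K\<^esub>j\<in>{..<n} - {i}. (vs ! j) (xs ! \<pi> j)))))"
    proof (rule finsum_cong')
      fix \<pi> assume "\<pi> \<in> {\<pi>. \<pi> permutes {..<n}}"
      then have \<pi>: "\<pi> permutes {..<n}" by simp
      have "(c \<odot>\<^bsub>V\<^esub> u) (xs ! \<pi> i) = c \<otimes>\<^bsub>K\<^esub> u (xs ! \<pi> i)"
        using nth_mem[OF perm_lt[OF \<pi> assms(2)]] by (simp add: free_space_simps(4))
      then show "(c \<odot>\<^bsub>V\<^esub> u) (xs ! \<pi> i) \<otimes>\<^bsub>K\<^esub> (sg \<pi> \<otimes>\<^bsub>K\<^esub> (\<Otimes>\<^bsub>K\<^esub>j\<in>{..<n} - {i}. (vs ! j) (xs ! \<pi> j))) =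
        c \<otimes>\<^bsub>K\<^esub> (u (xs ! \<pi> i) \<otimes>\<^bsub>K\<^esub> (sg \<pi> \<otimes>\<^bsub>K\<^esub> (\<Otimes>\<^bsub>K\<^esub>j\<in>{..<n} - {i}. (vs ! j) (xs ! \<pi> j))))"
        using m_assoc[OF assms(4) u[OF \<pi>] t[OF \<pi>]] by simp
    next
      show "(\<lambda>\<pi>. c \<otimes>\<^bsub>K\<^esub> (u (xs ! \<pi> i) \<otimes>\<^bsub>K\<^esub> (sg \<pi> \<otimes>\<^bsub>K\<^esub> (\<Otimes>\<^bsub>K\<^esub>j\<in>{..<n} - {i}. (vs ! j) (xs ! \<pi> j))))) \<in> {\<pi>. \<pi> permutes {..<n}} \<rightarrow> carrier K"
        by (intro Pi_I m_closed u t assms) blast+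
    qed simp
  next
    show "(\<lambda>\<pi>. u (xs ! \<pi> i) \<otimes>\<^bsub>K\<^esub> (sg \<pi> \<otimes>\<^bsub>K\<^esub> (\<Otimes>\<^bsub>K\<^esub>j\<in>{..<n} - {i}. (vs ! j) (xs ! \<pi> j)))) \<in> {\<pi>. \<pi> permutes {..<n}} \<rightarrow> carrier K"
      by (intro Pi_I m_closed u t) blast+
  qed (use assms(4) finite_permutations[of "{..<n}"] in simp_all)
qed

text \<open>Composition with the transposition of \<open>i\<close> and \<open>j\<close> matches even
  with odd permutations, and matched products agree because the two rows do. The terms cancel in
  pairs, so the argument is valid in characteristic 2 as well.\<close>

lemma det_form_alternating:
  assumes "vs \<in> T" "i < j" "j < n" "vs ! i = vs ! j"
  shows "det_form K xs vs = \<zero>\<^bsub>K\<^esub>"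
proof -
  let ?\<tau> = "Transposition.transpose i j"
  let ?Perm = "{\<pi>. \<pi> permutes {..<n}}"
  let ?E = "{\<pi>. \<pi> permutes {..<n} \<and> evenperm \<pi>}"
  let ?O = "{\<pi>. \<pi> permutes {..<n} \<and> \<not> evenperm \<pi>}"
  let ?p = "\<lambda>\<pi>. \<Otimes>\<^bsub>K\<^esub>k\<in>{..<n}. (vs ! k) (xs ! \<pi> k)"
  let ?t = "\<lambda>\<pi>. sg \<pi> \<otimes>\<^bsub>K\<^esub> ?p \<pi>"
  have \<tau>: "?\<tau> permutes {..<n}" using assms by (intro permutes_swap_id) auto
  have fin: "finite ?Perm" by (rule finite_permutations) simp
  have pc: "?p \<pi> \<in> carrier K" if "\<pi> permutes {..<n}" for \<pi>
    using tuple_coord[OF assms(1)] perm_lt[OF that] by (intro finprod_closed) auto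
  have p\<tau>: "?p (\<pi> \<circ> ?\<tau>) = ?p \<pi>" if "\<pi> permutes {..<n}" for \<pi>
  proof -
    have "?p (\<pi> \<circ> ?\<tau>) = (\<Otimes>\<^bsub>K\<^esub>k\<in>{..<n}. (vs ! ?\<tau> k) (xs ! \<pi> (?\<tau> k)))"
      by (rule finprod_cong') (use assms tuple_coord[OF assms(1)] perm_lt[OF that] perm_lt[OF \<tau>] in
        \<open>auto simp: Transposition.transpose_def\<close>)
    also have "\<dots> = (\<Otimes>\<^bsub>K\<^esub>k\<in>?\<tau> ` {..<n}. (vs ! k) (xs ! \<pi> k))"
      by (rule finprod_reindex[symmetric])
        (use tuple_coord[OF assms(1)] perm_lt[OF that] perm_lt[OF \<tau>] permutes_inj_on[OF \<tau>] in auto)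
    also have "?\<tau> ` {..<n} = {..<n}" by (rule permutes_image[OF \<tau>])
    finally show ?thesis .
  qed
  have even: "evenperm (\<pi> \<circ> ?\<tau>) \<longleftrightarrow> \<not> evenperm \<pi>" if "\<pi> permutes {..<n}" for \<pi>
    using evenperm_comp[of \<pi> ?\<tau>] permutation_of_permutes[OF that] permutation_swap_id[of i j] assms(2)
      evenperm_swap[of i j] by simp
  have \<tau>\<tau>: "?\<tau> \<circ> ?\<tau> = id" by simp
  have O: "?O = (\<lambda>\<pi>. \<pi> \<circ> ?\<tau>) ` ?E"
  proof
    show "?O \<subseteq> (\<lambda>\<pi>. \<pi> \<circ> ?\<tau>) ` ?E"
    proof
      fix \<pi> assume "\<pi> \<in> ?O"
      then have "\<pi> \<circ> ?\<tau> \<in> ?E" using even permutes_compose[OF \<tau>] by auto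
      moreover have "\<pi> = (\<pi> \<circ> ?\<tau>) \<circ> ?\<tau>" using \<tau>\<tau> by (simp add: comp_assoc)
      ultimately show "\<pi> \<in> (\<lambda>\<pi>. \<pi> \<circ> ?\<tau>) ` ?E" by blast
    qed
    show "(\<lambda>\<pi>. \<pi> \<circ> ?\<tau>) ` ?E \<subseteq> ?O" using even permutes_compose[OF \<tau>] by auto
  qed
  have inj: "inj_on (\<lambda>\<pi>. \<pi> \<circ> ?\<tau>) ?E"
    by (rule inj_on_inverseI[where g = "\<lambda>\<pi>. \<pi> \<circ> ?\<tau>"]) (simp add: comp_assoc)
  have tE: "?t \<in> ?E \<rightarrow> carrier K" and tO: "?t \<in> ?O \<rightarrow> carrier K" using pc by auto
  have "det_form K xs vs = finsum K ?t (?E \<union> ?O)"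
    unfolding det_form_def by (rule arg_cong[where f = "finsum K ?t"]) auto
  also have "\<dots> = finsum K ?t ?E \<oplus>\<^bsub>K\<^esub> finsum K ?t ?O"
    by (rule finsum_Un_disjoint[OF _ _ _ tE tO]) (use fin in \<open>auto intro: finite_subset[OF _ fin]\<close>)
  also have "finsum K ?t ?O = (\<Oplus>\<^bsub>K\<^esub>\<pi>\<in>?E. ?t (\<pi> \<circ> ?\<tau>))"
    unfolding O by (rule finsum_reindex[OF _ inj]) (use tO O in simp)
  also have "\<dots> = (\<Oplus>\<^bsub>K\<^esub>\<pi>\<in>?E. \<ominus>\<^bsub>K\<^esub> ?t \<pi>)"
    by (rule finsum_cong') (use pc p\<tau> even in \<open>auto simp: l_minus\<close>)
  also have "finsum K ?t ?E \<oplus>\<^bsub>K\<^esub> \<dots> = (\<Oplus>\<^bsub>K\<^esub>\<pi>\<in>?E. ?t \<pi> \<oplus>\<^bsub>K\<^esub> \<ominus>\<^bsub>K\<^esub> ?t \<pi>)"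
    by (rule finsum_addf[symmetric]) (use tE in auto)
  also have "\<dots> = \<zero>\<^bsub>K\<^esub>"
    by (rule add.finprod_one_eqI) (use pc in \<open>auto simp: r_neg\<close>)
  finally show ?thesis .
qed

lemma e_closed: "x \<in> X \<Longrightarrow> e x \<in> carrier V"
  by (rule basis_vec_closed) (rule ring_axioms)

lemma e_tuple: "\<lbrakk>set ys \<subseteq> X; length ys = n\<rbrakk> \<Longrightarrow> map e ys \<in> T"
  using e_closed by (auto simp: tuples_def)

lemma det_form_basis: "det_form K xs (map e xs) = \<one>\<^bsub>K\<^esub>"
proof -
  let ?Perm = "{\<pi>. \<pi> permutes {..<n}}"
  have fin: "finite ?Perm" by (rule finite_permutations) simp
  have ev: "(map e xs ! i) (xs ! \<pi> i) = (if \<pi> i = i then \<one>\<^bsub>K\<^esub> else \<zero>\<^bsub>K\<^esub>)"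
    if "\<pi> permutes {..<n}" "i < n" for \<pi> i
    using that perm_lt[OF that] distinct by (simp add: basis_vec_def nth_eq_iff_index_eq)
  have t: "sg \<pi> \<otimes>\<^bsub>K\<^esub> (\<Otimes>\<^bsub>K\<^esub>i\<in>{..<n}. (map e xs ! i) (xs ! \<pi> i)) = (if id = \<pi> then \<one>\<^bsub>K\<^esub> else \<zero>\<^bsub>K\<^esub>)"
    if \<pi>: "\<pi> permutes {..<n}" for \<pi>
  proof (cases "\<pi> = id")
    case True
    then have "(\<Otimes>\<^bsub>K\<^esub>i\<in>{..<n}. (map e xs ! i) (xs ! \<pi> i)) = \<one>\<^bsub>K\<^esub>"
      using ev[OF \<pi>] by (intro finprod_one_eqI) auto
    then show ?thesis using True by simp
  next
    case False
    then obtain i where i: "\<pi> i \<noteq> i" by (auto simp: fun_eq_iff)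
    then have "i < n" using permutes_not_in[OF \<pi>, of i] by auto
    have A: "{..<n} = insert i ({..<n} - {i})" using \<open>i < n\<close> by auto
    have "(\<lambda>k. (map e xs ! k) (xs ! \<pi> k)) \<in> {..<n} \<rightarrow> carrier K" using ev[OF \<pi>] by auto
    moreover from this have "(\<Otimes>\<^bsub>K\<^esub>k\<in>{..<n} - {i}. (map e xs ! k) (xs ! \<pi> k)) \<in> carrier K"
      by (intro finprod_closed) auto
    ultimately have "(\<Otimes>\<^bsub>K\<^esub>i\<in>{..<n}. (map e xs ! i) (xs ! \<pi> i)) = \<zero>\<^bsub>K\<^esub>"
      using ev[OF \<pi> \<open>i < n\<close>] i by (subst A, subst finprod_insert) auto
    then show ?thesis using False by auto
  qed
  have "det_form K xs (map e xs) = (\<Oplus>\<^bsub>K\<^esub>\<pi>\<in>?Perm. if id = \<pi> then \<one>\<^bsub>K\<^esub> else \<zero>\<^bsub>K\<^esub>)"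
    unfolding det_form_def by (rule finsum_cong') (use t in auto)
  also have "\<dots> = \<one>\<^bsub>K\<^esub>"
    by (rule finsum_singleton) (use fin permutes_id in auto)
  finally show ?thesis .
qed

lemma b_closed: "vs \<in> T \<Longrightarrow> b vs \<in> carrier F"
  by (rule basis_vec_closed) (rule ring_axioms)

lemma relations_subset: "ext_power_relations K V n \<subseteq> carrier F"
proof -
  have "b (vs[i := u \<oplus>\<^bsub>V\<^esub> w]) \<ominus>\<^bsub>F\<^esub> (b (vs[i := u]) \<oplus>\<^bsub>F\<^esub> b (vs[i := w])) \<in> carrier F"
    if "vs \<in> T" "u \<in> carrier V" "w \<in> carrier V" for vs i u w
    using that by (intro F.M.minus_closed F.M.a_closed b_closed tuple_update) auto
  moreover have "b (vs[i := c \<odot>\<^bsub>V\<^esub> u]) \<ominus>\<^bsub>F\<^esub> (c \<odot>\<^bsub>F\<^esub> b (vs[i := u])) \<in> carrier F"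
    if "vs \<in> T" "c \<in> carrier K" "u \<in> carrier V" for vs i u c
    using that by (intro F.M.minus_closed F.smult_closed b_closed tuple_update) auto
  ultimately show ?thesis
    unfolding ext_power_relations_def Let_def using b_closed by auto
qed

lemma Rel_submodule: "submodule Rel K F"
  by (rule F.submodule_gen[OF relations_subset])

lemma rel_in: "r \<in> ext_power_relations K V n \<Longrightarrow> r \<in> Rel"
  by (rule subsetD[OF gen_submodule_superset])

lemma rel_add:
  assumes "vs \<in> T" "i < n" "u \<in> carrier V" "w \<in> carrier V"
  shows "b (vs[i := u \<oplus>\<^bsub>V\<^esub> w]) \<ominus>\<^bsub>F\<^esub> (b (vs[i := u]) \<oplus>\<^bsub>F\<^esub> b (vs[i := w])) \<in> Rel"
  by (rule rel_in) (use assms in \<open>auto simp: ext_power_relations_def Let_def\<close>)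

lemma rel_smult:
  assumes "vs \<in> T" "i < n" "u \<in> carrier V" "c \<in> carrier K"
  shows "b (vs[i := c \<odot>\<^bsub>V\<^esub> u]) \<ominus>\<^bsub>F\<^esub> (c \<odot>\<^bsub>F\<^esub> b (vs[i := u])) \<in> Rel"
  by (rule rel_in) (use assms in \<open>auto simp: ext_power_relations_def Let_def\<close>)

lemma rel_alternating:
  assumes "vs \<in> T" "i < j" "j < n" "vs ! i = vs ! j"
  shows "b vs \<in> Rel"
  by (rule rel_in) (use assms in \<open>auto simp: ext_power_relations_def Let_def\<close>)

abbreviation Dhat where "Dhat \<equiv> linear_extension K T (det_form K xs)"

lemma Dhat_hom: "lmodule_hom K F (regular K) Dhat"
  by (rule linear_extension_hom) (auto intro: det_form_closed is_cring)

lemma Dhat_basis: "vs \<in> T \<Longrightarrow> Dhat (b vs) = det_form K xs vs"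
  by (rule linear_extension_basis) (auto intro: det_form_closed ring_axioms)

lemma Dhat_Rel: "r \<in> Rel \<Longrightarrow> Dhat r = \<zero>\<^bsub>K\<^esub>"
proof -
  interpret D: lmodule_hom K F "regular K" Dhat by (rule Dhat_hom)
  have dc: "det_form K xs vs \<ominus>\<^bsub>regular K\<^esub> det_form K xs vs = \<zero>\<^bsub>K\<^esub>" if "vs \<in> T" for vs
    using D.N.M.minus_self[of "det_form K xs vs"] det_form_closed[OF that] by simp
  have "Dhat (b (vs[i := u \<oplus>\<^bsub>V\<^esub> w]) \<ominus>\<^bsub>F\<^esub> (b (vs[i := u]) \<oplus>\<^bsub>F\<^esub> b (vs[i := w]))) = \<zero>\<^bsub>K\<^esub>"
    if "vs \<in> T" "i < n" "u \<in> carrier V" "w \<in> carrier V" for vs i u w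
  proof -
    have "u \<oplus>\<^bsub>V\<^esub> w \<in> carrier V" using that by simp
    then show ?thesis
      using that tuple_update[OF that(1)] dc[OF tuple_update[OF that(1)], of "u \<oplus>\<^bsub>V\<^esub> w" i]
      by (simp add: D.minus D.add b_closed Dhat_basis det_form_add)
  qed
  moreover have "Dhat (b (vs[i := c \<odot>\<^bsub>V\<^esub> u]) \<ominus>\<^bsub>F\<^esub> (c \<odot>\<^bsub>F\<^esub> b (vs[i := u]))) = \<zero>\<^bsub>K\<^esub>"
    if "vs \<in> T" "i < n" "u \<in> carrier V" "c \<in> carrier K" for vs i u c
  proof -
    have "c \<odot>\<^bsub>V\<^esub> u \<in> carrier V" using that by simp
    then show ?thesis
      using that tuple_update[OF that(1)] dc[OF tuple_update[OF that(1)], of "c \<odot>\<^bsub>V\<^esub> u" i]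
      by (simp add: D.minus D.smult b_closed Dhat_basis det_form_smult)
  qed
  moreover have "Dhat (b vs) = \<zero>\<^bsub>K\<^esub>" if "vs \<in> T" "i < j" "j < n" "vs ! i = vs ! j" for vs i j
    using that Dhat_basis det_form_alternating by simp
  ultimately have "Dhat r = \<zero>\<^bsub>K\<^esub>" if "r \<in> ext_power_relations K V n" for r
    using that unfolding ext_power_relations_def Let_def by auto
  then have "ext_power_relations K V n \<subseteq> {f \<in> carrier F. Dhat f = \<zero>\<^bsub>regular K\<^esub>}"
    using relations_subset by (simp add: subset_iff)
  then have "Rel \<subseteq> {f \<in> carrier F. Dhat f = \<zero>\<^bsub>regular K\<^esub>}"
    by (rule gen_submodule_minimal[OF D.kernel_submodule])
  then show "r \<in> Rel \<Longrightarrow> Dhat r = \<zero>\<^bsub>K\<^esub>" by auto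
qed

text \<open>The elements that are multiples of
  \<open>e\<^sub>1 \<and> \<cdots> \<and> e\<^sub>n\<close> modulo the relations. Once
  \<open>N\<close> is everything, the exterior power is at most a line, and the determinant shows
  that it is not zero.\<close>

definition N where "N = {f \<in> carrier F. \<exists>c\<in>carrier K. f \<ominus>\<^bsub>F\<^esub> c \<odot>\<^bsub>F\<^esub> b (map e xs) \<in> Rel}"

lemma b_xs_closed: "b (map e xs) \<in> carrier F"
  by (intro b_closed e_tuple) auto

lemma N_submodule: "submodule N K F"
  unfolding F.submodule_iff
proof (intro conjI ballI)
  note R = F.submoduleD[OF Rel_submodule] and bc = b_xs_closed
  show "N \<subseteq> carrier F" by (auto simp: N_def)
  show "\<zero>\<^bsub>F\<^esub> \<in> N" unfolding N_def using R(2) bc by (auto intro!: bexI[of _ "\<zero>\<^bsub>K\<^esub>"])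
  show "x \<oplus>\<^bsub>F\<^esub> y \<in> N" if "x \<in> N" "y \<in> N" for x y
  proof -
    from that(1) obtain c where c: "c \<in> carrier K" "x \<in> carrier F" "x \<ominus>\<^bsub>F\<^esub> c \<odot>\<^bsub>F\<^esub> b (map e xs) \<in> Rel"
      unfolding N_def by (elim CollectE conjE bexE)
    from that(2) obtain d where d: "d \<in> carrier K" "y \<in> carrier F" "y \<ominus>\<^bsub>F\<^esub> d \<odot>\<^bsub>F\<^esub> b (map e xs) \<in> Rel"
      unfolding N_def by (elim CollectE conjE bexE)
    have "(x \<oplus>\<^bsub>F\<^esub> y) \<ominus>\<^bsub>F\<^esub> (c \<oplus>\<^bsub>K\<^esub> d) \<odot>\<^bsub>F\<^esub> b (map e xs) =
      (x \<ominus>\<^bsub>F\<^esub> c \<odot>\<^bsub>F\<^esub> b (map e xs)) \<oplus>\<^bsub>F\<^esub> (y \<ominus>\<^bsub>F\<^esub> d \<odot>\<^bsub>F\<^esub> b (map e xs))"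
      using c(1,2) d(1,2) bc by (simp add: a_minus_def F.smult_l_distr F.M.minus_add F.M.a_ac)
    then show ?thesis
      using R(3)[OF c(3) d(3)] c(1,2) d(1,2) by (auto simp: N_def intro!: bexI[of _ "c \<oplus>\<^bsub>K\<^esub> d"])
  qed
  show "r \<odot>\<^bsub>F\<^esub> x \<in> N" if "r \<in> carrier K" "x \<in> N" for r x
  proof -
    from that(2) obtain c where c: "c \<in> carrier K" "x \<in> carrier F" "x \<ominus>\<^bsub>F\<^esub> c \<odot>\<^bsub>F\<^esub> b (map e xs) \<in> Rel"
      unfolding N_def by (elim CollectE conjE bexE)
    have "r \<odot>\<^bsub>F\<^esub> x \<ominus>\<^bsub>F\<^esub> (r \<otimes>\<^bsub>K\<^esub> c) \<odot>\<^bsub>F\<^esub> b (map e xs) = r \<odot>\<^bsub>F\<^esub> (x \<ominus>\<^bsub>F\<^esub> c \<odot>\<^bsub>F\<^esub> b (map e xs))"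
      using c(1,2) bc that(1) by (simp add: a_minus_def F.smult_r_distr F.smult_r_minus F.smult_assoc)
    then show ?thesis
      using R(4)[OF that(1) c(3)] c(1,2) that(1) by (auto simp: N_def intro!: bexI[of _ "r \<otimes>\<^bsub>K\<^esub> c"])
  qed
qed

lemma Rel_subset_N: "Rel \<subseteq> N"
proof
  fix r assume r: "r \<in> Rel"
  then have "r \<in> carrier F" using F.submoduleD(1)[OF Rel_submodule] by blast
  then show "r \<in> N" using r b_xs_closed by (auto simp: N_def intro!: bexI[of _ "\<zero>\<^bsub>K\<^esub>"])
qed

lemma N_shift:
  assumes "x \<in> carrier F" "y \<in> N" "x \<ominus>\<^bsub>F\<^esub> y \<in> Rel"
  shows "x \<in> N"
proof -
  have "(x \<ominus>\<^bsub>F\<^esub> y) \<oplus>\<^bsub>F\<^esub> y \<in> N"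
    using F.submoduleD(3)[OF N_submodule _ assms(2)] Rel_subset_N assms(3) by blast
  then show ?thesis using assms(1) F.submoduleD(1)[OF N_submodule] assms(2) by (auto simp: subset_iff)
qed

text \<open>Multilinearity modulo the relations; it allows one slot at a time to be restricted to
  basis vectors.\<close>

lemma slot_submodule:
  assumes "vs \<in> T" "i < n"
  shows "submodule {u \<in> carrier V. b (vs[i := u]) \<in> N} K V"
  unfolding V.submodule_iff
proof (intro conjI ballI)
  note S = F.submoduleD[OF N_submodule]
  have bc: "b (vs[i := u]) \<in> carrier F" if "u \<in> carrier V" for u
    by (intro b_closed tuple_update assms that)
  have sm: "b (vs[i := c \<odot>\<^bsub>V\<^esub> u]) \<in> N" if "c \<in> carrier K" "u \<in> carrier V" "c \<odot>\<^bsub>F\<^esub> b (vs[i := u]) \<in> N" for c u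
    by (rule N_shift[OF _ that(3) rel_smult]) (use bc that assms in auto)
  show "\<zero>\<^bsub>V\<^esub> \<in> {u \<in> carrier V. b (vs[i := u]) \<in> N}"
    using sm[of "\<zero>\<^bsub>K\<^esub>" "\<zero>\<^bsub>V\<^esub>"] bc S(2) by simp
  show "x \<oplus>\<^bsub>V\<^esub> y \<in> {u \<in> carrier V. b (vs[i := u]) \<in> N}"
    if "x \<in> {u \<in> carrier V. b (vs[i := u]) \<in> N}" "y \<in> {u \<in> carrier V. b (vs[i := u]) \<in> N}" for x y
  proof -
    have "b (vs[i := x \<oplus>\<^bsub>V\<^esub> y]) \<in> N"
      by (rule N_shift[OF _ S(3) rel_add]) (use that bc assms in auto)
    then show ?thesis using that by simp
  qed
  show "r \<odot>\<^bsub>V\<^esub> x \<in> {u \<in> carrier V. b (vs[i := u]) \<in> N}"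
    if "r \<in> carrier K" "x \<in> {u \<in> carrier V. b (vs[i := u]) \<in> N}" for r x
    using sm S(4) that by auto
qed auto

text \<open>Polarisation: from \<open>(u, u)\<close> and \<open>(u, w)\<close> one gets
  \<open>(u, u + w)\<close>; subtracting it from \<open>(u + w, u + w)\<close> leaves
  \<open>(w, u + w)\<close>, and subtracting \<open>(w, w)\<close> leaves \<open>(w, u)\<close>.
  Tuples with equal entries are relations, so all of this happens inside \<open>N\<close>.\<close>

lemma swap_in_N:
  assumes vs: "vs \<in> T" and ij: "i < n" "j < n" "i \<noteq> j" and uw: "u \<in> carrier V" "w \<in> carrier V"
    and in_N: "b (vs[i := u, j := w]) \<in> N"
  shows "b (vs[i := w, j := u]) \<in> N"
proof -
  have len: "length vs = n" using vs by (simp add: tuples_def)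
  have cl: "vs[i := p, j := q] \<in> T" if "p \<in> carrier V" "q \<in> carrier V" for p q
    by (intro tuple_update vs that)
  have alt: "b (vs[i := p, j := p]) \<in> N" if "p \<in> carrier V" for p
  proof (cases "i < j")
    case True
    then show ?thesis using rel_alternating[OF cl[OF that that] True ij(2)] ij len Rel_subset_N by auto
  next
    case False
    then have "j < i" using ij by simp
    then show ?thesis using rel_alternating[OF cl[OF that that] _ ij(1)] ij len Rel_subset_N by auto
  qed
  have J: "submodule {q \<in> carrier V. b (vs[i := p, j := q]) \<in> N} K V" if "p \<in> carrier V" for p
    using slot_submodule[OF tuple_update[OF vs that] ij(2)] .
  have I: "submodule {p \<in> carrier V. b (vs[i := p, j := q]) \<in> N} K V" if "q \<in> carrier V" for q
    using slot_submodule[OF tuple_update[OF vs that, of j] ij(1)] by (simp add: list_update_swap[OF ij(3)])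
  let ?s = "u \<oplus>\<^bsub>V\<^esub> w"
  have s: "?s \<in> carrier V" and w: "?s \<ominus>\<^bsub>V\<^esub> u = w"
    using uw V.M.add_minus_cancel[of w u] by (simp_all add: V.M.a_comm)
  have w': "?s \<ominus>\<^bsub>V\<^esub> w = u" using uw by simp
  have "b (vs[i := u, j := ?s]) \<in> N"
    using V.submoduleD(3)[OF J[OF uw(1)], of u w] alt[OF uw(1)] in_N uw by simp
  then have "b (vs[i := w, j := ?s]) \<in> N"
    using V.submoduleD(6)[OF I[OF s], of ?s u] alt[OF s] s uw w by simp
  then show ?thesis
    using V.submoduleD(6)[OF J[OF uw(2)], of ?s w] alt[OF uw(2)] s uw w' by simp
qed

lemma basis_tuple_in_N:
  assumes "set ys \<subseteq> X" "length ys = n"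
  shows "b (map e ys) \<in> N"
proof (cases "distinct ys")
  case False
  then obtain i j where "i < n" "j < n" "i \<noteq> j" "ys ! i = ys ! j"
    using assms(2) by (auto simp: distinct_conv_nth)
  then obtain i j where ij: "i < j" "j < n" "ys ! i = ys ! j" by (metis linorder_neqE_nat)
  then show ?thesis using rel_alternating[OF e_tuple[OF assms] ij(1,2)] assms(2) Rel_subset_N by auto
next
  case True
  \<comment> \<open>\<open>k\<close> counts the positions at the end that may still differ from
    \<open>xs\<close>; each step swaps the correct entry into position \<open>n - Suc k\<close>, as
    in selection sort.\<close>
  have "b (map e ys) \<in> N"
    if "k \<le> n" "set ys \<subseteq> X" "length ys = n" "distinct ys" "\<forall>i<n - k. ys ! i = xs ! i" for k ys
    using that
  proof (induction k arbitrary: ys)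
    case 0
    then have "ys = xs" by (auto intro: nth_equalityI)
    then show ?case unfolding N_def using b_xs_closed F.submoduleD(2)[OF Rel_submodule]
      by (auto intro!: bexI[of _ "\<one>\<^bsub>K\<^esub>"])
  next
    case (Suc k)
    let ?m = "n - Suc k"
    have m: "?m < n" "n - k = Suc ?m" using Suc.prems(1) by auto
    have "set ys = X"
      using Suc.prems distinct by (intro card_subset_eq) (auto simp: distinct_card)
    then obtain i where i: "i < n" "ys ! i = xs ! ?m"
      using nth_mem[OF m(1)] Suc.prems(3) by (metis in_set_conv_nth)
    have im: "i \<ge> ?m"
    proof (rule ccontr)
      assume "\<not> i \<ge> ?m"
      then have "xs ! i = xs ! ?m" using Suc.prems(5) i by auto
      then show False using \<open>\<not> i \<ge> ?m\<close> distinct i m by (simp add: nth_eq_iff_index_eq)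
    qed
    show ?case
    proof (cases "i = ?m")
      case True
      show ?thesis
        by (rule Suc.IH) (use Suc.prems i True m in \<open>auto simp: less_Suc_eq\<close>)
    next
      case False
      let ?zs = "ys[i := ys ! ?m, ?m := ys ! i]"
      have d: "distinct ?zs" using distinct_swap[of ?m ys i] m i Suc.prems(3,4) by (simp add: list_update_swap[OF False])
      have st: "set ?zs = set ys" using set_swap[of ?m ys i] m i Suc.prems(3) by (simp add: list_update_swap[OF False])
      have "b (map e ?zs) \<in> N"
      proof (rule Suc.IH)
        show "\<forall>l<n - k. ?zs ! l = xs ! l"
          using m i im False Suc.prems(3,5) by (auto simp: nth_list_update less_Suc_eq)
      qed (use d st Suc.prems in auto)
      moreover have "map e ?zs = (map e ys)[i := e (ys ! ?m), ?m := e (ys ! i)]" by (simp add: map_update)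
      ultimately have "b ((map e ys)[i := e (ys ! ?m), ?m := e (ys ! i)]) \<in> N" by simp
      then have "b ((map e ys)[i := e (ys ! i), ?m := e (ys ! ?m)]) \<in> N"
      proof (rule swap_in_N[rotated 6])
        have "ys ! i \<in> X" "ys ! ?m \<in> X"
          using Suc.prems(2,3) m i nth_mem[of i ys] nth_mem[of ?m ys] by (simp_all add: subset_iff)
        from this[THEN e_closed] show "e (ys ! i) \<in> carrier V" "e (ys ! ?m) \<in> carrier V" .
        show "map e ys \<in> T" by (rule e_tuple[OF Suc.prems(2,3)])
      qed (use m i False in simp_all)
      also have "(map e ys)[i := e (ys ! i), ?m := e (ys ! ?m)] = map e ys"
        by (simp flip: map_update)
      finally show ?thesis .
    qed
  qed
  from this[OF le_refl assms True] show ?thesis by simp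
qed

lemma tuple_in_N: "vs \<in> T \<Longrightarrow> b vs \<in> N"
proof -
  \<comment> \<open>Only the slots from \<open>k\<close> on are assumed to hold basis vectors;
    linearity frees one more slot in each step.\<close>
  have "b vs \<in> N" if "k \<le> n" "vs \<in> T" "\<forall>j<n. k \<le> j \<longrightarrow> vs ! j \<in> e ` X" for k vs
    using that
  proof (induction k arbitrary: vs)
    case 0
    have len: "length vs = n" using 0 by (simp add: tuples_def)
    have "set vs \<subseteq> e ` X" using 0(3) len by (auto simp: in_set_conv_nth)
    then have "vs \<in> lists (e ` X)" by auto
    then obtain ys where ys: "vs = map e ys" "ys \<in> lists X" unfolding lists_image by blast
    then show ?case using basis_tuple_in_N[of ys] len by auto
  next
    case (Suc k)
    have k: "k < n" using Suc.prems by simp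
    have len: "length vs = n" using Suc.prems by (simp add: tuples_def)
    have "e ` X \<subseteq> {u \<in> carrier V. b (vs[k := u]) \<in> N}"
    proof
      fix u assume "u \<in> e ` X"
      then have u: "u \<in> carrier V" "u \<in> e ` X" using e_closed by auto
      have "b (vs[k := u]) \<in> N"
        by (rule Suc.IH) (use Suc.prems u tuple_update len in \<open>auto simp: nth_list_update\<close>)
      then show "u \<in> {u \<in> carrier V. b (vs[k := u]) \<in> N}" using u by simp
    qed
    then have "{u \<in> carrier V. b (vs[k := u]) \<in> N} = carrier V"
      by (rule free_space_spanned[OF ring_axioms slot_submodule[OF Suc.prems(2) k]])
    moreover have "vs ! k \<in> carrier V" using Suc.prems(2) k len nth_mem[of k vs] by (auto simp: tuples_def)
    ultimately have "b (vs[k := vs ! k]) \<in> N" by blast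
    then show ?case by simp
  qed
  from this[of n] show "vs \<in> T \<Longrightarrow> b vs \<in> N" by simp
qed

lemma N_eq: "N = carrier F"
  by (rule free_space_spanned[OF ring_axioms N_submodule]) (use tuple_in_N in auto)

text \<open>Modulo the relations \<open>f\<close> is \<open>c\<close> times the standard wedge, on
  which the determinant is 1; hence the determinant of \<open>f\<close> is \<open>c\<close>.\<close>

lemma kernel_Dhat:
  assumes "f \<in> carrier F"
  shows "Dhat f = \<zero>\<^bsub>K\<^esub> \<longleftrightarrow> f \<in> Rel"
proof
  assume D0: "Dhat f = \<zero>\<^bsub>K\<^esub>"
  interpret D: lmodule_hom K F "regular K" Dhat by (rule Dhat_hom)
  obtain c where c: "c \<in> carrier K" "f \<ominus>\<^bsub>F\<^esub> c \<odot>\<^bsub>F\<^esub> b (map e xs) \<in> Rel"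
    using assms N_eq unfolding N_def by auto
  have "Dhat f = Dhat (f \<ominus>\<^bsub>F\<^esub> c \<odot>\<^bsub>F\<^esub> b (map e xs)) \<oplus>\<^bsub>regular K\<^esub> Dhat (c \<odot>\<^bsub>F\<^esub> b (map e xs))"
    using assms c(1) b_xs_closed by (subst D.add[symmetric]) simp_all
  also have "\<dots> = c"
    using Dhat_Rel[OF c(2)] c(1) b_xs_closed
    by (simp add: D.smult Dhat_basis e_tuple det_form_basis)
  finally have "c = \<zero>\<^bsub>K\<^esub>" using D0 by simp
  then show "f \<in> Rel" using c(2) assms b_xs_closed by simp
qed (rule Dhat_Rel)

lemma quot_iso_regular: "quot_module F Rel \<simeq>\<^bsub>K\<^esub> regular K"
proof (rule lquotient.quot_iso[OF lquotientI[OF F.lmodule_axioms Rel_submodule] Dhat_hom])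
  interpret D: lmodule_hom K F "regular K" Dhat by (rule Dhat_hom)
  show "Dhat ` carrier F = carrier (regular K)"
  proof
    show "carrier (regular K) \<subseteq> Dhat ` carrier F"
    proof
      fix c assume "c \<in> carrier (regular K)"
      then have "Dhat (c \<odot>\<^bsub>F\<^esub> b (map e xs)) = c" "c \<odot>\<^bsub>F\<^esub> b (map e xs) \<in> carrier F"
        using b_xs_closed by (simp_all add: D.smult Dhat_basis e_tuple det_form_basis)
      then show "c \<in> Dhat ` carrier F" by (metis image_eqI)
    qed
  qed (use D.closed in auto)
qed (use kernel_Dhat in simp)

end

lemma det_space_iso_regular:
  assumes "field K" "finite X"
  shows "lmodule K (det_space K X)" "det_space K X \<simeq>\<^bsub>K\<^esub> regular K"
proof -
  obtain xs where xs: "set xs = X" "distinct xs" using finite_distinct_list[OF assms(2)] by blast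
  interpret det_setup K xs by (intro det_setup.intro det_setup_axioms.intro assms xs)
  have "det_space K X = quot_module F Rel"
    using distinct_card[OF xs(2)] by (simp add: det_space_def ext_power_def Let_def flip: xs(1))
  moreover have "lmodule K (quot_module F Rel)"
    by (rule lquotient.lmodule_quot[OF lquotientI[OF F.lmodule_axioms Rel_submodule]])
  ultimately show "lmodule K (det_space K X)" "det_space K X \<simeq>\<^bsub>K\<^esub> regular K"
    using quot_iso_regular by simp_all
qed

section \<open>Finite-dimensional algebras\<close>

subsection \<open>Simple modules and composition series\<close>

context lquotient
begin

lemma submodule_of_quot:
  assumes "submodule L R (quot_module M N)"
  obtains W where "submodule W R M" "N \<subseteq> W" "L = (\<lambda>x. N +>\<^bsub>M\<^esub> x) ` W"
proof -
  interpret c: lmodule_hom R M "quot_module M N" "\<lambda>x. N +>\<^bsub>M\<^esub> x" by (rule lmodule_hom_coset)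
  let ?W = "{x \<in> carrier M. N +>\<^bsub>M\<^esub> x \<in> L}"
  have "submodule ?W R M" by (rule c.vimage_submodule[OF assms])
  moreover have "N \<subseteq> ?W"
  proof
    fix x assume "x \<in> N"
    then show "x \<in> ?W" using coset_eq_zero_iff[of x] N_subset c.N.submoduleD(2)[OF assms] by auto
  qed
  moreover have "L = (\<lambda>x. N +>\<^bsub>M\<^esub> x) ` ?W"
    using c.N.submoduleD(1)[OF assms] unfolding carrier_quot by blast
  ultimately show thesis using that by blast
qed

lemma simple_quot:
  assumes "N \<noteq> carrier M"
    "\<And>W. \<lbrakk>submodule W R M; N \<subseteq> W; W \<noteq> N\<rbrakk> \<Longrightarrow> W = carrier M"
  shows "simple_module R (quot_module M N)"
  unfolding simple_module_def
proof (intro conjI allI impI)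
  obtain x where x: "x \<in> carrier M" "x \<notin> N" using assms(1) N_subset by blast
  then have "N +>\<^bsub>M\<^esub> x \<noteq> N" "N +>\<^bsub>M\<^esub> x \<in> carrier (quot_module M N)" using coset_eq_zero_iff by auto
  then show "carrier (quot_module M N) \<noteq> {\<zero>\<^bsub>quot_module M N\<^esub>}" by auto
next
  fix L assume "submodule L R (quot_module M N)"
  then obtain W where W: "submodule W R M" "N \<subseteq> W" "L = (\<lambda>x. N +>\<^bsub>M\<^esub> x) ` W"
    by (rule submodule_of_quot)
  show "L = {\<zero>\<^bsub>quot_module M N\<^esub>} \<or> L = carrier (quot_module M N)"
  proof (cases "W = N")
    case True
    have "N +>\<^bsub>M\<^esub> x = N" if "x \<in> N" for x using that coset_eq_zero_iff N_subset by blast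
    moreover have "N \<noteq> {}" using submoduleD(2)[OF sub] by blast
    ultimately show ?thesis using True W(3) by auto
  next
    case False
    then show ?thesis using assms(2)[OF W(1,2)] W(3) carrier_quot by simp
  qed
qed

end

lemma (in lmodule) lquotient_sub:
  assumes "submodule U R M" "submodule U' R M" "U' \<subseteq> U"
  shows "lquotient R (M\<lparr>carrier := U\<rparr>) U'"
  using assms by (intro lquotientI lmodule_restrict) (simp_all add: submodule_restrict_iff)

lemma (in lmodule) simple_subquotient:
  assumes "submodule U R M" "submodule U' R M" "U' \<subset> U"
    "\<And>W. \<lbrakk>submodule W R M; U' \<subset> W; W \<subset> U\<rbrakk> \<Longrightarrow> False"
  shows "simple_module R (subquotient M U U')"
proof -
  interpret Q: lquotient R "M\<lparr>carrier := U\<rparr>" U' using assms by (intro lquotient_sub) auto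
  show ?thesis unfolding subquotient_def
    by (rule Q.simple_quot) (use assms in \<open>auto simp: submodule_restrict_iff\<close>)
qed

locale fd_algebra = A: ring A + kspace K A
  for K :: "('k, 'x) ring_scheme" and A :: "('k, 'a) module" +
  assumes smult_mult_left: "\<lbrakk>c \<in> carrier K; a \<in> carrier A; b \<in> carrier A\<rbrakk> \<Longrightarrow>
      (c \<odot>\<^bsub>A\<^esub> a) \<otimes>\<^bsub>A\<^esub> b = c \<odot>\<^bsub>A\<^esub> (a \<otimes>\<^bsub>A\<^esub> b)"
    and smult_mult_right: "\<lbrakk>c \<in> carrier K; a \<in> carrier A; b \<in> carrier A\<rbrakk> \<Longrightarrow>
      a \<otimes>\<^bsub>A\<^esub> (c \<odot>\<^bsub>A\<^esub> b) = c \<odot>\<^bsub>A\<^esub> (a \<otimes>\<^bsub>A\<^esub> b)"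
    and fin_dim: "fin_dim K A"

text \<open>Restriction of scalars along \<open>c \<mapsto> c \<odot> \<one>\<close>, the same
  action as the one on \<open>hom_space\<close>.\<close>

definition res_module :: "('k, 'a) module \<Rightarrow> ('a, 'm) module \<Rightarrow> ('k, 'm) module" where
  "res_module A N = \<lparr>carrier = carrier N, monoid.mult = undefined, one = undefined,
     zero = \<zero>\<^bsub>N\<^esub>, add = add N, smult = (\<lambda>c x. (c \<odot>\<^bsub>A\<^esub> \<one>\<^bsub>A\<^esub>) \<odot>\<^bsub>N\<^esub> x)\<rparr>"

lemma res_module_simps [simp]:
  "carrier (res_module A N) = carrier N" "zero (res_module A N) = zero N"
  "add (res_module A N) = add N" "c \<odot>\<^bsub>res_module A N\<^esub> x = (c \<odot>\<^bsub>A\<^esub> \<one>\<^bsub>A\<^esub>) \<odot>\<^bsub>N\<^esub> x"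
  by (simp_all add: res_module_def)

context fd_algebra
begin

abbreviation scal where "scal c \<equiv> c \<odot>\<^bsub>A\<^esub> \<one>\<^bsub>A\<^esub>"

lemma field_K: "field K" by (rule field_axioms)

lemma scal_closed: "c \<in> carrier K \<Longrightarrow> scal c \<in> carrier A" by simp

lemma scal_mult: "\<lbrakk>c \<in> carrier K; a \<in> carrier A\<rbrakk> \<Longrightarrow> scal c \<otimes>\<^bsub>A\<^esub> a = c \<odot>\<^bsub>A\<^esub> a"
  by (simp add: smult_mult_left)

lemma mult_scal: "\<lbrakk>c \<in> carrier K; a \<in> carrier A\<rbrakk> \<Longrightarrow> a \<otimes>\<^bsub>A\<^esub> scal c = c \<odot>\<^bsub>A\<^esub> a"
  by (simp add: smult_mult_right)

lemma lmodule_res: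
  assumes "lmodule A N"
  shows "lmodule K (res_module A N)"
proof -
  interpret N: lmodule A N by fact
  show ?thesis
  proof (rule lmoduleI)
    show "ring K" by (rule R.ring_axioms)
    show "(a \<otimes>\<^bsub>K\<^esub> b) \<odot>\<^bsub>res_module A N\<^esub> x = a \<odot>\<^bsub>res_module A N\<^esub> (b \<odot>\<^bsub>res_module A N\<^esub> x)"
      if "a \<in> carrier K" "b \<in> carrier K" "x \<in> carrier (res_module A N)" for a b x
      using that by (simp add: smult_assoc N.smult_assoc[symmetric] scal_mult)
  qed (auto simp: N.M.a_ac N.smult_l_distr N.smult_r_distr smult_l_distr)
qed

lemma res_submodule:
  assumes "lmodule A N" "submodule U A N"
  shows "submodule U K (res_module A N)"
proof -
  interpret N: lmodule A N by fact
  interpret r: lmodule K "res_module A N" by (rule lmodule_res[OF assms(1)])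
  show ?thesis unfolding r.submodule_iff
  proof (intro conjI ballI)
    show "c \<odot>\<^bsub>res_module A N\<^esub> x \<in> U" if "c \<in> carrier K" "x \<in> U" for c x
      using N.submoduleD(4)[OF assms(2) scal_closed[OF that(1)] that(2)] by simp
    show "x \<oplus>\<^bsub>res_module A N\<^esub> y \<in> U" if "x \<in> U" "y \<in> U" for x y
      using N.submoduleD(3)[OF assms(2) that] by simp
  qed (use N.submoduleD(1,2)[OF assms(2)] in simp_all)
qed

text \<open>The separating functionals of \<open>A\<close> are applied in each coordinate.\<close>

lemma fin_dim_free: "fin_dim K (res_module A (free_module A n))"
proof -
  obtain \<Phi> where \<Phi>': "finite \<Phi> \<and> (\<forall>\<phi>\<in>\<Phi>. lmodule_hom K A (regular K) \<phi>) \<and>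
     (\<forall>v\<in>carrier A. (\<forall>\<phi>\<in>\<Phi>. \<phi> v = \<zero>\<^bsub>K\<^esub>) \<longrightarrow> v = \<zero>\<^bsub>A\<^esub>)"
    using fin_dim unfolding fin_dim_def by (elim exE)
  have \<Phi>: "finite \<Phi>" "\<And>\<phi>. \<phi> \<in> \<Phi> \<Longrightarrow> lmodule_hom K A (regular K) \<phi>"
     "\<And>v. \<lbrakk>v \<in> carrier A; \<And>\<phi>. \<phi> \<in> \<Phi> \<Longrightarrow> \<phi> v = \<zero>\<^bsub>K\<^esub>\<rbrakk> \<Longrightarrow> v = \<zero>\<^bsub>A\<^esub>"
    using \<Phi>' by simp_all
  have c: "x i \<in> carrier A" if "x \<in> carrier (free_module A n)" "i < n" for x i
    using that by (auto simp: free_module_simps)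
  show ?thesis
  proof (rule fin_dimI[where X = "\<Phi> \<times> {..<n}" and \<phi> = "\<lambda>(\<phi>, i) x. \<phi> (x i)"])
    fix y assume "y \<in> \<Phi> \<times> {..<n}"
    then obtain \<phi> i where y: "y = (\<phi>, i)" "\<phi> \<in> \<Phi>" "i < n" by auto
    interpret \<phi>: lmodule_hom K A "regular K" \<phi> by (rule \<Phi>(2)[OF y(2)])
    show "lmodule_hom K (res_module A (free_module A n)) (regular K) (case y of (\<phi>, i) \<Rightarrow> \<lambda>x. \<phi> (x i))"
      unfolding y(1) prod.case
    proof (intro lmodule_hom.intro lmodule_res lmodule_free_module A.ring_axioms \<phi>.N.lmodule_axioms
        lmodule_hom_axioms.intro)
      fix r x assume "r \<in> carrier K" "x \<in> carrier (res_module A (free_module A n))"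
      then show "\<phi> ((r \<odot>\<^bsub>res_module A (free_module A n)\<^esub> x) i) = r \<odot>\<^bsub>regular K\<^esub> \<phi> (x i)"
        using c y(3) by (simp add: free_module_simps(4) scal_mult \<phi>.smult)
    qed (use c y(3) \<phi>.add \<phi>.closed in \<open>simp_all add: free_module_simps(3)\<close>)
  next
    fix v assume v: "v \<in> carrier (res_module A (free_module A n))"
      "\<And>x. x \<in> \<Phi> \<times> {..<n} \<Longrightarrow> (case x of (\<phi>, i) \<Rightarrow> \<lambda>x. \<phi> (x i)) v = \<zero>\<^bsub>K\<^esub>"
    have "v i = \<zero>\<^bsub>A\<^esub>" if "i < n" for i
    proof (rule \<Phi>(3))
      show "\<phi> (v i) = \<zero>\<^bsub>K\<^esub>" if "\<phi> \<in> \<Phi>" for \<phi>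
        using v(2)[of "(\<phi>, i)"] that \<open>i < n\<close> by simp
    qed (use c v(1) that in simp)
    then show "v = \<zero>\<^bsub>res_module A (free_module A n)\<^esub>"
      using v(1) by (auto simp: free_module_simps PiE_def intro!: extensionalityI[where A = "{..<n}"])
  qed (use \<Phi>(1) in simp)
qed

text \<open>Below each term comes a proper submodule with the greatest value of the strictly
  increasing function. Existence is needed for the maximality of the costandard module: for a
  submodule without composition series the condition on its composition factors would be
  empty.\<close>

lemma exists_composition_series:
  assumes "lmodule A N" "fin_dim K (res_module A N)"
  obtains Ns where "composition_series A N Ns"
proof -
  interpret N: lmodule A N by fact
  obtain D :: "_ set \<Rightarrow> nat" where
    "\<And>U U'. \<lbrakk>submodule U K (res_module A N); submodule U' K (res_module A N); U \<subset> U'\<rbrakk> \<Longrightarrow> D U < D U'"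
    using fin_dim_strict_dimension[OF field_K lmodule_res[OF assms(1)] assms(2)] by metis
  then have D: "D U < D U'" if "submodule U A N" "submodule U' A N" "U \<subset> U'" for U U'
    using that res_submodule[OF assms(1)] by blast
  have "\<exists>Ns. Ns \<noteq> [] \<and> hd Ns = {\<zero>\<^bsub>N\<^esub>} \<and> last Ns = U \<and> (\<forall>V\<in>set Ns. submodule V A N) \<and>
     (\<forall>i. Suc i < length Ns \<longrightarrow>
        Ns ! i \<subset> Ns ! Suc i \<and> simple_module A (subquotient N (Ns ! Suc i) (Ns ! i)))"
    if "submodule U A N" for U
    using that
  proof (induction "D U" arbitrary: U rule: less_induct)
    case less
    show ?case
    proof (cases "U = {\<zero>\<^bsub>N\<^esub>}")
      case True
      then show ?thesis using less.prems by (intro exI[of _ "[U]"]) auto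
    next
      case False
      have z: "{\<zero>\<^bsub>N\<^esub>} \<subset> U" using False N.submoduleD(2)[OF less.prems] by blast
      let ?P = "\<lambda>V. submodule V A N \<and> V \<subset> U"
      have "?P {\<zero>\<^bsub>N\<^esub>}" using z N.zero_submodule by blast
      moreover have "\<forall>V. ?P V \<longrightarrow> D V < D U" using D less.prems by blast
      ultimately have "\<exists>V. ?P V \<and> (\<forall>W. ?P W \<longrightarrow> D W \<le> D V)" by (rule ex_has_greatest_nat)
      then obtain V where V: "?P V" "\<And>W. ?P W \<Longrightarrow> D W \<le> D V" by blast
      have "\<exists>Ns. Ns \<noteq> [] \<and> hd Ns = {\<zero>\<^bsub>N\<^esub>} \<and> last Ns = V \<and> (\<forall>V\<in>set Ns. submodule V A N) \<and>
       (\<forall>i. Suc i < length Ns \<longrightarrow>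
        Ns ! i \<subset> Ns ! Suc i \<and> simple_module A (subquotient N (Ns ! Suc i) (Ns ! i)))"
      proof (rule less.hyps)
        show "D V < D U" using V(1) D less.prems by blast
        show "submodule V A N" using V(1) by (rule conjunct1)
      qed
      then obtain Ns where Ns: "Ns \<noteq> []" "hd Ns = {\<zero>\<^bsub>N\<^esub>}" "last Ns = V" "\<forall>V\<in>set Ns. submodule V A N"
        "\<And>i. Suc i < length Ns \<Longrightarrow> Ns ! i \<subset> Ns ! Suc i \<and> simple_module A (subquotient N (Ns ! Suc i) (Ns ! i))"
        by blast
      have s: "simple_module A (subquotient N U V)"
      proof (rule N.simple_subquotient)
        fix W assume W: "submodule W A N" "V \<subset> W" "W \<subset> U"
        then show False using V(2)[of W] D[of V W] V(1) by force
      qed (use V(1) less.prems in auto)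
      have "(Ns @ [U]) ! i \<subset> (Ns @ [U]) ! Suc i \<and>
          simple_module A (subquotient N ((Ns @ [U]) ! Suc i) ((Ns @ [U]) ! i))"
        if i: "Suc i < length (Ns @ [U])" for i
      proof (cases "Suc i < length Ns")
        case True
        then show ?thesis using Ns(5) by (simp add: nth_append)
      next
        case False
        then have "i = length Ns - 1" "Suc i = length Ns" using i by auto
        then have "(Ns @ [U]) ! i = V" "(Ns @ [U]) ! Suc i = U"
          using Ns(1,3) by (simp_all add: nth_append last_conv_nth)
        then show ?thesis using s V(1) by simp
      qed
      then show ?thesis using Ns less.prems by (intro exI[of _ "Ns @ [U]"]) auto
    qed
  qed
  from this[OF N.carrier_submodule] show thesis
    using that unfolding composition_series_def by blast
qed

subsection \<open>Existence of free resolutions\<close>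

text \<open>The kernel is finite-dimensional, and generators over \<open>K\<close> also generate
  over \<open>A\<close>.\<close>

lemma cover_kernel:
  assumes "lmodule A N" "f \<in> lin_hom A (free_module A m) N"
  obtains m' d where "d \<in> lin_hom A (free_module A m') (free_module A m)"
    "d ` carrier (free_module A m') = {x \<in> carrier (free_module A m). f x = \<zero>\<^bsub>N\<^esub>}"
proof -
  let ?F = "free_module A m"
  interpret F: lmodule A ?F by (rule lmodule_free_module) (rule A.ring_axioms)
  interpret f: lmodule_hom A ?F N f by (intro lmodule_hom_lin_hom assms F.lmodule_axioms)
  let ?Z = "{x \<in> carrier ?F. f x = \<zero>\<^bsub>N\<^esub>}"
  note Z = f.kernel_submodule
  obtain ws where ws: "set ws \<subseteq> ?Z" "gen_submodule K (res_module A ?F) (set ws) = ?Z"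
    using fin_dim_finitely_generated[OF field_K lmodule_res[OF F.lmodule_axioms] fin_dim_free
        res_submodule[OF F.lmodule_axioms Z]] by blast
  have wc: "set ws \<subseteq> carrier ?F" using ws(1) by auto
  have "gen_submodule A ?F (set ws) = ?Z"
  proof
    show "gen_submodule A ?F (set ws) \<subseteq> ?Z" by (rule gen_submodule_minimal[OF Z ws(1)])
    have "gen_submodule K (res_module A ?F) (set ws) \<subseteq> gen_submodule A ?F (set ws)"
      by (intro gen_submodule_minimal res_submodule F.lmodule_axioms F.submodule_gen wc gen_submodule_superset)
    then show "?Z \<subseteq> gen_submodule A ?F (set ws)" using ws(2) by simp
  qed
  then show thesis using that[OF F.comb_lin_hom[OF wc]] F.comb_image[OF wc] by simp
qed

lemma exists_free_resolution:
  assumes "lmodule A L" "set gs \<subseteq> carrier L" "gen_submodule A L (set gs) = carrier L"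
  obtains n d e where "free_resolution A L n d e"
proof -
  interpret L: lmodule A L by fact
  let ?F = "free_module A" and ?e = "comb A L gs"
  have e: "?e \<in> lin_hom A (?F (length gs)) L" "?e ` carrier (?F (length gs)) = carrier L"
    using L.comb_lin_hom[OF assms(2)] L.comb_image[OF assms(2)] assms(3) by auto
  \<comment> \<open>A state consists of the ranks of source and target and the differential between
    them. \<open>P\<close> ties degree 0 to the augmentation, and \<open>Q\<close> expresses that
    the next differential maps onto the kernel of the current one.\<close>
  define P where "P = (\<lambda>(i::nat) (m', m, d). d \<in> lin_hom A (?F m') (?F m) \<and>
     (i = 0 \<longrightarrow> m = length gs \<and> d ` carrier (?F m') = {x \<in> carrier (?F m). ?e x = \<zero>\<^bsub>L\<^esub>}))"
  define Q where "Q = (\<lambda>(i::nat) (m', m, d) (l', l, d'). l = m' \<and>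
     d' ` carrier (?F l') = {x \<in> carrier (?F l). d x = \<zero>\<^bsub>?F m\<^esub>})"
  have "\<exists>s. \<forall>i. P i (s i) \<and> Q i (s i) (s (Suc i))"
  proof (rule dependent_nat_choice)
    obtain m' d where "d \<in> lin_hom A (?F m') (?F (length gs))"
      "d ` carrier (?F m') = {x \<in> carrier (?F (length gs)). ?e x = \<zero>\<^bsub>L\<^esub>}"
      by (rule cover_kernel[OF assms(1) e(1)]) (rule that)
    then show "\<exists>s. P 0 s" unfolding P_def by (intro exI[of _ "(m', length gs, d)"]) simp
  next
    fix s i assume s: "P i s"
    obtain m' m d where smd: "s = (m', m, d)" by (cases s)
    have d: "d \<in> lin_hom A (?F m') (?F m)" using s unfolding smd P_def by simp
    obtain l' d' where d': "d' \<in> lin_hom A (?F l') (?F m')"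
      "d' ` carrier (?F l') = {x \<in> carrier (?F m'). d x = \<zero>\<^bsub>?F m\<^esub>}"
      by (rule cover_kernel[OF lmodule_free_module[OF A.ring_axioms] d]) (rule that)
    then show "\<exists>t. P (Suc i) t \<and> Q i s t"
      unfolding smd P_def Q_def by (intro exI[of _ "(l', m', d')"]) simp
  qed
  then obtain s where s: "\<And>i. P i (s i)" "\<And>i. Q i (s i) (s (Suc i))" by blast
  define n where "n = (\<lambda>i. fst (snd (s i)))"
  define d where "d = (\<lambda>i. snd (snd (s i)))"
  have n': "fst (s i) = n (Suc i)" for i
    using s(2)[of i] unfolding Q_def n_def by (auto split: prod.splits)
  have "s i = (n (Suc i), n i, d i)" for i
    using n'[of i] by (simp add: n_def d_def prod_eq_iff)
  then have PQ: "P i (n (Suc i), n i, d i)" "Q i (n (Suc i), n i, d i) (n (Suc (Suc i)), n (Suc i), d (Suc i))" for i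
    using s(1)[of i] s(2)[of i] by metis+
  have n0: "n 0 = length gs" using PQ(1)[of 0] by (simp add: P_def)
  have "free_resolution A L n d ?e"
    unfolding free_resolution_def using PQ e PQ(1)[of 0] unfolding P_def Q_def n0 by simp
  then show thesis using that by blast
qed

end

section \<open>Complexes with commuting projections\<close>

text \<open>In degree 0 the condition on \<open>j\<close> is empty, so every element is a cycle; the
  augmentation is not part of the complex.\<close>

definition cyc :: "(nat \<Rightarrow> ('k, 'v) module) \<Rightarrow> (nat \<Rightarrow> 'v \<Rightarrow> 'v) \<Rightarrow> nat \<Rightarrow> 'v \<Rightarrow> bool" where
  "cyc X d i x \<longleftrightarrow> x \<in> carrier (X i) \<and> (\<forall>j. i = Suc j \<longrightarrow> d j x = \<zero>\<^bsub>X j\<^esub>)"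

definition acyclic_at :: "(nat \<Rightarrow> ('k, 'v) module) \<Rightarrow> (nat \<Rightarrow> 'v \<Rightarrow> 'v) \<Rightarrow> nat \<Rightarrow> bool" where
  "acyclic_at X d i \<longleftrightarrow> (\<forall>x. cyc X d i x \<longrightarrow> (\<exists>y\<in>carrier (X (Suc i)). x = d i y))"

text \<open>The homology in degree \<open>h\<close> is one-dimensional.\<close>

definition line_at ::
  "('k, 'x) ring_scheme \<Rightarrow> (nat \<Rightarrow> ('k, 'v) module) \<Rightarrow> (nat \<Rightarrow> 'v \<Rightarrow> 'v) \<Rightarrow> nat \<Rightarrow> bool" where
  "line_at K X d h \<longleftrightarrow> (\<exists>z. cyc X d h z \<and>
     (\<forall>x. cyc X d h x \<longrightarrow>
       (\<exists>c\<in>carrier K. \<exists>y\<in>carrier (X (Suc h)). x = c \<odot>\<^bsub>X h\<^esub> z \<oplus>\<^bsub>X h\<^esub> d h y)) \<and>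
     (\<forall>c\<in>carrier K. \<forall>y\<in>carrier (X (Suc h)). c \<odot>\<^bsub>X h\<^esub> z = d h y \<longrightarrow> c = \<zero>\<^bsub>K\<^esub>))"

definition acyclic_complex where "acyclic_complex X d \<longleftrightarrow> (\<forall>i. acyclic_at X d i)"

definition line_complex where "line_complex K X d h \<longleftrightarrow> line_at K X d h \<and> (\<forall>i. i \<noteq> h \<longrightarrow> acyclic_at X d i)"

lemma acyclic_atD: "\<lbrakk>acyclic_at X d i; cyc X d i x\<rbrakk> \<Longrightarrow> \<exists>y\<in>carrier (X (Suc i)). x = d i y"
  unfolding acyclic_at_def by blast

text \<open>A projection \<open>q\<close> whose image is a subcomplex \<open>U\<close> identifies the quotient complex with the
  kernels \<open>W\<close> of \<open>q\<close>, carrying the differential \<open>(1 - q) d\<close>. The lemmas below are instances of the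
  long exact sequence.\<close>

locale projected_complex =
  fixes K :: "('k, 'x) ring_scheme" and X :: "nat \<Rightarrow> ('k, 'v) module"
    and d q :: "nat \<Rightarrow> 'v \<Rightarrow> 'v"
  assumes d_hom: "lmodule_hom K (X (Suc i)) (X i) (d i)"
    and dd: "x \<in> carrier (X (Suc (Suc i))) \<Longrightarrow> d i (d (Suc i) x) = \<zero>\<^bsub>X i\<^esub>"
    and q_hom: "lmodule_hom K (X i) (X i) (q i)"
    and qq: "x \<in> carrier (X i) \<Longrightarrow> q i (q i x) = q i x"
    and qdq: "x \<in> carrier (X (Suc i)) \<Longrightarrow> q i (d i (q (Suc i) x)) = d i (q (Suc i) x)"
begin

sublocale X: lmodule K "X i" for i by (rule q_hom[THEN lmodule_hom.axioms(1)])
sublocale d: lmodule_hom K "X (Suc i)" "X i" "d i" for i by (rule d_hom)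
sublocale q: lmodule_hom K "X i" "X i" "q i" for i by (rule q_hom)

definition U where "U i = X i\<lparr>carrier := {x \<in> carrier (X i). q i x = x}\<rparr>"
definition W where "W i = X i\<lparr>carrier := {x \<in> carrier (X i). q i x = \<zero>\<^bsub>X i\<^esub>}\<rparr>"
text \<open>This is \<open>1 - q\<close>, written with operations that do not change when carriers are restricted.\<close>

definition p where "p i x = x \<oplus>\<^bsub>X i\<^esub> (\<ominus>\<^bsub>K\<^esub> \<one>\<^bsub>K\<^esub>) \<odot>\<^bsub>X i\<^esub> q i x"
definition dW where "dW i x = p i (d i x)"

lemma U_carrier: "x \<in> carrier (U i) \<longleftrightarrow> x \<in> carrier (X i) \<and> q i x = x"
  by (simp add: U_def)

lemma W_carrier: "x \<in> carrier (W i) \<longleftrightarrow> x \<in> carrier (X i) \<and> q i x = \<zero>\<^bsub>X i\<^esub>"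
  by (simp add: W_def)

lemma UW_simps [simp]: "zero (U i) = zero (X i)" "add (U i) = add (X i)" "smult (U i) = smult (X i)"
  "zero (W i) = zero (X i)" "add (W i) = add (X i)" "smult (W i) = smult (X i)"
  by (simp_all add: U_def W_def)

lemma p_eq: "x \<in> carrier (X i) \<Longrightarrow> p i x = x \<ominus>\<^bsub>X i\<^esub> q i x"
  by (simp add: p_def X.minus_one_smult a_minus_def)

lemma p_closed [simp, intro]: "x \<in> carrier (X i) \<Longrightarrow> p i x \<in> carrier (X i)"
  by (simp add: p_eq)

lemma p_add: "\<lbrakk>x \<in> carrier (X i); y \<in> carrier (X i)\<rbrakk> \<Longrightarrow> p i (x \<oplus>\<^bsub>X i\<^esub> y) = p i x \<oplus>\<^bsub>X i\<^esub> p i y"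
  by (simp add: p_eq q.add a_minus_def X.M.minus_add X.M.a_ac)

lemma p_smult: "\<lbrakk>c \<in> carrier K; x \<in> carrier (X i)\<rbrakk> \<Longrightarrow> p i (c \<odot>\<^bsub>X i\<^esub> x) = c \<odot>\<^bsub>X i\<^esub> p i x"
  by (simp add: p_eq q.smult a_minus_def X.smult_r_distr X.smult_r_minus)

lemma q_p [simp]: "x \<in> carrier (X i) \<Longrightarrow> q i (p i x) = \<zero>\<^bsub>X i\<^esub>"
  by (simp add: p_eq q.minus qq)

lemma p_W: "x \<in> carrier (W i) \<Longrightarrow> p i x = x"
  by (simp add: W_carrier p_eq)

lemma p_U: "x \<in> carrier (U i) \<Longrightarrow> p i x = \<zero>\<^bsub>X i\<^esub>"
  by (simp add: U_carrier p_eq)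

lemma p_in_W [simp, intro]: "x \<in> carrier (X i) \<Longrightarrow> p i x \<in> carrier (W i)"
  by (simp add: W_carrier)

lemma dU_closed: "x \<in> carrier (U (Suc i)) \<Longrightarrow> d i x \<in> carrier (U i)"
  using qdq[of x i] by (simp add: U_carrier)

lemma d_split: "x \<in> carrier (X i) \<Longrightarrow> x = p i x \<oplus>\<^bsub>X i\<^esub> q i x"
  by (simp add: p_eq)

text \<open>The part \<open>q x\<close> lies in the subcomplex, so \<open>d\<close> keeps it there
  and \<open>p\<close> kills it. Thus \<open>p\<close> is a chain map from \<open>X\<close> onto
  \<open>W\<close>.\<close>

lemma p_d_p: "x \<in> carrier (X (Suc i)) \<Longrightarrow> p i (d i (p (Suc i) x)) = p i (d i x)"
proof -
  assume x: "x \<in> carrier (X (Suc i))"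
  have "q (Suc i) x \<in> carrier (U (Suc i))" using x by (simp add: U_carrier qq)
  then have "p i (d i (q (Suc i) x)) = \<zero>\<^bsub>X i\<^esub>" by (intro p_U dU_closed)
  moreover have "p i (d i x) = p i (d i (p (Suc i) x \<oplus>\<^bsub>X (Suc i)\<^esub> q (Suc i) x))"
    using d_split[OF x] by simp
  ultimately show ?thesis using x by (simp add: d.add p_add)
qed

lemma dW_p: "x \<in> carrier (X (Suc i)) \<Longrightarrow> dW i (p (Suc i) x) = p i (d i x)"
  by (simp add: dW_def p_d_p)

lemma cyc_X_p:
  assumes "cyc X d i x"
  shows "cyc W dW i (p i x)"
proof -
  have x: "x \<in> carrier (X i)" using assms by (simp add: cyc_def)
  have "dW j (p i x) = \<zero>\<^bsub>X j\<^esub>" if "i = Suc j" for j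
  proof -
    have "d j x = \<zero>\<^bsub>X j\<^esub>" using assms that by (simp add: cyc_def)
    then show ?thesis using x that dW_p[of x j] p_U[of "\<zero>\<^bsub>X j\<^esub>" j] by (simp add: U_carrier)
  qed
  then show ?thesis using x by (simp add: cyc_def)
qed

lemma dW_zero:
  assumes "w \<in> carrier (X (Suc j))" "dW j w = \<zero>\<^bsub>X j\<^esub>"
  shows "cyc U d j (d j w)"
proof -
  have "d j w = q j (d j w)" using assms by (simp add: dW_def p_eq)
  then have "d j w \<in> carrier (U j)" using assms(1) by (simp add: U_carrier)
  then show ?thesis using assms(1) dd by (auto simp: cyc_def)
qed

lemma cyc_U_boundary:
  assumes "cyc W dW (Suc j) w"
  shows "w \<in> carrier (X (Suc j))" "q (Suc j) w = \<zero>\<^bsub>X (Suc j)\<^esub>" "cyc U d j (d j w)"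
  using assms dW_zero[of w j] by (auto simp: cyc_def W_carrier)

text \<open>The hypothesis says that the inclusion of \<open>U\<close> is injective on homology, so
  the connecting map vanishes. Concretely, \<open>d w\<close> lies in \<open>U\<close> and bounds in
  \<open>X\<close>, hence in \<open>U\<close>, and the bounding element corrects \<open>w\<close> to
  a cycle of \<open>X\<close>.\<close>

lemma lift_cycle:
  assumes inj: "\<forall>i u. cyc U d i u \<longrightarrow> (\<exists>y\<in>carrier (X (Suc i)). u = d i y) \<longrightarrow> (\<exists>v\<in>carrier (U (Suc i)). u = d i v)"
    and w: "cyc W dW i w"
  obtains u where "u \<in> carrier (U i)" "cyc X d i (w \<ominus>\<^bsub>X i\<^esub> u)" "w \<in> carrier (X i)" "p i (w \<ominus>\<^bsub>X i\<^esub> u) = w"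
proof -
  have wc: "w \<in> carrier (W i)" "w \<in> carrier (X i)" using w by (auto simp: cyc_def W_carrier)
  have "\<exists>u\<in>carrier (U i). cyc X d i (w \<ominus>\<^bsub>X i\<^esub> u)"
  proof (cases i)
    case 0
    then show ?thesis using wc by (intro bexI[of _ "\<zero>\<^bsub>X i\<^esub>"]) (auto simp: cyc_def U_carrier)
  next
    case (Suc j)
    note c = cyc_U_boundary[OF w[unfolded Suc]]
    obtain v where v: "v \<in> carrier (U i)" "d j w = d j v"
      using inj c(1,3) Suc by blast
    have "cyc X d i (w \<ominus>\<^bsub>X i\<^esub> v)"
      using v c(1) Suc by (auto simp: cyc_def U_carrier d.minus)
    then show ?thesis using v by blast
  qed
  then obtain u where u: "u \<in> carrier (U i)" "cyc X d i (w \<ominus>\<^bsub>X i\<^esub> u)" by blast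
  have uX: "u \<in> carrier (X i)" using u by (simp add: U_carrier)
  have "w = p i (w \<ominus>\<^bsub>X i\<^esub> u \<oplus>\<^bsub>X i\<^esub> u)" using p_W[OF wc(1)] wc(2) uX by simp
  also have "\<dots> = p i (w \<ominus>\<^bsub>X i\<^esub> u)" using p_add[of "w \<ominus>\<^bsub>X i\<^esub> u" i u] wc uX p_U[OF u(1)] by simp
  finally show thesis using that u wc by metis
qed

text \<open>The two hypotheses make the inclusion of \<open>U\<close> bijective on homology, so
  nothing is left for the quotient.\<close>

lemma acyclic_W_of_iso:
  assumes inj: "\<forall>i u. cyc U d i u \<longrightarrow> (\<exists>y\<in>carrier (X (Suc i)). u = d i y) \<longrightarrow> (\<exists>v\<in>carrier (U (Suc i)). u = d i v)"
    and surj: "\<And>i x. cyc X d i x \<Longrightarrow> \<exists>u y. cyc U d i u \<and> y \<in> carrier (X (Suc i)) \<and> x = u \<oplus>\<^bsub>X i\<^esub> d i y"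
  shows "acyclic_complex W dW"
  unfolding acyclic_complex_def acyclic_at_def
proof (intro allI impI)
  fix i w assume "cyc W dW i w"
  then obtain u where u: "cyc X d i (w \<ominus>\<^bsub>X i\<^esub> u)" "p i (w \<ominus>\<^bsub>X i\<^esub> u) = w"
    by (rule lift_cycle[OF inj]) (rule that)
  obtain v y where v: "cyc U d i v" "y \<in> carrier (X (Suc i))" "w \<ominus>\<^bsub>X i\<^esub> u = v \<oplus>\<^bsub>X i\<^esub> d i y"
    using surj[OF u(1)] by blast
  have vU: "v \<in> carrier (U i)" "v \<in> carrier (X i)" using v(1) by (auto simp: cyc_def U_carrier)
  have "w = p i (d i y)" using u(2) v(2) p_U[OF vU(1)] p_add[OF vU(2), of "d i y"] unfolding v(3) by simp
  also have "\<dots> = dW i (p (Suc i) y)" using v(2) by (simp add: dW_p)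
  finally show "\<exists>y\<in>carrier (W (Suc i)). w = dW i y" using v(2) by blast
qed

lemma acyclic_W:
  assumes "acyclic_complex U d" "acyclic_complex X d"
  shows "acyclic_complex W dW"
proof (rule acyclic_W_of_iso)
  show "\<forall>i u. cyc U d i u \<longrightarrow> (\<exists>y\<in>carrier (X (Suc i)). u = d i y) \<longrightarrow> (\<exists>v\<in>carrier (U (Suc i)). u = d i v)"
    using assms(1) by (simp add: acyclic_complex_def acyclic_at_def)
  have z: "cyc U d i \<zero>\<^bsub>X i\<^esub>" for i by (auto simp: cyc_def U_carrier)
  show "\<exists>u y. cyc U d i u \<and> y \<in> carrier (X (Suc i)) \<and> x = u \<oplus>\<^bsub>X i\<^esub> d i y" if x: "cyc X d i x" for i x
  proof -
    have "acyclic_at X d i" using assms(2) by (simp add: acyclic_complex_def)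
    then obtain y where "y \<in> carrier (X (Suc i))" "x = d i y" using acyclic_atD[OF _ x] by blast
    then show ?thesis using z by (intro exI[of _ "\<zero>\<^bsub>X i\<^esub>"] exI[of _ y]) simp
  qed
qed

text \<open>With \<open>U\<close> acyclic, the chain map \<open>p\<close> is an isomorphism on
  homology, and it carries a generator to a generator.\<close>

lemma line_W_of_U_acyclic:
  assumes U: "acyclic_complex U d" and X: "line_complex K X d h"
  shows "line_complex K W dW h"
proof -
  have inj: "\<exists>v\<in>carrier (U (Suc i)). u = d i v" if "cyc U d i u" for i u
    using U that by (simp add: acyclic_complex_def acyclic_at_def)
  have "\<forall>i u. cyc U d i u \<longrightarrow> (\<exists>y\<in>carrier (X (Suc i)). u = d i y) \<longrightarrow> (\<exists>v\<in>carrier (U (Suc i)). u = d i v)"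
    using inj by blast
  note lift = lift_cycle[OF this]
  have "line_at K X d h" using X by (simp add: line_complex_def)
  then obtain z where z: "cyc X d h z"
    "\<And>x. cyc X d h x \<Longrightarrow> \<exists>c\<in>carrier K. \<exists>y\<in>carrier (X (Suc h)). x = c \<odot>\<^bsub>X h\<^esub> z \<oplus>\<^bsub>X h\<^esub> d h y"
    "\<And>c y. \<lbrakk>c \<in> carrier K; y \<in> carrier (X (Suc h)); c \<odot>\<^bsub>X h\<^esub> z = d h y\<rbrakk> \<Longrightarrow> c = \<zero>\<^bsub>K\<^esub>"
    unfolding line_at_def by blast
  have zX: "z \<in> carrier (X h)" using z(1) by (simp add: cyc_def)
  have "line_at K W dW h"
    unfolding line_at_def
  proof (intro exI[of _ "p h z"] conjI allI impI ballI)
    show "cyc W dW h (p h z)" by (rule cyc_X_p[OF z(1)])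
  next
    fix w assume "cyc W dW h w"
    then obtain u where u: "cyc X d h (w \<ominus>\<^bsub>X h\<^esub> u)" "p h (w \<ominus>\<^bsub>X h\<^esub> u) = w"
      by (rule lift) (rule that)
    obtain c y where c: "c \<in> carrier K" "y \<in> carrier (X (Suc h))" "w \<ominus>\<^bsub>X h\<^esub> u = c \<odot>\<^bsub>X h\<^esub> z \<oplus>\<^bsub>X h\<^esub> d h y"
      using z(2)[OF u(1)] by blast
    have "w = c \<odot>\<^bsub>X h\<^esub> p h z \<oplus>\<^bsub>X h\<^esub> dW h (p (Suc h) y)"
      using u(2) c(1,2) zX unfolding c(3) by (simp add: p_add p_smult dW_p)
    then show "\<exists>c\<in>carrier K. \<exists>y\<in>carrier (W (Suc h)). w = c \<odot>\<^bsub>W h\<^esub> p h z \<oplus>\<^bsub>W h\<^esub> dW h y"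
      using c(1,2) by auto
  next
    fix c y assume c: "c \<in> carrier K" and y: "y \<in> carrier (W (Suc h))" and eq: "c \<odot>\<^bsub>W h\<^esub> p h z = dW h y"
    have yX: "y \<in> carrier (X (Suc h))" using y by (simp add: W_carrier)
    \<comment> \<open>\<open>p\<close> kills this difference, so it is a cycle of \<open>X\<close>
      that lies in \<open>U\<close>, hence a boundary there; then \<open>c \<odot> z\<close> is a
      boundary in \<open>X\<close>.\<close>
    let ?t = "c \<odot>\<^bsub>X h\<^esub> z \<ominus>\<^bsub>X h\<^esub> d h y"
    have tX: "?t \<in> carrier (X h)" using c yX zX by simp
    have cz: "c \<odot>\<^bsub>X h\<^esub> z = ?t \<oplus>\<^bsub>X h\<^esub> d h y" using c yX zX by simp
    have "p h (?t \<oplus>\<^bsub>X h\<^esub> d h y) = p h (d h y)"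
      using eq c zX unfolding dW_def by (simp add: p_smult flip: cz)
    then have "p h ?t = \<zero>\<^bsub>X h\<^esub>" using p_add[OF tX, of "d h y"] yX tX
      by (metis X.M.add.r_cancel_one' d.closed p_closed)
    then have tU: "?t \<in> carrier (U h)" using tX by (simp add: U_carrier p_eq)
    have "cyc U d h ?t"
      unfolding cyc_def
    proof (intro conjI allI impI tU)
      fix j assume j: "h = Suc j"
      have "d j z = \<zero>\<^bsub>X j\<^esub>" using z(1) j by (simp add: cyc_def)
      then show "d j ?t = \<zero>\<^bsub>U j\<^esub>" using c yX zX j dd by (simp add: d.minus d.smult)
    qed
    then obtain v where v: "v \<in> carrier (U (Suc h))" "?t = d h v" using inj by blast
    have vX: "v \<in> carrier (X (Suc h))" using v(1) by (simp add: U_carrier)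
    have "c \<odot>\<^bsub>X h\<^esub> z = d h (v \<oplus>\<^bsub>X (Suc h)\<^esub> y)" using cz v(2) vX yX by (simp add: d.add)
    then show "c = \<zero>\<^bsub>K\<^esub>" by (rule z(3)[OF c X.M.a_closed[OF vX yX]])
  qed
  moreover have "acyclic_at W dW i" if "i \<noteq> h" for i
    unfolding acyclic_at_def
  proof (intro allI impI)
    fix w assume "cyc W dW i w"
    then obtain u where u: "cyc X d i (w \<ominus>\<^bsub>X i\<^esub> u)" "p i (w \<ominus>\<^bsub>X i\<^esub> u) = w"
      by (rule lift) (rule that)
    have "acyclic_at X d i" using X that by (simp add: line_complex_def)
    then obtain y where y: "y \<in> carrier (X (Suc i))" "w \<ominus>\<^bsub>X i\<^esub> u = d i y"
      using acyclic_atD[OF _ u(1)] by blast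
    then have "w = dW i (p (Suc i) y)" using u(2) by (simp add: dW_p)
    then show "\<exists>y\<in>carrier (W (Suc i)). w = dW i y" using y(1) by blast
  qed
  ultimately show ?thesis by (simp add: line_complex_def)
qed

text \<open>The degree is raised by the connecting homomorphism.\<close>

lemma line_W_of_X_acyclic:
  assumes U: "line_complex K U d h" and X: "acyclic_complex X d"
  shows "line_complex K W dW (Suc h)"
proof -
  have "line_at K U d h" using U by (simp add: line_complex_def)
  then obtain z where z: "cyc U d h z"
    "\<And>x. cyc U d h x \<Longrightarrow> \<exists>c\<in>carrier K. \<exists>y\<in>carrier (U (Suc h)). x = c \<odot>\<^bsub>X h\<^esub> z \<oplus>\<^bsub>X h\<^esub> d h y"
    "\<And>c y. \<lbrakk>c \<in> carrier K; y \<in> carrier (U (Suc h)); c \<odot>\<^bsub>X h\<^esub> z = d h y\<rbrakk> \<Longrightarrow> c = \<zero>\<^bsub>K\<^esub>"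
    unfolding line_at_def by auto
  have zU: "z \<in> carrier (U h)" "z \<in> carrier (X h)" using z(1) by (auto simp: cyc_def U_carrier)
  have "cyc X d h z" using z(1) by (auto simp: cyc_def U_carrier)
  moreover have XA: "\<exists>y\<in>carrier (X (Suc i)). x = d i y" if "cyc X d i x" for i x
    using X that by (simp add: acyclic_complex_def acyclic_at_def)
  \<comment> \<open>A bounding element in \<open>X\<close> for the generator of \<open>U\<close>:
    the connecting map sends the class of \<open>p x0\<close> to that of \<open>z\<close>.\<close>
  ultimately obtain x0 where x0: "x0 \<in> carrier (X (Suc h))" "z = d h x0" by blast
  \<comment> \<open>All degrees at once: \<open>c\<close> may be nonzero only in degree
    \<open>Suc h\<close>, where \<open>p x0\<close> generates.\<close>
  have key: "\<exists>c\<in>carrier K. \<exists>y\<in>carrier (X (Suc i)). (i \<noteq> Suc h \<longrightarrow> c = \<zero>\<^bsub>K\<^esub>) \<and>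
      (i = Suc h \<longrightarrow> w = c \<odot>\<^bsub>X i\<^esub> p i x0 \<oplus>\<^bsub>X i\<^esub> dW i (p (Suc i) y)) \<and> (i \<noteq> Suc h \<longrightarrow> w = dW i (p (Suc i) y))"
    if w: "cyc W dW i w" for i w
  proof -
    have wc: "w \<in> carrier (W i)" "w \<in> carrier (X i)" using w by (auto simp: cyc_def W_carrier)
    have fin: "w = p i s \<oplus>\<^bsub>X i\<^esub> dW i (p (Suc i) y)"
      if "s \<in> carrier (X i)" "y \<in> carrier (X (Suc i))" "w \<ominus>\<^bsub>X i\<^esub> s = d i y" for s y
    proof -
      have "w = s \<oplus>\<^bsub>X i\<^esub> d i y"
        using X.M.minus_add_cancel[OF wc(2) that(1)] X.M.a_comm[of "d i y" i s] that by simp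
      then show ?thesis using that(1,2) p_W[OF wc(1)] by (metis dW_p d.closed p_add)
    qed
    show ?thesis
    proof (cases i)
      case 0
      then have "cyc X d i (w \<ominus>\<^bsub>X i\<^esub> \<zero>\<^bsub>X i\<^esub>)" using wc by (simp add: cyc_def)
      then obtain y where y: "y \<in> carrier (X (Suc i))" "w \<ominus>\<^bsub>X i\<^esub> \<zero>\<^bsub>X i\<^esub> = d i y" using XA by blast
      then have "w = dW i (p (Suc i) y)" using fin[OF _ y] p_U[of "\<zero>\<^bsub>X i\<^esub>" i] by (simp add: U_carrier dW_p)
      then show ?thesis using y(1) 0 by (intro bexI[of _ "\<zero>\<^bsub>K\<^esub>"] bexI[of _ y]) auto
    next
      case (Suc j)
      note c = cyc_U_boundary[OF w[unfolded Suc]]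
      show ?thesis
      proof (cases "j = h")
        case True
        note Suc' = Suc[unfolded True] and c = c[unfolded True]
        obtain a v where a: "a \<in> carrier K" "v \<in> carrier (U (Suc h))" "d h w = a \<odot>\<^bsub>X h\<^esub> z \<oplus>\<^bsub>X h\<^esub> d h v"
          using z(2)[OF c(3)] by blast
        have vX: "v \<in> carrier (X (Suc h))" using a(2) by (simp add: U_carrier)
        \<comment> \<open>\<open>d w\<close> is \<open>a\<close> times \<open>z\<close> plus the
          boundary of \<open>v\<close>; subtracting \<open>a\<close> times \<open>x0\<close> and
          \<open>v\<close> from \<open>w\<close> leaves a cycle of \<open>X\<close>, which
          bounds.\<close>
        let ?s = "a \<odot>\<^bsub>X i\<^esub> x0 \<oplus>\<^bsub>X i\<^esub> v"
        have sX: "?s \<in> carrier (X i)" using a(1) x0(1) vX Suc' by simp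
        have ps: "p i ?s = a \<odot>\<^bsub>X i\<^esub> p i x0"
          using a(1) x0(1) vX Suc' p_U[OF a(2)] by (simp add: p_add p_smult)
        have "d h (w \<ominus>\<^bsub>X i\<^esub> ?s) = \<zero>\<^bsub>X h\<^esub>"
          using a x0 vX c(1) Suc' by (simp add: d.minus d.add d.smult)
        then have "cyc X d i (w \<ominus>\<^bsub>X i\<^esub> ?s)" using wc(2) sX Suc' by (simp add: cyc_def)
        then obtain y where y: "y \<in> carrier (X (Suc i))" "w \<ominus>\<^bsub>X i\<^esub> ?s = d i y" using XA by blast
        show ?thesis using fin[OF sX y] y(1) a(1) Suc' unfolding ps by blast
      next
        case False
        then have "acyclic_at U d j" using U by (simp add: line_complex_def)
        then obtain v where v: "v \<in> carrier (U i)" "d j w = d j v" using acyclic_atD[OF _ c(3)] Suc by blast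
        have vX: "v \<in> carrier (X i)" using v(1) by (simp add: U_carrier)
        have "cyc X d i (w \<ominus>\<^bsub>X i\<^esub> v)" using v vX c(1) Suc by (auto simp: cyc_def d.minus)
        then obtain y where y: "y \<in> carrier (X (Suc i))" "w \<ominus>\<^bsub>X i\<^esub> v = d i y" using XA by blast
        then have "w = dW i (p (Suc i) y)" using fin[OF vX y] p_U[OF v(1)] by (simp add: dW_p)
        then show ?thesis using y(1) Suc False by (intro bexI[of _ "\<zero>\<^bsub>K\<^esub>"] bexI[of _ y]) auto
      qed
    qed
  qed
  have "line_at K W dW (Suc h)"
    unfolding line_at_def
  proof (intro exI[of _ "p (Suc h) x0"] conjI allI impI ballI)
    have "p h (d h x0) = \<zero>\<^bsub>X h\<^esub>" using p_U[OF zU(1)] x0(2) by simp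
    then show "cyc W dW (Suc h) (p (Suc h) x0)" using x0(1) by (simp add: cyc_def dW_p)
  next
    fix w assume "cyc W dW (Suc h) w"
    from key[OF this] obtain c y where "c \<in> carrier K" "y \<in> carrier (X (Suc (Suc h)))"
      "w = c \<odot>\<^bsub>X (Suc h)\<^esub> p (Suc h) x0 \<oplus>\<^bsub>X (Suc h)\<^esub> dW (Suc h) (p (Suc (Suc h)) y)" by blast
    then show "\<exists>c\<in>carrier K. \<exists>y\<in>carrier (W (Suc (Suc h))).
        w = c \<odot>\<^bsub>W (Suc h)\<^esub> p (Suc h) x0 \<oplus>\<^bsub>W (Suc h)\<^esub> dW (Suc h) y" by auto
  next
    fix c y assume c: "c \<in> carrier K" and y: "y \<in> carrier (W (Suc (Suc h)))"
      and eq: "c \<odot>\<^bsub>W (Suc h)\<^esub> p (Suc h) x0 = dW (Suc h) y"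
    have yX: "y \<in> carrier (X (Suc (Suc h)))" using y by (simp add: W_carrier)
    \<comment> \<open>\<open>p\<close> kills this difference, so it lies in \<open>U\<close>, and
      its boundary is \<open>c \<odot> z\<close>, which therefore bounds already in
      \<open>U\<close>.\<close>
    let ?t = "c \<odot>\<^bsub>X (Suc h)\<^esub> x0 \<ominus>\<^bsub>X (Suc h)\<^esub> d (Suc h) y"
    have tX: "?t \<in> carrier (X (Suc h))" using c yX x0 by simp
    have cz: "c \<odot>\<^bsub>X (Suc h)\<^esub> x0 = ?t \<oplus>\<^bsub>X (Suc h)\<^esub> d (Suc h) y" using c yX x0 by simp
    have "p (Suc h) (?t \<oplus>\<^bsub>X (Suc h)\<^esub> d (Suc h) y) = p (Suc h) (d (Suc h) y)"
      using eq c x0(1) unfolding dW_def by (simp add: p_smult flip: cz)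
    then have "p (Suc h) ?t = \<zero>\<^bsub>X (Suc h)\<^esub>" using p_add[OF tX, of "d (Suc h) y"] yX tX
      by (metis X.M.add.r_cancel_one' d.closed p_closed)
    then have tU: "?t \<in> carrier (U (Suc h))" using tX by (simp add: U_carrier p_eq)
    have "c \<odot>\<^bsub>X h\<^esub> z = d h ?t" using c yX x0 dd by (simp add: d.minus d.smult)
    then show "c = \<zero>\<^bsub>K\<^esub>" using z(3)[OF c tU] by simp
  qed
  moreover have "acyclic_at W dW i" if "i \<noteq> Suc h" for i
    unfolding acyclic_at_def using key that p_in_W by blast
  ultimately show ?thesis by (simp add: line_complex_def)
qed

end

text \<open>The complex attached to the disjoint sets \<open>A\<close> and \<open>set bs\<close> represents the quotient of the
  subcomplex \<open>\<Inter>\<^bsub>a\<in>A\<^esub> q\<^sub>a X\<close> by the sum of its subcomplexes cut out by the \<open>q\<^sub>b\<close> with \<open>b\<close> in \<open>bs\<close>.\<close>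

locale multi_projected_complex =
  fixes K :: "('k, 'x) ring_scheme" and X :: "nat \<Rightarrow> ('k, 'v) module"
    and d :: "nat \<Rightarrow> 'v \<Rightarrow> 'v" and q :: "'b \<Rightarrow> nat \<Rightarrow> 'v \<Rightarrow> 'v" and M :: "'b set"
  assumes X_lmodule: "lmodule K (X i)"
    and d_hom: "lmodule_hom K (X (Suc i)) (X i) (d i)"
    and dd: "x \<in> carrier (X (Suc (Suc i))) \<Longrightarrow> d i (d (Suc i) x) = \<zero>\<^bsub>X i\<^esub>"
    and q_hom: "b \<in> M \<Longrightarrow> lmodule_hom K (X i) (X i) (q b i)"
    and qq: "\<lbrakk>b \<in> M; x \<in> carrier (X i)\<rbrakk> \<Longrightarrow> q b i (q b i x) = q b i x"
    and q_comm: "\<lbrakk>b \<in> M; c \<in> M; x \<in> carrier (X i)\<rbrakk> \<Longrightarrow> q b i (q c i x) = q c i (q b i x)"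
    and qdq: "\<lbrakk>b \<in> M; x \<in> carrier (X (Suc i))\<rbrakk> \<Longrightarrow> q b i (d i (q b (Suc i) x)) = d i (q b (Suc i) x)"
begin

sublocale X: lmodule K "X i" for i by (rule X_lmodule)
sublocale d: lmodule_hom K "X (Suc i)" "X i" "d i" for i by (rule d_hom)

text \<open>The product of the commuting projections \<open>1 - q b\<close>; its image is the common
  kernel of the \<open>q b\<close> with \<open>b\<close> in the list.\<close>

primrec r :: "'b list \<Rightarrow> nat \<Rightarrow> 'v \<Rightarrow> 'v" where
  "r [] i x = x"
| "r (b # bs) i x = r bs i x \<oplus>\<^bsub>X i\<^esub> (\<ominus>\<^bsub>K\<^esub> \<one>\<^bsub>K\<^esub>) \<odot>\<^bsub>X i\<^esub> q b i (r bs i x)"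

definition Y where
  "Y A bs i = X i\<lparr>carrier := {x \<in> carrier (X i). (\<forall>a\<in>A. q a i x = x) \<and> (\<forall>b\<in>set bs. q b i x = \<zero>\<^bsub>X i\<^esub>)}\<rparr>"

definition \<delta> where "\<delta> bs i x = r bs i (d i x)"

lemma Y_carrier: "x \<in> carrier (Y A bs i) \<longleftrightarrow>
    x \<in> carrier (X i) \<and> (\<forall>a\<in>A. q a i x = x) \<and> (\<forall>b\<in>set bs. q b i x = \<zero>\<^bsub>X i\<^esub>)"
  by (simp add: Y_def)

lemma Y_simps [simp]: "zero (Y A bs i) = zero (X i)" "add (Y A bs i) = add (X i)"
  "smult (Y A bs i) = smult (X i)"
  by (simp_all add: Y_def)

lemma \<delta>_Nil [simp]: "\<delta> [] = d"
  by (simp add: \<delta>_def fun_eq_iff)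

lemmas q_closed = lmodule_hom.closed[OF q_hom]
lemmas q_add = lmodule_hom.add[OF q_hom]
lemmas q_smult = lmodule_hom.smult[OF q_hom]
lemmas q_zero = lmodule_hom.zero[OF q_hom]

lemma r_closed: "\<lbrakk>set bs \<subseteq> M; x \<in> carrier (X i)\<rbrakk> \<Longrightarrow> r bs i x \<in> carrier (X i)"
  by (induction bs) (simp_all add: q_closed)

lemma r_add: "\<lbrakk>set bs \<subseteq> M; x \<in> carrier (X i); y \<in> carrier (X i)\<rbrakk> \<Longrightarrow>
    r bs i (x \<oplus>\<^bsub>X i\<^esub> y) = r bs i x \<oplus>\<^bsub>X i\<^esub> r bs i y"
  by (induction bs) (simp_all add: q_add q_closed r_closed X.smult_r_distr X.M.a_ac)

lemma r_smult: "\<lbrakk>set bs \<subseteq> M; c \<in> carrier K; x \<in> carrier (X i)\<rbrakk> \<Longrightarrow>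
    r bs i (c \<odot>\<^bsub>X i\<^esub> x) = c \<odot>\<^bsub>X i\<^esub> r bs i x"
  by (induction bs)
    (simp_all add: q_smult q_closed r_closed X.smult_r_distr X.smult_l_minus X.smult_r_minus)

lemma q_r: "\<lbrakk>set bs \<subseteq> M; c \<in> M; x \<in> carrier (X i)\<rbrakk> \<Longrightarrow> q c i (r bs i x) = r bs i (q c i x)"
proof (induction bs)
  case (Cons b bs)
  have rc: "r bs i x \<in> carrier (X i)" using Cons.prems by (simp add: r_closed)
  have "q c i (q b i (r bs i x)) = q b i (r bs i (q c i x))"
    using Cons rc q_comm[of c b "r bs i x" i] by simp
  then show ?case using Cons rc by (simp add: q_add q_smult q_closed)
qed simp

lemma q_r_zero: "\<lbrakk>set bs \<subseteq> M; c \<in> set bs; x \<in> carrier (X i)\<rbrakk> \<Longrightarrow> q c i (r bs i x) = \<zero>\<^bsub>X i\<^esub>"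
proof (induction bs)
  case (Cons b bs)
  have rc: "r bs i x \<in> carrier (X i)" and bM: "b \<in> M" "c \<in> M" using Cons.prems by (auto simp: r_closed)
  have e: "q c i (r (b # bs) i x) =
      q c i (r bs i x) \<oplus>\<^bsub>X i\<^esub> (\<ominus>\<^bsub>K\<^esub> \<one>\<^bsub>K\<^esub>) \<odot>\<^bsub>X i\<^esub> q c i (q b i (r bs i x))"
    using rc bM by (simp add: q_add q_smult q_closed)
  show ?case
  proof (cases "c = b")
    case True
    then show ?thesis unfolding e using rc bM by (simp add: qq q_closed X.minus_one_smult X.M.r_neg)
  next
    case False
    then have "q c i (r bs i x) = \<zero>\<^bsub>X i\<^esub>" using Cons by simp
    then show ?thesis unfolding e using rc bM q_comm[of c b "r bs i x" i] by (simp add: q_zero)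
  qed
qed simp

lemma r_id: "\<lbrakk>set bs \<subseteq> M; x \<in> carrier (X i); \<forall>b\<in>set bs. q b i x = \<zero>\<^bsub>X i\<^esub>\<rbrakk> \<Longrightarrow> r bs i x = x"
  by (induction bs) simp_all

text \<open>\<open>r bs\<close> changes an element only by images of the \<open>q b\<close>; by
  \<open>qdq\<close> the differential stays in these images, and \<open>r cs\<close> annihilates
  them. With \<open>cs = bs\<close> this makes \<open>r bs\<close> a chain map for
  \<open>\<delta> bs\<close>.\<close>

lemma r_d_r:
  "\<lbrakk>set cs \<subseteq> M; set bs \<subseteq> set cs; x \<in> carrier (X (Suc i))\<rbrakk> \<Longrightarrow> r cs i (d i (r bs (Suc i) x)) = r cs i (d i x)"
proof (induction bs)
  case (Cons b bs)
  let ?y = "r bs (Suc i) x"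
  have y: "?y \<in> carrier (X (Suc i))" and bM: "b \<in> M" using Cons.prems by (auto intro!: r_closed)
  have "r cs i (d i (q b (Suc i) ?y)) = r cs i (q b i (d i (q b (Suc i) ?y)))"
    using qdq[OF bM y] by simp
  also have "\<dots> = \<zero>\<^bsub>X i\<^esub>"
    using q_r[OF Cons.prems(1) bM] q_r_zero[OF Cons.prems(1), of b] Cons.prems(2) bM y q_closed by simp
  finally have "r cs i (d i (q b (Suc i) ?y)) = \<zero>\<^bsub>X i\<^esub>" .
  then show ?case using Cons y bM
    by (simp add: d.add d.smult r_add r_smult q_closed r_closed)
qed simp

lemma Y_submodule:
  assumes "A \<subseteq> M" "set bs \<subseteq> M"
  shows "submodule (carrier (Y A bs i)) K (X i)"
  unfolding X.submodule_iff
proof (intro conjI ballI)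
  have M: "a \<in> M" if "a \<in> A \<or> a \<in> set bs" for a using that assms by auto
  show "\<zero>\<^bsub>X i\<^esub> \<in> carrier (Y A bs i)" using M by (simp add: Y_carrier q_zero)
  show "x \<oplus>\<^bsub>X i\<^esub> y \<in> carrier (Y A bs i)" if "x \<in> carrier (Y A bs i)" "y \<in> carrier (Y A bs i)" for x y
    using that M by (simp add: Y_carrier q_add)
  show "c \<odot>\<^bsub>X i\<^esub> x \<in> carrier (Y A bs i)" if "c \<in> carrier K" "x \<in> carrier (Y A bs i)" for c x
    using that M by (simp add: Y_carrier q_smult)
qed (auto simp: Y_carrier)

lemma Y_eq: "Y A bs i = X i\<lparr>carrier := carrier (Y A bs i)\<rparr>"
  by (simp add: Y_def)

lemma Y_lmodule: "\<lbrakk>A \<subseteq> M; set bs \<subseteq> M\<rbrakk> \<Longrightarrow> lmodule K (Y A bs i)"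
  using X.lmodule_restrict[OF Y_submodule] by (simp flip: Y_eq)

lemma \<delta>_closed:
  assumes "A \<subseteq> M" "set bs \<subseteq> M" "x \<in> carrier (Y A bs (Suc i))"
  shows "\<delta> bs i x \<in> carrier (Y A bs i)"
proof -
  have x: "x \<in> carrier (X (Suc i))" using assms(3) by (simp add: Y_carrier)
  have "q a i (r bs i (d i x)) = r bs i (d i x)" if "a \<in> A" for a
  proof -
    have aM: "a \<in> M" using that assms(1) by auto
    have "q a (Suc i) x = x" using assms(3) that by (simp add: Y_carrier)
    then have "q a i (d i x) = d i x" using qdq[OF aM x] by simp
    then show ?thesis using q_r[OF assms(2) aM, of "d i x" i] x by simp
  qed
  then show ?thesis using x assms(2) q_r_zero by (simp add: Y_carrier \<delta>_def r_closed)
qed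

lemma \<delta>_hom:
  assumes "A \<subseteq> M" "set bs \<subseteq> M"
  shows "lmodule_hom K (Y A bs (Suc i)) (Y A bs i) (\<delta> bs i)"
proof (intro lmodule_hom.intro lmodule_hom_axioms.intro Y_lmodule assms)
  show "x \<in> carrier (Y A bs (Suc i)) \<Longrightarrow> \<delta> bs i x \<in> carrier (Y A bs i)" for x
    by (rule \<delta>_closed[OF assms])
qed (use assms(2) in \<open>simp_all add: \<delta>_def Y_carrier d.add d.smult r_add r_smult\<close>)

lemma \<delta>\<delta>:
  assumes "set bs \<subseteq> M" "x \<in> carrier (X (Suc (Suc i)))"
  shows "\<delta> bs i (\<delta> bs (Suc i) x) = \<zero>\<^bsub>X i\<^esub>"
proof -
  have "r bs i \<zero>\<^bsub>X i\<^esub> = \<zero>\<^bsub>X i\<^esub>"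
    by (rule r_id) (use assms(1) q_zero in auto)
  then show ?thesis using assms dd by (simp add: \<delta>_def r_d_r)
qed

lemma Y_projected:
  assumes "A \<subseteq> M" "set bs \<subseteq> M" "b \<in> M"
  shows "projected_complex K (Y A bs) (\<delta> bs) (q b)"
proof (rule projected_complex.intro)
  fix i
  show "lmodule_hom K (Y A bs (Suc i)) (Y A bs i) (\<delta> bs i)" by (rule \<delta>_hom[OF assms(1,2)])
  show "lmodule_hom K (Y A bs i) (Y A bs i) (q b i)"
  proof (intro lmodule_hom.intro lmodule_hom_axioms.intro Y_lmodule assms)
    have M: "a \<in> M" if "a \<in> A \<or> a \<in> set bs" for a using that assms by auto
    show "q b i x \<in> carrier (Y A bs i)" if "x \<in> carrier (Y A bs i)" for x
      using that M assms(3) by (simp add: Y_carrier q_closed q_comm[of _ b] q_zero)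
  qed (use assms(3) in \<open>simp_all add: Y_carrier q_add q_smult\<close>)
next
  fix i x assume "x \<in> carrier (Y A bs (Suc (Suc i)))"
  then show "\<delta> bs i (\<delta> bs (Suc i) x) = \<zero>\<^bsub>Y A bs i\<^esub>" using \<delta>\<delta>[OF assms(2)] by (simp add: Y_carrier)
next
  fix i x assume "x \<in> carrier (Y A bs i)"
  then show "q b i (q b i x) = q b i x" using qq[OF assms(3)] by (simp add: Y_carrier)
next
  fix i x assume "x \<in> carrier (Y A bs (Suc i))"
  then have x: "x \<in> carrier (X (Suc i))" by (simp add: Y_carrier)
  then show "q b i (\<delta> bs i (q b (Suc i) x)) = \<delta> bs i (q b (Suc i) x)"
    using q_r[OF assms(2,3)] qdq[OF assms(3) x] q_closed[OF assms(3) x] by (simp add: \<delta>_def)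
qed

text \<open>The inductive step: \<open>b\<close> is adjoined to \<open>A\<close> in the subcomplex
  and to \<open>bs\<close> in the quotient, so the three complexes form a short exact
  sequence.\<close>

lemma Y_step:
  assumes "A \<subseteq> M" "set bs \<subseteq> M" "b \<in> M"
  shows "projected_complex.U (Y A bs) (q b) = Y (insert b A) bs"
    "projected_complex.W (Y A bs) (q b) = Y A (b # bs)"
    "projected_complex.dW K (Y A bs) (\<delta> bs) (q b) = \<delta> (b # bs)"
proof -
  interpret P: projected_complex K "Y A bs" "\<delta> bs" "q b" by (rule Y_projected[OF assms])
  have "{x \<in> carrier (Y A bs i). q b i x = x} = carrier (Y (insert b A) bs i)"
    "{x \<in> carrier (Y A bs i). q b i x = \<zero>\<^bsub>Y A bs i\<^esub>} = carrier (Y A (b # bs) i)" for i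
    by (auto simp: Y_carrier)
  then show "P.U = Y (insert b A) bs" "P.W = Y A (b # bs)"
    unfolding P.U_def P.W_def fun_eq_iff by (simp_all add: Y_def)
  show "P.dW = \<delta> (b # bs)" by (simp add: P.dW_def P.p_def \<delta>_def fun_eq_iff)
qed

lemma acyclic_Y:
  assumes "set bs \<subseteq> M" "set cs \<subseteq> M" "A \<subseteq> M"
    and "\<And>B. \<lbrakk>A \<subseteq> B; B \<subseteq> A \<union> set bs\<rbrakk> \<Longrightarrow> acyclic_complex (Y B cs) (\<delta> cs)"
  shows "acyclic_complex (Y A (bs @ cs)) (\<delta> (bs @ cs))"
  using assms
proof (induction bs arbitrary: A)
  case (Cons b bs)
  have bM: "b \<in> M" and bcs: "set (bs @ cs) \<subseteq> M" using Cons.prems(1,2) by auto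
  interpret P: projected_complex K "Y A (bs @ cs)" "\<delta> (bs @ cs)" "q b"
    by (rule Y_projected[OF Cons.prems(3) bcs bM])
  have "acyclic_complex (Y A (bs @ cs)) (\<delta> (bs @ cs))"
  proof (rule Cons.IH)
    show "acyclic_complex (Y B cs) (\<delta> cs)" if "A \<subseteq> B" "B \<subseteq> A \<union> set bs" for B
      by (rule Cons.prems(4)) (use that in auto)
  qed (use Cons.prems in auto)
  moreover have "acyclic_complex (Y (insert b A) (bs @ cs)) (\<delta> (bs @ cs))"
  proof (rule Cons.IH)
    show "acyclic_complex (Y B cs) (\<delta> cs)" if "insert b A \<subseteq> B" "B \<subseteq> insert b A \<union> set bs" for B
      by (rule Cons.prems(4)) (use that in auto)
  qed (use Cons.prems in auto)
  ultimately show ?case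
    using P.acyclic_W by (simp add: Y_step[OF Cons.prems(3) bcs bM])
qed simp

text \<open>\<open>b\<close> stands last in the list, so its step is the innermost one. For every
  \<open>B\<close> the inclusion attached to \<open>b\<close> is an isomorphism on homology, and all
  further quotients are taken of acyclic complexes.\<close>

lemma acyclic_Y_of_iso:
  assumes "set bs \<subseteq> M - {b}" "b \<in> M"
    and inj: "\<And>A i u. \<lbrakk>A \<subseteq> M - {b}; cyc (Y (insert b A) []) d i u; \<exists>y\<in>carrier (Y A [] (Suc i)). u = d i y\<rbrakk> \<Longrightarrow>
      \<exists>v\<in>carrier (Y (insert b A) [] (Suc i)). u = d i v"
    and surj: "\<And>A i x. \<lbrakk>A \<subseteq> M - {b}; cyc (Y A []) d i x\<rbrakk> \<Longrightarrow>
      \<exists>u y. cyc (Y (insert b A) []) d i u \<and> y \<in> carrier (Y A [] (Suc i)) \<and> x = u \<oplus>\<^bsub>X i\<^esub> d i y"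
  shows "acyclic_complex (Y {} (bs @ [b])) (\<delta> (bs @ [b]))"
proof (rule acyclic_Y)
  fix B assume "B \<subseteq> {} \<union> set bs"
  then have B: "B \<subseteq> M - {b}" "B \<subseteq> M" using assms(1) by auto
  interpret P: projected_complex K "Y B []" "\<delta> []" "q b"
    by (rule Y_projected[OF B(2) _ assms(2)]) simp
  note st = Y_step[OF B(2) _ assms(2), of "[]", simplified]
  show "acyclic_complex (Y B [b]) (\<delta> [b])"
    using P.acyclic_W_of_iso inj[OF B(1)] surj[OF B(1)] unfolding st by (simp add: st)
qed (use assms in auto)

text \<open>Only the set \<open>D\<close> contributes, and each element of \<open>D\<close> in \<open>bs\<close> raises the degree by one.\<close>

lemma line_Y:
  assumes "D \<subseteq> M" and ac: "\<And>A. \<lbrakk>A \<subseteq> M; A \<noteq> D\<rbrakk> \<Longrightarrow> acyclic_complex (Y A []) d"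
    and li: "line_complex K (Y D []) d 0" and "distinct bs" "A \<inter> set bs = {}" "A \<subseteq> M" "set bs \<subseteq> M"
  shows "if A \<subseteq> D \<and> D \<subseteq> A \<union> set bs then line_complex K (Y A bs) (\<delta> bs) (card (D \<inter> set bs))
     else acyclic_complex (Y A bs) (\<delta> bs)"
  using assms(4-)
proof (induction bs arbitrary: A)
  case Nil
  then show ?case using ac[of A] li by (auto simp: subset_antisym)
next
  case (Cons b bs)
  have bM: "b \<in> M" and bs: "set bs \<subseteq> M" and bA: "b \<notin> A" and b': "b \<notin> set bs" using Cons.prems by auto
  interpret P: projected_complex K "Y A bs" "\<delta> bs" "q b" by (rule Y_projected[OF Cons.prems(3) bs bM])
  note st = Y_step[OF Cons.prems(3) bs bM]
  have X: "if A \<subseteq> D \<and> D \<subseteq> A \<union> set bs then line_complex K (Y A bs) (\<delta> bs) (card (D \<inter> set bs))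
     else acyclic_complex (Y A bs) (\<delta> bs)"
    by (rule Cons.IH) (use Cons.prems in auto)
  have U: "if insert b A \<subseteq> D \<and> D \<subseteq> insert b A \<union> set bs then line_complex K (Y (insert b A) bs) (\<delta> bs) (card (D \<inter> set bs))
     else acyclic_complex (Y (insert b A) bs) (\<delta> bs)"
    by (rule Cons.IH) (use Cons.prems in auto)
  show ?case
  proof (cases "b \<in> D")
    case True
    \<comment> \<open>\<open>b\<close> lies neither in \<open>A\<close> nor in \<open>bs\<close>, so
      no set between \<open>A\<close> and \<open>A \<union> set bs\<close> equals \<open>D\<close>;
      only the subcomplex can contribute, one degree higher.\<close>
    then have X': "acyclic_complex (Y A bs) (\<delta> bs)" using X bA b' by (auto split: if_splits)
    have c: "card (D \<inter> set (b # bs)) = Suc (card (D \<inter> set bs))" using True b' by simp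
    show ?thesis
    proof (cases "A \<subseteq> D \<and> D \<subseteq> A \<union> set (b # bs)")
      case c2: True
      then have "line_complex K (Y (insert b A) bs) (\<delta> bs) (card (D \<inter> set bs))" using U True by auto
      then show ?thesis using P.line_W_of_X_acyclic[OF _ X'] c2 unfolding st c by simp
    next
      case False
      then have "acyclic_complex (Y (insert b A) bs) (\<delta> bs)" using U True by auto
      then show ?thesis using P.acyclic_W[OF _ X'] False unfolding st by argo
    qed
  next
    case False
    \<comment> \<open>Now \<open>insert b A\<close> is not contained in \<open>D\<close>, so the
      subcomplex is acyclic and the degree does not change.\<close>
    then have U': "acyclic_complex (Y (insert b A) bs) (\<delta> bs)" using U by auto
    show ?thesis
    proof (cases "A \<subseteq> D \<and> D \<subseteq> A \<union> set bs")
      case True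
      then have L: "line_complex K (Y A bs) (\<delta> bs) (card (D \<inter> set bs))" using X by simp
      have "A \<subseteq> D \<and> D \<subseteq> A \<union> set (b # bs)" "D \<inter> set (b # bs) = D \<inter> set bs"
        using True False by auto
      then show ?thesis using P.line_W_of_U_acyclic[unfolded st, OF U' L] by simp
    next
      case F: False
      then have A: "acyclic_complex (Y A bs) (\<delta> bs)" using X by argo
      have "\<not> (A \<subseteq> D \<and> D \<subseteq> A \<union> set (b # bs))" using False F by auto
      then show ?thesis using P.acyclic_W[unfolded st, OF U' A] by argo
    qed
  qed
qed

end

section \<open>The algebra of interval representations in coordinates\<close>

subsection \<open>Endomorphism algebras\<close>

locale representation = K: cring K
  for K :: "('k, 'x) ring_scheme" +
  fixes P :: "'p::order set" and M :: "('p, 'k, 'v) poset_rep"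
  assumes vspace_lmodule: "x \<in> P \<Longrightarrow> lmodule K (vspace M x)"
    and struct_map_hom: "\<lbrakk>x \<in> P; y \<in> P; x \<le> y\<rbrakk> \<Longrightarrow> lmodule_hom K (vspace M x) (vspace M y) (struct_map M x y)"
begin

abbreviation V where "V x \<equiv> vspace M x"
abbreviation E where "E \<equiv> end_algebra K P M"

lemma end_simps:
  "carrier E = rep_hom K P M M"
  "\<phi> \<otimes>\<^bsub>E\<^esub> \<psi> = (\<lambda>x\<in>P. compose (carrier (V x)) (\<phi> x) (\<psi> x))"
  "\<one>\<^bsub>E\<^esub> = (\<lambda>x\<in>P. \<lambda>v\<in>carrier (V x). v)"
  "\<zero>\<^bsub>E\<^esub> = (\<lambda>x\<in>P. \<lambda>v\<in>carrier (V x). \<zero>\<^bsub>V x\<^esub>)"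
  "\<phi> \<oplus>\<^bsub>E\<^esub> \<psi> = (\<lambda>x\<in>P. \<lambda>v\<in>carrier (V x). \<phi> x v \<oplus>\<^bsub>V x\<^esub> \<psi> x v)"
  "c \<odot>\<^bsub>E\<^esub> \<phi> = (\<lambda>x\<in>P. \<lambda>v\<in>carrier (V x). c \<odot>\<^bsub>V x\<^esub> \<phi> x v)"
  by (simp_all add: end_algebra_def)

lemma repD:
  assumes "\<phi> \<in> rep_hom K P M M"
  shows "\<phi> \<in> extensional P" "x \<in> P \<Longrightarrow> \<phi> x \<in> extensional (carrier (V x))"
    "x \<in> P \<Longrightarrow> lmodule_hom K (V x) (V x) (\<phi> x)"
    "\<lbrakk>x \<in> P; v \<in> carrier (V x)\<rbrakk> \<Longrightarrow> \<phi> x v \<in> carrier (V x)"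
    "\<lbrakk>x \<in> P; y \<in> P; x \<le> y; v \<in> carrier (V x)\<rbrakk> \<Longrightarrow> \<phi> y (struct_map M x y v) = struct_map M x y (\<phi> x v)"
proof -
  note mn = assms[unfolded rep_hom_def mem_Collect_eq]
  note m = mn[THEN conjunct1] and n = mn[THEN conjunct2]
  note l = PiE_mem[OF m]
  show "\<phi> \<in> extensional P" using m by (simp add: PiE_def)
  show "x \<in> P \<Longrightarrow> \<phi> x \<in> extensional (carrier (V x))" by (rule lin_homD(1)[OF l])
  show "x \<in> P \<Longrightarrow> lmodule_hom K (V x) (V x) (\<phi> x)"
    by (intro lmodule_hom_lin_hom vspace_lmodule l)
  show "\<lbrakk>x \<in> P; v \<in> carrier (V x)\<rbrakk> \<Longrightarrow> \<phi> x v \<in> carrier (V x)" by (rule lin_homD(2)[OF l])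
  show "\<lbrakk>x \<in> P; y \<in> P; x \<le> y; v \<in> carrier (V x)\<rbrakk> \<Longrightarrow> \<phi> y (struct_map M x y v) = struct_map M x y (\<phi> x v)"
    using n by simp
qed

lemma repI:
  assumes "\<And>x v. \<lbrakk>x \<in> P; v \<in> carrier (V x)\<rbrakk> \<Longrightarrow> f x v \<in> carrier (V x)"
    "\<And>x v w. \<lbrakk>x \<in> P; v \<in> carrier (V x); w \<in> carrier (V x)\<rbrakk> \<Longrightarrow> f x (v \<oplus>\<^bsub>V x\<^esub> w) = f x v \<oplus>\<^bsub>V x\<^esub> f x w"
    "\<And>x c v. \<lbrakk>x \<in> P; c \<in> carrier K; v \<in> carrier (V x)\<rbrakk> \<Longrightarrow> f x (c \<odot>\<^bsub>V x\<^esub> v) = c \<odot>\<^bsub>V x\<^esub> f x v"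
    "\<And>x y v. \<lbrakk>x \<in> P; y \<in> P; x \<le> y; v \<in> carrier (V x)\<rbrakk> \<Longrightarrow> f y (struct_map M x y v) = struct_map M x y (f x v)"
  shows "(\<lambda>x\<in>P. \<lambda>v\<in>carrier (V x). f x v) \<in> rep_hom K P M M"
proof -
  have "(\<lambda>v\<in>carrier (V x). f x v) \<in> lin_hom K (V x) (V x)" if x: "x \<in> P" for x
  proof -
    interpret lmodule K "V x" by (rule vspace_lmodule[OF x])
    show ?thesis by (rule lin_homI) (use assms(1-3) x in auto)
  qed
  moreover have "struct_map M x y v \<in> carrier (V y)" if "x \<in> P" "y \<in> P" "x \<le> y" "v \<in> carrier (V x)" for x y v
    by (rule lmodule_hom.closed[OF struct_map_hom[OF that(1-3)] that(4)])
  ultimately show ?thesis using assms(4) by (auto simp: rep_hom_def)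
qed

lemma rep_eqI:
  assumes "\<phi> \<in> rep_hom K P M M" "\<psi> \<in> rep_hom K P M M"
    "\<And>x v. \<lbrakk>x \<in> P; v \<in> carrier (V x)\<rbrakk> \<Longrightarrow> \<phi> x v = \<psi> x v"
  shows "\<phi> = \<psi>"
proof (rule extensionalityI[OF repD(1)[OF assms(1)] repD(1)[OF assms(2)]])
  fix x assume x: "x \<in> P"
  show "\<phi> x = \<psi> x"
    by (rule extensionalityI[OF repD(2)[OF assms(1) x] repD(2)[OF assms(2) x]]) (rule assms(3)[OF x])
qed

lemma mult_rep: "\<phi> \<otimes>\<^bsub>E\<^esub> \<psi> = (\<lambda>x\<in>P. \<lambda>v\<in>carrier (V x). \<phi> x (\<psi> x v))"
  by (simp add: end_simps compose_def)

lemma end_closed: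
  assumes \<phi>: "\<phi> \<in> rep_hom K P M M" and \<psi>: "\<psi> \<in> rep_hom K P M M"
  shows "\<phi> \<oplus>\<^bsub>E\<^esub> \<psi> \<in> rep_hom K P M M" "\<phi> \<otimes>\<^bsub>E\<^esub> \<psi> \<in> rep_hom K P M M"
    "c \<in> carrier K \<Longrightarrow> c \<odot>\<^bsub>E\<^esub> \<phi> \<in> rep_hom K P M M"
proof -
  note [simp] = lmodule.smult_closed[OF vspace_lmodule] lmodule.smult_r_distr[OF vspace_lmodule]
    repD(4)[OF \<phi>] repD(4)[OF \<psi>]
    lmodule_hom.add[OF repD(3)[OF \<phi>]] lmodule_hom.add[OF repD(3)[OF \<psi>]]
    lmodule_hom.smult[OF repD(3)[OF \<phi>]] lmodule_hom.smult[OF repD(3)[OF \<psi>]]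
    repD(5)[OF \<phi>] repD(5)[OF \<psi>] lmodule_hom.add[OF struct_map_hom] lmodule_hom.smult[OF struct_map_hom]
    lmodule_hom.zero[OF struct_map_hom] lmodule.smult_r_null[OF vspace_lmodule]
  have ag: "abelian_group (V x)" if "x \<in> P" for x
    using vspace_lmodule[OF that] by (rule lmodule.axioms(2))
  note [simp] = abelian_group.axioms(1)[OF ag, THEN abelian_monoid.a_closed]
    abelian_group.axioms(1)[OF ag, THEN abelian_monoid.zero_closed]
    abelian_group.axioms(1)[OF ag, THEN abelian_monoid.r_zero]
    abelian_group.axioms(1)[OF ag, THEN abelian_monoid.a_assoc]
    abelian_group.axioms(1)[OF ag, THEN abelian_monoid.a_lcomm]
  show "\<phi> \<oplus>\<^bsub>E\<^esub> \<psi> \<in> rep_hom K P M M" unfolding end_simps by (rule repI) simp_all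
  show "\<phi> \<otimes>\<^bsub>E\<^esub> \<psi> \<in> rep_hom K P M M" unfolding mult_rep by (rule repI) simp_all
  assume c: "c \<in> carrier K"
  show "c \<odot>\<^bsub>E\<^esub> \<phi> \<in> rep_hom K P M M" unfolding end_simps
    by (rule repI) (use c in \<open>simp_all add: K.m_comm flip: lmodule.smult_assoc[OF vspace_lmodule]\<close>)
qed

lemma end_one_zero: "\<one>\<^bsub>E\<^esub> \<in> rep_hom K P M M" "\<zero>\<^bsub>E\<^esub> \<in> rep_hom K P M M"
proof -
  have ag: "abelian_monoid (V x)" if "x \<in> P" for x
    using vspace_lmodule[OF that, THEN lmodule.axioms(2)] by (rule abelian_group.axioms(1))
  note [simp] = ag[THEN abelian_monoid.zero_closed] ag[THEN abelian_monoid.r_zero]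
    lmodule_hom.zero[OF struct_map_hom] lmodule.smult_r_null[OF vspace_lmodule]
  show "\<one>\<^bsub>E\<^esub> \<in> rep_hom K P M M" "\<zero>\<^bsub>E\<^esub> \<in> rep_hom K P M M"
    unfolding end_simps by (rule repI; simp)+
qed

lemma end_apply:
  assumes "x \<in> P" "v \<in> carrier (V x)"
  shows "(\<phi> \<oplus>\<^bsub>E\<^esub> \<psi>) x v = \<phi> x v \<oplus>\<^bsub>V x\<^esub> \<psi> x v" "(\<phi> \<otimes>\<^bsub>E\<^esub> \<psi>) x v = \<phi> x (\<psi> x v)"
    "(c \<odot>\<^bsub>E\<^esub> \<phi>) x v = c \<odot>\<^bsub>V x\<^esub> \<phi> x v" "\<one>\<^bsub>E\<^esub> x v = v" "\<zero>\<^bsub>E\<^esub> x v = \<zero>\<^bsub>V x\<^esub>"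
  using assms by (simp_all add: mult_rep end_simps(3-))

lemma lmodule_end: "lmodule K E"
proof -
  have ag: "abelian_group (V x)" if "x \<in> P" for x
    using vspace_lmodule[OF that] by (rule lmodule.axioms(2))
  note [simp] = 
    abelian_group.axioms(1)[OF ag, THEN abelian_monoid.l_zero]
    abelian_group.axioms(1)[OF ag, THEN abelian_monoid.a_assoc]
    abelian_group.axioms(1)[OF ag, THEN abelian_monoid.a_comm]
    lmodule.smult_l_distr[OF vspace_lmodule] lmodule.smult_r_distr[OF vspace_lmodule]
    lmodule.smult_assoc[OF vspace_lmodule] lmodule.smult_one[OF vspace_lmodule]
    lmodule.smult_l_null[OF vspace_lmodule]
  show ?thesis
    by (rule lmoduleI)
      (auto simp: K.ring_axioms end_simps(1) end_closed end_one_zero end_apply repD(4) intro!: rep_eqI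
         abelian_group.axioms(1)[OF ag, THEN abelian_monoid.a_comm])
qed

lemma ring_end: "ring E"
proof (rule ringI)
  show "abelian_group E" by (rule lmodule.axioms(2)[OF lmodule_end])
  show "monoid E"
    by (rule monoidI) (auto simp: end_simps(1) end_closed end_one_zero end_apply repD(4) intro!: rep_eqI)
next
  fix x y z assume xyz: "x \<in> carrier E" "y \<in> carrier E" "z \<in> carrier E"
  then show "(x \<oplus>\<^bsub>E\<^esub> y) \<otimes>\<^bsub>E\<^esub> z = x \<otimes>\<^bsub>E\<^esub> z \<oplus>\<^bsub>E\<^esub> y \<otimes>\<^bsub>E\<^esub> z"
    by (intro rep_eqI) (auto simp: end_simps(1) end_closed end_one_zero end_apply repD(4))
  show "z \<otimes>\<^bsub>E\<^esub> (x \<oplus>\<^bsub>E\<^esub> y) = z \<otimes>\<^bsub>E\<^esub> x \<oplus>\<^bsub>E\<^esub> z \<otimes>\<^bsub>E\<^esub> y"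
    using xyz by (intro rep_eqI) (auto simp: end_simps(1) end_closed end_one_zero end_apply repD(4) lmodule_hom.add[OF repD(3)])
qed

lemma op_simps [simp]:
  "carrier (op_algebra A) = carrier A" "a \<otimes>\<^bsub>op_algebra A\<^esub> b = b \<otimes>\<^bsub>A\<^esub> a" "\<one>\<^bsub>op_algebra A\<^esub> = \<one>\<^bsub>A\<^esub>"
  "zero (op_algebra A) = zero A" "add (op_algebra A) = add A" "smult (op_algebra A) = smult A"
  by (simp_all add: op_algebra_def)

lemma lmodule_op: "lmodule K (op_algebra E)"
proof -
  interpret E: lmodule K E by (rule lmodule_end)
  show ?thesis
    by (rule lmoduleI)
      (auto simp: K.ring_axioms E.smult_l_distr E.smult_r_distr E.smult_assoc E.M.a_ac)
qed

lemma ring_op: "ring (op_algebra E)"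
proof (rule ringI)
  interpret E: ring E by (rule ring_end)
  show "abelian_group (op_algebra E)" by (rule lmodule.axioms(2)[OF lmodule_op])
  show "monoid (op_algebra E)" by (rule monoidI) (auto simp: E.m_assoc)
qed (use ring.ring_simprules[OF ring_end] in \<open>auto simp: ring.ring_simprules[OF ring_end]\<close>)

lemma op_smult_mult:
  assumes "c \<in> carrier K" "a \<in> carrier E" "b \<in> carrier E"
  shows "(c \<odot>\<^bsub>E\<^esub> a) \<otimes>\<^bsub>E\<^esub> b = c \<odot>\<^bsub>E\<^esub> (a \<otimes>\<^bsub>E\<^esub> b)" "a \<otimes>\<^bsub>E\<^esub> (c \<odot>\<^bsub>E\<^esub> b) = c \<odot>\<^bsub>E\<^esub> (a \<otimes>\<^bsub>E\<^esub> b)"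
  using assms by (auto simp: end_simps(1) end_closed end_one_zero end_apply repD(4) lmodule_hom.smult[OF repD(3)] intro!: rep_eqI)

end

subsection \<open>Coordinates\<close>

locale interval_algebra = field K
  for K :: "('k, 'x) ring_scheme" +
  fixes P :: "'p::order set"
  assumes finite_P: "finite P"
begin

abbreviation \<I> where "\<I> \<equiv> intervals P"
abbreviation \<Lambda> where "\<Lambda> \<equiv> Lam K P"
abbreviation G where "G \<equiv> gen_rep K P"

lemma finite_\<I>: "finite \<I>"
  by (rule finite_subset[of _ "Pow P"]) (auto simp: intervals_def finite_P)

lemma interval_subset: "S \<in> \<I> \<Longrightarrow> S \<subseteq> P"
  by (simp add: intervals_def)

lemma interval_mem: "\<lbrakk>S \<in> \<I>; x \<in> S\<rbrakk> \<Longrightarrow> x \<in> P"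
  using interval_subset by blast

lemma interval_finite: "S \<in> \<I> \<Longrightarrow> finite S"
  using finite_subset[OF interval_subset finite_P] .

lemma vspace_G:
  "carrier (vspace G x) = (\<Pi>\<^sub>E R\<in>\<I>. if x \<in> R then carrier K else {\<zero>\<^bsub>K\<^esub>})"
  "zero (vspace G x) = (\<lambda>R\<in>\<I>. \<zero>\<^bsub>K\<^esub>)"
  "v \<oplus>\<^bsub>vspace G x\<^esub> w = (\<lambda>R\<in>\<I>. v R \<oplus>\<^bsub>K\<^esub> w R)"
  "c \<odot>\<^bsub>vspace G x\<^esub> v = (\<lambda>R\<in>\<I>. c \<otimes>\<^bsub>K\<^esub> v R)"
  by (auto simp: gen_rep_def rep_dsum_def interval_rep_def dsum_simps intro!: PiE_cong restrict_ext)

lemma struct_map_G: "struct_map G x y v = (\<lambda>R\<in>\<I>. if x \<in> R \<and> y \<in> R then v R else \<zero>\<^bsub>K\<^esub>)"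
  by (simp add: gen_rep_def rep_dsum_def interval_rep_def)

lemma vspace_mem: "v \<in> carrier (vspace G x) \<longleftrightarrow>
    v \<in> extensional \<I> \<and> (\<forall>R\<in>\<I>. v R \<in> carrier K) \<and> (\<forall>R\<in>\<I>. x \<notin> R \<longrightarrow> v R = \<zero>\<^bsub>K\<^esub>)"
proof -
  have "v R \<in> (if x \<in> R then carrier K else {\<zero>\<^bsub>K\<^esub>}) \<longleftrightarrow> v R \<in> carrier K \<and> (x \<notin> R \<longrightarrow> v R = \<zero>\<^bsub>K\<^esub>)" for R
    by (cases "x \<in> R") auto
  then show ?thesis unfolding vspace_G(1) PiE_iff by blast
qed

lemma lmodule_vspace_G: "lmodule K (vspace G x)"
proof -
  have "lmodule K (dsum \<I> (\<lambda>R. if x \<in> R then regular K else (regular K)\<lparr>carrier := {\<zero>\<^bsub>K\<^esub>}\<rparr>))"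
  proof (rule lmodule_dsum[OF ring_axioms])
    fix R
    note l = lmodule_regular[OF ring_axioms]
    have "lmodule K ((regular K)\<lparr>carrier := {\<zero>\<^bsub>K\<^esub>}\<rparr>)"
      using lmodule.lmodule_restrict[OF l lmodule.zero_submodule[OF l]] by simp
    then show "lmodule K (if x \<in> R then regular K else (regular K)\<lparr>carrier := {\<zero>\<^bsub>K\<^esub>}\<rparr>)"
      using l by simp
  qed
  then show ?thesis by (simp add: gen_rep_def rep_dsum_def interval_rep_def)
qed

sublocale G: representation K P G
proof (intro representation.intro representation_axioms.intro)
  show "cring K" by (rule is_cring)
  show "lmodule_hom K (vspace G x) (vspace G y) (struct_map G x y)" for x y
    by (intro lmodule_hom.intro lmodule_vspace_G lmodule_hom_axioms.intro)
      (auto simp: vspace_mem struct_map_G vspace_G(3,4) fun_eq_iff)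
qed (rule lmodule_vspace_G)

lemma \<Lambda>_eq: "\<Lambda> = op_algebra G.E" by (simp add: Lam_def)

lemma \<Lambda>_simps:
  "carrier \<Lambda> = rep_hom K P G G" "a \<otimes>\<^bsub>\<Lambda>\<^esub> b = b \<otimes>\<^bsub>G.E\<^esub> a" "\<one>\<^bsub>\<Lambda>\<^esub> = \<one>\<^bsub>G.E\<^esub>"
  "zero \<Lambda> = zero G.E" "add \<Lambda> = add G.E" "smult \<Lambda> = smult G.E"
  by (simp_all add: \<Lambda>_eq G.end_simps(1))

sublocale \<Lambda>: ring \<Lambda> unfolding \<Lambda>_eq by (rule G.ring_op)
sublocale K\<Lambda>: lmodule K \<Lambda> unfolding \<Lambda>_eq by (rule G.lmodule_op)

text \<open>The matrix of \<open>a\<close> at \<open>x\<close>, with respect to the basis of \<open>G(x)\<close> given by the intervals that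
  contain \<open>x\<close>. Since the multiplication of \<open>\<Lambda>\<close> is opposite to composition, it corresponds to the
  product of matrices in the usual order.\<close>

definition unit_vec :: "'p set \<Rightarrow> 'p set \<Rightarrow> 'k" where
  "unit_vec Q = (\<lambda>R\<in>\<I>. if R = Q then \<one>\<^bsub>K\<^esub> else \<zero>\<^bsub>K\<^esub>)"

definition cf :: "('p \<Rightarrow> ('p set \<Rightarrow> 'k) \<Rightarrow> ('p set \<Rightarrow> 'k)) \<Rightarrow> 'p \<Rightarrow> 'p set \<Rightarrow> 'p set \<Rightarrow> 'k" where
  "cf a x Q R = (if x \<in> P \<and> Q \<in> \<I> \<and> R \<in> \<I> \<and> x \<in> Q then a x (unit_vec Q) R else \<zero>\<^bsub>K\<^esub>)"

text \<open>The last clause is compatibility with the structure map from \<open>x\<close> to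
  \<open>y\<close>, tested on unit vectors.\<close>

definition natural_matrix :: "('p \<Rightarrow> 'p set \<Rightarrow> 'p set \<Rightarrow> 'k) \<Rightarrow> bool" where
  "natural_matrix m \<longleftrightarrow> (\<forall>x Q R. m x Q R \<in> carrier K) \<and>
     (\<forall>x Q R. \<not> (x \<in> P \<and> Q \<in> \<I> \<and> R \<in> \<I> \<and> x \<in> Q \<and> x \<in> R) \<longrightarrow> m x Q R = \<zero>\<^bsub>K\<^esub>) \<and>
     (\<forall>x y Q R. x \<in> P \<longrightarrow> y \<in> P \<longrightarrow> x \<le> y \<longrightarrow>
       (if x \<in> Q \<and> y \<in> Q then m y Q R else \<zero>\<^bsub>K\<^esub>) = (if x \<in> R \<and> y \<in> R then m x Q R else \<zero>\<^bsub>K\<^esub>))"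

definition of_matrix :: "('p \<Rightarrow> 'p set \<Rightarrow> 'p set \<Rightarrow> 'k) \<Rightarrow> 'p \<Rightarrow> ('p set \<Rightarrow> 'k) \<Rightarrow> ('p set \<Rightarrow> 'k)" where
  "of_matrix m = (\<lambda>x\<in>P. \<lambda>v\<in>carrier (vspace G x). \<lambda>R\<in>\<I>. \<Oplus>\<^bsub>K\<^esub>Q\<in>\<I>. v Q \<otimes>\<^bsub>K\<^esub> m x Q R)"

lemma unit_vec_closed: "x \<in> Q \<Longrightarrow> unit_vec Q \<in> carrier (vspace G x)"
  by (auto simp: vspace_mem unit_vec_def)

text \<open>Linearity, by induction on a set containing the support of \<open>v\<close>. A
  coefficient \<open>v Q\<close> with \<open>x \<notin> Q\<close> is zero, in accordance with the
  value 0 of \<open>cf\<close> there.\<close>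

lemma expand:
  assumes "a \<in> carrier \<Lambda>" "x \<in> P" "v \<in> carrier (vspace G x)" "R \<in> \<I>"
  shows "a x v R = (\<Oplus>\<^bsub>K\<^esub>Q\<in>\<I>. v Q \<otimes>\<^bsub>K\<^esub> cf a x Q R)"
proof -
  interpret a: lmodule_hom K "vspace G x" "vspace G x" "a x"
    using G.repD(3) assms(1,2) by (simp add: \<Lambda>_simps)
  have cfc: "cf a x Q R \<in> carrier K" for Q
    using a.closed[OF unit_vec_closed, of Q] assms(4) by (auto simp: cf_def vspace_mem)
  have "a x v R = (\<Oplus>\<^bsub>K\<^esub>Q\<in>S. v Q \<otimes>\<^bsub>K\<^esub> cf a x Q R)"
    if "finite S" "S \<subseteq> \<I>" "v \<in> carrier (vspace G x)" "\<forall>Q\<in>\<I> - S. v Q = \<zero>\<^bsub>K\<^esub>" for S v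
    using that
  proof (induction S arbitrary: v)
    case empty
    then have "v = \<zero>\<^bsub>vspace G x\<^esub>"
      by (auto simp: vspace_G(2) vspace_mem intro!: extensionalityI[where A = \<I>])
    then have "a x v = \<zero>\<^bsub>vspace G x\<^esub>" by simp
    then show ?case using assms(4) by (simp add: vspace_G(2))
  next
    case (insert Q S)
    have vc: "v W \<in> carrier K" if "W \<in> \<I>" for W using insert.prems(2) that by (simp add: vspace_mem)
    have Q: "Q \<in> \<I>" using insert.prems by simp
    let ?w = "\<lambda>W\<in>\<I>. if W = Q then \<zero>\<^bsub>K\<^esub> else v W"
    have w: "?w \<in> carrier (vspace G x)" using insert.prems(2) by (auto simp: vspace_mem)
    have w': "(\<lambda>W. v W \<otimes>\<^bsub>K\<^esub> cf a x W R) \<in> S \<rightarrow> carrier K" using insert.prems(1) vc cfc by auto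
    have IH: "a x ?w R = (\<Oplus>\<^bsub>K\<^esub>W\<in>S. ?w W \<otimes>\<^bsub>K\<^esub> cf a x W R)"
      by (rule insert.IH[OF _ w]) (use insert.prems in auto)
    also have "\<dots> = (\<Oplus>\<^bsub>K\<^esub>W\<in>S. v W \<otimes>\<^bsub>K\<^esub> cf a x W R)"
      by (rule finsum_cong') (use insert.hyps insert.prems(1) w' in auto)
    finally have IH': "a x ?w R = (\<Oplus>\<^bsub>K\<^esub>W\<in>S. v W \<otimes>\<^bsub>K\<^esub> cf a x W R)" .
    have "a x v R = v Q \<otimes>\<^bsub>K\<^esub> cf a x Q R \<oplus>\<^bsub>K\<^esub> a x ?w R"
    proof (cases "x \<in> Q")
      case True
      have u: "unit_vec Q \<in> carrier (vspace G x)" by (rule unit_vec_closed[OF True])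
      have "v = v Q \<odot>\<^bsub>vspace G x\<^esub> unit_vec Q \<oplus>\<^bsub>vspace G x\<^esub> ?w"
        using insert.prems(2) vc Q by (auto simp: vspace_G(3,4) vspace_mem unit_vec_def intro!: extensionalityI[where A = \<I>])
      then have "a x v = v Q \<odot>\<^bsub>vspace G x\<^esub> a x (unit_vec Q) \<oplus>\<^bsub>vspace G x\<^esub> a x ?w"
        using a.add[OF a.M.smult_closed[OF vc[OF Q] u] w] a.smult[OF vc[OF Q] u] by simp
      then show ?thesis using assms(2,4) Q True by (simp add: vspace_G(3,4) cf_def)
    next
      case False
      then have "v Q = \<zero>\<^bsub>K\<^esub>" using insert.prems(2) Q by (simp add: vspace_mem)
      moreover from this have "?w = v" using insert.prems(2) by (auto simp: vspace_mem intro!: extensionalityI[where A = \<I>])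
      moreover have "a x v R \<in> carrier K" using a.closed[OF insert.prems(2)] assms(4) by (simp add: vspace_mem)
      ultimately show ?thesis using cfc by simp
    qed
    then show ?case unfolding IH' using insert.hyps vc[OF Q] cfc w' by simp
  qed
  from this[OF finite_\<I> subset_refl assms(3)] show ?thesis by simp
qed

lemma cf_closed [simp, intro]:
  assumes "a \<in> carrier \<Lambda>"
  shows "cf a x Q R \<in> carrier K"
  using G.repD(4)[of a x "unit_vec Q"] assms unit_vec_closed[of x Q]
  by (auto simp: cf_def vspace_mem \<Lambda>_simps)

lemma cf_support:
  assumes "a \<in> carrier \<Lambda>" "\<not> (x \<in> P \<and> Q \<in> \<I> \<and> R \<in> \<I> \<and> x \<in> Q \<and> x \<in> R)"
  shows "cf a x Q R = \<zero>\<^bsub>K\<^esub>"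
  using G.repD(4)[of a x "unit_vec Q"] assms unit_vec_closed[of x Q]
  by (auto simp: cf_def vspace_mem \<Lambda>_simps)

lemma cf_natural:
  assumes a: "a \<in> carrier \<Lambda>" and xy: "x \<in> P" "y \<in> P" "x \<le> y"
  shows "(if x \<in> Q \<and> y \<in> Q then cf a y Q R else \<zero>\<^bsub>K\<^esub>) = (if x \<in> R \<and> y \<in> R then cf a x Q R else \<zero>\<^bsub>K\<^esub>)"
proof (cases "x \<in> Q \<and> Q \<in> \<I> \<and> R \<in> \<I>")
  case False
  then show ?thesis using cf_support[OF a] by auto
next
  case True
  have u: "unit_vec Q \<in> carrier (vspace G x)" using True unit_vec_closed by blast
  interpret a: lmodule_hom K "vspace G y" "vspace G y" "a y"
    using G.repD(3) a xy by (simp add: \<Lambda>_simps)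
  have "struct_map G x y (unit_vec Q) = (if y \<in> Q then unit_vec Q else \<zero>\<^bsub>vspace G y\<^esub>)"
    using True by (auto simp: struct_map_G unit_vec_def vspace_G)
  then have "a y (struct_map G x y (unit_vec Q)) R = (if x \<in> Q \<and> y \<in> Q then cf a y Q R else \<zero>\<^bsub>K\<^esub>)"
    using True xy a.zero by (cases "y \<in> Q") (simp_all add: cf_def, simp add: vspace_G(2))
  moreover have "struct_map G x y (a x (unit_vec Q)) R = (if x \<in> R \<and> y \<in> R then cf a x Q R else \<zero>\<^bsub>K\<^esub>)"
    using True xy by (simp add: struct_map_G cf_def)
  ultimately show ?thesis using G.repD(5)[of a x y "unit_vec Q"] a xy u by (simp add: \<Lambda>_simps)
qed

text \<open>Most later identities in \<open>\<Lambda>\<close> are proved in this way, by comparing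
  matrix entries.\<close>

lemma cf_ext:
  assumes a: "a \<in> carrier \<Lambda>" and b: "b \<in> carrier \<Lambda>" and eq: "\<And>x Q R. cf a x Q R = cf b x Q R"
  shows "a = b"
proof (rule G.rep_eqI)
  show "a \<in> rep_hom K P G G" "b \<in> rep_hom K P G G" using a b by (simp_all add: \<Lambda>_simps)
  fix x v assume xv: "x \<in> P" "v \<in> carrier (vspace G x)"
  have "a x v \<in> carrier (vspace G x)" "b x v \<in> carrier (vspace G x)"
    using G.repD(4) a b xv by (simp_all add: \<Lambda>_simps)
  then show "a x v = b x v"
    using expand[OF a xv] expand[OF b xv] eq by (auto simp: vspace_mem intro!: extensionalityI[where A = \<I>])
qed

lemma cf_mult:
  assumes a: "a \<in> carrier \<Lambda>" and b: "b \<in> carrier \<Lambda>"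
  shows "cf (a \<otimes>\<^bsub>\<Lambda>\<^esub> b) x Q R = (\<Oplus>\<^bsub>K\<^esub>W\<in>\<I>. cf a x Q W \<otimes>\<^bsub>K\<^esub> cf b x W R)"
proof (cases "x \<in> P \<and> Q \<in> \<I> \<and> R \<in> \<I> \<and> x \<in> Q")
  case True
  then have u: "unit_vec Q \<in> carrier (vspace G x)" using unit_vec_closed by blast
  have au: "a x (unit_vec Q) \<in> carrier (vspace G x)" using G.repD(4) a u True by (simp add: \<Lambda>_simps)
  have "cf (a \<otimes>\<^bsub>\<Lambda>\<^esub> b) x Q R = b x (a x (unit_vec Q)) R"
    using True u G.end_apply(2)[of x "unit_vec Q" b a] by (simp add: cf_def \<Lambda>_simps)
  also have "\<dots> = (\<Oplus>\<^bsub>K\<^esub>W\<in>\<I>. a x (unit_vec Q) W \<otimes>\<^bsub>K\<^esub> cf b x W R)"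
    using expand[OF b _ au] True by simp
  also have "\<dots> = (\<Oplus>\<^bsub>K\<^esub>W\<in>\<I>. cf a x Q W \<otimes>\<^bsub>K\<^esub> cf b x W R)"
  proof (rule finsum_cong')
    show "a x (unit_vec Q) W \<otimes>\<^bsub>K\<^esub> cf b x W R = cf a x Q W \<otimes>\<^bsub>K\<^esub> cf b x W R" if "W \<in> \<I>" for W
      using that True by (simp add: cf_def[of a])
  qed (use a b in auto)
  finally show ?thesis .
next
  case False
  have "(\<Oplus>\<^bsub>K\<^esub>W\<in>\<I>. cf a x Q W \<otimes>\<^bsub>K\<^esub> cf b x W R) = \<zero>\<^bsub>K\<^esub>"
  proof (rule add.finprod_one_eqI)
    fix W
    have "cf a x Q W = \<zero>\<^bsub>K\<^esub> \<or> cf b x W R = \<zero>\<^bsub>K\<^esub>"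
      using cf_support[OF a, of x Q W] cf_support[OF b, of x W R] False by blast
    then show "cf a x Q W \<otimes>\<^bsub>K\<^esub> cf b x W R = \<zero>\<^bsub>K\<^esub>"
      using cf_closed[OF a] cf_closed[OF b] by (elim disjE) simp_all
  qed
  moreover have "cf (a \<otimes>\<^bsub>\<Lambda>\<^esub> b) x Q R = \<zero>\<^bsub>K\<^esub>"
    using False unfolding cf_def by (rule if_not_P)
  ultimately show ?thesis by simp
qed

text \<open>Serves for products with an idempotent or with \<open>proj_to\<close>, and for diagonal
  entries: in each case only one intermediate interval contributes.\<close>

lemma cf_mult_single:
  assumes a: "a \<in> carrier \<Lambda>" and b: "b \<in> carrier \<Lambda>" and W: "W \<in> \<I>"
    and z: "\<And>W'. \<lbrakk>W' \<in> \<I>; W' \<noteq> W\<rbrakk> \<Longrightarrow> cf a x Q W' = \<zero>\<^bsub>K\<^esub> \<or> cf b x W' R = \<zero>\<^bsub>K\<^esub>"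
  shows "cf (a \<otimes>\<^bsub>\<Lambda>\<^esub> b) x Q R = cf a x Q W \<otimes>\<^bsub>K\<^esub> cf b x W R"
proof -
  have "cf (a \<otimes>\<^bsub>\<Lambda>\<^esub> b) x Q R = (\<Oplus>\<^bsub>K\<^esub>W'\<in>\<I>. if W = W' then cf a x Q W' \<otimes>\<^bsub>K\<^esub> cf b x W' R else \<zero>\<^bsub>K\<^esub>)"
    unfolding cf_mult[OF a b]
  proof (rule finsum_cong'[OF refl])
    fix W' assume W': "W' \<in> \<I>"
    show "cf a x Q W' \<otimes>\<^bsub>K\<^esub> cf b x W' R = (if W = W' then cf a x Q W' \<otimes>\<^bsub>K\<^esub> cf b x W' R else \<zero>\<^bsub>K\<^esub>)"
      using z[OF W'] a b by (cases "W = W'") auto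
  qed (use a b in auto)
  also have "\<dots> = cf a x Q W \<otimes>\<^bsub>K\<^esub> cf b x W R"
    by (rule finsum_singleton[OF W finite_\<I>]) (use a b in auto)
  finally show ?thesis .
qed

lemma cf_add:
  assumes "a \<in> carrier \<Lambda>" "b \<in> carrier \<Lambda>"
  shows "cf (a \<oplus>\<^bsub>\<Lambda>\<^esub> b) x Q R = cf a x Q R \<oplus>\<^bsub>K\<^esub> cf b x Q R"
  using unit_vec_closed[of x Q] G.end_apply(1)[of x "unit_vec Q" a b]
  by (auto simp: cf_def \<Lambda>_simps vspace_G(3))

lemma cf_smult:
  assumes "c \<in> carrier K" "a \<in> carrier \<Lambda>"
  shows "cf (c \<odot>\<^bsub>\<Lambda>\<^esub> a) x Q R = c \<otimes>\<^bsub>K\<^esub> cf a x Q R"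
  using unit_vec_closed[of x Q] G.end_apply(3)[of x "unit_vec Q" c a] assms(1)
  by (auto simp: cf_def \<Lambda>_simps vspace_G(4))

lemma cf_zero [simp]: "cf \<zero>\<^bsub>\<Lambda>\<^esub> x Q R = \<zero>\<^bsub>K\<^esub>"
  using unit_vec_closed[of x Q] G.end_apply(5)[of x "unit_vec Q"]
  by (auto simp: cf_def \<Lambda>_simps vspace_G(2))

lemma cf_one: "cf \<one>\<^bsub>\<Lambda>\<^esub> x Q R = (if x \<in> P \<and> Q \<in> \<I> \<and> x \<in> Q \<and> R = Q then \<one>\<^bsub>K\<^esub> else \<zero>\<^bsub>K\<^esub>)"
  using unit_vec_closed[of x Q] G.end_apply(4)[of x "unit_vec Q"]
  by (auto simp: cf_def \<Lambda>_simps unit_vec_def)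

lemma
  assumes m: "natural_matrix m"
  shows of_matrix_closed [simp]: "of_matrix m \<in> carrier \<Lambda>" and cf_of_matrix: "cf (of_matrix m) = m"
proof -
  have mc: "m x Q R \<in> carrier K" for x Q R using m by (simp add: natural_matrix_def)
  have ms: "m x Q R = \<zero>\<^bsub>K\<^esub>" if "\<not> (x \<in> P \<and> Q \<in> \<I> \<and> R \<in> \<I> \<and> x \<in> Q \<and> x \<in> R)" for x Q R
    using m that unfolding natural_matrix_def by blast
  have mn: "(if x \<in> Q \<and> y \<in> Q then m y Q R else \<zero>\<^bsub>K\<^esub>) = (if x \<in> R \<and> y \<in> R then m x Q R else \<zero>\<^bsub>K\<^esub>)"
    if "x \<in> P" "y \<in> P" "x \<le> y" for x y Q R
    using m that unfolding natural_matrix_def by blast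
  have vc: "v Q \<in> carrier K" if "v \<in> carrier (vspace G x)" "Q \<in> \<I>" for v x Q
    using that by (simp add: vspace_mem)
  let ?f = "\<lambda>x v. \<lambda>R\<in>\<I>. \<Oplus>\<^bsub>K\<^esub>Q\<in>\<I>. v Q \<otimes>\<^bsub>K\<^esub> m x Q R"
  have "(\<lambda>x\<in>P. \<lambda>v\<in>carrier (vspace G x). ?f x v) \<in> rep_hom K P G G"
  proof (rule G.repI)
    fix x v assume xv: "x \<in> P" "v \<in> carrier (vspace G x)"
    have "(\<Oplus>\<^bsub>K\<^esub>Q\<in>\<I>. v Q \<otimes>\<^bsub>K\<^esub> m x Q R) \<in> carrier K" for R
      using vc[OF xv(2)] mc by (auto intro!: finsum_closed)
    moreover have "(\<Oplus>\<^bsub>K\<^esub>Q\<in>\<I>. v Q \<otimes>\<^bsub>K\<^esub> m x Q R) = \<zero>\<^bsub>K\<^esub>" if "x \<notin> R" for R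
      by (rule add.finprod_one_eqI) (use that vc[OF xv(2)] ms in auto)
    ultimately show "?f x v \<in> carrier (vspace G x)" by (simp add: vspace_mem)
  next
    fix x v w assume xv: "x \<in> P" "v \<in> carrier (vspace G x)" "w \<in> carrier (vspace G x)"
    have "(\<Oplus>\<^bsub>K\<^esub>Q\<in>\<I>. (v \<oplus>\<^bsub>vspace G x\<^esub> w) Q \<otimes>\<^bsub>K\<^esub> m x Q R) =
       (\<Oplus>\<^bsub>K\<^esub>Q\<in>\<I>. v Q \<otimes>\<^bsub>K\<^esub> m x Q R) \<oplus>\<^bsub>K\<^esub> (\<Oplus>\<^bsub>K\<^esub>Q\<in>\<I>. w Q \<otimes>\<^bsub>K\<^esub> m x Q R)" for R
    proof -
      have "(\<Oplus>\<^bsub>K\<^esub>Q\<in>\<I>. (v \<oplus>\<^bsub>vspace G x\<^esub> w) Q \<otimes>\<^bsub>K\<^esub> m x Q R) =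
        (\<Oplus>\<^bsub>K\<^esub>Q\<in>\<I>. v Q \<otimes>\<^bsub>K\<^esub> m x Q R \<oplus>\<^bsub>K\<^esub> w Q \<otimes>\<^bsub>K\<^esub> m x Q R)"
        by (rule finsum_cong') (use vc[OF xv(2)] vc[OF xv(3)] mc in \<open>auto simp: vspace_G(3) l_distr\<close>)
      also have "\<dots> = (\<Oplus>\<^bsub>K\<^esub>Q\<in>\<I>. v Q \<otimes>\<^bsub>K\<^esub> m x Q R) \<oplus>\<^bsub>K\<^esub> (\<Oplus>\<^bsub>K\<^esub>Q\<in>\<I>. w Q \<otimes>\<^bsub>K\<^esub> m x Q R)"
        by (rule finsum_addf) (use vc[OF xv(2)] vc[OF xv(3)] mc in auto)
      finally show ?thesis .
    qed
    then show "?f x (v \<oplus>\<^bsub>vspace G x\<^esub> w) = ?f x v \<oplus>\<^bsub>vspace G x\<^esub> ?f x w"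
      by (subst (2) vspace_G(3)) (simp add: fun_eq_iff)
  next
    fix x c v assume xv: "x \<in> P" "c \<in> carrier K" "v \<in> carrier (vspace G x)"
    have "(\<Oplus>\<^bsub>K\<^esub>Q\<in>\<I>. (c \<odot>\<^bsub>vspace G x\<^esub> v) Q \<otimes>\<^bsub>K\<^esub> m x Q R) = c \<otimes>\<^bsub>K\<^esub> (\<Oplus>\<^bsub>K\<^esub>Q\<in>\<I>. v Q \<otimes>\<^bsub>K\<^esub> m x Q R)" for R
    proof -
      have "(\<Oplus>\<^bsub>K\<^esub>Q\<in>\<I>. (c \<odot>\<^bsub>vspace G x\<^esub> v) Q \<otimes>\<^bsub>K\<^esub> m x Q R) =
        (\<Oplus>\<^bsub>K\<^esub>Q\<in>\<I>. c \<otimes>\<^bsub>K\<^esub> (v Q \<otimes>\<^bsub>K\<^esub> m x Q R))"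
        by (rule finsum_cong') (use vc[OF xv(3)] xv(2) mc in \<open>auto simp: vspace_G(4) m_assoc\<close>)
      also have "\<dots> = c \<otimes>\<^bsub>K\<^esub> (\<Oplus>\<^bsub>K\<^esub>Q\<in>\<I>. v Q \<otimes>\<^bsub>K\<^esub> m x Q R)"
        by (rule finsum_rdistr[symmetric]) (use vc[OF xv(3)] xv(2) mc finite_\<I> in auto)
      finally show ?thesis .
    qed
    then show "?f x (c \<odot>\<^bsub>vspace G x\<^esub> v) = c \<odot>\<^bsub>vspace G x\<^esub> ?f x v"
      by (subst (2) vspace_G(4)) (simp add: fun_eq_iff)
  next
    fix x y v assume xy: "x \<in> P" "y \<in> P" "x \<le> y" and v: "v \<in> carrier (vspace G x)"
    have "(\<Oplus>\<^bsub>K\<^esub>Q\<in>\<I>. struct_map G x y v Q \<otimes>\<^bsub>K\<^esub> m y Q R) =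
       (if x \<in> R \<and> y \<in> R then \<Oplus>\<^bsub>K\<^esub>Q\<in>\<I>. v Q \<otimes>\<^bsub>K\<^esub> m x Q R else \<zero>\<^bsub>K\<^esub>)" for R
    proof -
      have "(\<Oplus>\<^bsub>K\<^esub>Q\<in>\<I>. struct_map G x y v Q \<otimes>\<^bsub>K\<^esub> m y Q R) =
        (\<Oplus>\<^bsub>K\<^esub>Q\<in>\<I>. if x \<in> R \<and> y \<in> R then v Q \<otimes>\<^bsub>K\<^esub> m x Q R else \<zero>\<^bsub>K\<^esub>)"
      proof (rule finsum_cong'[OF refl])
        fix Q assume Q: "Q \<in> \<I>"
        have "struct_map G x y v Q \<otimes>\<^bsub>K\<^esub> m y Q R = v Q \<otimes>\<^bsub>K\<^esub> (if x \<in> Q \<and> y \<in> Q then m y Q R else \<zero>\<^bsub>K\<^esub>)"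
          using vc[OF v Q] mc Q by (simp add: struct_map_G)
        also have "\<dots> = v Q \<otimes>\<^bsub>K\<^esub> (if x \<in> R \<and> y \<in> R then m x Q R else \<zero>\<^bsub>K\<^esub>)"
          using mn[OF xy, of Q R] by simp
        finally show "struct_map G x y v Q \<otimes>\<^bsub>K\<^esub> m y Q R =
          (if x \<in> R \<and> y \<in> R then v Q \<otimes>\<^bsub>K\<^esub> m x Q R else \<zero>\<^bsub>K\<^esub>)"
          using vc[OF v Q] by simp
      qed (use vc[OF v] mc in auto)
      then show ?thesis by (cases "x \<in> R \<and> y \<in> R") (simp_all only: if_True if_False finsum_zero simp_thms)
    qed
    then show "?f y (struct_map G x y v) = struct_map G x y (?f x v)"
      unfolding struct_map_G[of x y "?f x v"] by (simp add: fun_eq_iff)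
  qed
  then show c: "of_matrix m \<in> carrier \<Lambda>" by (simp add: of_matrix_def \<Lambda>_simps)
  show "cf (of_matrix m) = m"
  proof (intro ext)
    fix x Q R
    show "cf (of_matrix m) x Q R = m x Q R"
    proof (cases "x \<in> P \<and> Q \<in> \<I> \<and> R \<in> \<I> \<and> x \<in> Q")
      case True
      then have u: "unit_vec Q \<in> carrier (vspace G x)" using unit_vec_closed by blast
      have "cf (of_matrix m) x Q R = (\<Oplus>\<^bsub>K\<^esub>W\<in>\<I>. unit_vec Q W \<otimes>\<^bsub>K\<^esub> m x W R)"
        using True u by (simp add: cf_def of_matrix_def)
      also have "\<dots> = (\<Oplus>\<^bsub>K\<^esub>W\<in>\<I>. if Q = W then m x W R else \<zero>\<^bsub>K\<^esub>)"
        by (rule finsum_cong') (use mc in \<open>auto simp: unit_vec_def\<close>)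
      also have "\<dots> = m x Q R" by (rule finsum_singleton) (use True finite_\<I> mc in auto)
      finally show ?thesis .
    next
      case False
      have "m x Q R = \<zero>\<^bsub>K\<^esub>" by (rule ms) (use False in blast)
      moreover have "cf (of_matrix m) x Q R = \<zero>\<^bsub>K\<^esub>" unfolding cf_def by (rule if_not_P[OF False])
      ultimately show ?thesis by simp
    qed
  qed
qed

abbreviation e where "e S \<equiv> idem K P S"

lemma
  assumes "S \<in> \<I>"
  shows e_closed [simp]: "e S \<in> carrier \<Lambda>"
    and cf_e: "cf (e S) x Q R = (if x \<in> S \<and> Q = S \<and> R = S then \<one>\<^bsub>K\<^esub> else \<zero>\<^bsub>K\<^esub>)"
proof -
  let ?f = "\<lambda>(x::'p) v. \<lambda>R\<in>\<I>. if R = S then v R else \<zero>\<^bsub>K\<^esub>"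
  have "(\<lambda>x\<in>P. \<lambda>v\<in>carrier (vspace G x). ?f x v) \<in> rep_hom K P G G"
    by (rule G.repI) (auto simp: vspace_mem vspace_G(3,4) struct_map_G fun_eq_iff)
  then show "e S \<in> carrier \<Lambda>" by (simp add: idem_def \<Lambda>_simps)
  show "cf (e S) x Q R = (if x \<in> S \<and> Q = S \<and> R = S then \<one>\<^bsub>K\<^esub> else \<zero>\<^bsub>K\<^esub>)"
    using unit_vec_closed[of x Q] interval_subset[OF assms] assms
    by (auto simp: cf_def idem_def unit_vec_def)
qed

text \<open>The finitely many matrix entries are linear functionals that separate the
  elements.\<close>

lemma fd_algebra_\<Lambda>: "fd_algebra K \<Lambda>"
proof (intro fd_algebra.intro fd_algebra_axioms.intro kspaceI)
  show "ring \<Lambda>" "field K" "lmodule K \<Lambda>" by (rule \<Lambda>.ring_axioms field_axioms K\<Lambda>.lmodule_axioms)+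
  fix c a b assume "c \<in> carrier K" "a \<in> carrier \<Lambda>" "b \<in> carrier \<Lambda>"
  then show "(c \<odot>\<^bsub>\<Lambda>\<^esub> a) \<otimes>\<^bsub>\<Lambda>\<^esub> b = c \<odot>\<^bsub>\<Lambda>\<^esub> (a \<otimes>\<^bsub>\<Lambda>\<^esub> b)" "a \<otimes>\<^bsub>\<Lambda>\<^esub> (c \<odot>\<^bsub>\<Lambda>\<^esub> b) = c \<odot>\<^bsub>\<Lambda>\<^esub> (a \<otimes>\<^bsub>\<Lambda>\<^esub> b)"
    using G.op_smult_mult by (simp_all add: \<Lambda>_simps G.end_simps(1))
next
  show "fin_dim K \<Lambda>"
  proof (rule fin_dimI[where X = "P \<times> \<I> \<times> \<I>" and \<phi> = "\<lambda>(x, Q, R) a. cf a x Q R"])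
    show "finite (P \<times> \<I> \<times> \<I>)" using finite_P finite_\<I> by simp
    fix t :: "'p \<times> 'p set \<times> 'p set"
    show "lmodule_hom K \<Lambda> (regular K) (case t of (x, Q, R) \<Rightarrow> \<lambda>a. cf a x Q R)"
      by (cases t) (auto intro!: lmodule_hom.intro lmodule_hom_axioms.intro K\<Lambda>.lmodule_axioms
          lmodule_regular ring_axioms simp: cf_add cf_smult)
  next
    fix a assume a: "a \<in> carrier \<Lambda>"
      and z: "\<And>t. t \<in> P \<times> \<I> \<times> \<I> \<Longrightarrow> (case t of (x, Q, R) \<Rightarrow> \<lambda>a. cf a x Q R) a = \<zero>\<^bsub>K\<^esub>"
    show "a = \<zero>\<^bsub>\<Lambda>\<^esub>"
    proof (rule cf_ext[OF a])
      fix x Q R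
      show "cf a x Q R = cf \<zero>\<^bsub>\<Lambda>\<^esub> x Q R"
      proof (cases "x \<in> P \<and> Q \<in> \<I> \<and> R \<in> \<I>")
        case True
        then show ?thesis using z[of "(x, Q, R)"] by simp
      next
        case False
        then have "cf a x Q R = \<zero>\<^bsub>K\<^esub>" by (intro cf_support[OF a]) blast
        then show ?thesis by simp
      qed
    qed simp
  qed
qed

end

section \<open>Connected components of downsets\<close>

definition joined :: "'p::order set \<Rightarrow> 'p \<Rightarrow> 'p \<Rightarrow> bool" where
  "joined Z x y \<longleftrightarrow> (x, y) \<in> {(a, b). a \<in> Z \<and> b \<in> Z \<and> (a \<le> b \<or> b \<le> a)}\<^sup>*"

definition component :: "'p::order set \<Rightarrow> 'p \<Rightarrow> 'p set" where
  "component Z x = {y \<in> Z. joined Z x y}"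

lemma connected_poset_iff: "connected_poset S \<longleftrightarrow> (\<forall>x\<in>S. \<forall>y\<in>S. joined S x y)"
  by (simp add: connected_poset_def joined_def)

lemma joined_refl [simp]: "joined Z x x"
  by (simp add: joined_def)

lemma joined_trans: "\<lbrakk>joined Z x y; joined Z y z\<rbrakk> \<Longrightarrow> joined Z x z"
  unfolding joined_def by (rule rtrancl_trans)

lemma joined_sym: "joined Z x y \<Longrightarrow> joined Z y x"
proof -
  have "sym {(a, b). a \<in> Z \<and> b \<in> Z \<and> (a \<le> b \<or> b \<le> a)}" by (auto simp: sym_def)
  then show "joined Z x y \<Longrightarrow> joined Z y x" unfolding joined_def by (meson sym_rtrancl symE)
qed

lemma joined_step: "\<lbrakk>x \<in> Z; y \<in> Z; x \<le> y \<or> y \<le> x\<rbrakk> \<Longrightarrow> joined Z x y"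
  unfolding joined_def by (rule r_into_rtrancl) simp

lemma joined_induct [consumes 1, case_names base step]:
  assumes "joined Z x y" "Q x"
    "\<And>a b. \<lbrakk>Q a; a \<in> Z; b \<in> Z; a \<le> b \<or> b \<le> a\<rbrakk> \<Longrightarrow> Q b"
  shows "Q y"
  using assms(1) unfolding joined_def by (induction rule: rtrancl_induct) (use assms(2,3) in auto)

lemma joined_mono:
  assumes "joined Z x y" "Z \<subseteq> Z'"
  shows "joined Z' x y"
  using assms(1)
proof (induction rule: joined_induct)
  case (step a b)
  then show ?case using assms(2) joined_step[of a Z' b] joined_trans by blast
qed simp

lemma joined_eq:
  assumes "joined Z x y" "\<And>a b. \<lbrakk>a \<in> Z; b \<in> Z; a \<le> b\<rbrakk> \<Longrightarrow> f a = f b"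
  shows "f x = f y"
  using assms(1)
proof (induction rule: joined_induct)
  case (step a b)
  then have "f a = f b" using assms(2)[of a b] assms(2)[of b a, THEN sym] by blast
  then show ?case using step(1) by simp
qed simp

lemma joined_eq_iff: "joined Z a b \<Longrightarrow> joined Z a c \<longleftrightarrow> joined Z b c"
  using joined_sym[of Z a b] joined_trans[of Z b a c] joined_trans[of Z a b c] by blast

lemma connected_closed:
  assumes "connected_poset S" "x \<in> S" "x \<in> A" "\<And>a b. \<lbrakk>a \<in> A; a \<in> S; b \<in> S; a \<le> b \<or> b \<le> a\<rbrakk> \<Longrightarrow> b \<in> A"
  shows "S \<subseteq> A"
proof
  fix y assume "y \<in> S"
  then have "joined S x y" using assms(1,2) by (simp add: connected_poset_iff)
  then show "y \<in> A" by (induction rule: joined_induct) (use assms(3,4) in auto)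
qed

lemma component_mem: "x \<in> Z \<Longrightarrow> x \<in> component Z x"
  by (simp add: component_def)

lemma component_subset: "component Z x \<subseteq> Z"
  by (auto simp: component_def)

lemma component_closed: "\<lbrakk>a \<in> component Z x; b \<in> Z; a \<le> b \<or> b \<le> a\<rbrakk> \<Longrightarrow> b \<in> component Z x"
  unfolding component_def using joined_trans joined_step by blast

lemma component_eq: "y \<in> component Z x \<Longrightarrow> component Z x = component Z y"
  unfolding component_def using joined_trans joined_sym by blast

lemma component_connected:
  assumes "x \<in> Z"
  shows "connected_poset (component Z x)"
proof -
  have j: "joined (component Z x) x y" if "y \<in> component Z x" for y
  proof -
    have "joined Z x y" using that by (simp add: component_def)
    then have "joined (component Z x) x y \<and> y \<in> component Z x"
    proof (induction rule: joined_induct)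
      case base
      then show ?case using component_mem[OF assms] by simp
    next
      case (step a b)
      then have "b \<in> component Z x" using component_closed[of a Z x b] by blast
      then show ?case using step joined_step[of a "component Z x" b] joined_trans by blast
    qed
    then show ?thesis ..
  qed
  then show ?thesis unfolding connected_poset_iff using joined_sym joined_trans by blast
qed

lemma finite_le_max:
  assumes "finite T" "(t::'p::order) \<in> T"
  obtains m where "m \<in> max_elements T" "t \<le> m"
proof -
  have "finite {x \<in> T. t \<le> x}" "{x \<in> T. t \<le> x} \<noteq> {}" using assms by auto
  then obtain m where m: "m \<in> {x \<in> T. t \<le> x}" "\<forall>b\<in>{x \<in> T. t \<le> x}. m \<le> b \<longrightarrow> m = b"
    using finite_has_maximal by blast
  have "m \<in> max_elements T"
    unfolding max_elements_def
  proof (intro CollectI conjI notI)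
    show "m \<in> T" using m by simp
    assume "\<exists>y\<in>T. m < y"
    then obtain y where y: "y \<in> T" "m < y" by blast
    then have "t \<le> y" "m \<le> y" using m(1) by auto
    then show False using m(2) y by auto
  qed
  then show thesis using that m(1) by blast
qed

context
  fixes P T :: "'p::order set"
  assumes T: "T \<in> intervals P" and finite_P': "finite P"
begin

lemma rel_downsetD:
  assumes "C \<in> rel_downsets P T"
  shows "C \<in> intervals P" "C \<subseteq> T" "\<And>s x. \<lbrakk>s \<in> C; x \<in> T; x \<le> s\<rbrakk> \<Longrightarrow> x \<in> C"
  using assms by (auto simp: rel_downsets_def)

text \<open>An element strictly below another element of \<open>T\<close> is not maximal, so it is
  never removed with \<open>A\<close>; hence a component is closed downwards in \<open>T\<close>.
  Convexity then follows from that of \<open>T\<close>.\<close>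

lemma component_rel_downset:
  assumes "A \<subseteq> max_elements T" "x \<in> T - A"
  shows "component (T - A) x \<in> rel_downsets P T"
proof -
  let ?C = "component (T - A) x"
  have CT: "?C \<subseteq> T - A" by (rule component_subset)
  have down: "y \<in> ?C" if "s \<in> ?C" "y \<in> T" "y \<le> s" for s y
  proof (cases "y = s")
    case False
    then have "y < s" using that by simp
    then have "y \<notin> A" using assms(1) that CT unfolding max_elements_def by blast
    then show ?thesis using component_closed[OF that(1)] that by blast
  qed (use that in simp)
  have "convex_in P ?C"
    unfolding convex_in_def
  proof (intro ballI impI)
    fix a b z assume abz: "a \<in> ?C" "b \<in> ?C" "z \<in> P" "a \<le> z \<and> z \<le> b"
    then have "a \<in> T" "b \<in> T" using CT by auto
    then have "z \<in> T" using abz T unfolding intervals_def convex_in_def by blast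
    then show "z \<in> ?C" using down abz by blast
  qed
  moreover have "?C \<subseteq> P" using CT T by (auto simp: intervals_def)
  ultimately show ?thesis
    unfolding rel_downsets_def intervals_def
    using component_connected[OF assms(2)] component_mem[OF assms(2)] CT down by blast
qed

definition comps :: "'p set \<Rightarrow> 'p set set" where
  "comps A = component (T - A) ` (T - A)"

lemma finite_comps: "finite (comps A)"
  using T finite_P' by (auto simp: comps_def intervals_def intro: finite_subset)

lemma comps_rel_downsets: "A \<subseteq> max_elements T \<Longrightarrow> comps A \<subseteq> rel_downsets P T"
  using component_rel_downset by (auto simp: comps_def)

lemma comps_disjoint: "C \<in> comps A \<Longrightarrow> C \<inter> A = {}"
  using component_subset by (fastforce simp: comps_def)

lemma comps_unique: "\<lbrakk>C \<in> comps A; C' \<in> comps A; x \<in> C; x \<in> C'\<rbrakk> \<Longrightarrow> C = C'"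
  unfolding comps_def using component_eq by blast

lemma comps_closed: "\<lbrakk>C \<in> comps A; a \<in> C; b \<in> T - A; a \<le> b \<or> b \<le> a\<rbrakk> \<Longrightarrow> b \<in> C"
  unfolding comps_def using component_closed by blast

text \<open>For a connected subset, being a component means being closed under comparability in
  \<open>T - A\<close>. Downward closure is the downset condition, and upward closure can be reduced
  to covers because \<open>T\<close> is finite.\<close>

lemma comps_iff:
  assumes A: "A \<subseteq> max_elements T" and S: "S \<in> intervals P"
  shows "S \<in> comps A \<longleftrightarrow> S \<in> rel_downsets P T \<and> A \<inter> S = {} \<and> upper_boundary T S \<subseteq> A"
proof
  assume SA: "S \<in> comps A"
  have "x \<in> A" if x: "x \<in> upper_boundary T S" for x
  proof (rule ccontr)
    assume "x \<notin> A"
    obtain s where "s \<in> S" "x \<in> T - S" "s < x" using x by (auto simp: upper_boundary_def covers_in_def)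
    then show False using comps_closed[OF SA, of s x] \<open>x \<notin> A\<close> less_imp_le[of s x] by blast
  qed
  then show "S \<in> rel_downsets P T \<and> A \<inter> S = {} \<and> upper_boundary T S \<subseteq> A"
    using comps_rel_downsets[OF A] comps_disjoint[OF SA] SA by blast
next
  assume *: "S \<in> rel_downsets P T \<and> A \<inter> S = {} \<and> upper_boundary T S \<subseteq> A"
  then have ST: "S \<subseteq> T - A" using rel_downsetD(2) by blast
  obtain s0 where s0: "s0 \<in> S" using S by (auto simp: intervals_def)
  have fT: "finite T" using T finite_P' by (auto simp: intervals_def intro: finite_subset)
  \<comment> \<open>Between \<open>s\<close> and an \<open>x\<close> outside \<open>S\<close> take a
    minimal element \<open>x'\<close> outside \<open>S\<close>, and then a maximal element
    \<open>s'\<close> strictly below \<open>x'\<close>. Now \<open>s' \<in> S\<close> is covered by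
    \<open>x'\<close>, so \<open>x'\<close> lies in \<open>A\<close> and is maximal in
    \<open>T\<close>; this forces \<open>x' = x\<close>, which was not removed.\<close>
  have up: "x \<in> S" if s: "s \<in> S" and x: "x \<in> T - A" and sx: "s \<le> x" for s x
  proof (rule ccontr)
    assume xS: "x \<notin> S"
    let ?B = "{y \<in> T. s \<le> y \<and> y \<le> x \<and> y \<notin> S}"
    have "finite ?B" "?B \<noteq> {}" using fT x sx xS by auto
    then obtain x' where x': "x' \<in> ?B" "\<forall>b\<in>?B. b \<le> x' \<longrightarrow> x' = b"
      using finite_has_minimal by blast
    let ?D = "{y \<in> T. s \<le> y \<and> y < x'}"
    have "s < x'" using x'(1) s by (auto simp: less_le)
    then have "finite ?D" "?D \<noteq> {}" using fT s ST by auto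
    then obtain s' where s': "s' \<in> ?D" "\<forall>b\<in>?D. s' \<le> b \<longrightarrow> s' = b"
      using finite_has_maximal by blast
    have "s' \<in> S"
    proof (rule ccontr)
      assume "s' \<notin> S"
      then have "s' \<in> ?B" "s' \<le> x'" using s'(1) x'(1) by auto
      then show False using x'(2) s'(1) by auto
    qed
    moreover have "covers_in T s' x'"
      unfolding covers_in_def
    proof (intro conjI notI)
      assume "\<exists>z\<in>T. s' < z \<and> z < x'"
      then obtain z where z: "z \<in> T" "s' < z" "z < x'" by blast
      then have "z \<in> ?D" "s' \<le> z" using s'(1) by auto
      then show False using s'(2) z by auto
    qed (use s'(1) x'(1) in auto)
    ultimately have "x' \<in> upper_boundary T S" using x'(1) by (auto simp: upper_boundary_def)
    then have "x' \<in> A" using * by blast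
    then have "x' = x" using A x'(1) x by (auto simp: max_elements_def less_le)
    then show False using \<open>x' \<in> A\<close> x by simp
  qed
  have "component (T - A) s0 = S"
  proof
    show "S \<subseteq> component (T - A) s0"
    proof
      fix y assume "y \<in> S"
      then have "joined S s0 y" using S s0 by (simp add: intervals_def connected_poset_iff)
      then show "y \<in> component (T - A) s0" using joined_mono ST \<open>y \<in> S\<close> by (auto simp: component_def)
    qed
    show "component (T - A) s0 \<subseteq> S"
    proof
      fix y assume "y \<in> component (T - A) s0"
      then have "joined (T - A) s0 y" by (simp add: component_def)
      then show "y \<in> S"
      proof (induction rule: joined_induct)
        case (step a b)
        then show ?case using up rel_downsetD(3)[of S a b] * by blast
      qed (rule s0)
    qed
  qed
  then show "S \<in> comps A" using s0 ST by (auto simp: comps_def)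
qed

text \<open>\<open>S\<close> is closed downwards, so whatever lies above an element of
  \<open>T - S\<close> is again outside \<open>S\<close>.\<close>

lemma max_elements_diff:
  assumes "S \<in> rel_downsets P T"
  shows "max_elements (T - S) = max_elements T - S"
  using rel_downsetD(3)[OF assms] unfolding max_elements_def by (auto simp: less_le)

end

section \<open>Elements of the algebra\<close>

context interval_algebra
begin

text \<open>Naturality closes the support of a morphism from the module of \<open>Q\<close> to that
  of \<open>R\<close> downwards in \<open>Q\<close> and, by \<open>cf_up\<close>, upwards in
  \<open>R\<close>.\<close>

lemma cf_down:
  assumes "a \<in> carrier \<Lambda>" "cf a y Q R \<noteq> \<zero>\<^bsub>K\<^esub>" "x \<le> y" "x \<in> Q"
  shows "x \<in> R" "cf a x Q R = cf a y Q R"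
proof -
  have *: "y \<in> P" "y \<in> Q" "y \<in> R" "Q \<in> \<I>" using cf_support[OF assms(1)] assms(2) by blast+
  then have "x \<in> P" using interval_mem assms(4) by blast
  then show "x \<in> R" "cf a x Q R = cf a y Q R"
    using cf_natural[OF assms(1) _ *(1) assms(3), of Q R] assms(2,4) * by (auto split: if_splits)
qed

lemma cf_up:
  assumes "a \<in> carrier \<Lambda>" "cf a x Q R \<noteq> \<zero>\<^bsub>K\<^esub>" "x \<le> y" "y \<in> R"
  shows "y \<in> Q" "cf a y Q R = cf a x Q R"
proof -
  have *: "x \<in> P" "x \<in> Q" "x \<in> R" "R \<in> \<I>" using cf_support[OF assms(1)] assms(2) by blast+
  then have "y \<in> P" using interval_mem assms(4) by blast
  then show "y \<in> Q" "cf a y Q R = cf a x Q R"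
    using cf_natural[OF assms(1) *(1) _ assms(3), of Q R] assms(2,4) * by (auto split: if_splits)
qed

text \<open>Between comparable points of \<open>Q \<inter> R\<close> both structure maps are
  identities, so naturality makes the entries equal.\<close>

lemma cf_joined:
  assumes a: "a \<in> carrier \<Lambda>" and "joined (Q \<inter> R) x y"
  shows "cf a x Q R = cf a y Q R"
  using assms(2)
proof (rule joined_eq)
  fix x y assume xy: "x \<in> Q \<inter> R" "y \<in> Q \<inter> R" "x \<le> y"
  show "cf a x Q R = cf a y Q R"
  proof (cases "x \<in> P \<and> y \<in> P")
    case True
    then show ?thesis using cf_natural[OF a _ _ xy(3), of Q R] xy by auto
  next
    case False
    then have "Q \<notin> \<I>" using xy interval_mem by blast
    then show ?thesis using cf_support[OF a] by simp
  qed
qed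

lemma idem_mult_cf:
  assumes "T \<in> \<I>" "a \<in> carrier \<Lambda>"
  shows "cf (e T \<otimes>\<^bsub>\<Lambda>\<^esub> a) x Q R = (if Q = T then cf a x T R else \<zero>\<^bsub>K\<^esub>)"
proof -
  have "cf (e T \<otimes>\<^bsub>\<Lambda>\<^esub> a) x Q R = cf (e T) x Q T \<otimes>\<^bsub>K\<^esub> cf a x T R"
    by (rule cf_mult_single) (use assms in \<open>auto simp: cf_e\<close>)
  then show ?thesis using assms cf_support[OF assms(2), of x T R] by (auto simp: cf_e)
qed

lemma mult_idem_cf:
  assumes "T \<in> \<I>" "a \<in> carrier \<Lambda>"
  shows "cf (a \<otimes>\<^bsub>\<Lambda>\<^esub> e T) x Q R = (if R = T then cf a x Q T else \<zero>\<^bsub>K\<^esub>)"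
proof -
  have "cf (a \<otimes>\<^bsub>\<Lambda>\<^esub> e T) x Q R = cf a x Q T \<otimes>\<^bsub>K\<^esub> cf (e T) x T R"
    by (rule cf_mult_single) (use assms in \<open>auto simp: cf_e\<close>)
  then show ?thesis using assms cf_support[OF assms(2), of x Q T] by (auto simp: cf_e)
qed

lemma idem_mult_iff:
  assumes "T \<in> \<I>" "a \<in> carrier \<Lambda>"
  shows "e T \<otimes>\<^bsub>\<Lambda>\<^esub> a = a \<longleftrightarrow> (\<forall>x Q R. Q \<noteq> T \<longrightarrow> cf a x Q R = \<zero>\<^bsub>K\<^esub>)"
proof
  assume "e T \<otimes>\<^bsub>\<Lambda>\<^esub> a = a"
  then show "\<forall>x Q R. Q \<noteq> T \<longrightarrow> cf a x Q R = \<zero>\<^bsub>K\<^esub>" using idem_mult_cf[OF assms] by metis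
next
  assume "\<forall>x Q R. Q \<noteq> T \<longrightarrow> cf a x Q R = \<zero>\<^bsub>K\<^esub>"
  then show "e T \<otimes>\<^bsub>\<Lambda>\<^esub> a = a" using assms by (intro cf_ext) (simp_all add: idem_mult_cf)
qed

lemma mult_idem_iff:
  assumes "T \<in> \<I>" "a \<in> carrier \<Lambda>"
  shows "a \<otimes>\<^bsub>\<Lambda>\<^esub> e T = a \<longleftrightarrow> (\<forall>x Q R. R \<noteq> T \<longrightarrow> cf a x Q R = \<zero>\<^bsub>K\<^esub>)"
proof
  assume "a \<otimes>\<^bsub>\<Lambda>\<^esub> e T = a"
  then show "\<forall>x Q R. R \<noteq> T \<longrightarrow> cf a x Q R = \<zero>\<^bsub>K\<^esub>" using mult_idem_cf[OF assms] by metis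
next
  assume "\<forall>x Q R. R \<noteq> T \<longrightarrow> cf a x Q R = \<zero>\<^bsub>K\<^esub>"
  then show "a \<otimes>\<^bsub>\<Lambda>\<^esub> e T = a" using assms by (intro cf_ext) (simp_all add: mult_idem_cf)
qed

lemma idem_idem [simp]: "T \<in> \<I> \<Longrightarrow> e T \<otimes>\<^bsub>\<Lambda>\<^esub> e T = e T"
  by (simp add: idem_mult_iff cf_e)

lemma idem_idem_mult [simp]:
  assumes "T \<in> \<I>" "a \<in> carrier \<Lambda>"
  shows "e T \<otimes>\<^bsub>\<Lambda>\<^esub> (e T \<otimes>\<^bsub>\<Lambda>\<^esub> a) = e T \<otimes>\<^bsub>\<Lambda>\<^esub> a"
  using assms \<Lambda>.m_assoc[of "e T" "e T" a] by simp

lemma cf_finsum: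
  assumes "finite A" "f \<in> A \<rightarrow> carrier \<Lambda>"
  shows "cf (finsum \<Lambda> f A) x Q R = (\<Oplus>\<^bsub>K\<^esub>i\<in>A. cf (f i) x Q R)"
proof -
  interpret c: lmodule_hom K \<Lambda> "regular K" "\<lambda>a. cf a x Q R"
    by (intro lmodule_hom.intro lmodule_hom_axioms.intro K\<Lambda>.lmodule_axioms lmodule_regular ring_axioms)
      (auto simp: cf_add cf_smult)
  have "finsum (regular K) g A = finsum K g A" if "g \<in> A \<rightarrow> carrier K" for g
    using assms(1) that
  proof (induction A)
    case (insert y B)
    then have "g \<in> B \<rightarrow> carrier K" "g y \<in> carrier K" by auto
    then show ?case using insert c.N.M.finsum_insert[of B y g] by simp
  qed (use c.N.M.finsum_empty in simp)
  then show ?thesis using c.finsum[OF assms] assms(2) by (simp add: Pi_iff)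
qed

lemma sum_idem: "(\<Oplus>\<^bsub>\<Lambda>\<^esub>S\<in>\<I>. e S) = \<one>\<^bsub>\<Lambda>\<^esub>"
proof (rule cf_ext)
  fix x Q R
  have "cf (\<Oplus>\<^bsub>\<Lambda>\<^esub>S\<in>\<I>. e S) x Q R = (\<Oplus>\<^bsub>K\<^esub>S\<in>\<I>. cf (e S) x Q R)"
    by (rule cf_finsum) (use finite_\<I> in auto)
  also have "\<dots> = (\<Oplus>\<^bsub>K\<^esub>S\<in>\<I>. if Q = S then (if x \<in> Q \<and> R = Q then \<one>\<^bsub>K\<^esub> else \<zero>\<^bsub>K\<^esub>) else \<zero>\<^bsub>K\<^esub>)"
    by (rule finsum_cong') (auto simp: cf_e)
  also have "\<dots> = cf \<one>\<^bsub>\<Lambda>\<^esub> x Q R"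
  proof (cases "Q \<in> \<I>")
    case True
    then have "(\<Oplus>\<^bsub>K\<^esub>S\<in>\<I>. if Q = S then (if x \<in> Q \<and> R = Q then \<one>\<^bsub>K\<^esub> else \<zero>\<^bsub>K\<^esub>) else \<zero>\<^bsub>K\<^esub>)
        = (if x \<in> Q \<and> R = Q then \<one>\<^bsub>K\<^esub> else \<zero>\<^bsub>K\<^esub>)"
      by (intro finsum_singleton) (auto simp: finite_\<I>)
    then show ?thesis using True interval_mem by (auto simp: cf_one)
  next
    case False
    then have "(\<Oplus>\<^bsub>K\<^esub>S\<in>\<I>. if Q = S then (if x \<in> Q \<and> R = Q then \<one>\<^bsub>K\<^esub> else \<zero>\<^bsub>K\<^esub>) else \<zero>\<^bsub>K\<^esub>) = \<zero>\<^bsub>K\<^esub>"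
      by (intro add.finprod_one_eqI) auto
    then show ?thesis using False by (simp add: cf_one)
  qed
  finally show "cf (\<Oplus>\<^bsub>\<Lambda>\<^esub>S\<in>\<I>. e S) x Q R = cf \<one>\<^bsub>\<Lambda>\<^esub> x Q R" .
qed (auto intro: \<Lambda>.finsum_closed)

text \<open>The projection of the interval module of \<open>T\<close> onto that of a downset \<open>C\<close>.\<close>

definition proj_to :: "'p set \<Rightarrow> 'p set \<Rightarrow> 'p \<Rightarrow> ('p set \<Rightarrow> 'k) \<Rightarrow> ('p set \<Rightarrow> 'k)" where
  "proj_to T C = of_matrix (\<lambda>x Q R. if x \<in> C \<and> Q = T \<and> R = C then \<one>\<^bsub>K\<^esub> else \<zero>\<^bsub>K\<^esub>)"

text \<open>The restriction of a morphism \<open>f\<close> from the interval module of \<open>T\<close> to that of \<open>C\<close>; it is a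
  morphism if \<open>f\<close> vanishes at the elements of \<open>T - C\<close> above \<open>C\<close>.\<close>

definition cut :: "'p set \<Rightarrow> 'p set \<Rightarrow> ('p \<Rightarrow> ('p set \<Rightarrow> 'k) \<Rightarrow> ('p set \<Rightarrow> 'k)) \<Rightarrow> 'p \<Rightarrow> ('p set \<Rightarrow> 'k) \<Rightarrow> ('p set \<Rightarrow> 'k)" where
  "cut T C f = of_matrix (\<lambda>x Q R. if x \<in> C \<and> Q = C then cf f x T R else \<zero>\<^bsub>K\<^esub>)"

text \<open>Drops the components of the support of \<open>f\<close> that contain \<open>b\<close>.\<close>

definition kill :: "'p set \<Rightarrow> 'p \<Rightarrow> ('p \<Rightarrow> ('p set \<Rightarrow> 'k) \<Rightarrow> ('p set \<Rightarrow> 'k)) \<Rightarrow> 'p \<Rightarrow> ('p set \<Rightarrow> 'k) \<Rightarrow> ('p set \<Rightarrow> 'k)" where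
  "kill T b f = of_matrix (\<lambda>x Q R. if Q = T \<and> \<not> joined (T \<inter> R) x b then cf f x T R else \<zero>\<^bsub>K\<^esub>)"

lemma
  assumes T: "T \<in> \<I>" and C: "C \<in> rel_downsets P T"
  shows proj_to_closed: "proj_to T C \<in> carrier \<Lambda>"
    and cf_proj_to: "cf (proj_to T C) x Q R = (if x \<in> C \<and> Q = T \<and> R = C then \<one>\<^bsub>K\<^esub> else \<zero>\<^bsub>K\<^esub>)"
proof -
  have CD: "C \<in> \<I>" "C \<subseteq> T" "\<And>s x. \<lbrakk>s \<in> C; x \<in> T; x \<le> s\<rbrakk> \<Longrightarrow> x \<in> C" using C by (auto simp: rel_downsets_def)
  have "natural_matrix (\<lambda>x Q R. if x \<in> C \<and> Q = T \<and> R = C then \<one>\<^bsub>K\<^esub> else \<zero>\<^bsub>K\<^esub>)"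
    unfolding natural_matrix_def
  proof (intro conjI allI impI)
    fix x Q R assume "\<not> (x \<in> P \<and> Q \<in> \<I> \<and> R \<in> \<I> \<and> x \<in> Q \<and> x \<in> R)"
    then show "(if x \<in> C \<and> Q = T \<and> R = C then \<one>\<^bsub>K\<^esub> else \<zero>\<^bsub>K\<^esub>) = \<zero>\<^bsub>K\<^esub>"
      using T CD(1,2) interval_mem by auto
  next
    fix x y Q R assume "x \<in> P" "y \<in> P" "x \<le> y"
    then show "(if x \<in> Q \<and> y \<in> Q then if y \<in> C \<and> Q = T \<and> R = C then \<one>\<^bsub>K\<^esub> else \<zero>\<^bsub>K\<^esub> else \<zero>\<^bsub>K\<^esub>) =
       (if x \<in> R \<and> y \<in> R then if x \<in> C \<and> Q = T \<and> R = C then \<one>\<^bsub>K\<^esub> else \<zero>\<^bsub>K\<^esub> else \<zero>\<^bsub>K\<^esub>)"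
      using CD(2,3) by auto
  qed simp
  then show "proj_to T C \<in> carrier \<Lambda>"
    "cf (proj_to T C) x Q R = (if x \<in> C \<and> Q = T \<and> R = C then \<one>\<^bsub>K\<^esub> else \<zero>\<^bsub>K\<^esub>)"
    unfolding proj_to_def by (simp_all add: cf_of_matrix)
qed

lemma cf_proj_to_mult:
  assumes "T \<in> \<I>" "C \<in> rel_downsets P T" "b \<in> carrier \<Lambda>"
  shows "cf (proj_to T C \<otimes>\<^bsub>\<Lambda>\<^esub> b) x Q R = (if x \<in> C \<and> Q = T then cf b x C R else \<zero>\<^bsub>K\<^esub>)"
proof -
  have C: "C \<in> \<I>" using assms(2) by (simp add: rel_downsets_def)
  have "cf (proj_to T C \<otimes>\<^bsub>\<Lambda>\<^esub> b) x Q R = cf (proj_to T C) x Q C \<otimes>\<^bsub>K\<^esub> cf b x C R"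
    by (rule cf_mult_single) (use assms C in \<open>auto simp: cf_proj_to proj_to_closed\<close>)
  then show ?thesis using assms by (simp add: cf_proj_to)
qed

lemma
  assumes T: "T \<in> \<I>" and C: "C \<in> \<I>" "C \<subseteq> T" and f: "f \<in> carrier \<Lambda>"
    and v: "\<And>x y R. \<lbrakk>x \<in> C; y \<in> T; y \<notin> C; x \<le> y\<rbrakk> \<Longrightarrow> cf f y T R = \<zero>\<^bsub>K\<^esub>"
  shows cut_closed: "cut T C f \<in> carrier \<Lambda>"
    and cf_cut: "cf (cut T C f) x Q R = (if x \<in> C \<and> Q = C then cf f x T R else \<zero>\<^bsub>K\<^esub>)"
proof -
  have "natural_matrix (\<lambda>x Q R. if x \<in> C \<and> Q = C then cf f x T R else \<zero>\<^bsub>K\<^esub>)"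
    unfolding natural_matrix_def
  proof (intro conjI allI impI)
    fix x Q R assume n: "\<not> (x \<in> P \<and> Q \<in> \<I> \<and> R \<in> \<I> \<and> x \<in> Q \<and> x \<in> R)"
    show "(if x \<in> C \<and> Q = C then cf f x T R else \<zero>\<^bsub>K\<^esub>) = \<zero>\<^bsub>K\<^esub>"
    proof (cases "x \<in> C \<and> Q = C")
      case True
      then have "\<not> (x \<in> P \<and> T \<in> \<I> \<and> R \<in> \<I> \<and> x \<in> T \<and> x \<in> R)" using n C by blast
      then show ?thesis using cf_support[OF f] by simp
    qed (rule if_not_P)
  next
    fix x y Q R assume xy: "x \<in> P" "y \<in> P" "x \<le> y"
    note nat = cf_natural[OF f xy, of T R]
    show "(if x \<in> Q \<and> y \<in> Q then if y \<in> C \<and> Q = C then cf f y T R else \<zero>\<^bsub>K\<^esub> else \<zero>\<^bsub>K\<^esub>) =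
       (if x \<in> R \<and> y \<in> R then if x \<in> C \<and> Q = C then cf f x T R else \<zero>\<^bsub>K\<^esub> else \<zero>\<^bsub>K\<^esub>)"
    proof (cases "Q = C \<and> x \<in> C")
      case True
      then have xT: "x \<in> T" using C by blast
      show ?thesis
      proof (cases "y \<in> C")
        case y: True
        then have "y \<in> T" using C by blast
        then show ?thesis using nat True y xT by simp
      next
        case False
        then have "(if x \<in> T \<and> y \<in> T then cf f y T R else \<zero>\<^bsub>K\<^esub>) = \<zero>\<^bsub>K\<^esub>" using v[of x y R] True xy(3) by simp
        then show ?thesis using nat True False by auto
      qed
    qed auto
  qed (use f in simp)
  then show "cut T C f \<in> carrier \<Lambda>"
    "cf (cut T C f) x Q R = (if x \<in> C \<and> Q = C then cf f x T R else \<zero>\<^bsub>K\<^esub>)"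
    unfolding cut_def by (simp_all add: cf_of_matrix)
qed

text \<open>Membership in the component of \<open>b\<close> in \<open>T \<inter> R\<close> does not
  change between comparable points of \<open>T \<inter> R\<close>, the only pairs at which
  naturality equates two entries instead of making one vanish.\<close>

lemma
  assumes T: "T \<in> \<I>" and f: "f \<in> carrier \<Lambda>"
  shows kill_closed: "kill T b f \<in> carrier \<Lambda>"
    and cf_kill: "cf (kill T b f) x Q R = (if Q = T \<and> \<not> joined (T \<inter> R) x b then cf f x T R else \<zero>\<^bsub>K\<^esub>)"
proof -
  have "natural_matrix (\<lambda>x Q R. if Q = T \<and> \<not> joined (T \<inter> R) x b then cf f x T R else \<zero>\<^bsub>K\<^esub>)"
    unfolding natural_matrix_def
  proof (intro conjI allI impI)
    fix x Q R assume "\<not> (x \<in> P \<and> Q \<in> \<I> \<and> R \<in> \<I> \<and> x \<in> Q \<and> x \<in> R)"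
    then show "(if Q = T \<and> \<not> joined (T \<inter> R) x b then cf f x T R else \<zero>\<^bsub>K\<^esub>) = \<zero>\<^bsub>K\<^esub>"
      using cf_support[OF f, of x Q R] by auto
  next
    fix x y Q R assume xy: "x \<in> P" "y \<in> P" "x \<le> y"
    note nat = cf_natural[OF f xy, of T R]
    show "(if x \<in> Q \<and> y \<in> Q then if Q = T \<and> \<not> joined (T \<inter> R) y b then cf f y T R else \<zero>\<^bsub>K\<^esub> else \<zero>\<^bsub>K\<^esub>) =
       (if x \<in> R \<and> y \<in> R then if Q = T \<and> \<not> joined (T \<inter> R) x b then cf f x T R else \<zero>\<^bsub>K\<^esub> else \<zero>\<^bsub>K\<^esub>)"
    proof (cases "Q = T \<and> x \<in> T \<and> y \<in> T \<and> x \<in> R \<and> y \<in> R")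
      case True
      then have "joined (T \<inter> R) x b \<longleftrightarrow> joined (T \<inter> R) y b"
        using xy(3) by (intro joined_eq_iff joined_step) auto
      then show ?thesis using True nat by simp
    next
      case False
      then show ?thesis using nat by (auto split: if_splits)
    qed
  qed (use f in simp)
  then show "kill T b f \<in> carrier \<Lambda>"
    "cf (kill T b f) x Q R = (if Q = T \<and> \<not> joined (T \<inter> R) x b then cf f x T R else \<zero>\<^bsub>K\<^esub>)"
    unfolding kill_def by (simp_all add: cf_of_matrix)
qed

text \<open>For the free module of rank one, \<open>A = {m}\<close> gives the subspace
  \<open>F\<^sub>m\<close> of the overview, and a nonempty \<open>A\<close> the intersection of
  these; the empty set gives all of \<open>e T \<Lambda>\<close>.\<close>

definition vanishes :: "'p set \<Rightarrow> 'p set \<Rightarrow> ('p \<Rightarrow> ('p set \<Rightarrow> 'k) \<Rightarrow> ('p set \<Rightarrow> 'k)) \<Rightarrow> bool" where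
  "vanishes T A f \<longleftrightarrow> f \<in> carrier \<Lambda> \<and> e T \<otimes>\<^bsub>\<Lambda>\<^esub> f = f \<and> (\<forall>a\<in>A. \<forall>R. cf f a T R = \<zero>\<^bsub>K\<^esub>)"

lemma vanishes_proj_to:
  assumes T: "T \<in> \<I>" and A: "A \<subseteq> max_elements T" and C: "C \<in> comps T A" and b: "b \<in> carrier \<Lambda>"
  shows "vanishes T A (proj_to T C \<otimes>\<^bsub>\<Lambda>\<^esub> b)"
proof -
  have CD: "C \<in> rel_downsets P T" using comps_rel_downsets[OF T finite_P A] C by blast
  have "proj_to T C \<otimes>\<^bsub>\<Lambda>\<^esub> b \<in> carrier \<Lambda>" using proj_to_closed[OF T CD] b by simp
  moreover have "a \<notin> C" if "a \<in> A" for a using comps_disjoint[OF T finite_P C] that by blast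
  ultimately show ?thesis
    using T by (simp add: vanishes_def idem_mult_iff cf_proj_to_mult[OF T CD b])
qed

text \<open>An element of \<open>T - C\<close> above the component \<open>C\<close> must have been
  removed, so it lies in \<open>A\<close>, where \<open>f\<close> vanishes; this is the condition
  under which \<open>cut\<close> is a morphism.\<close>

lemma
  assumes T: "T \<in> \<I>" and A: "A \<subseteq> max_elements T" and C: "C \<in> comps T A" and f: "vanishes T A f"
  shows cut_closed': "cut T C f \<in> carrier \<Lambda>"
    and cf_cut': "cf (cut T C f) x Q R = (if x \<in> C \<and> Q = C then cf f x T R else \<zero>\<^bsub>K\<^esub>)"
    and idem_cut: "e C \<otimes>\<^bsub>\<Lambda>\<^esub> cut T C f = cut T C f"
proof -
  have CD: "C \<in> \<I>" "C \<subseteq> T" using comps_rel_downsets[OF T finite_P A] C by (auto simp: rel_downsets_def)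
  have f': "f \<in> carrier \<Lambda>" using f by (simp add: vanishes_def)
  have v: "cf f y T R = \<zero>\<^bsub>K\<^esub>" if "x \<in> C" "y \<in> T" "y \<notin> C" "x \<le> y" for x y R
  proof -
    have "y \<in> A" using comps_closed[OF T finite_P C that(1), of y] that by blast
    then show ?thesis using f by (simp add: vanishes_def)
  qed
  show 1: "cut T C f \<in> carrier \<Lambda>"
    and 2: "cf (cut T C f) x Q R = (if x \<in> C \<and> Q = C then cf f x T R else \<zero>\<^bsub>K\<^esub>)" for x Q R
    by (rule cut_closed[OF T CD f' v] cf_cut[OF T CD f' v]; assumption)+
  show "e C \<otimes>\<^bsub>\<Lambda>\<^esub> cut T C f = cut T C f" using 1 CD(1) by (simp add: idem_mult_iff 2)
qed

text \<open>At a point of \<open>T - A\<close> exactly one component contributes, and it contributes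
  the entry of \<open>f\<close>; elsewhere both sides vanish.\<close>

lemma decompose:
  assumes T: "T \<in> \<I>" and A: "A \<subseteq> max_elements T" and f: "vanishes T A f"
  shows "f = (\<Oplus>\<^bsub>\<Lambda>\<^esub>C\<in>comps T A. proj_to T C \<otimes>\<^bsub>\<Lambda>\<^esub> cut T C f)"
proof (rule cf_ext)
  note CD = comps_rel_downsets[OF T finite_P A, THEN subsetD]
  have f': "f \<in> carrier \<Lambda>" using f by (simp add: vanishes_def)
  have c: "(\<lambda>C. proj_to T C \<otimes>\<^bsub>\<Lambda>\<^esub> cut T C f) \<in> comps T A \<rightarrow> carrier \<Lambda>"
    using proj_to_closed[OF T CD] cut_closed'[OF T A _ f] by auto
  show "f \<in> carrier \<Lambda>" by (rule f')
  show "(\<Oplus>\<^bsub>\<Lambda>\<^esub>C\<in>comps T A. proj_to T C \<otimes>\<^bsub>\<Lambda>\<^esub> cut T C f) \<in> carrier \<Lambda>" by (rule \<Lambda>.finsum_closed[OF c])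
  fix x Q R
  have "cf (\<Oplus>\<^bsub>\<Lambda>\<^esub>C\<in>comps T A. proj_to T C \<otimes>\<^bsub>\<Lambda>\<^esub> cut T C f) x Q R =
      (\<Oplus>\<^bsub>K\<^esub>C\<in>comps T A. cf (proj_to T C \<otimes>\<^bsub>\<Lambda>\<^esub> cut T C f) x Q R)"
    by (rule cf_finsum[OF finite_comps[OF T finite_P] c])
  also have "\<dots> = (\<Oplus>\<^bsub>K\<^esub>C\<in>comps T A. if x \<in> C \<and> Q = T then cf f x T R else \<zero>\<^bsub>K\<^esub>)"
  proof (rule finsum_cong'[OF refl])
    fix C assume C: "C \<in> comps T A"
    show "cf (proj_to T C \<otimes>\<^bsub>\<Lambda>\<^esub> cut T C f) x Q R = (if x \<in> C \<and> Q = T then cf f x T R else \<zero>\<^bsub>K\<^esub>)"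
      by (simp add: cf_proj_to_mult[OF T CD[OF C] cut_closed'[OF T A C f]] cf_cut'[OF T A C f])
  qed (use f' in auto)
  also have "\<dots> = cf f x Q R"
  proof (cases "Q = T \<and> x \<in> T - A")
    case True
    let ?C = "component (T - A) x"
    have C: "?C \<in> comps T A" using True by (simp add: comps_def[OF T finite_P])
    have "x \<in> ?C" using True by (intro component_mem) blast
    then have eq: "x \<in> C \<longleftrightarrow> ?C = C" if "C \<in> comps T A" for C using comps_unique[OF T finite_P C that] by blast
    have "(\<Oplus>\<^bsub>K\<^esub>C\<in>comps T A. if x \<in> C \<and> Q = T then cf f x T R else \<zero>\<^bsub>K\<^esub>) =
      (\<Oplus>\<^bsub>K\<^esub>C\<in>comps T A. if ?C = C then cf f x T R else \<zero>\<^bsub>K\<^esub>)"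
      by (rule finsum_cong') (use f' eq True in auto)
    also have "\<dots> = cf f x T R"
      by (rule finsum_singleton[OF C finite_comps[OF T finite_P]]) (use f' in auto)
    finally show ?thesis using True by simp
  next
    case False
    have "(\<Oplus>\<^bsub>K\<^esub>C\<in>comps T A. if x \<in> C \<and> Q = T then cf f x T R else \<zero>\<^bsub>K\<^esub>) = \<zero>\<^bsub>K\<^esub>"
    proof (rule add.finprod_one_eqI)
      fix C assume C: "C \<in> comps T A"
      then have "\<not> (x \<in> C \<and> Q = T)"
        using False CD[OF C] comps_disjoint[OF T finite_P C] by (auto simp: rel_downsets_def)
      then show "(if x \<in> C \<and> Q = T then cf f x T R else \<zero>\<^bsub>K\<^esub>) = \<zero>\<^bsub>K\<^esub>" by (rule if_not_P)
    qed
    also have "cf f x Q R = \<zero>\<^bsub>K\<^esub>"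
    proof (cases "Q = T")
      case True
      then show ?thesis using False f cf_support[OF f', of x T R] by (auto simp: vanishes_def)
    next
      case False
      then show ?thesis using f idem_mult_iff[OF T f'] by (auto simp: vanishes_def)
    qed
    finally show ?thesis by simp
  qed
  finally show "cf f x Q R = cf (\<Oplus>\<^bsub>\<Lambda>\<^esub>C\<in>comps T A. proj_to T C \<otimes>\<^bsub>\<Lambda>\<^esub> cut T C f) x Q R" by simp
qed

text \<open>With \<open>decompose\<close> this shows that the sum over the components is direct,
  with the restrictions as coordinates in \<open>e C \<Lambda>\<close>.\<close>

lemma cut_proj_to:
  assumes T: "T \<in> \<I>" and A: "A \<subseteq> max_elements T" and C: "C \<in> comps T A" "C' \<in> comps T A"
    and b: "b \<in> carrier \<Lambda>"
  shows "cut T C (proj_to T C' \<otimes>\<^bsub>\<Lambda>\<^esub> b) = (if C = C' then e C \<otimes>\<^bsub>\<Lambda>\<^esub> b else \<zero>\<^bsub>\<Lambda>\<^esub>)"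
proof (rule cf_ext)
  note CD = comps_rel_downsets[OF T finite_P A, THEN subsetD]
  have CI: "C \<in> \<I>" using CD[OF C(1)] by (simp add: rel_downsets_def)
  note v = vanishes_proj_to[OF T A C(2) b]
  show "cut T C (proj_to T C' \<otimes>\<^bsub>\<Lambda>\<^esub> b) \<in> carrier \<Lambda>" by (rule cut_closed'[OF T A C(1) v])
  show "(if C = C' then e C \<otimes>\<^bsub>\<Lambda>\<^esub> b else \<zero>\<^bsub>\<Lambda>\<^esub>) \<in> carrier \<Lambda>"
    using \<Lambda>.m_closed[OF e_closed[OF CI] b] by (cases "C = C'") simp_all
  fix x Q R
  have "cf (cut T C (proj_to T C' \<otimes>\<^bsub>\<Lambda>\<^esub> b)) x Q R = (if x \<in> C \<and> Q = C \<and> x \<in> C' then cf b x C' R else \<zero>\<^bsub>K\<^esub>)"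
    using cf_proj_to_mult[OF T CD[OF C(2)] b] by (simp add: cf_cut'[OF T A C(1) v])
  also have "\<dots> = cf (if C = C' then e C \<otimes>\<^bsub>\<Lambda>\<^esub> b else \<zero>\<^bsub>\<Lambda>\<^esub>) x Q R"
  proof (cases "C = C'")
    case True
    have "cf b x C R = \<zero>\<^bsub>K\<^esub>" if "x \<notin> C" by (rule cf_support[OF b]) (use that in simp)
    then show ?thesis unfolding True[symmetric] if_P[OF refl] idem_mult_cf[OF CI b]
      by (cases "x \<in> C"; cases "Q = C") simp_all
  next
    case False
    then have "\<not> (x \<in> C \<and> Q = C \<and> x \<in> C')" using comps_unique[OF T finite_P C, of x] by blast
    then show ?thesis unfolding if_not_P[OF False] cf_zero by (rule if_not_P)
  qed
  finally show "cf (cut T C (proj_to T C' \<otimes>\<^bsub>\<Lambda>\<^esub> b)) x Q R = cf (if C = C' then e C \<otimes>\<^bsub>\<Lambda>\<^esub> b else \<zero>\<^bsub>\<Lambda>\<^esub>) x Q R" .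
qed

text \<open>Entries are constant on the components of \<open>T \<inter> R\<close>, so vanishing at
  \<open>b\<close> means vanishing on everything that \<open>kill\<close> removes. Thus
  \<open>kill T b\<close> projects \<open>e T \<Lambda>\<close> onto the elements that vanish at
  \<open>b\<close>.\<close>

lemma kill_eq_iff:
  assumes T: "T \<in> \<I>" and f: "f \<in> carrier \<Lambda>" "e T \<otimes>\<^bsub>\<Lambda>\<^esub> f = f"
  shows "kill T b f = f \<longleftrightarrow> (\<forall>R. cf f b T R = \<zero>\<^bsub>K\<^esub>)"
proof
  assume "kill T b f = f"
  then show "\<forall>R. cf f b T R = \<zero>\<^bsub>K\<^esub>" using cf_kill[OF T f(1), of b b T] by simp
next
  assume z: "\<forall>R. cf f b T R = \<zero>\<^bsub>K\<^esub>"
  show "kill T b f = f"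
  proof (rule cf_ext[OF kill_closed[OF T f(1)] f(1)])
    fix x Q R
    show "cf (kill T b f) x Q R = cf f x Q R"
    proof (cases "Q = T")
      case True
      then show ?thesis using cf_kill[OF T f(1), of b x Q R] cf_joined[OF f(1), of T R x b] z by simp
    next
      case False
      then have "cf f x Q R = \<zero>\<^bsub>K\<^esub>" using f(2)[unfolded idem_mult_iff[OF T f(1)]] by blast
      then show ?thesis using cf_kill[OF T f(1), of b x Q R] False by simp
    qed
  qed
qed

end

section \<open>Simple modules\<close>

context interval_algebra
begin

sublocale A: fd_algebra K \<Lambda> by (rule fd_algebra_\<Lambda>)

abbreviation Pm where "Pm S \<equiv> left_ideal_of \<Lambda> (e S)"

text \<open>The endomorphisms of the module of \<open>S\<close> are scalars because \<open>S\<close>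
  is connected, and this is the scalar that belongs to \<open>a\<close>; by \<open>cf_top\<close>
  the choice of the point does not matter.\<close>

definition top_coeff :: "'p set \<Rightarrow> ('p \<Rightarrow> ('p set \<Rightarrow> 'k) \<Rightarrow> ('p set \<Rightarrow> 'k)) \<Rightarrow> 'k" where
  "top_coeff S a = cf a (SOME x. x \<in> S) S S"

definition J :: "'p set \<Rightarrow> ('p \<Rightarrow> ('p set \<Rightarrow> 'k) \<Rightarrow> ('p set \<Rightarrow> 'k)) set" where
  "J S = {a \<in> carrier (Pm S). top_coeff S a = \<zero>\<^bsub>K\<^esub>}"

text \<open>The identity of an interval module does not factor through another interval module.\<close>

lemma factor_identity:
  assumes a: "a \<in> carrier \<Lambda>" and b: "b \<in> carrier \<Lambda>" and S: "S \<in> \<I>" and W: "W \<in> \<I>"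
    and nz: "cf b x S W \<noteq> \<zero>\<^bsub>K\<^esub>" "cf a x W S \<noteq> \<zero>\<^bsub>K\<^esub>"
  shows "W = S"
proof -
  let ?Z = "{y. cf b y S W \<noteq> \<zero>\<^bsub>K\<^esub> \<and> cf a y W S \<noteq> \<zero>\<^bsub>K\<^esub>}"
  have x: "x \<in> S" "x \<in> W" using cf_support[OF b] nz(1) by blast+
  have conn: "connected_poset S" "connected_poset W" using S W by (auto simp: intervals_def)
  \<comment> \<open>A move upwards uses that supports are closed upwards in the target, first for
    \<open>a\<close> and then for \<open>b\<close>; a move downwards uses closure in the source,
    first for \<open>b\<close> and then for \<open>a\<close>. In the second half, where the moves
    stay in \<open>W\<close>, the roles are exchanged.\<close>
  have "S \<subseteq> ?Z"
  proof (rule connected_closed[OF conn(1) x(1)])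
    fix y y' assume y: "y \<in> ?Z" "y' \<in> S" "y \<le> y' \<or> y' \<le> y"
    then have by': "cf b y S W \<noteq> \<zero>\<^bsub>K\<^esub>" and ay': "cf a y W S \<noteq> \<zero>\<^bsub>K\<^esub>" by auto
    from y(3) show "y' \<in> ?Z"
    proof
      assume le: "y \<le> y'"
      note u = cf_up[OF a ay' le y(2)]
      show ?thesis using u(2) cf_up(2)[OF b by' le u(1)] ay' by' by simp
    next
      assume le: "y' \<le> y"
      note d = cf_down[OF b by' le y(2)]
      show ?thesis using d(2) cf_down(2)[OF a ay' le d(1)] ay' by' by simp
    qed
  qed (use nz in simp)
  then have 1: "S \<subseteq> W" using cf_support[OF b] by blast
  have "W \<subseteq> ?Z"
  proof (rule connected_closed[OF conn(2) x(2)])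
    fix y y' assume y: "y \<in> ?Z" "y' \<in> W" "y \<le> y' \<or> y' \<le> y"
    then have by': "cf b y S W \<noteq> \<zero>\<^bsub>K\<^esub>" and ay': "cf a y W S \<noteq> \<zero>\<^bsub>K\<^esub>" by auto
    from y(3) show "y' \<in> ?Z"
    proof
      assume le: "y \<le> y'"
      note u = cf_up[OF b by' le y(2)]
      show ?thesis using u(2) cf_up(2)[OF a ay' le u(1)] ay' by' by simp
    next
      assume le: "y' \<le> y"
      note d = cf_down[OF a ay' le y(2)]
      show ?thesis using d(2) cf_down(2)[OF b by' le d(1)] ay' by' by simp
    qed
  qed (use nz in simp)
  then have "W \<subseteq> S" using cf_support[OF b] by blast
  then show ?thesis using 1 by blast
qed

lemma interval_nonempty: "S \<in> \<I> \<Longrightarrow> (SOME x. x \<in> S) \<in> S"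
  by (rule someI_ex) (auto simp: intervals_def)

lemma cf_top:
  assumes S: "S \<in> \<I>" and a: "a \<in> carrier \<Lambda>" and x: "x \<in> S"
  shows "cf a x S S = top_coeff S a"
  unfolding top_coeff_def
proof (rule cf_joined[OF a])
  show "joined (S \<inter> S) x (SOME x. x \<in> S)"
    using S x interval_nonempty[OF S] by (simp add: intervals_def connected_poset_iff)
qed

lemma top_coeff_closed [simp]: "a \<in> carrier \<Lambda> \<Longrightarrow> top_coeff S a \<in> carrier K"
  by (simp add: top_coeff_def)

lemma top_coeff_add: "\<lbrakk>a \<in> carrier \<Lambda>; b \<in> carrier \<Lambda>\<rbrakk> \<Longrightarrow> top_coeff S (a \<oplus>\<^bsub>\<Lambda>\<^esub> b) = top_coeff S a \<oplus>\<^bsub>K\<^esub> top_coeff S b"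
  by (simp add: top_coeff_def cf_add)

lemma top_coeff_smult: "\<lbrakk>c \<in> carrier K; a \<in> carrier \<Lambda>\<rbrakk> \<Longrightarrow> top_coeff S (c \<odot>\<^bsub>\<Lambda>\<^esub> a) = c \<otimes>\<^bsub>K\<^esub> top_coeff S a"
  by (simp add: top_coeff_def cf_smult)

lemma top_coeff_idem: "\<lbrakk>S \<in> \<I>; C \<in> \<I>\<rbrakk> \<Longrightarrow> top_coeff S (e C) = (if C = S then \<one>\<^bsub>K\<^esub> else \<zero>\<^bsub>K\<^esub>)"
  using interval_nonempty by (auto simp: top_coeff_def cf_e)

text \<open>A path through an interval other than \<open>S\<close> contributes nothing by
  \<open>factor_identity\<close>, so only the product of the two diagonal entries remains.\<close>

lemma top_coeff_mult:
  assumes S: "S \<in> \<I>" and a: "a \<in> carrier \<Lambda>" and b: "b \<in> carrier \<Lambda>"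
  shows "top_coeff S (b \<otimes>\<^bsub>\<Lambda>\<^esub> a) = top_coeff S b \<otimes>\<^bsub>K\<^esub> top_coeff S a"
  unfolding top_coeff_def
  by (rule cf_mult_single[OF b a S]) (use factor_identity[OF a b S] in blast)

text \<open>The corner \<open>e S \<Lambda> e S\<close> consists of scalars, since \<open>S\<close>
  is connected.\<close>

lemma idem_mult_eq_top:
  assumes S: "S \<in> \<I>" and a: "a \<in> carrier \<Lambda>" "a \<otimes>\<^bsub>\<Lambda>\<^esub> e S = a"
  shows "e S \<otimes>\<^bsub>\<Lambda>\<^esub> a = top_coeff S a \<odot>\<^bsub>\<Lambda>\<^esub> e S"
proof (rule cf_ext)
  fix x Q R
  have "cf a x Q R = \<zero>\<^bsub>K\<^esub>" if "R \<noteq> S" for x Q R using a mult_idem_iff[OF S a(1)] that by blast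
  moreover have "cf a x S R = \<zero>\<^bsub>K\<^esub>" if "x \<notin> S" by (rule cf_support[OF a(1)]) (use that in simp)
  ultimately show "cf (e S \<otimes>\<^bsub>\<Lambda>\<^esub> a) x Q R = cf (top_coeff S a \<odot>\<^bsub>\<Lambda>\<^esub> e S) x Q R"
    using S a(1) cf_top[OF S a(1), of x] by (auto simp: idem_mult_cf cf_smult cf_e)
qed (use S a in auto)

section \<open>Projective modules, their radicals and simple tops\<close>

lemma Pm_simps [simp]: "zero (Pm S) = \<zero>\<^bsub>\<Lambda>\<^esub>" "add (Pm S) = add \<Lambda>" "smult (Pm S) = monoid.mult \<Lambda>"
  by (simp_all add: left_ideal_of_def)

lemma Pm_mem: "S \<in> \<I> \<Longrightarrow> a \<in> carrier (Pm S) \<longleftrightarrow> a \<in> carrier \<Lambda> \<and> a \<otimes>\<^bsub>\<Lambda>\<^esub> e S = a"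
  by (auto simp: left_ideal_of_def \<Lambda>.m_assoc intro: rev_image_eqI)

lemma lmodule_Pm:
  assumes S: "S \<in> \<I>"
  shows "lmodule \<Lambda> (Pm S)"
proof -
  interpret r: lmodule \<Lambda> "regular \<Lambda>" by (rule lmodule_regular) (rule \<Lambda>.ring_axioms)
  have "submodule (carrier (Pm S)) \<Lambda> (regular \<Lambda>)"
    unfolding r.submodule_iff using S by (auto simp: Pm_mem \<Lambda>.l_distr \<Lambda>.m_assoc)
  moreover have "Pm S = regular \<Lambda>\<lparr>carrier := carrier (Pm S)\<rparr>" by (simp add: left_ideal_of_def)
  ultimately show ?thesis using r.lmodule_restrict by metis
qed

lemma J_submodule:
  assumes S: "S \<in> \<I>"
  shows "submodule (J S) \<Lambda> (Pm S)"
proof -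
  interpret p: lmodule \<Lambda> "Pm S" by (rule lmodule_Pm[OF S])
  have "top_coeff S \<zero>\<^bsub>\<Lambda>\<^esub> = \<zero>\<^bsub>K\<^esub>" by (simp add: top_coeff_def)
  then show ?thesis
    unfolding p.submodule_iff
    using S by (auto simp: J_def Pm_mem top_coeff_add top_coeff_mult \<Lambda>.l_distr \<Lambda>.m_assoc)
qed

lemma e_Pm: "S \<in> \<I> \<Longrightarrow> e S \<in> carrier (Pm S)"
  by (simp add: Pm_mem)

lemma e_not_J: "S \<in> \<I> \<Longrightarrow> e S \<notin> J S"
  by (simp add: J_def top_coeff_idem)

text \<open>An element outside \<open>J S\<close> can be rescaled and multiplied by
  \<open>e S\<close> to give \<open>e S\<close> itself, which generates everything. So
  \<open>J S\<close> is the only maximal submodule.\<close>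

lemma proper_submodule_J:
  assumes S: "S \<in> \<I>" and N: "submodule N \<Lambda> (Pm S)" "N \<noteq> carrier (Pm S)"
  shows "N \<subseteq> J S"
proof
  interpret p: lmodule \<Lambda> "Pm S" by (rule lmodule_Pm[OF S])
  fix a assume aN: "a \<in> N"
  have aP: "a \<in> carrier (Pm S)" using p.submoduleD(1)[OF N(1)] aN by blast
  then have a: "a \<in> carrier \<Lambda>" "a \<otimes>\<^bsub>\<Lambda>\<^esub> e S = a" using Pm_mem[OF S] by auto
  show "a \<in> J S"
  proof (rule ccontr)
    assume "a \<notin> J S"
    then have "top_coeff S a \<noteq> \<zero>\<^bsub>K\<^esub>" using aP by (simp add: J_def)
    then obtain c where c: "c \<in> carrier K" "c \<otimes>\<^bsub>K\<^esub> top_coeff S a = \<one>\<^bsub>K\<^esub>"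
      using inverse_exists[of "top_coeff S a"] a(1) by auto
    have "(c \<odot>\<^bsub>\<Lambda>\<^esub> e S) \<odot>\<^bsub>Pm S\<^esub> a \<in> N"
      by (rule p.submoduleD(4)[OF N(1) _ aN]) (use c S in simp)
    also have "(c \<odot>\<^bsub>\<Lambda>\<^esub> e S) \<odot>\<^bsub>Pm S\<^esub> a = e S"
      using c S a by (simp add: A.smult_mult_left idem_mult_eq_top[OF S a] flip: K\<Lambda>.smult_assoc)
    finally have eN: "e S \<in> N" .
    have "b \<in> N" if "b \<in> carrier (Pm S)" for b
      using p.submoduleD(4)[OF N(1) _ eN, of b] that Pm_mem[OF S] by simp
    then show False using N(2) p.submoduleD(1)[OF N(1)] by blast
  qed
qed

lemma mod_radical_Pm:
  assumes S: "S \<in> \<I>"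
  shows "mod_radical \<Lambda> (Pm S) = J S"
proof -
  have Jc: "J S \<subseteq> carrier (Pm S)" "J S \<noteq> carrier (Pm S)" using e_Pm[OF S] e_not_J[OF S] by (auto simp: J_def)
  have "maximal_submodule \<Lambda> (Pm S) N \<longleftrightarrow> N = J S" for N
    unfolding maximal_submodule_def
    using proper_submodule_J[OF S] J_submodule[OF S] Jc by blast
  then have "{N. maximal_submodule \<Lambda> (Pm S) N} = {J S}" by blast
  then show ?thesis using Jc(1) by (simp add: mod_radical_def Int_absorb1)
qed

lemma simple_L_eq: "S \<in> \<I> \<Longrightarrow> simple_L K P S = quot_module (Pm S) (J S)"
  by (simp add: simple_L_def mod_top_def mod_radical_Pm)

lemma lquotient_J: "S \<in> \<I> \<Longrightarrow> lquotient \<Lambda> (Pm S) (J S)"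
  by (intro lquotientI lmodule_Pm J_submodule)

lemma lmodule_simple_L: "S \<in> \<I> \<Longrightarrow> lmodule \<Lambda> (simple_L K P S)"
  using lquotient.lmodule_quot[OF lquotient_J] by (simp add: simple_L_eq)

text \<open>Multiplication by \<open>e C\<close> makes the coefficient at \<open>S\<close> zero, so
  the product lies in the radical.\<close>

lemma idem_simple_L:
  assumes S: "S \<in> \<I>" and C: "C \<in> \<I>" "C \<noteq> S" and w: "w \<in> carrier (simple_L K P S)"
  shows "e C \<odot>\<^bsub>simple_L K P S\<^esub> w = \<zero>\<^bsub>simple_L K P S\<^esub>"
proof -
  interpret q: lquotient \<Lambda> "Pm S" "J S" by (rule lquotient_J[OF S])
  obtain a where a: "a \<in> carrier (Pm S)" "w = J S +>\<^bsub>Pm S\<^esub> a"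
    using w q.carrier_quot by (auto simp: simple_L_eq[OF S])
  have a': "a \<in> carrier \<Lambda>" using a(1) Pm_mem[OF S] by simp
  have "e C \<otimes>\<^bsub>\<Lambda>\<^esub> a \<in> J S"
    using a(1) C S a' by (simp add: J_def top_coeff_mult top_coeff_idem Pm_mem \<Lambda>.m_assoc)
  then have "J S +>\<^bsub>Pm S\<^esub> (e C \<otimes>\<^bsub>\<Lambda>\<^esub> a) = J S" using q.coset_eq_zero_iff q.N_subset by blast
  then show ?thesis
    using q.coset_smult[OF e_closed[OF C(1)] a(1)] by (simp add: simple_L_eq[OF S] a(2))
qed

text \<open>The generator is the class of \<open>e S\<close>. Together with
  \<open>idem_simple_L\<close> this is all that the computation uses about the simple module:
  \<open>e S\<close> cuts out a line, and the other idempotents act as zero.\<close>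

lemma simple_L_generator:
  assumes S: "S \<in> \<I>"
  obtains u where "u \<in> carrier (simple_L K P S)" "e S \<odot>\<^bsub>simple_L K P S\<^esub> u = u"
    "\<And>w. \<lbrakk>w \<in> carrier (simple_L K P S); e S \<odot>\<^bsub>simple_L K P S\<^esub> w = w\<rbrakk> \<Longrightarrow>
      \<exists>c\<in>carrier K. w = A.scal c \<odot>\<^bsub>simple_L K P S\<^esub> u"
    "\<And>c. \<lbrakk>c \<in> carrier K; A.scal c \<odot>\<^bsub>simple_L K P S\<^esub> u = \<zero>\<^bsub>simple_L K P S\<^esub>\<rbrakk> \<Longrightarrow> c = \<zero>\<^bsub>K\<^esub>"
    "gen_submodule \<Lambda> (simple_L K P S) {u} = carrier (simple_L K P S)"
proof -
  interpret q: lquotient \<Lambda> "Pm S" "J S" by (rule lquotient_J[OF S])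
  interpret L: lmodule \<Lambda> "quot_module (Pm S) (J S)" by (rule q.lmodule_quot)
  note eq = simple_L_eq[OF S]
  let ?u = "J S +>\<^bsub>Pm S\<^esub> e S"
  have mult_u: "a \<odot>\<^bsub>quot_module (Pm S) (J S)\<^esub> ?u = J S +>\<^bsub>Pm S\<^esub> (a \<otimes>\<^bsub>\<Lambda>\<^esub> e S)" if "a \<in> carrier \<Lambda>" for a
    using q.coset_smult[OF that e_Pm[OF S]] by simp
  have u: "?u \<in> carrier (quot_module (Pm S) (J S))" using e_Pm[OF S] by simp
  show thesis
  proof (rule that[of ?u, unfolded eq])
    show "?u \<in> carrier (quot_module (Pm S) (J S))" by (rule u)
    show "e S \<odot>\<^bsub>quot_module (Pm S) (J S)\<^esub> ?u = ?u" using mult_u S by simp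
  next
    fix w assume w: "w \<in> carrier (quot_module (Pm S) (J S))" "e S \<odot>\<^bsub>quot_module (Pm S) (J S)\<^esub> w = w"
    obtain a where a: "a \<in> carrier (Pm S)" "w = J S +>\<^bsub>Pm S\<^esub> a" using w(1) q.carrier_quot by auto
    have a': "a \<in> carrier \<Lambda>" "a \<otimes>\<^bsub>\<Lambda>\<^esub> e S = a" using a(1) Pm_mem[OF S] by auto
    have "w = J S +>\<^bsub>Pm S\<^esub> (e S \<otimes>\<^bsub>\<Lambda>\<^esub> a)" using w(2) q.coset_smult[OF e_closed[OF S] a(1)] a(2) by simp
    also have "e S \<otimes>\<^bsub>\<Lambda>\<^esub> a = (top_coeff S a \<odot>\<^bsub>\<Lambda>\<^esub> \<one>\<^bsub>\<Lambda>\<^esub>) \<otimes>\<^bsub>\<Lambda>\<^esub> e S"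
      using idem_mult_eq_top[OF S a'] a'(1) S by (simp add: A.scal_mult)
    finally have "w = (top_coeff S a \<odot>\<^bsub>\<Lambda>\<^esub> \<one>\<^bsub>\<Lambda>\<^esub>) \<odot>\<^bsub>quot_module (Pm S) (J S)\<^esub> ?u"
      using mult_u a'(1) by simp
    then show "\<exists>c\<in>carrier K. w = A.scal c \<odot>\<^bsub>quot_module (Pm S) (J S)\<^esub> ?u"
      using a'(1) top_coeff_closed by blast
  next
    fix c assume c: "c \<in> carrier K"
      "A.scal c \<odot>\<^bsub>quot_module (Pm S) (J S)\<^esub> ?u = \<zero>\<^bsub>quot_module (Pm S) (J S)\<^esub>"
    have cS: "c \<odot>\<^bsub>\<Lambda>\<^esub> e S \<in> carrier (Pm S)" using c(1) S by (simp add: Pm_mem A.smult_mult_left)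
    have "J S +>\<^bsub>Pm S\<^esub> (c \<odot>\<^bsub>\<Lambda>\<^esub> e S) = J S" using c mult_u[of "c \<odot>\<^bsub>\<Lambda>\<^esub> \<one>\<^bsub>\<Lambda>\<^esub>"] S by (simp add: A.scal_mult)
    then have "c \<odot>\<^bsub>\<Lambda>\<^esub> e S \<in> J S" using q.coset_eq_zero_iff[OF cS] by simp
    then have "top_coeff S (c \<odot>\<^bsub>\<Lambda>\<^esub> e S) = \<zero>\<^bsub>K\<^esub>" unfolding J_def by (rule CollectE) (rule conjunct2)
    then show "c = \<zero>\<^bsub>K\<^esub>"
      using c(1) top_coeff_idem[OF S S] top_coeff_smult[OF c(1) e_closed[OF S]] by simp
  next
    show "gen_submodule \<Lambda> (quot_module (Pm S) (J S)) {?u} = carrier (quot_module (Pm S) (J S))"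
    proof
      have s: "submodule (gen_submodule \<Lambda> (quot_module (Pm S) (J S)) {?u}) \<Lambda> (quot_module (Pm S) (J S))"
        using u by (intro L.submodule_gen) simp
      show "gen_submodule \<Lambda> (quot_module (Pm S) (J S)) {?u} \<subseteq> carrier (quot_module (Pm S) (J S))"
        by (rule L.submoduleD(1)[OF s])
      show "carrier (quot_module (Pm S) (J S)) \<subseteq> gen_submodule \<Lambda> (quot_module (Pm S) (J S)) {?u}"
      proof
        fix w assume "w \<in> carrier (quot_module (Pm S) (J S))"
        then obtain a where a: "a \<in> carrier (Pm S)" "w = J S +>\<^bsub>Pm S\<^esub> a" using q.carrier_quot by auto
        have a': "a \<in> carrier \<Lambda>" "a \<otimes>\<^bsub>\<Lambda>\<^esub> e S = a" using a(1) Pm_mem[OF S] by auto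
        have ug: "?u \<in> gen_submodule \<Lambda> (quot_module (Pm S) (J S)) {?u}"
          by (rule subsetD[OF gen_submodule_superset]) simp
        show "w \<in> gen_submodule \<Lambda> (quot_module (Pm S) (J S)) {?u}"
          using L.submoduleD(4)[OF s a'(1) ug] mult_u[OF a'(1)] a'(2) a(2) by simp
      qed
    qed
  qed
qed

text \<open>\<open>a \<mapsto> a \<odot> u\<close> maps the projective module of \<open>R\<close>
  onto \<open>X\<close>. Its kernel is a proper submodule, hence inside \<open>J R\<close>; it
  remains to see that it is all of \<open>J R\<close>.\<close>

lemma simple_module_iso:
  assumes R: "R \<in> \<I>" and X: "lmodule \<Lambda> X" "simple_module \<Lambda> X" and u: "u \<in> carrier X" "e R \<odot>\<^bsub>X\<^esub> u \<noteq> \<zero>\<^bsub>X\<^esub>"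
  shows "X \<simeq>\<^bsub>\<Lambda>\<^esub> simple_L K P R"
proof -
  interpret X: lmodule \<Lambda> X by fact
  interpret q: lquotient \<Lambda> "Pm R" "J R" by (rule lquotient_J[OF R])
  let ?f = "\<lambda>a. a \<odot>\<^bsub>X\<^esub> u"
  have mem: "a \<in> carrier \<Lambda>" "a \<otimes>\<^bsub>\<Lambda>\<^esub> e R = a" if "a \<in> carrier (Pm R)" for a using that Pm_mem[OF R] by auto
  interpret f: lmodule_hom \<Lambda> "Pm R" X ?f
    by (intro lmodule_hom.intro lmodule_hom_axioms.intro lmodule_Pm R X.lmodule_axioms)
      (use u mem in \<open>auto simp: X.smult_l_distr X.smult_assoc\<close>)
  have simple: "N = {\<zero>\<^bsub>X\<^esub>} \<or> N = carrier X" if "submodule N \<Lambda> X" for N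
    using X(2) that unfolding simple_module_def by blast
  have "?f (e R) \<in> ?f ` carrier (Pm R)" by (rule imageI[OF e_Pm[OF R]])
  then have "?f ` carrier (Pm R) \<noteq> {\<zero>\<^bsub>X\<^esub>}" using u(2) by auto
  then have surj: "?f ` carrier (Pm R) = carrier X"
    using simple[OF f.image_submodule[OF q.carrier_submodule]] by blast
  have Z: "submodule {x \<in> carrier (Pm R). ?f x = \<zero>\<^bsub>X\<^esub>} \<Lambda> (Pm R)" by (rule f.kernel_submodule)
  have ZJ: "{x \<in> carrier (Pm R). ?f x = \<zero>\<^bsub>X\<^esub>} \<subseteq> J R"
    by (rule proper_submodule_J[OF R Z]) (use u(2) e_Pm[OF R] in blast)
  \<comment> \<open>Otherwise \<open>J R\<close> would also map onto \<open>X\<close>, so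
    \<open>e R\<close> would differ from an element of \<open>J R\<close> by an element of the
    kernel, which is contained in \<open>J R\<close>; but \<open>e R \<notin> J R\<close>.\<close>
  have J0: "?f ` J R = {\<zero>\<^bsub>X\<^esub>}"
  proof (rule ccontr)
    assume "?f ` J R \<noteq> {\<zero>\<^bsub>X\<^esub>}"
    then have "?f ` J R = carrier X" using simple[OF f.image_submodule[OF J_submodule[OF R]]] by argo
    then have "?f (e R) \<in> ?f ` J R" using f.closed[OF e_Pm[OF R]] by (simp only:)
    then obtain j where j: "j \<in> J R" "?f (e R) = ?f j" by (rule imageE)
    have jP: "j \<in> carrier (Pm R)" using j(1) by (rule subsetD[OF q.N_subset])
    have "?f (e R \<ominus>\<^bsub>Pm R\<^esub> j) = \<zero>\<^bsub>X\<^esub>"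
      unfolding f.minus[OF e_Pm[OF R] jP] j(2) by (rule X.M.minus_self[OF f.closed[OF jP]])
    then have "e R \<ominus>\<^bsub>Pm R\<^esub> j \<in> J R" using q.M.minus_closed[OF e_Pm[OF R] jP] by (intro subsetD[OF ZJ] CollectI conjI)
    then have "(e R \<ominus>\<^bsub>Pm R\<^esub> j) \<oplus>\<^bsub>Pm R\<^esub> j \<in> J R" using j(1) by (rule q.submoduleD(3)[OF J_submodule[OF R]])
    then show False using q.M.minus_add_cancel[OF e_Pm[OF R] jP] e_not_J[OF R] by simp
  qed
  have ker: "?f x = \<zero>\<^bsub>X\<^esub> \<longleftrightarrow> x \<in> J R" if "x \<in> carrier (Pm R)" for x
  proof
    show "?f x = \<zero>\<^bsub>X\<^esub> \<Longrightarrow> x \<in> J R" using that by (intro subsetD[OF ZJ]) simp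
    show "x \<in> J R \<Longrightarrow> ?f x = \<zero>\<^bsub>X\<^esub>" using imageI[of x "J R" ?f] unfolding J0 by simp
  qed
  have "quot_module (Pm R) (J R) \<simeq>\<^bsub>\<Lambda>\<^esub> X"
    by (rule q.quot_iso[OF f.lmodule_hom_axioms surj ker])
  then show ?thesis using mod_iso_sym[OF q.lmodule_quot] by (simp add: simple_L_eq[OF R])
qed

text \<open>The idempotents \<open>e R\<close> sum to the identity.\<close>

lemma nonzero_idem:
  assumes X: "lmodule \<Lambda> X" and c: "c \<in> carrier X" "c \<noteq> \<zero>\<^bsub>X\<^esub>"
  obtains R where "R \<in> \<I>" "e R \<odot>\<^bsub>X\<^esub> c \<noteq> \<zero>\<^bsub>X\<^esub>"
proof -
  interpret X: lmodule \<Lambda> X by fact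
  have "\<exists>R\<in>\<I>. e R \<odot>\<^bsub>X\<^esub> c \<noteq> \<zero>\<^bsub>X\<^esub>"
  proof (rule ccontr)
    assume *: "\<not> ?thesis"
    have "c = (\<Oplus>\<^bsub>\<Lambda>\<^esub>R\<in>\<I>. e R) \<odot>\<^bsub>X\<^esub> c" using c(1) by (simp add: sum_idem)
    also have "\<dots> = (\<Oplus>\<^bsub>X\<^esub>R\<in>\<I>. e R \<odot>\<^bsub>X\<^esub> c)" using c(1) finite_\<I> by (intro X.finsum_smult_left) auto
    also have "\<dots> = \<zero>\<^bsub>X\<^esub>" using * by (intro X.M.add.finprod_one_eqI) blast
    finally show False using c(2) by simp
  qed
  then show thesis using that by blast
qed

end

section \<open>Costandard modules\<close>

lemma dual_right_ideal_simps:
  fixes A :: "('k, 'a) module"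
  shows "carrier (dual_right_ideal K A e) =
      lin_hom K (A\<lparr>carrier := (\<lambda>a. e \<otimes>\<^bsub>A\<^esub> a) ` carrier A\<rparr>) (regular K)"
    "zero (dual_right_ideal K A e) = (\<lambda>x\<in>(\<lambda>a. e \<otimes>\<^bsub>A\<^esub> a) ` carrier A. \<zero>\<^bsub>K\<^esub>)"
    "f \<oplus>\<^bsub>dual_right_ideal K A e\<^esub> g = (\<lambda>x\<in>(\<lambda>a. e \<otimes>\<^bsub>A\<^esub> a) ` carrier A. f x \<oplus>\<^bsub>K\<^esub> g x)"
    "a \<odot>\<^bsub>dual_right_ideal K A e\<^esub> f = (\<lambda>x\<in>(\<lambda>a. e \<otimes>\<^bsub>A\<^esub> a) ` carrier A. f (x \<otimes>\<^bsub>A\<^esub> a))"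
  by (simp_all add: dual_right_ideal_def Let_def)

context fd_algebra
begin

context
  fixes e assumes e: "e \<in> carrier A"
begin

definition E where "E = (\<lambda>a. e \<otimes>\<^bsub>A\<^esub> a) ` carrier A"

lemmas dual_simps = dual_right_ideal_simps[of K A e, folded E_def]

lemma E_closed: "x \<in> E \<Longrightarrow> x \<in> carrier A"
  using e by (auto simp: E_def)

lemma E_mult: "\<lbrakk>x \<in> E; a \<in> carrier A\<rbrakk> \<Longrightarrow> x \<otimes>\<^bsub>A\<^esub> a \<in> E"
  using e by (auto simp: E_def A.m_assoc)

lemma e_mult_E: "a \<in> carrier A \<Longrightarrow> e \<otimes>\<^bsub>A\<^esub> a \<in> E"
  by (simp add: E_def)

lemma E_submodule: "submodule E K A"
  unfolding submodule_iff
proof (intro conjI ballI)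
  show "E \<subseteq> carrier A" using E_closed by blast
  show "\<zero>\<^bsub>A\<^esub> \<in> E" using e_mult_E[of "\<zero>\<^bsub>A\<^esub>"] e by simp
  show "x \<oplus>\<^bsub>A\<^esub> y \<in> E" if xy: "x \<in> E" "y \<in> E" for x y
  proof -
    obtain a b where "x = e \<otimes>\<^bsub>A\<^esub> a" "y = e \<otimes>\<^bsub>A\<^esub> b" "a \<in> carrier A" "b \<in> carrier A"
      using xy unfolding E_def by blast
    then show ?thesis using e_mult_E[of "a \<oplus>\<^bsub>A\<^esub> b"] e by (simp add: A.r_distr)
  qed
  show "c \<odot>\<^bsub>A\<^esub> x \<in> E" if c: "c \<in> carrier K" "x \<in> E" for c x
  proof -
    obtain a where "x = e \<otimes>\<^bsub>A\<^esub> a" "a \<in> carrier A" using c unfolding E_def by blast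
    then show ?thesis using e_mult_E[of "c \<odot>\<^bsub>A\<^esub> a"] e c by (simp add: smult_mult_right)
  qed
qed

lemma dualD:
  assumes "f \<in> carrier (dual_right_ideal K A e)"
  shows "f \<in> extensional E" "x \<in> E \<Longrightarrow> f x \<in> carrier K"
    "\<lbrakk>x \<in> E; y \<in> E\<rbrakk> \<Longrightarrow> f (x \<oplus>\<^bsub>A\<^esub> y) = f x \<oplus>\<^bsub>K\<^esub> f y"
    "\<lbrakk>c \<in> carrier K; x \<in> E\<rbrakk> \<Longrightarrow> f (c \<odot>\<^bsub>A\<^esub> x) = c \<otimes>\<^bsub>K\<^esub> f x"
  using lin_homD[OF assms[unfolded dual_simps]] by simp_all

lemma dualI:
  assumes "\<And>x. x \<in> E \<Longrightarrow> f x \<in> carrier K" "f \<in> extensional E"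
    "\<And>x y. \<lbrakk>x \<in> E; y \<in> E\<rbrakk> \<Longrightarrow> f (x \<oplus>\<^bsub>A\<^esub> y) = f x \<oplus>\<^bsub>K\<^esub> f y"
    "\<And>c x. \<lbrakk>c \<in> carrier K; x \<in> E\<rbrakk> \<Longrightarrow> f (c \<odot>\<^bsub>A\<^esub> x) = c \<otimes>\<^bsub>K\<^esub> f x"
  shows "f \<in> carrier (dual_right_ideal K A e)"
  unfolding dual_simps by (rule lin_homI) (use assms in simp_all)

lemma lmodule_dual: "lmodule A (dual_right_ideal K A e)"
proof -
  let ?D = "dual_right_ideal K A e"
  note E = submoduleD[OF E_submodule]
  show ?thesis
  proof (rule lmoduleI)
    fix f g assume f: "f \<in> carrier ?D" and g: "g \<in> carrier ?D"
    show "f \<oplus>\<^bsub>?D\<^esub> g \<in> carrier ?D"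
      by (rule dualI)
        (use E dualD[OF f] dualD[OF g] in \<open>simp_all add: dual_simps(2-) R.a_ac R.r_distr\<close>)
    show "f \<oplus>\<^bsub>?D\<^esub> g = g \<oplus>\<^bsub>?D\<^esub> f"
      unfolding dual_simps(3) by (rule restrict_ext) (use dualD[OF f] dualD[OF g] in \<open>simp add: R.a_comm\<close>)
  next
    fix f g h assume f: "f \<in> carrier ?D" and g: "g \<in> carrier ?D" and h: "h \<in> carrier ?D"
    show "(f \<oplus>\<^bsub>?D\<^esub> g) \<oplus>\<^bsub>?D\<^esub> h = f \<oplus>\<^bsub>?D\<^esub> (g \<oplus>\<^bsub>?D\<^esub> h)"
      unfolding dual_simps(3) by (rule restrict_ext) (use dualD[OF f] dualD[OF g] dualD[OF h] in \<open>simp add: R.a_assoc\<close>)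
  next
    show "\<zero>\<^bsub>?D\<^esub> \<in> carrier ?D" by (rule dualI) (use E in \<open>simp_all add: dual_simps(2-)\<close>)
    fix f assume f: "f \<in> carrier ?D"
    note fD = dualD[OF f]
    show "\<zero>\<^bsub>?D\<^esub> \<oplus>\<^bsub>?D\<^esub> f = f" by (rule extensionalityI[where A = E]) (use fD in \<open>simp_all add: dual_simps(2-)\<close>)
    show "\<one>\<^bsub>A\<^esub> \<odot>\<^bsub>?D\<^esub> f = f" by (rule extensionalityI[where A = E]) (use fD E_closed in \<open>simp_all add: dual_simps(2-)\<close>)
    have "f \<zero>\<^bsub>A\<^esub> = \<zero>\<^bsub>K\<^esub>" using fD(4)[of "\<zero>\<^bsub>K\<^esub>" "\<zero>\<^bsub>A\<^esub>"] fD(2) E(2) by simp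
    then show "\<zero>\<^bsub>A\<^esub> \<odot>\<^bsub>?D\<^esub> f = \<zero>\<^bsub>?D\<^esub>"
      unfolding dual_simps(2-) by (intro restrict_ext) (use E_closed in simp)
    fix a assume a: "a \<in> carrier A"
    show "a \<odot>\<^bsub>?D\<^esub> f \<in> carrier ?D"
      by (rule dualI)
        (use E fD E_mult a E_closed in \<open>simp_all add: dual_simps(2-) A.l_distr smult_mult_left\<close>)
    fix b assume b: "b \<in> carrier A"
    show "(a \<oplus>\<^bsub>A\<^esub> b) \<odot>\<^bsub>?D\<^esub> f = a \<odot>\<^bsub>?D\<^esub> f \<oplus>\<^bsub>?D\<^esub> b \<odot>\<^bsub>?D\<^esub> f"
      unfolding dual_simps(2-) by (rule restrict_ext) (use fD E_mult a b E_closed in \<open>simp add: A.r_distr\<close>)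
    show "(a \<otimes>\<^bsub>A\<^esub> b) \<odot>\<^bsub>?D\<^esub> f = a \<odot>\<^bsub>?D\<^esub> (b \<odot>\<^bsub>?D\<^esub> f)"
      unfolding dual_simps(2-) by (rule restrict_ext) (use fD E_mult a b E_closed in \<open>simp add: A.m_assoc\<close>)
  next
    fix a f g assume a: "a \<in> carrier A" and f: "f \<in> carrier ?D" and g: "g \<in> carrier ?D"
    show "a \<odot>\<^bsub>?D\<^esub> (f \<oplus>\<^bsub>?D\<^esub> g) = a \<odot>\<^bsub>?D\<^esub> f \<oplus>\<^bsub>?D\<^esub> a \<odot>\<^bsub>?D\<^esub> g"
      unfolding dual_simps(2-) by (rule restrict_ext) (use dualD[OF f] dualD[OF g] E_mult a in simp)
  qed (rule A.ring_axioms)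
qed

lemma scal_dual:
  assumes "c \<in> carrier K" "f \<in> carrier (dual_right_ideal K A e)" "x \<in> E"
  shows "(scal c \<odot>\<^bsub>dual_right_ideal K A e\<^esub> f) x = c \<otimes>\<^bsub>K\<^esub> f x"
  using assms dualD(4)[OF assms(2)] E_closed by (simp add: dual_simps(4) mult_scal)

text \<open>Evaluations at finitely many generators of the right ideal separate the
  functionals.\<close>

lemma fin_dim_dual: "fin_dim K (res_module A (dual_right_ideal K A e))"
proof -
  let ?D = "dual_right_ideal K A e"
  obtain ws where ws: "set ws \<subseteq> E" "gen_submodule K A (set ws) = E"
    using fin_dim_finitely_generated[OF field_K lmodule_axioms fin_dim E_submodule] by blast
  show ?thesis
  proof (rule fin_dimI[where X = "set ws" and \<phi> = "\<lambda>w f. f w"])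
    fix w assume "w \<in> set ws"
    then have w: "w \<in> E" using ws(1) by blast
    show "lmodule_hom K (res_module A ?D) (regular K) (\<lambda>f. f w)"
    proof (intro lmodule_hom.intro lmodule_hom_axioms.intro lmodule_res lmodule_dual lmodule_regular R.ring_axioms)
      fix r f assume "r \<in> carrier K" "f \<in> carrier (res_module A ?D)"
      then show "(r \<odot>\<^bsub>res_module A ?D\<^esub> f) w = r \<odot>\<^bsub>regular K\<^esub> f w" using scal_dual w by simp
    qed (use w dualD(2) in \<open>simp_all add: dual_simps(3)\<close>)
  next
    fix f assume f: "f \<in> carrier (res_module A ?D)" and z: "\<And>w. w \<in> set ws \<Longrightarrow> f w = \<zero>\<^bsub>K\<^esub>"
    have f': "f \<in> carrier ?D" using f by simp
    note fD = dualD[OF f'] and E = submoduleD[OF E_submodule]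
    have "f \<zero>\<^bsub>A\<^esub> = \<zero>\<^bsub>K\<^esub>" using fD(4)[of "\<zero>\<^bsub>K\<^esub>" "\<zero>\<^bsub>A\<^esub>"] fD(2) E(2) by simp
    then have "submodule {x \<in> E. f x = \<zero>\<^bsub>K\<^esub>} K A"
      unfolding submodule_iff using E_closed E fD by (simp add: subset_iff)
    then have "E \<subseteq> {x \<in> E. f x = \<zero>\<^bsub>K\<^esub>}"
      using gen_submodule_minimal[of "{x \<in> E. f x = \<zero>\<^bsub>K\<^esub>}" K A "set ws"] ws z by auto
    then have "f = (\<lambda>x\<in>E. \<zero>\<^bsub>K\<^esub>)" using fD(1) by (intro extensionalityI[where A = E]) auto
    then show "f = \<zero>\<^bsub>res_module A ?D\<^esub>" by (simp add: dual_simps(2))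
  qed simp
qed

end

text \<open>Take the first term of the series on which \<open>a\<close> does not act as zero. As
  \<open>a\<close> is idempotent, \<open>a \<odot> y\<close> is fixed by \<open>a\<close>, so it is
  not in the preceding term and survives in the subquotient.\<close>

lemma series_detect:
  assumes N: "lmodule A N" "composition_series A N Ns" and a: "a \<in> carrier A" "a \<otimes>\<^bsub>A\<^esub> a = a"
    and x: "x \<in> carrier N" "a \<odot>\<^bsub>N\<^esub> x \<noteq> \<zero>\<^bsub>N\<^esub>"
  obtains X c where "X \<in> composition_factors A N" "lmodule A X" "c \<in> carrier X" "a \<odot>\<^bsub>X\<^esub> c \<noteq> \<zero>\<^bsub>X\<^esub>"
proof -
  interpret N: lmodule A N by fact
  have Ns: "Ns \<noteq> []" "hd Ns = {\<zero>\<^bsub>N\<^esub>}" "last Ns = carrier N" "\<And>V. V \<in> set Ns \<Longrightarrow> submodule V A N"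
    "\<And>i. Suc i < length Ns \<Longrightarrow> Ns ! i \<subset> Ns ! Suc i"
    using N(2) unfolding composition_series_def by auto
  let ?Q = "\<lambda>i. i < length Ns \<and> (\<exists>y\<in>Ns ! i. a \<odot>\<^bsub>N\<^esub> y \<noteq> \<zero>\<^bsub>N\<^esub>)"
  have "?Q (length Ns - 1)" using Ns(1,3) x by (auto simp: last_conv_nth)
  then obtain i where i: "?Q i" "\<And>j. j < i \<Longrightarrow> \<not> ?Q j" using exists_least_iff[of ?Q] by blast
  have "i \<noteq> 0"
  proof
    assume "i = 0"
    then show False using i(1) Ns(1,2) a(1) by (auto simp: hd_conv_nth)
  qed
  then obtain j where j: "i = Suc j" using not0_implies_Suc by blast
  obtain y where y: "y \<in> Ns ! i" "a \<odot>\<^bsub>N\<^esub> y \<noteq> \<zero>\<^bsub>N\<^esub>" using i(1) by blast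
  have sub: "submodule (Ns ! i) A N" "submodule (Ns ! j) A N" using i(1) j Ns(4) by auto
  have lt: "Ns ! j \<subset> Ns ! i" using Ns(5) i(1) j by simp
  let ?X = "subquotient N (Ns ! i) (Ns ! j)"
  interpret Q: lquotient A "N\<lparr>carrier := Ns ! i\<rparr>" "Ns ! j" using N.lquotient_sub[OF sub] lt by blast
  have yc: "y \<in> carrier N" using y(1) N.submoduleD(1)[OF sub(1)] by blast
  have ay: "a \<odot>\<^bsub>N\<^esub> y \<in> Ns ! i" by (rule N.submoduleD(4)[OF sub(1) a(1) y(1)])
  have "a \<odot>\<^bsub>N\<^esub> y \<notin> Ns ! j"
  proof
    assume "a \<odot>\<^bsub>N\<^esub> y \<in> Ns ! j"
    moreover have "a \<odot>\<^bsub>N\<^esub> (a \<odot>\<^bsub>N\<^esub> y) = a \<odot>\<^bsub>N\<^esub> y" using a yc by (simp flip: N.smult_assoc)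
    ultimately show False using i(1) i(2)[of j] j y(2) by auto
  qed
  then have "a \<odot>\<^bsub>?X\<^esub> (Ns ! j +>\<^bsub>N\<lparr>carrier := Ns ! i\<rparr>\<^esub> y) \<noteq> \<zero>\<^bsub>?X\<^esub>"
    using Q.coset_smult[OF a(1), of y] Q.coset_eq_zero_iff[of "a \<odot>\<^bsub>N\<^esub> y"] y(1) ay by (simp add: subquotient_def)
  moreover have "?X \<in> composition_factors A N"
    unfolding composition_factors_def using N(2) i(1) j by blast
  moreover have "Ns ! j +>\<^bsub>N\<lparr>carrier := Ns ! i\<rparr>\<^esub> y \<in> carrier ?X"
    using Q.coset_in[of y] y(1) by (simp add: subquotient_def)
  moreover have "lmodule A ?X" using Q.lmodule_quot by (simp add: subquotient_def)
  ultimately show thesis using that by blast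
qed

end

context interval_algebra
begin

abbreviation Inj where "Inj T \<equiv> injective_I K P T"

definition nabla_carrier where
  "nabla_carrier T = {\<phi> \<in> carrier (Inj T). \<forall>C\<in>rel_downsets P T. C \<noteq> T \<longrightarrow>
     (\<forall>g\<in>carrier \<Lambda>. \<phi> (proj_to T C \<otimes>\<^bsub>\<Lambda>\<^esub> g) = \<zero>\<^bsub>K\<^esub>)}"

section \<open>Identification of the costandard module\<close>

context
  fixes T assumes T: "T \<in> \<I>"
begin

lemma Inj_eq: "Inj T = dual_right_ideal K \<Lambda> (e T)"
  by (simp add: injective_I_def)

abbreviation ET where "ET \<equiv> A.E (e T)"

lemmas Inj_simps = A.dual_simps[OF e_closed[OF T], folded Inj_eq]
lemmas InjD = A.dualD[OF e_closed[OF T], folded Inj_eq]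
lemmas lmodule_Inj = A.lmodule_dual[OF e_closed[OF T], folded Inj_eq]

lemma ET_iff: "x \<in> ET \<longleftrightarrow> x \<in> carrier \<Lambda> \<and> e T \<otimes>\<^bsub>\<Lambda>\<^esub> x = x"
  using T by (auto simp: A.E_def[OF e_closed[OF T]] intro: rev_image_eqI)

lemma proj_to_ET: "\<lbrakk>C \<in> rel_downsets P T; g \<in> carrier \<Lambda>\<rbrakk> \<Longrightarrow> proj_to T C \<otimes>\<^bsub>\<Lambda>\<^esub> g \<in> ET"
  using T by (simp add: ET_iff proj_to_closed idem_mult_iff cf_proj_to_mult)

lemma nabla_submodule: "submodule (nabla_carrier T) \<Lambda> (Inj T)"
proof -
  interpret I: lmodule \<Lambda> "Inj T" by (rule lmodule_Inj)
  show ?thesis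
    unfolding I.submodule_iff
  proof (intro conjI ballI)
    show "\<zero>\<^bsub>Inj T\<^esub> \<in> nabla_carrier T"
      using I.M.zero_closed proj_to_ET by (simp add: nabla_carrier_def Inj_simps(2))
    show "x \<oplus>\<^bsub>Inj T\<^esub> y \<in> nabla_carrier T" if "x \<in> nabla_carrier T" "y \<in> nabla_carrier T" for x y
      using that proj_to_ET I.M.a_closed[of x y] by (simp add: nabla_carrier_def Inj_simps(3))
    show "a \<odot>\<^bsub>Inj T\<^esub> x \<in> nabla_carrier T" if "a \<in> carrier \<Lambda>" "x \<in> nabla_carrier T" for a x
      using that proj_to_ET I.smult_closed[of a x] T
      by (simp add: nabla_carrier_def Inj_simps(4) \<Lambda>.m_assoc proj_to_closed)
  qed (auto simp: nabla_carrier_def)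
qed

lemma functional_finsum:
  assumes \<phi>: "\<phi> \<in> carrier (Inj T)" and f: "finite B" "f \<in> B \<rightarrow> ET" and z: "\<And>i. i \<in> B \<Longrightarrow> \<phi> (f i) = \<zero>\<^bsub>K\<^esub>"
  shows "\<phi> (finsum \<Lambda> f B) = \<zero>\<^bsub>K\<^esub>"
proof -
  note ETs = K\<Lambda>.submoduleD[OF A.E_submodule[OF e_closed[OF T]]]
  have "\<phi> \<zero>\<^bsub>\<Lambda>\<^esub> = \<zero>\<^bsub>K\<^esub>"
    using InjD(4)[OF \<phi>, of "\<zero>\<^bsub>K\<^esub>" "\<zero>\<^bsub>\<Lambda>\<^esub>"] InjD(2)[OF \<phi>, of "\<zero>\<^bsub>\<Lambda>\<^esub>"] ETs(2) by simp
  then have "submodule {x \<in> ET. \<phi> x = \<zero>\<^bsub>K\<^esub>} K \<Lambda>"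
    unfolding K\<Lambda>.submodule_iff using ETs InjD[OF \<phi>] by (simp add: subset_iff)
  moreover have "f \<in> B \<rightarrow> {x \<in> ET. \<phi> x = \<zero>\<^bsub>K\<^esub>}" using f(2) z by auto
  ultimately have "finsum \<Lambda> f B \<in> {x \<in> ET. \<phi> x = \<zero>\<^bsub>K\<^esub>}" by (rule K\<Lambda>.submodule_finsum)
  then show ?thesis by simp
qed

text \<open>Decompose \<open>f\<close> along the components of \<open>T - {m}\<close>. None of them
  is \<open>T\<close>, so each summand factors through a proper downset.\<close>

lemma nabla_vanish:
  assumes \<phi>: "\<phi> \<in> nabla_carrier T" and m: "m \<in> max_elements T" and f: "vanishes T {m} f"
  shows "\<phi> f = \<zero>\<^bsub>K\<^esub>"
proof -
  have mA: "{m} \<subseteq> max_elements T" using m by simp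
  have mT: "m \<in> T" using m by (simp add: max_elements_def)
  note CD = comps_rel_downsets[OF T finite_P mA, THEN subsetD]
  have \<phi>I: "\<phi> \<in> carrier (Inj T)" using \<phi> by (simp add: nabla_carrier_def)
  have "\<phi> (\<Oplus>\<^bsub>\<Lambda>\<^esub>C\<in>comps T {m}. proj_to T C \<otimes>\<^bsub>\<Lambda>\<^esub> cut T C f) = \<zero>\<^bsub>K\<^esub>"
  proof (rule functional_finsum[OF \<phi>I finite_comps[OF T finite_P]])
    fix C assume C: "C \<in> comps T {m}"
    have "C \<noteq> T" using comps_disjoint[OF T finite_P C] mT by blast
    then show "\<phi> (proj_to T C \<otimes>\<^bsub>\<Lambda>\<^esub> cut T C f) = \<zero>\<^bsub>K\<^esub>"
      using \<phi> CD[OF C] cut_closed'[OF T mA C f] by (simp add: nabla_carrier_def)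
  qed (use proj_to_ET CD cut_closed'[OF T mA _ f] in blast)
  then show ?thesis using decompose[OF T mA f] by simp
qed

text \<open>The support of a morphism from the module of \<open>T\<close> to that of
  \<open>R\<close> is closed downwards in \<open>T\<close>. If \<open>T\<close> had a point outside
  \<open>R\<close>, the morphism would vanish at a maximal element above that point, and
  \<open>nabla_vanish\<close> would apply. Hence even \<open>T \<subseteq> R\<close>.\<close>

lemma nabla_idem:
  assumes \<phi>: "\<phi> \<in> nabla_carrier T" and R: "R \<in> \<I>" and nz: "e R \<odot>\<^bsub>Inj T\<^esub> \<phi> \<noteq> \<zero>\<^bsub>Inj T\<^esub>"
  shows "qh_le R T"
proof -
  have "\<exists>x\<in>ET. \<phi> (x \<otimes>\<^bsub>\<Lambda>\<^esub> e R) \<noteq> \<zero>\<^bsub>K\<^esub>"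
  proof (rule ccontr)
    assume "\<not> ?thesis"
    then have "e R \<odot>\<^bsub>Inj T\<^esub> \<phi> = \<zero>\<^bsub>Inj T\<^esub>" unfolding Inj_simps by (intro restrict_ext) blast
    then show False using nz by simp
  qed
  then obtain x where x: "x \<in> ET" "\<phi> (x \<otimes>\<^bsub>\<Lambda>\<^esub> e R) \<noteq> \<zero>\<^bsub>K\<^esub>" by blast
  let ?f = "x \<otimes>\<^bsub>\<Lambda>\<^esub> e R"
  have xc: "x \<in> carrier \<Lambda>" "e T \<otimes>\<^bsub>\<Lambda>\<^esub> x = x" using x(1) ET_iff by auto
  have f: "?f \<in> carrier \<Lambda>" using xc R by simp
  have fT: "e T \<otimes>\<^bsub>\<Lambda>\<^esub> ?f = ?f" using xc R T by (simp flip: \<Lambda>.m_assoc)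
  have fR: "cf ?f y Q R' = \<zero>\<^bsub>K\<^esub>" if "R' \<noteq> R" for y Q R' using mult_idem_cf[OF R xc(1)] that by simp
  have "T \<subseteq> R"
  proof (rule ccontr)
    assume "\<not> T \<subseteq> R"
    then obtain t where t: "t \<in> T" "t \<notin> R" by blast
    obtain m where m: "m \<in> max_elements T" "t \<le> m" using finite_le_max[OF interval_finite[OF T] t(1)] .
    have "cf ?f m T R = \<zero>\<^bsub>K\<^esub>"
    proof (rule ccontr)
      assume nz: "cf ?f m T R \<noteq> \<zero>\<^bsub>K\<^esub>"
      show False using cf_down(1)[OF f nz m(2) t(1)] t(2) by simp
    qed
    then have "vanishes T {m} ?f" using f fT fR by (auto simp: vanishes_def) metis
    then show False using nabla_vanish[OF \<phi> m(1)] x(2) by simp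
  qed
  then show ?thesis unfolding qh_le_def using psubset_card_mono[OF interval_finite[OF R], of T] by blast
qed

text \<open>A composition factor is nonzero, so some \<open>e R\<close> does not annihilate it;
  lifting an element to the submodule gives \<open>qh_le R T\<close> by
  \<open>nabla_idem\<close>.\<close>

lemma nabla_factors:
  assumes X: "X \<in> composition_factors \<Lambda> (Inj T\<lparr>carrier := nabla_carrier T\<rparr>)"
  shows "\<exists>R\<in>\<I>. qh_le R T \<and> X \<simeq>\<^bsub>\<Lambda>\<^esub> simple_L K P R"
proof -
  interpret I: lmodule \<Lambda> "Inj T" by (rule lmodule_Inj)
  let ?N = "Inj T\<lparr>carrier := nabla_carrier T\<rparr>"
  interpret N: lmodule \<Lambda> ?N by (rule I.lmodule_restrict[OF nabla_submodule])
  obtain Ns i where Ns: "X = subquotient ?N (Ns ! Suc i) (Ns ! i)" "composition_series \<Lambda> ?N Ns" "Suc i < length Ns"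
    using X unfolding composition_factors_def by blast
  have sub: "submodule (Ns ! Suc i) \<Lambda> ?N" "submodule (Ns ! i) \<Lambda> ?N" and lt: "Ns ! i \<subseteq> Ns ! Suc i"
    and simple: "simple_module \<Lambda> X"
    using Ns unfolding composition_series_def by auto
  interpret Q: lquotient \<Lambda> "?N\<lparr>carrier := Ns ! Suc i\<rparr>" "Ns ! i" by (rule N.lquotient_sub[OF sub lt])
  have Xq: "X = quot_module (?N\<lparr>carrier := Ns ! Suc i\<rparr>) (Ns ! i)" using Ns(1) by (simp add: subquotient_def)
  have lX: "lmodule \<Lambda> X" unfolding Xq by (rule Q.lmodule_quot)
  interpret X: lmodule \<Lambda> X by (rule lX)
  obtain c where c: "c \<in> carrier X" "c \<noteq> \<zero>\<^bsub>X\<^esub>"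
    using simple X.M.zero_closed unfolding simple_module_def by blast
  obtain R where R: "R \<in> \<I>" "e R \<odot>\<^bsub>X\<^esub> c \<noteq> \<zero>\<^bsub>X\<^esub>" using nonzero_idem[OF lX c] .
  obtain y where y: "y \<in> Ns ! Suc i" "c = Ns ! i +>\<^bsub>?N\<lparr>carrier := Ns ! Suc i\<rparr>\<^esub> y"
    using c(1) Q.carrier_quot unfolding Xq by auto
  have yN: "y \<in> nabla_carrier T" using y(1) N.submoduleD(1)[OF sub(1)] by auto
  have "e R \<odot>\<^bsub>Inj T\<^esub> y \<noteq> \<zero>\<^bsub>Inj T\<^esub>"
  proof
    assume z: "e R \<odot>\<^bsub>Inj T\<^esub> y = \<zero>\<^bsub>Inj T\<^esub>"
    then have "e R \<odot>\<^bsub>X\<^esub> c = Ns ! i +>\<^bsub>?N\<lparr>carrier := Ns ! Suc i\<rparr>\<^esub> \<zero>\<^bsub>?N\<lparr>carrier := Ns ! Suc i\<rparr>\<^esub>"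
      using Q.coset_smult[OF e_closed[OF R(1)], of y] y by (simp add: Xq)
    then show False using R(2) Q.coset_zero unfolding Xq by simp
  qed
  then have "qh_le R T" by (rule nabla_idem[OF yN R(1)])
  moreover have "X \<simeq>\<^bsub>\<Lambda>\<^esub> simple_L K P R" by (rule simple_module_iso[OF R(1) lX simple c(1) R(2)])
  ultimately show ?thesis using R(1) by blast
qed

text \<open>If some \<open>\<phi> \<in> N\<close> were nonzero on a morphism through a proper
  downset \<open>C\<close>, then \<open>e C\<close> would not annihilate \<open>N\<close>, so some
  composition factor would be the simple module of \<open>C\<close>. But \<open>C\<close> has fewer
  elements than \<open>T\<close>, so \<open>qh_le C T\<close> fails.\<close>

lemma nabla_greatest:
  assumes N: "submodule N \<Lambda> (Inj T)"
    and X: "\<And>X. X \<in> composition_factors \<Lambda> (Inj T\<lparr>carrier := N\<rparr>) \<Longrightarrow> \<exists>R\<in>\<I>. qh_le R T \<and> X \<simeq>\<^bsub>\<Lambda>\<^esub> simple_L K P R"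
  shows "N \<subseteq> nabla_carrier T"
proof
  interpret I: lmodule \<Lambda> "Inj T" by (rule lmodule_Inj)
  let ?N = "Inj T\<lparr>carrier := N\<rparr>"
  interpret N: lmodule \<Lambda> ?N by (rule I.lmodule_restrict[OF N])
  have rs: "res_module \<Lambda> ?N = res_module \<Lambda> (Inj T)\<lparr>carrier := N\<rparr>" by (simp add: res_module_def)
  have "fin_dim K (res_module \<Lambda> ?N)"
    unfolding rs by (intro fin_dim_subspace A.res_submodule A.lmodule_res lmodule_Inj N
        A.fin_dim_dual[OF e_closed[OF T], folded Inj_eq])
  then obtain Ns where Ns: "composition_series \<Lambda> ?N Ns"
    using A.exists_composition_series[OF N.lmodule_axioms] by blast
  fix \<phi> assume \<phi>: "\<phi> \<in> N"
  have \<phi>I: "\<phi> \<in> carrier (Inj T)" using I.submoduleD(1)[OF N] \<phi> by blast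
  have "\<phi> (proj_to T C \<otimes>\<^bsub>\<Lambda>\<^esub> g) = \<zero>\<^bsub>K\<^esub>" if C: "C \<in> rel_downsets P T" "C \<noteq> T" and g: "g \<in> carrier \<Lambda>" for C g
  proof (rule ccontr)
    assume nz: "\<phi> (proj_to T C \<otimes>\<^bsub>\<Lambda>\<^esub> g) \<noteq> \<zero>\<^bsub>K\<^esub>"
    have CI: "C \<in> \<I>" "C \<subseteq> T" using C(1) by (auto simp: rel_downsets_def)
    note pc = proj_to_closed[OF T C(1)]
    \<comment> \<open>Evaluating \<open>e C \<odot> ?x\<close> at the projection onto
      \<open>C\<close> recovers the nonzero value.\<close>
    let ?x = "g \<odot>\<^bsub>Inj T\<^esub> \<phi>"
    have xN: "?x \<in> N" by (rule I.submoduleD(4)[OF N g \<phi>])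
    have pE: "proj_to T C \<in> ET" using proj_to_ET[OF C(1) \<Lambda>.one_closed] pc by simp
    have pe: "proj_to T C \<otimes>\<^bsub>\<Lambda>\<^esub> e C = proj_to T C" using CI pc T C(1) by (simp add: mult_idem_iff cf_proj_to)
    have "(e C \<odot>\<^bsub>Inj T\<^esub> ?x) (proj_to T C) = \<phi> (proj_to T C \<otimes>\<^bsub>\<Lambda>\<^esub> g)"
      using pE pe by (simp add: Inj_simps(4))
    then have "e C \<odot>\<^bsub>?N\<^esub> ?x \<noteq> \<zero>\<^bsub>?N\<^esub>" using nz pE by (auto simp: Inj_simps(2))
    then obtain X c where Xc: "X \<in> composition_factors \<Lambda> ?N" "lmodule \<Lambda> X" "c \<in> carrier X" "e C \<odot>\<^bsub>X\<^esub> c \<noteq> \<zero>\<^bsub>X\<^esub>"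
      using A.series_detect[OF N.lmodule_axioms Ns e_closed[OF CI(1)] idem_idem[OF CI(1)], of ?x] xN by auto
    obtain R f where R: "R \<in> \<I>" "qh_le R T" and f: "f \<in> lin_hom \<Lambda> X (simple_L K P R)"
      "bij_betw f (carrier X) (carrier (simple_L K P R))"
      using X[OF Xc(1)] unfolding mod_iso_def by blast
    interpret f: lmodule_hom \<Lambda> X "simple_L K P R" f
      by (rule lmodule_hom_lin_hom[OF Xc(2) lmodule_simple_L[OF R(1)] f(1)])
    have "R \<noteq> C" using R(2) C(2) CI(2) interval_finite[OF T] by (auto simp: qh_le_def psubset_card_mono dest: card_mono)
    then have "f (e C \<odot>\<^bsub>X\<^esub> c) = \<zero>\<^bsub>simple_L K P R\<^esub>"
      using f.smult[OF e_closed[OF CI(1)] Xc(3)] idem_simple_L[OF R(1) CI(1) _ f.closed[OF Xc(3)]] by simp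
    moreover have "inj_on f (carrier X)" using f(2) by (simp add: bij_betw_def)
    ultimately show False using Xc(3,4) CI(1) unfolding f.inj_on_iff by simp
  qed
  then show "\<phi> \<in> nabla_carrier T" using \<phi>I by (simp add: nabla_carrier_def)
qed

lemma costandard_eq: "costandard K P T = Inj T\<lparr>carrier := nabla_carrier T\<rparr>"
proof -
  have "(GREATEST N. submodule N \<Lambda> (Inj T) \<and>
        (\<forall>X \<in> composition_factors \<Lambda> (Inj T\<lparr>carrier := N\<rparr>).
           \<exists>R\<in>\<I>. qh_le R T \<and> X \<simeq>\<^bsub>\<Lambda>\<^esub> simple_L K P R)) = nabla_carrier T"
    by (rule Greatest_equality) (use nabla_submodule nabla_factors nabla_greatest in blast)+
  then show ?thesis by (simp add: costandard_def)
qed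

lemma lmodule_costandard: "lmodule \<Lambda> (costandard K P T)"
  unfolding costandard_eq by (rule lmodule.lmodule_restrict[OF lmodule_Inj nabla_submodule])

end

end

section \<open>The complexes attached to a free resolution\<close>

context interval_algebra
begin

lemma kill_add:
  assumes "T \<in> \<I>" "f \<in> carrier \<Lambda>" "g \<in> carrier \<Lambda>"
  shows "kill T b (f \<oplus>\<^bsub>\<Lambda>\<^esub> g) = kill T b f \<oplus>\<^bsub>\<Lambda>\<^esub> kill T b g"
  by (rule cf_ext) (use assms in \<open>simp_all add: kill_closed cf_kill cf_add\<close>)

lemma kill_smult:
  assumes "T \<in> \<I>" "f \<in> carrier \<Lambda>" "c \<in> carrier K"
  shows "kill T b (c \<odot>\<^bsub>\<Lambda>\<^esub> f) = c \<odot>\<^bsub>\<Lambda>\<^esub> kill T b f"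
  by (rule cf_ext) (use assms in \<open>simp_all add: kill_closed cf_kill cf_smult\<close>)

lemma idem_kill:
  assumes "T \<in> \<I>" "f \<in> carrier \<Lambda>"
  shows "e T \<otimes>\<^bsub>\<Lambda>\<^esub> kill T b f = kill T b f"
  using assms by (simp add: idem_mult_iff kill_closed cf_kill)

lemma kill_kill:
  assumes "T \<in> \<I>" "f \<in> carrier \<Lambda>"
  shows "kill T b (kill T c f) = kill T c (kill T b f)" "kill T b (kill T b f) = kill T b f"
  by (rule cf_ext; use assms in \<open>simp add: kill_closed cf_kill\<close>)+

lemma vanishes_kill:
  assumes "T \<in> \<I>" "f \<in> carrier \<Lambda>"
  shows "vanishes T {b} (kill T b f)"
  using assms by (simp add: vanishes_def kill_closed cf_kill idem_kill)

lemma vanishes_zero: "T \<in> \<I> \<Longrightarrow> vanishes T A \<zero>\<^bsub>\<Lambda>\<^esub>"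
  by (simp add: vanishes_def)

lemma vanishes_add: "\<lbrakk>T \<in> \<I>; vanishes T A f; vanishes T A g\<rbrakk> \<Longrightarrow> vanishes T A (f \<oplus>\<^bsub>\<Lambda>\<^esub> g)"
  by (simp add: vanishes_def \<Lambda>.r_distr cf_add)

lemma cut_add:
  assumes T: "T \<in> \<I>" and A: "A \<subseteq> max_elements T" and C: "C \<in> comps T A" and f: "vanishes T A f" "vanishes T A g"
  shows "cut T C (f \<oplus>\<^bsub>\<Lambda>\<^esub> g) = cut T C f \<oplus>\<^bsub>\<Lambda>\<^esub> cut T C g"
proof (rule cf_ext)
  have fc: "f \<in> carrier \<Lambda>" "g \<in> carrier \<Lambda>" using f by (auto simp: vanishes_def)
  note v = vanishes_add[OF T f]
  show "cut T C (f \<oplus>\<^bsub>\<Lambda>\<^esub> g) \<in> carrier \<Lambda>" by (rule cut_closed'[OF T A C v])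
  note c = cut_closed'[OF T A C f(1)] cut_closed'[OF T A C f(2)]
  show "cut T C f \<oplus>\<^bsub>\<Lambda>\<^esub> cut T C g \<in> carrier \<Lambda>" using c by simp
  fix x Q R
  show "cf (cut T C (f \<oplus>\<^bsub>\<Lambda>\<^esub> g)) x Q R = cf (cut T C f \<oplus>\<^bsub>\<Lambda>\<^esub> cut T C g) x Q R"
    using fc by (simp add: cf_cut'[OF T A C v] cf_cut'[OF T A C f(1)] cf_cut'[OF T A C f(2)] cf_add[OF c] cf_add)
qed

lemma cut_smult:
  assumes T: "T \<in> \<I>" and A: "A \<subseteq> max_elements T" and C: "C \<in> comps T A" and f: "vanishes T A f"
    and c: "c \<in> carrier K"
  shows "vanishes T A (c \<odot>\<^bsub>\<Lambda>\<^esub> f)" "cut T C (c \<odot>\<^bsub>\<Lambda>\<^esub> f) = c \<odot>\<^bsub>\<Lambda>\<^esub> cut T C f"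
proof -
  have fc: "f \<in> carrier \<Lambda>" using f by (simp add: vanishes_def)
  show v: "vanishes T A (c \<odot>\<^bsub>\<Lambda>\<^esub> f)"
    using f c T by (simp add: vanishes_def cf_smult A.smult_mult_right)
  show "cut T C (c \<odot>\<^bsub>\<Lambda>\<^esub> f) = c \<odot>\<^bsub>\<Lambda>\<^esub> cut T C f"
    by (rule cf_ext) (use c fc cut_closed'[OF T A C v] cut_closed'[OF T A C f] in
      \<open>simp_all add: cf_cut'[OF T A C v] cf_cut'[OF T A C f] cf_smult\<close>)
qed

lemma cut_zero: "\<lbrakk>T \<in> \<I>; A \<subseteq> max_elements T; C \<in> comps T A\<rbrakk> \<Longrightarrow> cut T C \<zero>\<^bsub>\<Lambda>\<^esub> = \<zero>\<^bsub>\<Lambda>\<^esub>"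
  by (intro cf_ext cut_closed'[OF _ _ _ vanishes_zero]) (simp_all add: cf_cut'[OF _ _ _ vanishes_zero])

end

locale resolution_setup = interval_algebra K P
  for K :: "('k, 'x) ring_scheme" and P :: "'p::order set" +
  fixes S T n d eps
  assumes S: "S \<in> \<I>" and T: "T \<in> \<I>"
    and resolution: "free_resolution \<Lambda> (simple_L K P S) n d eps"
begin

abbreviation L where "L \<equiv> simple_L K P S"
abbreviation F where "F i \<equiv> free_module \<Lambda> (n i)"
abbreviation M where "M \<equiv> max_elements T"

sublocale F: lmodule \<Lambda> "F i" for i by (rule lmodule_free_module) (rule \<Lambda>.ring_axioms)
sublocale L: lmodule \<Lambda> L by (rule lmodule_simple_L[OF S])

lemma d_lin: "d i \<in> lin_hom \<Lambda> (F (Suc i)) (F i)"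
  using resolution by (simp add: free_resolution_def)

sublocale d: lmodule_hom \<Lambda> "F (Suc i)" "F i" "d i" for i
  by (intro lmodule_hom_lin_hom F.lmodule_axioms d_lin)

sublocale eps: lmodule_hom \<Lambda> "F 0" L eps
  by (intro lmodule_hom_lin_hom F.lmodule_axioms L.lmodule_axioms)
    (use resolution in \<open>simp add: free_resolution_def\<close>)

lemma eps_surj: "eps ` carrier (F 0) = carrier L"
  using resolution by (simp add: free_resolution_def)

lemma exact0: "d 0 ` carrier (F (Suc 0)) = {x \<in> carrier (F 0). eps x = \<zero>\<^bsub>L\<^esub>}"
  using resolution by (simp add: free_resolution_def)

lemma exact: "d (Suc i) ` carrier (F (Suc (Suc i))) = {x \<in> carrier (F (Suc i)). d i x = \<zero>\<^bsub>F i\<^esub>}"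
  using resolution by (simp add: free_resolution_def)

lemma eps_d: "x \<in> carrier (F (Suc 0)) \<Longrightarrow> eps (d 0 x) = \<zero>\<^bsub>L\<^esub>"
  using exact0 by blast

lemma d_d: "x \<in> carrier (F (Suc (Suc i))) \<Longrightarrow> d i (d (Suc i) x) = \<zero>\<^bsub>F i\<^esub>"
  using exact[of i] by blast

lemma F_mem: "x \<in> carrier (F i) \<longleftrightarrow> x \<in> extensional {..<n i} \<and> (\<forall>j<n i. x j \<in> carrier \<Lambda>)"
  by (auto simp: free_module_simps PiE_iff)

lemma F_eqI: "\<lbrakk>x \<in> carrier (F i); y \<in> carrier (F i); \<And>j. j < n i \<Longrightarrow> x j = y j\<rbrakk> \<Longrightarrow> x = y"
  by (rule extensionalityI[where A = "{..<n i}"]) (auto simp: F_mem)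

lemma F_smult: "j < n i \<Longrightarrow> (a \<odot>\<^bsub>F i\<^esub> x) j = a \<otimes>\<^bsub>\<Lambda>\<^esub> x j"
  by (simp add: free_module_simps)

lemma F_add: "j < n i \<Longrightarrow> (x \<oplus>\<^bsub>F i\<^esub> y) j = x j \<oplus>\<^bsub>\<Lambda>\<^esub> y j"
  by (simp add: free_module_simps)

lemma F_zero: "j < n i \<Longrightarrow> \<zero>\<^bsub>F i\<^esub> j = \<zero>\<^bsub>\<Lambda>\<^esub>"
  by (simp add: free_module_simps)

definition X where "X i = res_module \<Lambda> (F i)\<lparr>carrier := {x \<in> carrier (F i). e T \<odot>\<^bsub>F i\<^esub> x = x}\<rparr>"
definition q where "q b i x = (\<lambda>j\<in>{..<n i}. kill T b (x j))"

text \<open>The vanishing condition, coordinate by coordinate. \<open>cutF\<close> and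
  \<open>prF\<close> are the two directions of the decomposition of this subspace into the
  \<open>e C F\<^sub>i\<close> for the components \<open>C\<close>.\<close>

definition van where "van A i x \<longleftrightarrow> x \<in> carrier (F i) \<and> (\<forall>j<n i. vanishes T A (x j))"
definition cutF where "cutF C i x = (\<lambda>j\<in>{..<n i}. cut T C (x j))"
definition prF where "prF C i y = proj_to T C \<odot>\<^bsub>F i\<^esub> y"

lemma X_simps [simp]: "zero (X i) = \<zero>\<^bsub>F i\<^esub>" "add (X i) = add (F i)"
  "c \<odot>\<^bsub>X i\<^esub> x = A.scal c \<odot>\<^bsub>F i\<^esub> x"
  by (simp_all add: X_def)

lemma idem_F_iff:
  assumes "x \<in> carrier (F i)" "C \<in> \<I>"
  shows "e C \<odot>\<^bsub>F i\<^esub> x = x \<longleftrightarrow> (\<forall>j<n i. e C \<otimes>\<^bsub>\<Lambda>\<^esub> x j = x j)"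
proof
  assume "e C \<odot>\<^bsub>F i\<^esub> x = x"
  then show "\<forall>j<n i. e C \<otimes>\<^bsub>\<Lambda>\<^esub> x j = x j" using F_smult by metis
next
  assume "\<forall>j<n i. e C \<otimes>\<^bsub>\<Lambda>\<^esub> x j = x j"
  then show "e C \<odot>\<^bsub>F i\<^esub> x = x"
    using F.smult_closed[OF e_closed[OF assms(2)] assms(1)] assms(1) by (intro F_eqI[of _ i]) (simp_all add: F_smult)
qed

lemma X_mem: "x \<in> carrier (X i) \<longleftrightarrow> x \<in> carrier (F i) \<and> e T \<odot>\<^bsub>F i\<^esub> x = x"
  by (simp add: X_def)

lemma X_mem_iff: "x \<in> carrier (X i) \<longleftrightarrow> x \<in> carrier (F i) \<and> (\<forall>j<n i. e T \<otimes>\<^bsub>\<Lambda>\<^esub> x j = x j)"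
  using idem_F_iff[OF _ T] X_mem by blast

lemma X_iff_van: "x \<in> carrier (X i) \<longleftrightarrow> van {} i x"
  by (auto simp: X_mem_iff van_def vanishes_def F_mem)

lemma scal_F: "\<lbrakk>c \<in> carrier K; x \<in> carrier (F i); j < n i\<rbrakk> \<Longrightarrow> (A.scal c \<odot>\<^bsub>F i\<^esub> x) j = c \<odot>\<^bsub>\<Lambda>\<^esub> x j"
  by (simp add: F_smult F_mem A.scal_mult)

lemma van_closed: "van A i x \<Longrightarrow> x \<in> carrier (F i)"
  by (simp add: van_def)

lemma van_add: "\<lbrakk>van A i x; van A i y\<rbrakk> \<Longrightarrow> van A i (x \<oplus>\<^bsub>F i\<^esub> y)"
  using T by (simp add: van_def F_add vanishes_add)

lemma van_zero: "van A i \<zero>\<^bsub>F i\<^esub>"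
  using T by (simp add: van_def F_zero vanishes_zero)

lemma X_submodule: "submodule (carrier (X i)) K (res_module \<Lambda> (F i))"
proof -
  interpret r: lmodule K "res_module \<Lambda> (F i)" by (rule A.lmodule_res[OF F.lmodule_axioms])
  show ?thesis
    unfolding r.submodule_iff
  proof (intro conjI ballI)
    show "carrier (X i) \<subseteq> carrier (res_module \<Lambda> (F i))" by (auto simp: X_mem)
    show "\<zero>\<^bsub>res_module \<Lambda> (F i)\<^esub> \<in> carrier (X i)" using van_zero by (simp add: X_iff_van)
    show "x \<oplus>\<^bsub>res_module \<Lambda> (F i)\<^esub> y \<in> carrier (X i)" if "x \<in> carrier (X i)" "y \<in> carrier (X i)" for x y
      using that van_add by (simp add: X_iff_van)
    show "c \<odot>\<^bsub>res_module \<Lambda> (F i)\<^esub> x \<in> carrier (X i)" if "c \<in> carrier K" "x \<in> carrier (X i)" for c x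
    proof -
      have xF: "x \<in> carrier (F i)" using that by (simp add: X_mem)
      then have "A.scal c \<odot>\<^bsub>F i\<^esub> x \<in> carrier (F i)" using that(1) by simp
      moreover have "x j \<in> carrier \<Lambda>" if "j < n i" for j using xF that by (simp add: F_mem)
      ultimately show ?thesis using that T scal_F[OF that(1) xF] by (simp add: X_mem_iff A.smult_mult_right)
    qed
  qed
qed

lemma X_eq: "X i = res_module \<Lambda> (F i)\<lparr>carrier := carrier (X i)\<rparr>"
  by (simp add: X_def)

lemma X_lmodule: "lmodule K (X i)"
  using lmodule.lmodule_restrict[OF A.lmodule_res[OF F.lmodule_axioms] X_submodule] by (simp flip: X_eq)

lemma fin_dim_X: "fin_dim K (X i)"
  using fin_dim_subspace[OF A.fin_dim_free X_submodule A.lmodule_res[OF F.lmodule_axioms]] by (simp flip: X_eq)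

lemma q_closed_F: "x \<in> carrier (F i) \<Longrightarrow> q b i x \<in> carrier (F i)"
  using T by (simp add: F_mem q_def kill_closed)

lemma q_eq_iff:
  assumes "x \<in> carrier (X i)"
  shows "q b i x = x \<longleftrightarrow> (\<forall>j<n i. \<forall>R. cf (x j) b T R = \<zero>\<^bsub>K\<^esub>)"
proof -
  have xF: "x \<in> carrier (F i)" using assms by (simp add: X_mem)
  have "q b i x = x \<longleftrightarrow> (\<forall>j<n i. kill T b (x j) = x j)"
  proof
    assume eq: "q b i x = x"
    show "\<forall>j<n i. kill T b (x j) = x j"
    proof (intro allI impI)
      show "kill T b (x j) = x j" if "j < n i" for j using fun_cong[OF eq, of j] that by (simp add: q_def)
    qed
  next
    assume "\<forall>j<n i. kill T b (x j) = x j"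
    then show "q b i x = x" using xF q_closed_F by (intro F_eqI[of _ i]) (simp_all add: q_def)
  qed
  then show ?thesis using assms kill_eq_iff[OF T] by (simp add: X_mem_iff F_mem)
qed

text \<open>Translates vanishing at points into fixed points of the projections \<open>q\<close>,
  the form required for a complex with commuting projections.\<close>

lemma van_iff: "van A i x \<longleftrightarrow> x \<in> carrier (X i) \<and> (\<forall>a\<in>A. q a i x = x)"
  using q_eq_iff by (auto simp: van_def vanishes_def X_mem_iff F_mem)

lemma van_q: "x \<in> carrier (F i) \<Longrightarrow> van {b} i (q b i x)"
  using vanishes_kill[OF T] q_closed_F by (simp add: van_def F_mem q_def)

lemma prF_closed: "\<lbrakk>C \<in> rel_downsets P T; y \<in> carrier (F i)\<rbrakk> \<Longrightarrow> prF C i y \<in> carrier (F i)"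
  unfolding prF_def by (rule F.smult_closed[OF proj_to_closed[OF T]])

context
  fixes A assumes A: "A \<subseteq> M"
begin

lemma compsD: "C \<in> comps T A \<Longrightarrow> C \<in> rel_downsets P T" "C \<in> comps T A \<Longrightarrow> C \<in> \<I>"
  using comps_rel_downsets[OF T finite_P A] by (auto simp: rel_downsets_def)

lemma van_prF: "\<lbrakk>C \<in> comps T A; y \<in> carrier (F i)\<rbrakk> \<Longrightarrow> van A i (prF C i y)"
  using prF_closed[OF compsD(1)] vanishes_proj_to[OF T A]
  by (simp add: van_def prF_def F_smult F_mem)

lemma cutF_closed: "\<lbrakk>C \<in> comps T A; van A i x\<rbrakk> \<Longrightarrow> cutF C i x \<in> carrier (F i)"
  using cut_closed'[OF T A] by (simp add: van_def F_mem cutF_def)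

lemma idem_cutF: "\<lbrakk>C \<in> comps T A; van A i x\<rbrakk> \<Longrightarrow> e C \<odot>\<^bsub>F i\<^esub> cutF C i x = cutF C i x"
  using cutF_closed idem_cut[OF T A] by (simp add: idem_F_iff compsD van_def cutF_def)

lemma cutF_add: "\<lbrakk>C \<in> comps T A; van A i x; van A i y\<rbrakk> \<Longrightarrow> cutF C i (x \<oplus>\<^bsub>F i\<^esub> y) = cutF C i x \<oplus>\<^bsub>F i\<^esub> cutF C i y"
  using cutF_closed cut_add[OF T A] van_add F.M.a_closed
  by (intro F_eqI[of _ i]) (simp_all add: van_def cutF_def F_add)

lemma van_scal: "\<lbrakk>van A i x; c \<in> carrier K\<rbrakk> \<Longrightarrow> van A i (A.scal c \<odot>\<^bsub>F i\<^esub> x)"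
  using T by (simp add: van_def scal_F vanishes_def cf_smult A.smult_mult_right)

lemma cutF_scal:
  assumes "C \<in> comps T A" "van A i x" "c \<in> carrier K"
  shows "cutF C i (A.scal c \<odot>\<^bsub>F i\<^esub> x) = A.scal c \<odot>\<^bsub>F i\<^esub> cutF C i x"
proof (rule F_eqI)
  show "cutF C i (A.scal c \<odot>\<^bsub>F i\<^esub> x) \<in> carrier (F i)"
    by (rule cutF_closed[OF assms(1) van_scal[OF assms(2,3)]])
  note cc = cutF_closed[OF assms(1,2)]
  show "A.scal c \<odot>\<^bsub>F i\<^esub> cutF C i x \<in> carrier (F i)" using cc assms(3) by simp
  fix j assume j: "j < n i"
  then have v: "vanishes T A (x j)" and xF: "x \<in> carrier (F i)" using assms(2) by (simp_all add: van_def)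
  show "cutF C i (A.scal c \<odot>\<^bsub>F i\<^esub> x) j = (A.scal c \<odot>\<^bsub>F i\<^esub> cutF C i x) j"
    using scal_F[OF assms(3) cc j] scal_F[OF assms(3) xF j] cut_smult(2)[OF T A assms(1) v assms(3)] j
    by (simp add: cutF_def)
qed

lemma cutF_zero: "C \<in> comps T A \<Longrightarrow> cutF C i \<zero>\<^bsub>F i\<^esub> = \<zero>\<^bsub>F i\<^esub>"
  using cutF_closed[OF _ van_zero] cut_zero[OF T A]
  by (intro F_eqI[of _ i]) (simp_all add: cutF_def F_zero)

lemma cutF_prF:
  assumes "C \<in> comps T A" "C' \<in> comps T A" "y \<in> carrier (F i)"
  shows "cutF C i (prF C' i y) = (if C = C' then e C \<odot>\<^bsub>F i\<^esub> y else \<zero>\<^bsub>F i\<^esub>)"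
proof (rule F_eqI)
  show "cutF C i (prF C' i y) \<in> carrier (F i)" by (rule cutF_closed[OF assms(1) van_prF[OF assms(2,3)]])
  show "(if C = C' then e C \<odot>\<^bsub>F i\<^esub> y else \<zero>\<^bsub>F i\<^esub>) \<in> carrier (F i)"
    using F.smult_closed[OF e_closed[OF compsD(2)[OF assms(1)]] assms(3)] by auto
  show "cutF C i (prF C' i y) j = (if C = C' then e C \<odot>\<^bsub>F i\<^esub> y else \<zero>\<^bsub>F i\<^esub>) j" if "j < n i" for j
    using that assms(3) cut_proj_to[OF T A assms(1,2)] by (simp add: cutF_def prF_def F_smult F_zero F_mem)
qed

lemmas F_abelian = F.M.abelian_monoid_axioms

lemma decomposeF:
  assumes x: "van A i x"
  shows "x = (\<Oplus>\<^bsub>F i\<^esub>C\<in>comps T A. prF C i (cutF C i x))"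
proof (rule F_eqI)
  have c: "prF C i (cutF C i x) \<in> carrier (F i)" if "C \<in> comps T A" for C
    using prF_closed[OF compsD(1)] cutF_closed x that by blast
  show "x \<in> carrier (F i)" by (rule van_closed[OF x])
  show "(\<Oplus>\<^bsub>F i\<^esub>C\<in>comps T A. prF C i (cutF C i x)) \<in> carrier (F i)" using c by (intro F.M.finsum_closed) auto
  fix j assume j: "j < n i"
  have Fj: "y j \<in> carrier \<Lambda>" if "y \<in> carrier (F i)" for y using that j by (simp add: F_mem)
  have "(\<Oplus>\<^bsub>F i\<^esub>C\<in>comps T A. prF C i (cutF C i x)) j = (\<Oplus>\<^bsub>\<Lambda>\<^esub>C\<in>comps T A. prF C i (cutF C i x) j)"
    by (rule finsum_additive_on(2)[OF F_abelian \<Lambda>.abelian_monoid_axioms subset_refl])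
      (use j c finite_comps[OF T finite_P] in \<open>simp_all add: Fj F_zero F_add\<close>)
  also have "\<dots> = (\<Oplus>\<^bsub>\<Lambda>\<^esub>C\<in>comps T A. proj_to T C \<otimes>\<^bsub>\<Lambda>\<^esub> cut T C (x j))"
    using j by (simp add: prF_def F_smult cutF_def)
  also have "\<dots> = x j" using decompose[OF T A, of "x j"] x j by (simp add: van_def)
  finally show "x j = (\<Oplus>\<^bsub>F i\<^esub>C\<in>comps T A. prF C i (cutF C i x)) j" by simp
qed

lemma d_prF: "\<lbrakk>C \<in> comps T A; y \<in> carrier (F (Suc i))\<rbrakk> \<Longrightarrow> d i (prF C (Suc i) y) = prF C i (d i y)"
  unfolding prF_def by (rule d.smult[OF proj_to_closed[OF T compsD(1)]])

lemma d_sum_prF: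
  assumes "\<And>C. C \<in> comps T A \<Longrightarrow> y C \<in> carrier (F (Suc i))"
  shows "van A (Suc i) (\<Oplus>\<^bsub>F (Suc i)\<^esub>C\<in>comps T A. prF C (Suc i) (y C))"
    "d i (\<Oplus>\<^bsub>F (Suc i)\<^esub>C\<in>comps T A. prF C (Suc i) (y C)) = (\<Oplus>\<^bsub>F i\<^esub>C\<in>comps T A. prF C i (d i (y C)))"
proof -
  have N: "{x. van A (Suc i) x} \<subseteq> carrier (F (Suc i))" using van_closed by blast
  have v: "van A (Suc i) (prF C (Suc i) (y C))" if "C \<in> comps T A" for C using van_prF assms that by blast
  have "finsum (F (Suc i)) (\<lambda>C. prF C (Suc i) (y C)) (comps T A) \<in> {x. van A (Suc i) x}"
    by (rule finsum_additive_on(1)[OF F_abelian F_abelian N, where h = "d i"])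
      (use v van_zero van_add van_closed finite_comps[OF T finite_P] in \<open>simp_all add: d.add\<close>)
  then show "van A (Suc i) (\<Oplus>\<^bsub>F (Suc i)\<^esub>C\<in>comps T A. prF C (Suc i) (y C))" by simp
  have "d i (\<Oplus>\<^bsub>F (Suc i)\<^esub>C\<in>comps T A. prF C (Suc i) (y C)) = (\<Oplus>\<^bsub>F i\<^esub>C\<in>comps T A. d i (prF C (Suc i) (y C)))"
    by (rule finsum_additive_on(2)[OF F_abelian F_abelian N])
      (use v van_zero van_add van_closed finite_comps[OF T finite_P] in \<open>simp_all add: d.add\<close>)
  also have "\<dots> = (\<Oplus>\<^bsub>F i\<^esub>C\<in>comps T A. prF C i (d i (y C)))"
    by (rule F.M.finsum_cong') (use assms d_prF prF_closed[OF compsD(1)] in auto)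
  finally show "d i (\<Oplus>\<^bsub>F (Suc i)\<^esub>C\<in>comps T A. prF C (Suc i) (y C)) = (\<Oplus>\<^bsub>F i\<^esub>C\<in>comps T A. prF C i (d i (y C)))" .
qed

text \<open>\<open>prF\<close> is multiplication by an element of \<open>\<Lambda>\<close>, so it
  commutes with the differential; \<open>cutF\<close> is not given in this form, and its
  compatibility is obtained by decomposing \<open>x\<close>, applying \<open>d\<close> and cutting
  again.\<close>

lemma
  assumes x: "van A (Suc i) x"
  shows d_van: "van A i (d i x)" and cutF_d: "C \<in> comps T A \<Longrightarrow> cutF C i (d i x) = d i (cutF C (Suc i) x)"
proof -
  let ?y = "\<lambda>C. d i (cutF C (Suc i) x)"
  have yc: "?y C \<in> carrier (F i)" if "C \<in> comps T A" for C using cutF_closed[OF that x] by simp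
  have dx: "d i x = (\<Oplus>\<^bsub>F i\<^esub>C\<in>comps T A. prF C i (?y C))"
    by (subst decomposeF[OF x], rule d_sum_prF(2)) (rule cutF_closed[OF _ x])
  have N: "{x. van A i x} \<subseteq> carrier (F i)" using van_closed by blast
  have v: "prF C i (?y C) \<in> {x. van A i x}" if "C \<in> comps T A" for C using van_prF[OF that yc[OF that]] by simp
  have "finsum (F i) (\<lambda>C. prF C i (?y C)) (comps T A) \<in> {x. van A i x}"
    by (rule finsum_additive_on(1)[OF F_abelian F_abelian N, where h = "\<lambda>x. x"])
      (use v van_zero van_add van_closed finite_comps[OF T finite_P] in simp_all)
  then show "van A i (d i x)" using dx by simp
  assume C: "C \<in> comps T A"
  have "cutF C i (d i x) = (\<Oplus>\<^bsub>F i\<^esub>C'\<in>comps T A. cutF C i (prF C' i (?y C')))"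
    unfolding dx
    by (rule finsum_additive_on(2)[OF F_abelian F_abelian N])
      (use v van_zero van_add finite_comps[OF T finite_P] C in \<open>simp_all add: cutF_closed cutF_add cutF_zero\<close>)
  also have "\<dots> = (\<Oplus>\<^bsub>F i\<^esub>C'\<in>comps T A. if C = C' then e C' \<odot>\<^bsub>F i\<^esub> ?y C' else \<zero>\<^bsub>F i\<^esub>)"
    by (rule F.M.finsum_cong') (use C yc compsD(2) cutF_prF in auto)
  also have "\<dots> = e C \<odot>\<^bsub>F i\<^esub> ?y C"
    by (rule F.M.finsum_singleton[OF C finite_comps[OF T finite_P]]) (use yc compsD(2) in auto)
  also have "\<dots> = d i (e C \<odot>\<^bsub>F (Suc i)\<^esub> cutF C (Suc i) x)"
    using d.smult[OF e_closed[OF compsD(2)[OF C]] cutF_closed[OF C x]] by simp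
  also have "\<dots> = d i (cutF C (Suc i) x)" using idem_cutF[OF C x] by simp
  finally show "cutF C i (d i x) = d i (cutF C (Suc i) x)" .
qed

text \<open>The bounding elements for the different components can be chosen independently in the
  whole free module: applying \<open>prF\<close> and summing puts them in place.\<close>

lemma boundaryI:
  assumes x: "van A i x" and "\<And>C. C \<in> comps T A \<Longrightarrow> \<exists>z\<in>carrier (F (Suc i)). cutF C i x = d i z"
  shows "\<exists>y. van A (Suc i) y \<and> x = d i y"
proof -
  obtain z where z: "\<And>C. C \<in> comps T A \<Longrightarrow> z C \<in> carrier (F (Suc i))" "\<And>C. C \<in> comps T A \<Longrightarrow> cutF C i x = d i (z C)"
    using assms(2) by metis
  have "d i (\<Oplus>\<^bsub>F (Suc i)\<^esub>C\<in>comps T A. prF C (Suc i) (z C)) = (\<Oplus>\<^bsub>F i\<^esub>C\<in>comps T A. prF C i (d i (z C)))"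
    by (rule d_sum_prF(2)[OF z(1)])
  also have "\<dots> = (\<Oplus>\<^bsub>F i\<^esub>C\<in>comps T A. prF C i (cutF C i x))"
    by (rule F.M.finsum_cong') (use z(2) prF_closed[OF compsD(1)] cutF_closed[OF _ x] in auto)
  also have "\<dots> = x" by (rule decomposeF[OF x, symmetric])
  finally have "d i (\<Oplus>\<^bsub>F (Suc i)\<^esub>C\<in>comps T A. prF C (Suc i) (z C)) = x" .
  moreover have "van A (Suc i) (\<Oplus>\<^bsub>F (Suc i)\<^esub>C\<in>comps T A. prF C (Suc i) (z C))"
    by (rule d_sum_prF(1)) (rule z(1))
  ultimately show ?thesis by blast
qed

lemma positive_exact:
  assumes x: "van A (Suc i) x" "d i x = \<zero>\<^bsub>F i\<^esub>"
  shows "\<exists>y. van A (Suc (Suc i)) y \<and> x = d (Suc i) y"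
proof (rule boundaryI[OF x(1)])
  fix C assume C: "C \<in> comps T A"
  have "d i (cutF C (Suc i) x) = \<zero>\<^bsub>F i\<^esub>" using cutF_d[OF x(1) C] x(2) cutF_zero[OF C] by simp
  then have "cutF C (Suc i) x \<in> d (Suc i) ` carrier (F (Suc (Suc i)))"
    unfolding exact using cutF_closed[OF C x(1)] by simp
  then show "\<exists>z\<in>carrier (F (Suc (Suc i))). cutF C (Suc i) x = d (Suc i) z" by blast
qed

text \<open>For a component \<open>C\<close> other than \<open>S\<close> the augmentation takes
  values in \<open>e C L(S) = 0\<close>, so only the component \<open>S\<close> can
  obstruct.\<close>

lemma zero_boundary:
  assumes x: "van A 0 x" and S0: "S \<in> comps T A \<Longrightarrow> eps (cutF S 0 x) = \<zero>\<^bsub>L\<^esub>"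
  shows "\<exists>y. van A (Suc 0) y \<and> x = d 0 y"
proof (rule boundaryI[OF x])
  fix C assume C: "C \<in> comps T A"
  note cc = cutF_closed[OF C x] and CI = compsD(2)[OF C]
  have "eps (cutF C 0 x) = \<zero>\<^bsub>L\<^esub>"
  proof (cases "C = S")
    case False
    have "eps (cutF C 0 x) = e C \<odot>\<^bsub>L\<^esub> eps (cutF C 0 x)"
      using eps.smult[OF e_closed[OF CI] cc] idem_cutF[OF C x] by simp
    then show ?thesis using idem_simple_L[OF S CI False eps.closed[OF cc]] by simp
  qed (use S0 C in simp)
  then have "cutF C 0 x \<in> d 0 ` carrier (F (Suc 0))" unfolding exact0 using cc by simp
  then show "\<exists>z\<in>carrier (F (Suc 0)). cutF C 0 x = d 0 z" by blast
qed

lemma eps_boundary: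
  assumes "S \<in> comps T A" "van A (Suc 0) y"
  shows "eps (cutF S 0 (d 0 y)) = \<zero>\<^bsub>L\<^esub>"
  using cutF_d[OF assms(2,1)] eps_d[OF cutF_closed[OF assms]] by simp

end

section \<open>The complex with projections attached to the maximal elements\<close>

lemma q_hom: "lmodule_hom K (X i) (X i) (q b i)"
proof (intro lmodule_hom.intro lmodule_hom_axioms.intro X_lmodule)
  show qX: "q b i x \<in> carrier (X i)" if "x \<in> carrier (X i)" for x
    using van_q[of x i b] that by (simp add: van_iff X_mem)
  show "q b i (x \<oplus>\<^bsub>X i\<^esub> y) = q b i x \<oplus>\<^bsub>X i\<^esub> q b i y" if "x \<in> carrier (X i)" "y \<in> carrier (X i)" for x y
    using that T by (auto simp: q_def X_mem F_mem kill_add free_module_simps(3) intro!: restrict_ext)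
  show "q b i (c \<odot>\<^bsub>X i\<^esub> x) = c \<odot>\<^bsub>X i\<^esub> q b i x" if "c \<in> carrier K" "x \<in> carrier (X i)" for c x
  proof -
    have xF: "x \<in> carrier (F i)" using that by (simp add: X_mem)
    have c1: "c \<odot>\<^bsub>\<Lambda>\<^esub> \<one>\<^bsub>\<Lambda>\<^esub> \<in> carrier \<Lambda>" using that(1) by simp
    have "q b i (A.scal c \<odot>\<^bsub>F i\<^esub> x) = A.scal c \<odot>\<^bsub>F i\<^esub> q b i x"
    proof (rule F_eqI)
      show "q b i (A.scal c \<odot>\<^bsub>F i\<^esub> x) \<in> carrier (F i)" by (intro q_closed_F F.smult_closed c1 xF)
      show "A.scal c \<odot>\<^bsub>F i\<^esub> q b i x \<in> carrier (F i)" by (intro q_closed_F F.smult_closed c1 xF)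
      fix j assume j: "j < n i"
      show "q b i (A.scal c \<odot>\<^bsub>F i\<^esub> x) j = (A.scal c \<odot>\<^bsub>F i\<^esub> q b i x) j"
        using scal_F[OF that(1) xF j] scal_F[OF that(1) q_closed_F[OF xF] j] xF j kill_smult[OF T _ that(1)]
        by (simp add: q_def F_mem)
    qed
    then show ?thesis by simp
  qed
qed

lemma dX_hom: "lmodule_hom K (X (Suc i)) (X i) (d i)"
proof (intro lmodule_hom.intro lmodule_hom_axioms.intro X_lmodule)
  show "d i x \<in> carrier (X i)" if "x \<in> carrier (X (Suc i))" for x
    using that d.smult[OF e_closed[OF T], of x i] by (simp add: X_mem)
qed (simp_all add: X_mem d.add d.smult)

sublocale MC: multi_projected_complex K X d q M
proof (rule multi_projected_complex.intro)
  show "lmodule K (X i)" for i by (rule X_lmodule)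
  show "lmodule_hom K (X (Suc i)) (X i) (d i)" for i by (rule dX_hom)
  show "d i (d (Suc i) x) = \<zero>\<^bsub>X i\<^esub>" if "x \<in> carrier (X (Suc (Suc i)))" for i x
    using that d_d by (simp add: X_mem)
  show "lmodule_hom K (X i) (X i) (q b i)" for b i by (rule q_hom)
  show "q b i (q b i x) = q b i x" if "x \<in> carrier (X i)" for b i x
    using that van_q[of x i b] by (simp add: van_iff X_mem)
  show "q b i (q c i x) = q c i (q b i x)" if "x \<in> carrier (X i)" for b c i x
    using that kill_kill(1)[OF T] by (auto simp: q_def X_mem F_mem intro!: restrict_ext)
  \<comment> \<open>The image of \<open>q b\<close> consists of the elements vanishing at
    \<open>b\<close>, and the differential preserves this condition by \<open>d_van\<close>.\<close>
  show "q b i (d i (q b (Suc i) x)) = d i (q b (Suc i) x)" if "b \<in> M" "x \<in> carrier (X (Suc i))" for b i x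
    using d_van[of "{b}" i "q b (Suc i) x"] that van_q[of x "Suc i" b] by (simp add: van_iff X_mem)
qed

lemma Y_van: "x \<in> carrier (MC.Y A [] i) \<longleftrightarrow> van A i x"
  by (simp add: MC.Y_carrier van_iff)

lemma cyc_van: "cyc (MC.Y A []) d i x \<longleftrightarrow> van A i x \<and> (\<forall>j. i = Suc j \<longrightarrow> d j x = \<zero>\<^bsub>F j\<^esub>)"
  by (simp add: cyc_def Y_van)

lemma acyclic_at_positive: "A \<subseteq> M \<Longrightarrow> acyclic_at (MC.Y A []) d (Suc i)"
  using positive_exact by (simp add: acyclic_at_def cyc_van Bex_def Y_van)

lemma acyclic_not_comp:
  assumes "A \<subseteq> M" "S \<notin> comps T A"
  shows "acyclic_complex (MC.Y A []) d"
  unfolding acyclic_complex_def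
proof
  fix i
  show "acyclic_at (MC.Y A []) d i"
  proof (cases i)
    case 0
    then show ?thesis using zero_boundary[OF assms(1)] assms(2) by (simp add: acyclic_at_def cyc_van Bex_def Y_van)
  qed (use acyclic_at_positive[OF assms(1)] in simp)
qed

text \<open>A preimage of the generator under the augmentation is multiplied by \<open>e S\<close>,
  which leaves its image unchanged.\<close>

lemma comp_generator:
  obtains y u where "y \<in> carrier (F 0)" "e S \<odot>\<^bsub>F 0\<^esub> y = y" "eps y = u"
    "\<And>w. \<lbrakk>w \<in> carrier L; e S \<odot>\<^bsub>L\<^esub> w = w\<rbrakk> \<Longrightarrow> \<exists>c\<in>carrier K. w = A.scal c \<odot>\<^bsub>L\<^esub> u"
    "\<And>c. \<lbrakk>c \<in> carrier K; A.scal c \<odot>\<^bsub>L\<^esub> u = \<zero>\<^bsub>L\<^esub>\<rbrakk> \<Longrightarrow> c = \<zero>\<^bsub>K\<^esub>"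
proof -
  obtain u where u: "u \<in> carrier L" "e S \<odot>\<^bsub>L\<^esub> u = u"
    "\<And>w. \<lbrakk>w \<in> carrier L; e S \<odot>\<^bsub>L\<^esub> w = w\<rbrakk> \<Longrightarrow> \<exists>c\<in>carrier K. w = A.scal c \<odot>\<^bsub>L\<^esub> u"
    "\<And>c. \<lbrakk>c \<in> carrier K; A.scal c \<odot>\<^bsub>L\<^esub> u = \<zero>\<^bsub>L\<^esub>\<rbrakk> \<Longrightarrow> c = \<zero>\<^bsub>K\<^esub>"
    by (rule simple_L_generator[OF S]) (rule that)
  have "u \<in> eps ` carrier (F 0)" using u(1) by (simp add: eps_surj)
  then obtain y where y: "y \<in> carrier (F 0)" "eps y = u" by (auto elim: imageE)
  have "e S \<odot>\<^bsub>F 0\<^esub> (e S \<odot>\<^bsub>F 0\<^esub> y) = e S \<odot>\<^bsub>F 0\<^esub> y" using S y(1) by (simp flip: F.smult_assoc)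
  moreover have "eps (e S \<odot>\<^bsub>F 0\<^esub> y) = u" using eps.smult[OF e_closed[OF S] y(1)] y(2) u(2) by simp
  ultimately show thesis by (rule that[OF F.smult_closed[OF e_closed[OF S] y(1)]]) (fact u(3), fact u(4))
qed

text \<open>Taking the same cycle for \<open>A\<close> and \<open>B\<close> makes an inclusion of one complex into the other an
  isomorphism on homology.\<close>

lemma common_generator:
  assumes A: "A \<subseteq> M" "S \<in> comps T A" and B: "B \<subseteq> M" "S \<in> comps T B"
  obtains z where "van A 0 z" "van B 0 z"
    "\<And>x. van A 0 x \<Longrightarrow> \<exists>c\<in>carrier K. \<exists>y. van A (Suc 0) y \<and> x = A.scal c \<odot>\<^bsub>F 0\<^esub> z \<oplus>\<^bsub>F 0\<^esub> d 0 y"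
    "\<And>c y. \<lbrakk>c \<in> carrier K; van A (Suc 0) y; A.scal c \<odot>\<^bsub>F 0\<^esub> z = d 0 y\<rbrakk> \<Longrightarrow> c = \<zero>\<^bsub>K\<^esub>"
proof -
  obtain y u where y: "y \<in> carrier (F 0)" "e S \<odot>\<^bsub>F 0\<^esub> y = y" "eps y = u"
    and u: "\<And>w. \<lbrakk>w \<in> carrier L; e S \<odot>\<^bsub>L\<^esub> w = w\<rbrakk> \<Longrightarrow> \<exists>c\<in>carrier K. w = A.scal c \<odot>\<^bsub>L\<^esub> u"
    "\<And>c. \<lbrakk>c \<in> carrier K; A.scal c \<odot>\<^bsub>L\<^esub> u = \<zero>\<^bsub>L\<^esub>\<rbrakk> \<Longrightarrow> c = \<zero>\<^bsub>K\<^esub>"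
    by (rule comp_generator) (rule that)
  \<comment> \<open>This element is built from \<open>S\<close> and \<open>y\<close> without
    reference to the removed set, so it serves for \<open>A\<close> and \<open>B\<close>
    alike.\<close>
  let ?z = "prF S 0 y"
  have zA: "van A 0 ?z" and zB: "van B 0 ?z" using van_prF[OF A y(1)] van_prF[OF B y(1)] by auto
  have cz: "cutF S 0 ?z = y" using cutF_prF[OF A(1,2,2) y(1)] y(2) by simp
  have ez: "eps (cutF S 0 (A.scal c \<odot>\<^bsub>F 0\<^esub> ?z)) = A.scal c \<odot>\<^bsub>L\<^esub> u" if c: "c \<in> carrier K" for c
    using cutF_scal[OF A zA c] cz eps.smult[OF A.scal_closed[OF c] y(1)] y(3) by simp
  show thesis
  proof (rule that[OF zA zB])
    fix x assume x: "van A 0 x"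
    note cc = cutF_closed[OF A x]
    have "e S \<odot>\<^bsub>L\<^esub> eps (cutF S 0 x) = eps (cutF S 0 x)"
      using eps.smult[OF e_closed[OF S] cc] idem_cutF[OF A x] by simp
    then obtain c where c: "c \<in> carrier K" "eps (cutF S 0 x) = A.scal c \<odot>\<^bsub>L\<^esub> u"
      using u(1)[OF eps.closed[OF cc]] by blast
    let ?s = "A.scal c \<odot>\<^bsub>F 0\<^esub> ?z"
    have mc: "\<ominus>\<^bsub>K\<^esub> c \<in> carrier K" using c(1) by simp
    \<comment> \<open>\<open>?t\<close> is the negative of \<open>?s\<close>; adding it to
      \<open>x\<close> makes the augmentation vanish on the component \<open>S\<close>, so the sum
      is a boundary.\<close>
    let ?t = "A.scal (\<ominus>\<^bsub>K\<^esub> c) \<odot>\<^bsub>F 0\<^esub> ?z"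
    have s: "van A 0 ?s" and t: "van A 0 ?t" by (rule van_scal[OF A(1) zA c(1)] van_scal[OF A(1) zA mc])+
    have uL: "u \<in> carrier L" using eps.closed[OF y(1)] y(3) by simp
    have "eps (cutF S 0 (x \<oplus>\<^bsub>F 0\<^esub> ?t)) = eps (cutF S 0 x) \<oplus>\<^bsub>L\<^esub> A.scal (\<ominus>\<^bsub>K\<^esub> c) \<odot>\<^bsub>L\<^esub> u"
      using cutF_add[OF A x t] eps.add[OF cc cutF_closed[OF A t]] ez[OF mc] by simp
    also have "\<dots> = ((c \<odot>\<^bsub>\<Lambda>\<^esub> \<one>\<^bsub>\<Lambda>\<^esub>) \<oplus>\<^bsub>\<Lambda>\<^esub> ((\<ominus>\<^bsub>K\<^esub> c) \<odot>\<^bsub>\<Lambda>\<^esub> \<one>\<^bsub>\<Lambda>\<^esub>)) \<odot>\<^bsub>L\<^esub> u"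
      using L.smult_l_distr[OF A.scal_closed[OF c(1)] A.scal_closed[OF mc] uL] c(2) by simp
    also have sc: "(c \<odot>\<^bsub>\<Lambda>\<^esub> \<one>\<^bsub>\<Lambda>\<^esub>) \<oplus>\<^bsub>\<Lambda>\<^esub> ((\<ominus>\<^bsub>K\<^esub> c) \<odot>\<^bsub>\<Lambda>\<^esub> \<one>\<^bsub>\<Lambda>\<^esub>) = \<zero>\<^bsub>\<Lambda>\<^esub>"
      using K\<Lambda>.smult_l_distr[OF c(1) mc \<Lambda>.one_closed] c(1) by (simp add: r_neg)
    finally have "eps (cutF S 0 (x \<oplus>\<^bsub>F 0\<^esub> ?t)) = \<zero>\<^bsub>L\<^esub>" using uL by simp
    then obtain w where w: "van A (Suc 0) w" "x \<oplus>\<^bsub>F 0\<^esub> ?t = d 0 w"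
      using zero_boundary[OF A(1) van_add[OF x t]] by blast
    have "x = ?s \<oplus>\<^bsub>F 0\<^esub> (x \<oplus>\<^bsub>F 0\<^esub> ?t)"
    proof -
      have st: "?s \<oplus>\<^bsub>F 0\<^esub> ?t = \<zero>\<^bsub>F 0\<^esub>"
        using F.smult_l_distr[OF A.scal_closed[OF c(1)] A.scal_closed[OF mc] van_closed[OF zA]] van_closed[OF zA]
        unfolding sc by simp
      have "?s \<oplus>\<^bsub>F 0\<^esub> (x \<oplus>\<^bsub>F 0\<^esub> ?t) = x \<oplus>\<^bsub>F 0\<^esub> (?s \<oplus>\<^bsub>F 0\<^esub> ?t)"
        by (rule F.M.a_lcomm[OF van_closed[OF s] van_closed[OF x] van_closed[OF t]])
      then show ?thesis using st van_closed[OF x] by simp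
    qed
    then show "\<exists>c\<in>carrier K. \<exists>y. van A (Suc 0) y \<and> x = A.scal c \<odot>\<^bsub>F 0\<^esub> ?z \<oplus>\<^bsub>F 0\<^esub> d 0 y"
      using c(1) w by metis
  next
    fix c y assume c: "c \<in> carrier K" and y: "van A (Suc 0) y" and eq: "A.scal c \<odot>\<^bsub>F 0\<^esub> ?z = d 0 y"
    show "c = \<zero>\<^bsub>K\<^esub>" by (rule u(2)[OF c]) (use ez[OF c] eq eps_boundary[OF A y] in simp)
  qed
qed

lemma line_comp:
  assumes A: "A \<subseteq> M" "S \<in> comps T A"
  shows "line_complex K (MC.Y A []) d 0"
proof -
  obtain z where z: "van A 0 z"
    "\<And>x. van A 0 x \<Longrightarrow> \<exists>c\<in>carrier K. \<exists>y. van A (Suc 0) y \<and> x = A.scal c \<odot>\<^bsub>F 0\<^esub> z \<oplus>\<^bsub>F 0\<^esub> d 0 y"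
    "\<And>c y. \<lbrakk>c \<in> carrier K; van A (Suc 0) y; A.scal c \<odot>\<^bsub>F 0\<^esub> z = d 0 y\<rbrakk> \<Longrightarrow> c = \<zero>\<^bsub>K\<^esub>"
    by (rule common_generator[OF A A]) (rule that)
  have "line_at K (MC.Y A []) d 0"
    unfolding line_at_def
    unfolding Bex_def Ball_def Y_van cyc_van using z by (intro exI[of _ z]) (simp add: Bex_def)
  moreover have "acyclic_at (MC.Y A []) d i" if "i \<noteq> 0" for i
    using that acyclic_at_positive[OF A(1)] by (cases i) simp_all
  ultimately show ?thesis by (simp add: line_complex_def)
qed

text \<open>Both complexes have homology at most in degree 0. If \<open>S\<close> is a component for
  neither set, there is none; if it is one for both, a common cycle spans both homologies.\<close>

lemma comps_iso:
  assumes A: "A \<subseteq> M - {b}" and b: "b \<in> M" and same: "S \<in> comps T A \<longleftrightarrow> S \<in> comps T (insert b A)"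
  shows "\<lbrakk>cyc (MC.Y (insert b A) []) d i u; \<exists>y\<in>carrier (MC.Y A [] (Suc i)). u = d i y\<rbrakk> \<Longrightarrow>
      \<exists>v\<in>carrier (MC.Y (insert b A) [] (Suc i)). u = d i v"
    and "cyc (MC.Y A []) d i x \<Longrightarrow>
      \<exists>u y. cyc (MC.Y (insert b A) []) d i u \<and> y \<in> carrier (MC.Y A [] (Suc i)) \<and> x = u \<oplus>\<^bsub>X i\<^esub> d i y"
proof -
  have A': "A \<subseteq> M" "insert b A \<subseteq> M" using A b by auto
  show "\<exists>v\<in>carrier (MC.Y (insert b A) [] (Suc i)). u = d i v"
    if u: "cyc (MC.Y (insert b A) []) d i u" and y: "\<exists>y\<in>carrier (MC.Y A [] (Suc i)). u = d i y"
  proof (cases i)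
    case 0
    obtain y where "van A (Suc 0) y" "u = d 0 y" using y 0 by (auto simp: Y_van)
    then have "\<exists>v. van (insert b A) (Suc 0) v \<and> u = d 0 v"
      using u 0 same eps_boundary[OF A'(1)] by (intro zero_boundary[OF A'(2)]) (simp_all add: cyc_van)
    then show ?thesis using 0 by (auto simp: Y_van)
  next
    case (Suc j)
    then show ?thesis using acyclic_atD[OF acyclic_at_positive[OF A'(2)]] u by blast
  qed
  show "\<exists>u y. cyc (MC.Y (insert b A) []) d i u \<and> y \<in> carrier (MC.Y A [] (Suc i)) \<and> x = u \<oplus>\<^bsub>X i\<^esub> d i y"
    if x: "cyc (MC.Y A []) d i x"
  proof -
    have ac: ?thesis if ac: "acyclic_at (MC.Y A []) d i"
    proof -
      obtain y where y: "y \<in> carrier (MC.Y A [] (Suc i))" "x = d i y" using acyclic_atD[OF ac x] by blast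
      have "x \<in> carrier (F i)" using x by (auto simp: cyc_van intro: van_closed)
      then show ?thesis using y van_zero
        by (intro exI[of _ "\<zero>\<^bsub>F i\<^esub>"] exI[of _ y]) (simp add: cyc_van)
    qed
    show ?thesis
    proof (cases i)
      case (Suc j)
      then show ?thesis using ac acyclic_at_positive[OF A'(1)] by simp
    next
      case 0
      show ?thesis
      proof (cases "S \<in> comps T A")
        case False
        then show ?thesis using ac acyclic_not_comp[OF A'(1)] by (simp add: acyclic_complex_def)
      next
        case True
        obtain z where z: "van A 0 z" "van (insert b A) 0 z"
          "\<And>x. van A 0 x \<Longrightarrow> \<exists>c\<in>carrier K. \<exists>y. van A (Suc 0) y \<and> x = A.scal c \<odot>\<^bsub>F 0\<^esub> z \<oplus>\<^bsub>F 0\<^esub> d 0 y"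
          by (rule common_generator[OF A'(1) True A'(2)]) (use True same that in blast)+
        obtain c y where c: "c \<in> carrier K" "van A (Suc 0) y" "x = A.scal c \<odot>\<^bsub>F 0\<^esub> z \<oplus>\<^bsub>F 0\<^esub> d 0 y"
          using z(3)[of x] x 0 by (auto simp: cyc_van)
        then show ?thesis using van_scal[OF A'(2) z(2) c(1)] 0
          by (intro exI[of _ "A.scal c \<odot>\<^bsub>F 0\<^esub> z"] exI[of _ y]) (simp add: cyc_van Y_van)
      qed
    qed
  qed
qed

text \<open>The list of maximal elements is supplied by the lemma, because an element that makes
  everything cancel is put last.\<close>

lemma koszul_homology:
  obtains Ms where "set Ms = M"
    "if (S, T) \<in> Upsilon_plus P then line_complex K (MC.Y {} Ms) (MC.\<delta> Ms) (omega_plus S T)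
     else acyclic_complex (MC.Y {} Ms) (MC.\<delta> Ms)"
proof -
  have finM: "finite M" using interval_finite[OF T] by (auto simp: max_elements_def)
  note iff = comps_iff[OF T finite_P _ S]
  show thesis
  proof (cases "S \<in> rel_downsets P T \<and> upper_boundary T S \<subseteq> M")
    case False
    \<comment> \<open>No choice of removed elements makes \<open>S\<close> a component, so every
      intersection is acyclic.\<close>
    then have "S \<notin> comps T A" if "A \<subseteq> M" for A using iff[OF that] that by blast
    then have ac: "acyclic_complex (MC.Y A []) d" if "A \<subseteq> M" for A using acyclic_not_comp that by blast
    obtain Ms where Ms: "set Ms = M" using finite_list[OF finM] by blast
    have "acyclic_complex (MC.Y {} (Ms @ [])) (MC.\<delta> (Ms @ []))"
      by (rule MC.acyclic_Y) (use Ms ac in auto)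
    moreover have "(S, T) \<notin> Upsilon_plus P"
      using False max_elements_diff[OF T finite_P] by (auto simp: Upsilon_plus_def max_elements_def)
    ultimately show ?thesis using that[OF Ms] by simp
  next
    case True
    then have D: "S \<in> rel_downsets P T" "upper_boundary T S \<subseteq> M" by auto
    have max: "max_elements (T - S) = M - S" by (rule max_elements_diff[OF T finite_P D(1)])
    have bd: "upper_boundary T S \<subseteq> M - S" using D(2) by (auto simp: upper_boundary_def)
    have comp: "S \<in> comps T A \<longleftrightarrow> A \<inter> S = {} \<and> upper_boundary T S \<subseteq> A" if "A \<subseteq> M" for A
      using iff[OF that] D(1) by blast
    show ?thesis
    proof (cases "upper_boundary T S = M - S")
      case eq: True
      obtain Ms where Ms: "set Ms = M" "distinct Ms" using finite_distinct_list[OF finM] by blast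
      have c: "S \<in> comps T A \<longleftrightarrow> A = M - S" if "A \<subseteq> M" for A using comp[OF that] eq that by blast
      have "if {} \<subseteq> M - S \<and> M - S \<subseteq> {} \<union> set Ms then line_complex K (MC.Y {} Ms) (MC.\<delta> Ms) (card ((M - S) \<inter> set Ms))
          else acyclic_complex (MC.Y {} Ms) (MC.\<delta> Ms)"
        by (rule MC.line_Y) (use Ms c acyclic_not_comp line_comp in auto)
      moreover have "(M - S) \<inter> set Ms = M - S" using Ms(1) by blast
      ultimately have "line_complex K (MC.Y {} Ms) (MC.\<delta> Ms) (omega_plus S T)"
        using Ms(1) max by (simp add: omega_plus_def)
      moreover have "(S, T) \<in> Upsilon_plus P" using T D(1) eq max by (simp add: Upsilon_plus_def)
      ultimately show ?thesis using that[OF Ms(1)] by simp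
    next
      case False
      \<comment> \<open>Adding or removing such a \<open>b\<close> does not affect the conditions
        \<open>A \<inter> S = {}\<close> and \<open>upper_boundary T S \<subseteq> A\<close>, so the
        sets \<open>A\<close> cancel in pairs.\<close>
      then obtain b where b: "b \<in> M" "b \<notin> S" "b \<notin> upper_boundary T S" using bd by blast
      have "finite (M - {b})" using finM by simp
      then obtain bs where bs: "set bs = M - {b}" using finite_list by blast
      have same: "S \<in> comps T A \<longleftrightarrow> S \<in> comps T (insert b A)" if "A \<subseteq> M - {b}" for A
        using comp[of A] comp[of "insert b A"] b that by blast
      have "acyclic_complex (MC.Y {} (bs @ [b])) (MC.\<delta> (bs @ [b]))"
      proof (rule MC.acyclic_Y_of_iso)
        show "set bs \<subseteq> M - {b}" "b \<in> M" using bs b by auto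
        show "\<exists>v\<in>carrier (MC.Y (insert b A) [] (Suc i)). u = d i v"
          if "A \<subseteq> M - {b}" "cyc (MC.Y (insert b A) []) d i u" "\<exists>y\<in>carrier (MC.Y A [] (Suc i)). u = d i y" for A i u
          by (rule comps_iso(1)[OF that(1) b(1) same[OF that(1)] that(2,3)])
        show "\<exists>u y. cyc (MC.Y (insert b A) []) d i u \<and> y \<in> carrier (MC.Y A [] (Suc i)) \<and> x = u \<oplus>\<^bsub>X i\<^esub> d i y"
          if "A \<subseteq> M - {b}" "cyc (MC.Y A []) d i x" for A i x
          by (rule comps_iso(2)[OF that(1) b(1) same[OF that(1)] that(2)])
      qed
      moreover have "set (bs @ [b]) = M" using bs b by auto
      moreover have "(S, T) \<notin> Upsilon_plus P" using False max by (simp add: Upsilon_plus_def)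
      ultimately show ?thesis using that[of "bs @ [b]"] by simp
    qed
  qed
qed

end

section \<open>Cohomology of a dual complex\<close>

text \<open>\<open>\<theta>\<close> identifies \<open>H i\<close> with the dual space of
  \<open>Y i\<close> and makes \<open>dH\<close> the transpose of \<open>d\<close>. A pairing is
  used instead of an equality because the cochains are homomorphisms into the costandard module, not
  functionals.\<close>

locale dual_complex =
  fixes K :: "('k, 'x) ring_scheme" and H :: "nat \<Rightarrow> ('k, 'c) module" and dH :: "nat \<Rightarrow> 'c \<Rightarrow> 'c"
    and Y :: "nat \<Rightarrow> ('k, 'v) module" and d :: "nat \<Rightarrow> 'v \<Rightarrow> 'v" and \<theta> :: "nat \<Rightarrow> 'c \<Rightarrow> 'v \<Rightarrow> 'k"
  assumes field_K: "field K"
    and dH_hom: "lmodule_hom K (H i) (H (Suc i)) (dH i)"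
    and d_hom: "lmodule_hom K (Y (Suc i)) (Y i) (d i)"
    and fin_dim_Y: "fin_dim K (Y i)"
    and dd: "y \<in> carrier (Y (Suc (Suc i))) \<Longrightarrow> d i (d (Suc i) y) = \<zero>\<^bsub>Y i\<^esub>"
    and \<theta>_hom: "f \<in> carrier (H i) \<Longrightarrow> lmodule_hom K (Y i) (regular K) (\<theta> i f)"
    and \<theta>_add: "\<lbrakk>f \<in> carrier (H i); g \<in> carrier (H i); y \<in> carrier (Y i)\<rbrakk> \<Longrightarrow>
      \<theta> i (f \<oplus>\<^bsub>H i\<^esub> g) y = \<theta> i f y \<oplus>\<^bsub>K\<^esub> \<theta> i g y"
    and \<theta>_smult: "\<lbrakk>c \<in> carrier K; f \<in> carrier (H i); y \<in> carrier (Y i)\<rbrakk> \<Longrightarrow>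
      \<theta> i (c \<odot>\<^bsub>H i\<^esub> f) y = c \<otimes>\<^bsub>K\<^esub> \<theta> i f y"
    and \<theta>_inj: "\<lbrakk>f \<in> carrier (H i); \<And>y. y \<in> carrier (Y i) \<Longrightarrow> \<theta> i f y = \<zero>\<^bsub>K\<^esub>\<rbrakk> \<Longrightarrow> f = \<zero>\<^bsub>H i\<^esub>"
    and \<theta>_surj: "lmodule_hom K (Y i) (regular K) G \<Longrightarrow> \<exists>f\<in>carrier (H i). \<forall>y\<in>carrier (Y i). \<theta> i f y = G y"
    and \<theta>_d: "\<lbrakk>f \<in> carrier (H i); y \<in> carrier (Y (Suc i))\<rbrakk> \<Longrightarrow> \<theta> (Suc i) (dH i f) y = \<theta> i f (d i y)"
begin

sublocale K: field K by (rule field_K)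
sublocale H: lmodule K "H i" for i by (rule lmodule_hom.axioms(1)[OF dH_hom])
sublocale Y: lmodule K "Y i" for i by (rule lmodule_hom.axioms(2)[OF d_hom])
sublocale dH: lmodule_hom K "H i" "H (Suc i)" "dH i" for i by (rule dH_hom)
sublocale d: lmodule_hom K "Y (Suc i)" "Y i" "d i" for i by (rule d_hom)

lemmas \<theta>_simps = lmodule_hom.closed[OF \<theta>_hom, simplified] lmodule_hom.add[OF \<theta>_hom, simplified]
  lmodule_hom.smult[OF \<theta>_hom, simplified]

lemma \<theta>_arg_zero: "f \<in> carrier (H i) \<Longrightarrow> \<theta> i f \<zero>\<^bsub>Y i\<^esub> = \<zero>\<^bsub>K\<^esub>"
  using lmodule_hom.zero[OF \<theta>_hom] by simp

lemma \<theta>_zero: "y \<in> carrier (Y i) \<Longrightarrow> \<theta> i \<zero>\<^bsub>H i\<^esub> y = \<zero>\<^bsub>K\<^esub>"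
  using \<theta>_smult[of "\<zero>\<^bsub>K\<^esub>" "\<zero>\<^bsub>H i\<^esub>" i y] \<theta>_simps(1)[of "\<zero>\<^bsub>H i\<^esub>" i y] by simp

lemma \<theta>_eqI:
  assumes fg: "f \<in> carrier (H i)" "g \<in> carrier (H i)" and eq: "\<And>y. y \<in> carrier (Y i) \<Longrightarrow> \<theta> i f y = \<theta> i g y"
  shows "f = g"
proof -
  have m: "\<ominus>\<^bsub>K\<^esub> \<one>\<^bsub>K\<^esub> \<in> carrier K" by simp
  have "f \<oplus>\<^bsub>H i\<^esub> (\<ominus>\<^bsub>K\<^esub> \<one>\<^bsub>K\<^esub>) \<odot>\<^bsub>H i\<^esub> g = \<zero>\<^bsub>H i\<^esub>"
  proof (rule \<theta>_inj)
    show "f \<oplus>\<^bsub>H i\<^esub> (\<ominus>\<^bsub>K\<^esub> \<one>\<^bsub>K\<^esub>) \<odot>\<^bsub>H i\<^esub> g \<in> carrier (H i)" using fg by simp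
    fix y assume y: "y \<in> carrier (Y i)"
    have "\<theta> i (f \<oplus>\<^bsub>H i\<^esub> (\<ominus>\<^bsub>K\<^esub> \<one>\<^bsub>K\<^esub>) \<odot>\<^bsub>H i\<^esub> g) y = \<theta> i f y \<oplus>\<^bsub>K\<^esub> (\<ominus>\<^bsub>K\<^esub> \<one>\<^bsub>K\<^esub>) \<otimes>\<^bsub>K\<^esub> \<theta> i g y"
      using \<theta>_add[OF fg(1) H.smult_closed[OF m fg(2)] y] \<theta>_smult[OF m fg(2) y] by simp
    then show "\<theta> i (f \<oplus>\<^bsub>H i\<^esub> (\<ominus>\<^bsub>K\<^esub> \<one>\<^bsub>K\<^esub>) \<odot>\<^bsub>H i\<^esub> g) y = \<zero>\<^bsub>K\<^esub>"
      using eq[OF y] \<theta>_simps(1)[OF fg(2) y] by (simp add: K.l_minus K.r_neg)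
  qed
  then have "f \<ominus>\<^bsub>H i\<^esub> g = \<zero>\<^bsub>H i\<^esub>" using fg by (simp add: H.minus_one_smult a_minus_def)
  then show ?thesis using fg by simp
qed

definition Z where "Z i = {z \<in> carrier (H i). dH i z = \<zero>\<^bsub>H (Suc i)\<^esub>}"
definition B where "B i = (case i of 0 \<Rightarrow> {\<zero>\<^bsub>H 0\<^esub>} | Suc j \<Rightarrow> dH j ` carrier (H j))"

lemma Z_iff: "f \<in> Z i \<longleftrightarrow> f \<in> carrier (H i) \<and> (\<forall>y\<in>carrier (Y (Suc i)). \<theta> i f (d i y) = \<zero>\<^bsub>K\<^esub>)"
proof -
  have "dH i f = \<zero>\<^bsub>H (Suc i)\<^esub> \<longleftrightarrow> (\<forall>y\<in>carrier (Y (Suc i)). \<theta> i f (d i y) = \<zero>\<^bsub>K\<^esub>)" if f: "f \<in> carrier (H i)"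
  proof
    assume "dH i f = \<zero>\<^bsub>H (Suc i)\<^esub>"
    then show "\<forall>y\<in>carrier (Y (Suc i)). \<theta> i f (d i y) = \<zero>\<^bsub>K\<^esub>" using \<theta>_d[OF f] \<theta>_zero by simp
  next
    assume "\<forall>y\<in>carrier (Y (Suc i)). \<theta> i f (d i y) = \<zero>\<^bsub>K\<^esub>"
    then show "dH i f = \<zero>\<^bsub>H (Suc i)\<^esub>" using \<theta>_d[OF f] f by (intro \<theta>_inj) simp_all
  qed
  then show ?thesis by (auto simp: Z_def)
qed

text \<open>A functional that vanishes on cycles factors through the differential by
  \<open>functional_factor\<close>, which uses finite dimension. In degree 0 every element is a
  cycle, in accordance with the zero coboundaries there.\<close>

lemma B_iff: "f \<in> B i \<longleftrightarrow> f \<in> carrier (H i) \<and> (\<forall>y. cyc Y d i y \<longrightarrow> \<theta> i f y = \<zero>\<^bsub>K\<^esub>)"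
proof (cases i)
  case 0
  then show ?thesis using \<theta>_inj[of f 0] \<theta>_zero[of _ 0] by (auto simp: B_def cyc_def)
next
  case (Suc j)
  show ?thesis
  proof
    assume "f \<in> B i"
    then obtain g where g: "g \<in> carrier (H j)" "f = dH j g" using Suc by (auto simp: B_def)
    have "\<theta> i f y = \<zero>\<^bsub>K\<^esub>" if "cyc Y d i y" for y
      using that g Suc \<theta>_d[OF g(1)] \<theta>_arg_zero[OF g(1)] by (simp add: cyc_def)
    then show "f \<in> carrier (H i) \<and> (\<forall>y. cyc Y d i y \<longrightarrow> \<theta> i f y = \<zero>\<^bsub>K\<^esub>)" using g Suc by simp
  next
    assume f: "f \<in> carrier (H i) \<and> (\<forall>y. cyc Y d i y \<longrightarrow> \<theta> i f y = \<zero>\<^bsub>K\<^esub>)"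
    then have fh: "f \<in> carrier (H (Suc j))" using Suc by simp
    obtain G where G: "lmodule_hom K (Y j) (regular K) G" "\<And>y. y \<in> carrier (Y (Suc j)) \<Longrightarrow> G (d j y) = \<theta> (Suc j) f y"
    proof (rule functional_factor[OF field_K d_hom fin_dim_Y \<theta>_hom[OF fh]])
      show "\<theta> (Suc j) f y = \<zero>\<^bsub>K\<^esub>" if "y \<in> carrier (Y (Suc j))" "d j y = \<zero>\<^bsub>Y j\<^esub>" for y
        using f that Suc by (simp add: cyc_def)
    qed (rule that)
    obtain g where g: "g \<in> carrier (H j)" "\<forall>y\<in>carrier (Y j). \<theta> j g y = G y" using \<theta>_surj[OF G(1)] by blast
    have "f = dH j g"
      by (rule \<theta>_eqI[OF fh dH.closed[OF g(1)]]) (use g(2) G(2) \<theta>_d[OF g(1)] in simp)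
    then show "f \<in> B i" using g(1) Suc by (simp add: B_def)
  qed
qed

lemma B_Z: "B i \<subseteq> Z i"
proof
  fix f assume "f \<in> B i"
  then have f: "f \<in> carrier (H i)" "\<And>y. cyc Y d i y \<Longrightarrow> \<theta> i f y = \<zero>\<^bsub>K\<^esub>" by (simp_all add: B_iff)
  have "cyc Y d i (d i y)" if "y \<in> carrier (Y (Suc i))" for y using that dd by (auto simp: cyc_def)
  then show "f \<in> Z i" using f by (simp add: Z_iff)
qed

lemma lquotient_cohomology: "lquotient K (H i\<lparr>carrier := Z i\<rparr>) (B i)"
proof (rule H.lquotient_sub)
  show "submodule (Z i) K (H i)" unfolding Z_def by (rule dH.kernel_submodule)
  show "submodule (B i) K (H i)"
  proof (cases i)
    case (Suc j)
    then show ?thesis using dH.image_submodule[OF H.carrier_submodule] by (simp add: B_def)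
  qed (simp add: B_def H.zero_submodule)
qed (rule B_Z)

lemma cohomology_eq: "cohomology H dH i = quot_module (H i\<lparr>carrier := Z i\<rparr>) (B i)"
  by (simp add: cohomology_def subquotient_def Z_def B_def)

lemma cohomology_acyclic:
  assumes "acyclic_at Y d i"
  shows "carrier (cohomology H dH i) = {\<zero>\<^bsub>cohomology H dH i\<^esub>}"
proof -
  interpret Q: lquotient K "H i\<lparr>carrier := Z i\<rparr>" "B i" by (rule lquotient_cohomology)
  have ZB: "f \<in> B i" if "f \<in> Z i" for f
    unfolding B_iff using that acyclic_atD[OF assms] by (auto simp: Z_iff)
  have z: "\<zero>\<^bsub>H i\<^esub> \<in> Z i" by (simp add: Z_def)
  have "B i +>\<^bsub>H i\<lparr>carrier := Z i\<rparr>\<^esub> f = B i" if "f \<in> Z i" for f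
    using Q.coset_eq_zero_iff[of f] that ZB[OF that] by (simp add: quot_module_simps)
  then have "(\<lambda>f. B i +>\<^bsub>H i\<lparr>carrier := Z i\<rparr>\<^esub> f) ` Z i = {B i}" using z by auto
  then show ?thesis by (simp add: cohomology_eq Q.carrier_quot quot_module_simps)
qed

text \<open>Evaluation at the generating cycle \<open>z\<close> gives the isomorphism. It is onto
  because a functional can separate \<open>z\<close> from the boundaries, and its kernel consists of
  the cocycles that vanish on all cycles, i.e. the coboundaries.\<close>

lemma cohomology_line:
  assumes "line_at K Y d i"
  shows "cohomology H dH i \<simeq>\<^bsub>K\<^esub> regular K"
proof -
  interpret Q: lquotient K "H i\<lparr>carrier := Z i\<rparr>" "B i" by (rule lquotient_cohomology)
  obtain z where z: "cyc Y d i z"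
    "\<forall>x. cyc Y d i x \<longrightarrow> (\<exists>c\<in>carrier K. \<exists>y\<in>carrier (Y (Suc i)). x = c \<odot>\<^bsub>Y i\<^esub> z \<oplus>\<^bsub>Y i\<^esub> d i y)"
    "\<forall>c\<in>carrier K. \<forall>y\<in>carrier (Y (Suc i)). c \<odot>\<^bsub>Y i\<^esub> z = d i y \<longrightarrow> c = \<zero>\<^bsub>K\<^esub>"
    using assms unfolding line_at_def by blast
  have zY: "z \<in> carrier (Y i)" using z(1) by (simp add: cyc_def)
  have ZH: "f \<in> carrier (H i)" if "f \<in> Z i" for f using that by (simp add: Z_def)
  show ?thesis
    unfolding cohomology_eq
  proof (rule Q.quot_iso)
    show hom: "lmodule_hom K (H i\<lparr>carrier := Z i\<rparr>) (regular K) (\<lambda>f. \<theta> i f z)"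
      by (intro lmodule_hom.intro lmodule_hom_axioms.intro Q.lmodule_axioms lmodule_regular K.ring_axioms)
        (use zY \<theta>_add \<theta>_smult \<theta>_simps(1) in \<open>simp_all add: ZH\<close>)
    have image: "submodule (d i ` carrier (Y (Suc i))) K (Y i)" by (rule d.image_submodule[OF Y.carrier_submodule])
    have "z \<notin> d i ` carrier (Y (Suc i))"
    proof
      assume "z \<in> d i ` carrier (Y (Suc i))"
      then have "\<exists>y\<in>carrier (Y (Suc i)). \<one>\<^bsub>K\<^esub> \<odot>\<^bsub>Y i\<^esub> z = d i y" using zY by auto
      then show False using z(3) K.one_closed K.one_not_zero by blast
    qed
    then obtain G where G: "lmodule_hom K (Y i) (regular K) G"
      "\<And>u. u \<in> d i ` carrier (Y (Suc i)) \<Longrightarrow> G u = \<zero>\<^bsub>K\<^esub>" "G z = \<one>\<^bsub>K\<^esub>"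
      by (rule functional_separate[OF field_K Y.lmodule_axioms fin_dim_Y image zY]) (rule that)
    obtain g where g: "g \<in> carrier (H i)" "\<forall>y\<in>carrier (Y i). \<theta> i g y = G y" using \<theta>_surj[OF G(1)] by blast
    have gZ: "g \<in> Z i" using g G(2) by (simp add: Z_iff)
    have "c \<in> (\<lambda>f. \<theta> i f z) ` Z i" if c: "c \<in> carrier K" for c
    proof (rule image_eqI)
      show "c = \<theta> i (c \<odot>\<^bsub>H i\<^esub> g) z" using \<theta>_smult[OF c g(1) zY] g(2) zY G(3) c by simp
      show "c \<odot>\<^bsub>H i\<^esub> g \<in> Z i" using Q.smult_closed[of c g] c gZ by simp
    qed
    then show "(\<lambda>f. \<theta> i f z) ` carrier (H i\<lparr>carrier := Z i\<rparr>) = carrier (regular K)"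
      using zY \<theta>_simps(1) ZH by auto
    show "\<theta> i f z = \<zero>\<^bsub>regular K\<^esub> \<longleftrightarrow> f \<in> B i" if f: "f \<in> carrier (H i\<lparr>carrier := Z i\<rparr>)" for f
    proof
      assume 0: "\<theta> i f z = \<zero>\<^bsub>regular K\<^esub>"
      have fZ: "f \<in> Z i" using f by simp
      have "\<theta> i f x = \<zero>\<^bsub>K\<^esub>" if x: "cyc Y d i x" for x
      proof -
        obtain c y where "c \<in> carrier K" "y \<in> carrier (Y (Suc i))" "x = c \<odot>\<^bsub>Y i\<^esub> z \<oplus>\<^bsub>Y i\<^esub> d i y"
          using spec[OF z(2), of x, THEN mp, OF x] by (elim bexE) (rule that)
        then show ?thesis using 0 zY fZ ZH[OF fZ] by (simp add: \<theta>_simps Z_iff)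
      qed
      then show "f \<in> B i" using ZH[OF fZ] by (simp add: B_iff)
    qed (use z(1) in \<open>simp add: B_iff\<close>)
  qed
qed

end

section \<open>Computation of Ext\<close>

lemma hom_space_simps:
  "carrier (hom_space A M N) = lin_hom A M N" "zero (hom_space A M N) = (\<lambda>x\<in>carrier M. \<zero>\<^bsub>N\<^esub>)"
  "f \<oplus>\<^bsub>hom_space A M N\<^esub> g = (\<lambda>x\<in>carrier M. f x \<oplus>\<^bsub>N\<^esub> g x)"
  "c \<odot>\<^bsub>hom_space A M N\<^esub> f = (\<lambda>x\<in>carrier M. (c \<odot>\<^bsub>A\<^esub> \<one>\<^bsub>A\<^esub>) \<odot>\<^bsub>N\<^esub> f x)"
  by (simp_all add: hom_space_def)

context fd_algebra
begin

lemma lmodule_hom_space: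
  assumes "lmodule A M" "lmodule A N"
  shows "lmodule K (hom_space A M N)"
proof -
  interpret M: lmodule A M by fact
  interpret N: lmodule A N by fact
  let ?D = "dsum (carrier M) (\<lambda>_. res_module A N)"
  interpret D: lmodule K ?D by (intro lmodule_dsum R.ring_axioms lmodule_res N.lmodule_axioms)
  have "submodule (lin_hom A M N) K ?D"
    unfolding D.submodule_iff
  proof (intro conjI ballI)
    show "lin_hom A M N \<subseteq> carrier ?D" by (auto simp: dsum_simps lin_hom_def)
    show "\<zero>\<^bsub>?D\<^esub> \<in> lin_hom A M N" by (rule lin_homI) (simp_all add: dsum_simps)
    show "f \<oplus>\<^bsub>?D\<^esub> g \<in> lin_hom A M N" if f: "f \<in> lin_hom A M N" and g: "g \<in> lin_hom A M N" for f g
      by (rule lin_homI)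
        (use lin_homD(2-)[OF f] lin_homD(2-)[OF g] in \<open>simp_all add: dsum_simps N.M.a_ac N.smult_r_distr\<close>)
    show "c \<odot>\<^bsub>?D\<^esub> f \<in> lin_hom A M N" if c: "c \<in> carrier K" and f: "f \<in> lin_hom A M N" for c f
    proof (rule lin_homI)
      fix r x assume "r \<in> carrier A" "x \<in> carrier M"
      then show "(c \<odot>\<^bsub>?D\<^esub> f) (r \<odot>\<^bsub>M\<^esub> x) = r \<odot>\<^bsub>N\<^esub> (c \<odot>\<^bsub>?D\<^esub> f) x"
        using c lin_homD(2-)[OF f] by (simp add: dsum_simps scal_mult mult_scal flip: N.smult_assoc)
    qed (use c lin_homD(2-)[OF f] in \<open>simp_all add: dsum_simps N.smult_r_distr\<close>)
  qed
  moreover have "hom_space A M N = ?D\<lparr>carrier := lin_hom A M N\<rparr>"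
    by (simp add: hom_space_def dsum_def)
  ultimately show ?thesis using D.lmodule_restrict by simp
qed

lemma compose_hom:
  assumes "lmodule A M'" "lmodule A M" "lmodule A N" and d: "d \<in> lin_hom A M' M"
  shows "lmodule_hom K (hom_space A M N) (hom_space A M' N) (\<lambda>f. compose (carrier M') f d)"
proof (intro lmodule_hom.intro lmodule_hom_axioms.intro lmodule_hom_space assms(1-3))
  note dD = lin_homD[OF d]
  interpret M': lmodule A M' by fact
  show "compose (carrier M') f d \<in> carrier (hom_space A M' N)" if "f \<in> carrier (hom_space A M N)" for f
    unfolding hom_space_simps
    by (rule lin_homI) (use dD(2-) lin_homD(2-)[OF that[unfolded hom_space_simps]] in \<open>simp_all add: compose_def\<close>)
qed (use lin_homD(2)[OF d] in \<open>auto simp: hom_space_simps compose_def intro!: restrict_ext\<close>)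

end

context resolution_setup
begin

abbreviation N where "N \<equiv> costandard K P T"

sublocale N: lmodule \<Lambda> N by (rule lmodule_costandard[OF T])
sublocale I: lmodule \<Lambda> "Inj T" by (rule lmodule_Inj[OF T])

lemma N_simps: "carrier N = nabla_carrier T" "zero N = zero (Inj T)" "add N = add (Inj T)" "smult N = smult (Inj T)"
  by (simp_all add: costandard_eq[OF T])

abbreviation eA where "eA \<equiv> A.E (e T)"

lemma idem_ET: "e T \<in> eA"
  using T by (simp add: ET_iff)

lemma ET_X: "\<lbrakk>v \<in> eA; x \<in> carrier (F i)\<rbrakk> \<Longrightarrow> v \<odot>\<^bsub>F i\<^esub> x \<in> carrier (X i)"
  using T by (simp add: X_mem ET_iff[OF T] flip: F.smult_assoc)

section \<open>Homomorphisms into the costandard module as functionals\<close>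

context
  fixes i f assumes f: "f \<in> lin_hom \<Lambda> (F i) N"
begin

lemma value_Inj: "x \<in> carrier (F i) \<Longrightarrow> f x \<in> carrier (Inj T)"
  using lin_homD(2)[OF f] by (simp add: N_simps(1) nabla_carrier_def)

lemma value_smult: "\<lbrakk>x \<in> carrier (F i); a \<in> carrier \<Lambda>; v \<in> eA\<rbrakk> \<Longrightarrow> f (a \<odot>\<^bsub>F i\<^esub> x) v = f x (v \<otimes>\<^bsub>\<Lambda>\<^esub> a)"
  using lin_homD(4)[OF f] by (simp add: N_simps Inj_simps(4)[OF T])

lemma value_idem: "\<lbrakk>x \<in> carrier (F i); v \<in> eA\<rbrakk> \<Longrightarrow> f (v \<odot>\<^bsub>F i\<^esub> x) (e T) = f x v"
  using value_smult idem_ET by (simp add: ET_iff[OF T])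

text \<open>The adjunction between homomorphisms into the dual of \<open>e T \<Lambda>\<close> and
  functionals on \<open>e T F\<close>: by \<open>value_idem\<close> a homomorphism is determined by
  its values at \<open>e T\<close>.\<close>

lemma eval_hom: "lmodule_hom K (X i) (regular K) (\<lambda>x. f x (e T))"
proof (intro lmodule_hom.intro lmodule_hom_axioms.intro X_lmodule lmodule_regular)
  show "f (x \<oplus>\<^bsub>X i\<^esub> y) (e T) = f x (e T) \<oplus>\<^bsub>regular K\<^esub> f y (e T)"
    if "x \<in> carrier (X i)" "y \<in> carrier (X i)" for x y
    using that lin_homD(3)[OF f, of x y] idem_ET by (simp add: X_mem N_simps Inj_simps(3)[OF T])
  show "f (c \<odot>\<^bsub>X i\<^esub> x) (e T) = c \<odot>\<^bsub>regular K\<^esub> f x (e T)" if "c \<in> carrier K" "x \<in> carrier (X i)" for c x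
    using that lin_homD(4)[OF f A.scal_closed[OF that(1)], of x] value_Inj[of x] idem_ET
      A.scal_dual[OF e_closed[OF T] that(1), folded Inj_eq[OF T]] by (simp add: X_mem N_simps)
  show "f x (e T) \<in> carrier (regular K)" if "x \<in> carrier (X i)" for x
    using InjD(2)[OF T value_Inj idem_ET] that by (simp add: X_mem)
qed (rule cring.axioms(1)[OF domain.axioms(1)[OF field.axioms(1)[OF A.field_K]]])

text \<open>\<open>q b i x\<close> vanishes at the maximal element \<open>b\<close>, so it is a sum
  of pieces through the components of \<open>T - {b}\<close>. These are proper downsets, which the
  functionals in the costandard module ignore.\<close>

lemma eval_q:
  assumes b: "b \<in> M" and x: "x \<in> carrier (X i)"
  shows "f (q b i x) (e T) = \<zero>\<^bsub>K\<^esub>"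
proof -
  interpret h: lmodule_hom K "X i" "regular K" "\<lambda>x. f x (e T)" by (rule eval_hom)
  let ?z = "\<lambda>C. cutF C i (q b i x)"
  have bM: "{b} \<subseteq> M" using b by simp
  have v: "van {b} i (q b i x)" using van_q x by (simp add: X_mem)
  note zc = cutF_closed[OF bM _ v]
  have pX: "prF C i (?z C) \<in> carrier (X i)" if "C \<in> comps T {b}" for C
    using van_prF[OF bM that zc[OF that]] by (simp add: van_iff)
  have p0: "f (prF C i (?z C)) (e T) = \<zero>\<^bsub>K\<^esub>" if C: "C \<in> comps T {b}" for C
  proof -
    have CD: "C \<in> rel_downsets P T" and "C \<noteq> T"
      using C compsD[OF bM C] comps_iff[OF T finite_P bM] b by (auto simp: max_elements_def)
    moreover have "f (?z C) \<in> nabla_carrier T" using lin_homD(2)[OF f zc[OF C]] by (simp add: N_simps)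
    ultimately have "f (?z C) (proj_to T C \<otimes>\<^bsub>\<Lambda>\<^esub> \<one>\<^bsub>\<Lambda>\<^esub>) = \<zero>\<^bsub>K\<^esub>" by (simp add: nabla_carrier_def)
    moreover have "e T \<otimes>\<^bsub>\<Lambda>\<^esub> proj_to T C = proj_to T C"
      using proj_to_ET[OF T CD \<Lambda>.one_closed] proj_to_closed[OF T CD] by (simp add: ET_iff[OF T])
    ultimately show ?thesis
      using value_smult[OF zc[OF C] proj_to_closed[OF T CD] idem_ET] proj_to_closed[OF T CD] by (simp add: prF_def)
  qed
  have "f (\<Oplus>\<^bsub>F i\<^esub>C\<in>comps T {b}. prF C i (?z C)) (e T) = (\<Oplus>\<^bsub>regular K\<^esub>C\<in>comps T {b}. f (prF C i (?z C)) (e T))"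
    by (rule finsum_additive_on(2)[OF F.M.abelian_monoid_axioms h.N.M.abelian_monoid_axioms, where N = "carrier (X i)"])
      (use MC.X.M.zero_closed MC.X.M.a_closed h.closed h.add h.zero pX finite_comps[OF T finite_P] in \<open>auto simp: X_mem\<close>)
  also have "\<dots> = \<zero>\<^bsub>K\<^esub>" using p0 h.N.M.finsum_zero by (simp cong: h.N.M.finsum_cong)
  finally show ?thesis using decomposeF[OF bM v] by simp
qed

text \<open>By \<open>eval_q\<close> each factor of \<open>r\<close> changes the argument by
  something the functional kills; so the functional descends to the quotient represented by
  \<open>Y\<close>.\<close>

lemma eval_r: "\<lbrakk>set bs \<subseteq> M; x \<in> carrier (X i)\<rbrakk> \<Longrightarrow> f (MC.r bs i x) (e T) = f x (e T)"
proof (induction bs)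
  case (Cons b bs)
  interpret h: lmodule_hom K "X i" "regular K" "\<lambda>x. f x (e T)" by (rule eval_hom)
  have m: "\<ominus>\<^bsub>K\<^esub> \<one>\<^bsub>K\<^esub> \<in> carrier K" by simp
  have b: "b \<in> M" "set bs \<subseteq> M" using Cons.prems by auto
  note rc = MC.r_closed[OF b(2) Cons.prems(2)]
  note qc = MC.q_closed[OF b(1) rc]
  show ?case
    using h.add[OF rc MC.X.smult_closed[OF m qc]] h.smult[OF m qc] eval_q[OF b(1) rc] Cons h.closed[OF rc] b(2) m
    by simp
qed simp

end

lemma functional_lift:
  assumes \<gamma>: "lmodule_hom K (X i) (regular K) \<gamma>" and Gq: "\<And>b x. \<lbrakk>b \<in> M; x \<in> carrier (X i)\<rbrakk> \<Longrightarrow> \<gamma> (q b i x) = \<zero>\<^bsub>K\<^esub>"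
  obtains f where "f \<in> lin_hom \<Lambda> (F i) N" "\<And>x. x \<in> carrier (X i) \<Longrightarrow> f x (e T) = \<gamma> x"
proof -
  interpret \<gamma>: lmodule_hom K "X i" "regular K" \<gamma> by fact
  \<comment> \<open>The inverse of the adjunction; this formula is forced by
    \<open>value_idem\<close>.\<close>
  define f where "f = (\<lambda>x\<in>carrier (F i). \<lambda>v\<in>eA. \<gamma> (v \<odot>\<^bsub>F i\<^esub> x))"
  note ETs = K\<Lambda>.submoduleD[OF A.E_submodule[OF e_closed[OF T]]]
  have ETc: "v \<in> carrier \<Lambda>" if "v \<in> eA" for v using that by (simp add: ET_iff[OF T])
  have ETm: "v \<otimes>\<^bsub>\<Lambda>\<^esub> a \<in> eA" if "v \<in> eA" "a \<in> carrier \<Lambda>" for v a using A.E_mult[OF e_closed[OF T] that] .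
  have fI: "f x \<in> carrier (Inj T)" if x: "x \<in> carrier (F i)" for x
    unfolding Inj_eq[OF T]
  proof (rule A.dualI[OF e_closed[OF T]])
    show "f x \<in> extensional eA" using x by (simp add: f_def)
    show "f x v \<in> carrier K" if "v \<in> eA" for v using \<gamma>.closed[OF ET_X[OF that x]] x that by (simp add: f_def)
    show "f x (v \<oplus>\<^bsub>\<Lambda>\<^esub> w) = f x v \<oplus>\<^bsub>K\<^esub> f x w" if "v \<in> eA" "w \<in> eA" for v w
      using \<gamma>.add[OF ET_X[OF that(1) x] ET_X[OF that(2) x]] x that ETs(3)[OF that] ETc
      by (simp add: f_def F.smult_l_distr)
    show "f x (c \<odot>\<^bsub>\<Lambda>\<^esub> v) = c \<otimes>\<^bsub>K\<^esub> f x v" if c: "c \<in> carrier K" and v: "v \<in> eA" for c v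
      using \<gamma>.smult[OF c ET_X[OF v x]] x v ETs(4)[OF c v] ETc[OF v] A.scal_closed[OF c]
      by (simp add: f_def A.scal_mult[OF c] flip: F.smult_assoc)
  qed
  have fN: "f x \<in> carrier N" if x: "x \<in> carrier (F i)" for x
    unfolding N_simps nabla_carrier_def
  proof (intro CollectI conjI ballI impI)
    fix C h assume C: "C \<in> rel_downsets P T" "C \<noteq> T" and h: "h \<in> carrier \<Lambda>"
    let ?w = "proj_to T C \<otimes>\<^bsub>\<Lambda>\<^esub> h"
    have "C \<subseteq> T" using C(1) by (simp add: rel_downsets_def)
    then obtain t where t: "t \<in> T" "t \<notin> C" using C(2) by blast
    obtain m where m: "m \<in> M" "t \<le> m" using finite_le_max[OF interval_finite[OF T] t(1)] by blast
    have mC: "m \<notin> C" using C(1) t m(2) by (auto simp: rel_downsets_def)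
    have wE: "?w \<in> eA" by (rule proj_to_ET[OF T C(1) h])
    \<comment> \<open>\<open>C\<close> is a downset missing \<open>t\<close>, so it misses the
      maximal element \<open>m\<close> above \<open>t\<close>. Hence the product vanishes at
      \<open>m\<close> and is fixed by \<open>q m i\<close>, and \<open>\<gamma>\<close> kills
      it.\<close>
    have "q m i (?w \<odot>\<^bsub>F i\<^esub> x) = ?w \<odot>\<^bsub>F i\<^esub> x"
      unfolding q_eq_iff[OF ET_X[OF wE x]]
    proof (intro allI impI)
      fix j R assume j: "j < n i"
      then have xj: "x j \<in> carrier \<Lambda>" using x by (simp add: F_mem)
      have "cf (proj_to T C \<otimes>\<^bsub>\<Lambda>\<^esub> (h \<otimes>\<^bsub>\<Lambda>\<^esub> x j)) m T R = \<zero>\<^bsub>K\<^esub>"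
        using cf_proj_to_mult[OF T C(1)] h xj mC by simp
      then show "cf ((?w \<odot>\<^bsub>F i\<^esub> x) j) m T R = \<zero>\<^bsub>K\<^esub>"
        using j xj h proj_to_closed[OF T C(1)] by (simp add: F_smult \<Lambda>.m_assoc)
    qed
    then show "f x ?w = \<zero>\<^bsub>K\<^esub>" using Gq[OF m(1) ET_X[OF wE x]] x wE by (simp add: f_def)
  qed (rule fI[OF x])
  have "f \<in> lin_hom \<Lambda> (F i) N"
  proof (rule lin_homI)
    show "f \<in> extensional (carrier (F i))" by (simp add: f_def)
    fix x assume x: "x \<in> carrier (F i)"
    show "f x \<in> carrier N" by (rule fN[OF x])
    show "f (x \<oplus>\<^bsub>F i\<^esub> y) = f x \<oplus>\<^bsub>N\<^esub> f y" if y: "y \<in> carrier (F i)" for y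
    proof -
      have "\<gamma> (v \<odot>\<^bsub>F i\<^esub> (x \<oplus>\<^bsub>F i\<^esub> y)) = \<gamma> (v \<odot>\<^bsub>F i\<^esub> x) \<oplus>\<^bsub>K\<^esub> \<gamma> (v \<odot>\<^bsub>F i\<^esub> y)" if v: "v \<in> eA" for v
        using \<gamma>.add[OF ET_X[OF v x] ET_X[OF v y]] x y ETc[OF v] by (simp add: F.smult_r_distr)
      then show ?thesis unfolding N_simps Inj_simps[OF T] using x y by (simp add: f_def cong: restrict_cong)
    qed
    show "f (a \<odot>\<^bsub>F i\<^esub> x) = a \<odot>\<^bsub>N\<^esub> f x" if a: "a \<in> carrier \<Lambda>" for a
    proof -
      have "\<gamma> (v \<odot>\<^bsub>F i\<^esub> (a \<odot>\<^bsub>F i\<^esub> x)) = f x (v \<otimes>\<^bsub>\<Lambda>\<^esub> a)" if v: "v \<in> eA" for v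
        using x a ETc[OF v] ETm[OF v a] by (simp add: f_def F.smult_assoc)
      then show ?thesis unfolding N_simps Inj_simps[OF T] using x a by (simp add: f_def[of] cong: restrict_cong)
    qed
  qed
  moreover have "f x (e T) = \<gamma> x" if "x \<in> carrier (X i)" for x
    using that idem_ET by (simp add: f_def X_mem)
  ultimately show thesis by (rule that)
qed

lemma dual_complex_Y:
  assumes Ms: "set Ms = M"
  shows "dual_complex K (\<lambda>i. hom_space \<Lambda> (F i) N) (\<lambda>i f. compose (carrier (F (Suc i))) f (d i))
    (MC.Y {} Ms) (MC.\<delta> Ms) (\<lambda>i f y. f y (e T))"
proof (rule dual_complex.intro)
  have sM: "set Ms \<subseteq> M" using Ms by simp
  have YX: "y \<in> carrier (X i)" if "y \<in> carrier (MC.Y {} Ms i)" for y i using that by (simp add: MC.Y_carrier)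
  have YF: "y \<in> carrier (F i)" if "y \<in> carrier (MC.Y {} Ms i)" for y i using YX[OF that] by (simp add: X_mem)
  note YM = MC.Y_submodule[OF empty_subsetI sM]
  show "field K" by (rule A.field_K)
  show "lmodule_hom K (hom_space \<Lambda> (F i) N) (hom_space \<Lambda> (F (Suc i)) N) (\<lambda>f. compose (carrier (F (Suc i))) f (d i))" for i
    by (intro A.compose_hom F.lmodule_axioms N.lmodule_axioms d_lin)
  show "lmodule_hom K (MC.Y {} Ms (Suc i)) (MC.Y {} Ms i) (MC.\<delta> Ms i)" for i
    by (rule MC.\<delta>_hom[OF empty_subsetI sM])
  show "fin_dim K (MC.Y {} Ms i)" for i
    using fin_dim_subspace[OF fin_dim_X YM X_lmodule] by (simp flip: MC.Y_eq)
  show "MC.\<delta> Ms i (MC.\<delta> Ms (Suc i) y) = \<zero>\<^bsub>MC.Y {} Ms i\<^esub>" if "y \<in> carrier (MC.Y {} Ms (Suc (Suc i)))" for y i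
    using MC.\<delta>\<delta>[OF sM YX[OF that]] by simp
  show "lmodule_hom K (MC.Y {} Ms i) (regular K) (\<lambda>y. f y (e T))" if f: "f \<in> carrier (hom_space \<Lambda> (F i) N)" for f i
  proof -
    interpret h: lmodule_hom K "X i" "regular K" "\<lambda>x. f x (e T)"
      by (rule eval_hom) (use f in \<open>simp add: hom_space_simps\<close>)
    show ?thesis
      by (intro lmodule_hom.intro lmodule_hom_axioms.intro MC.Y_lmodule sM empty_subsetI h.N.lmodule_axioms)
        (use YX h.closed h.add h.smult in simp_all)
  qed
  show "(f \<oplus>\<^bsub>hom_space \<Lambda> (F i) N\<^esub> g) y (e T) = f y (e T) \<oplus>\<^bsub>K\<^esub> g y (e T)" if "y \<in> carrier (MC.Y {} Ms i)" for f g y i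
    using YF[OF that] idem_ET by (simp add: hom_space_simps N_simps Inj_simps(3)[OF T])
  show "(c \<odot>\<^bsub>hom_space \<Lambda> (F i) N\<^esub> f) y (e T) = c \<otimes>\<^bsub>K\<^esub> f y (e T)"
    if "c \<in> carrier K" "f \<in> carrier (hom_space \<Lambda> (F i) N)" "y \<in> carrier (MC.Y {} Ms i)" for c f y i
    using that YF[OF that(3)] value_Inj[of f i y] idem_ET
      A.scal_dual[OF e_closed[OF T] that(1), folded Inj_eq[OF T]] by (simp add: hom_space_simps N_simps)
  show "f = \<zero>\<^bsub>hom_space \<Lambda> (F i) N\<^esub>"
    if f: "f \<in> carrier (hom_space \<Lambda> (F i) N)" and 0: "\<And>y. y \<in> carrier (MC.Y {} Ms i) \<Longrightarrow> f y (e T) = \<zero>\<^bsub>K\<^esub>" for f i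
  proof -
    have f': "f \<in> lin_hom \<Lambda> (F i) N" using f by (simp add: hom_space_simps)
    have "f x = \<zero>\<^bsub>N\<^esub>" if x: "x \<in> carrier (F i)" for x
    proof -
      have "f x v = \<zero>\<^bsub>K\<^esub>" if v: "v \<in> eA" for v
      proof -
        note vX = ET_X[OF v x]
        \<comment> \<open>The value \<open>f x v\<close> equals the value at \<open>e T\<close> of
          \<open>f\<close> on an element of \<open>e T F\<close>; applying \<open>r\<close> moves
          that element into \<open>Y\<close> and leaves the value unchanged.\<close>
        have "MC.r Ms i (v \<odot>\<^bsub>F i\<^esub> x) \<in> carrier (MC.Y {} Ms i)"
          using MC.r_closed[OF sM vX] MC.q_r_zero[OF sM _ vX] by (simp add: MC.Y_carrier)
        then show ?thesis using 0 eval_r[OF f' sM vX] value_idem[OF f' x v] by simp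
      qed
      then show ?thesis
        unfolding N_simps Inj_simps(2)[OF T] using InjD(1)[OF T value_Inj[OF f' x]]
        by (intro extensionalityI[where A = eA]) simp_all
    qed
    then show ?thesis
      unfolding hom_space_simps using lin_homD(1)[OF f'] by (intro extensionalityI[where A = "carrier (F i)"]) simp_all
  qed
  show "\<exists>f\<in>carrier (hom_space \<Lambda> (F i) N). \<forall>y\<in>carrier (MC.Y {} Ms i). f y (e T) = \<gamma> y"
    if \<gamma>: "lmodule_hom K (MC.Y {} Ms i) (regular K) \<gamma>" for \<gamma> i
  proof -
    interpret \<gamma>: lmodule_hom K "MC.Y {} Ms i" "regular K" \<gamma> by fact
    have rY: "MC.r Ms i x \<in> carrier (MC.Y {} Ms i)" if "x \<in> carrier (X i)" for x
      using MC.r_closed[OF sM that] MC.q_r_zero[OF sM _ that] by (simp add: MC.Y_carrier)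
    \<comment> \<open>A functional on \<open>Y\<close> is extended to all of \<open>X\<close> by
      composing with \<open>r\<close>; the extension vanishes on the images of the projections, as
      \<open>functional_lift\<close> demands.\<close>
    have hom: "lmodule_hom K (X i) (regular K) (\<lambda>x. \<gamma> (MC.r Ms i x))"
    proof (intro lmodule_hom.intro lmodule_hom_axioms.intro X_lmodule \<gamma>.N.lmodule_axioms)
      show "\<gamma> (MC.r Ms i x) \<in> carrier (regular K)" if "x \<in> carrier (X i)" for x by (rule \<gamma>.closed[OF rY[OF that]])
      show "\<gamma> (MC.r Ms i (x \<oplus>\<^bsub>X i\<^esub> y)) = \<gamma> (MC.r Ms i x) \<oplus>\<^bsub>regular K\<^esub> \<gamma> (MC.r Ms i y)"
        if "x \<in> carrier (X i)" "y \<in> carrier (X i)" for x y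
        using MC.r_add[OF sM that] \<gamma>.add[OF rY rY] that by simp
      show "\<gamma> (MC.r Ms i (c \<odot>\<^bsub>X i\<^esub> x)) = c \<odot>\<^bsub>regular K\<^esub> \<gamma> (MC.r Ms i x)"
        if "c \<in> carrier K" "x \<in> carrier (X i)" for c x
        using MC.r_smult[OF sM that] \<gamma>.smult[OF that(1) rY[OF that(2)]] by simp
    qed
    have Gq: "\<gamma> (MC.r Ms i (q b i x)) = \<zero>\<^bsub>K\<^esub>" if "b \<in> M" "x \<in> carrier (X i)" for b x
      using MC.q_r[OF sM that] MC.q_r_zero[OF sM _ that(2)] that(1) Ms \<gamma>.zero by simp
    obtain f where f: "f \<in> lin_hom \<Lambda> (F i) N" "\<And>x. x \<in> carrier (X i) \<Longrightarrow> f x (e T) = \<gamma> (MC.r Ms i x)"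
      by (rule functional_lift[OF hom Gq]) (assumption | rule that)+
    have "f y (e T) = \<gamma> y" if "y \<in> carrier (MC.Y {} Ms i)" for y
      using f(2)[OF YX[OF that]] MC.r_id[OF sM YX[OF that]] that by (simp add: MC.Y_carrier)
    then show ?thesis using f(1) by (intro bexI[of _ f]) (simp_all add: hom_space_simps)
  qed
  show "compose (carrier (F (Suc i))) f (d i) y (e T) = f (MC.\<delta> Ms i y) (e T)"
    if "f \<in> carrier (hom_space \<Lambda> (F i) N)" "y \<in> carrier (MC.Y {} Ms (Suc i))" for f y i
    using eval_r[OF _ sM MC.d.closed[OF YX[OF that(2)]], of f] that(1) YF[OF that(2)]
    by (simp add: hom_space_simps MC.\<delta>_def compose_def)
qed

lemma ext_complex:
  fixes p defines "E \<equiv> cohomology (\<lambda>i. hom_space \<Lambda> (F i) N) (\<lambda>i f. compose (carrier (F (Suc i))) f (d i)) p"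
  shows "if (S, T) \<in> Upsilon_plus P \<and> p = omega_plus S T then E \<simeq>\<^bsub>K\<^esub> regular K else carrier E = {\<zero>\<^bsub>E\<^esub>}"
proof -
  obtain Ms where Ms: "set Ms = M"
    "if (S, T) \<in> Upsilon_plus P then line_complex K (MC.Y {} Ms) (MC.\<delta> Ms) (omega_plus S T)
     else acyclic_complex (MC.Y {} Ms) (MC.\<delta> Ms)"
    by (rule koszul_homology)
  interpret D: dual_complex K "\<lambda>i. hom_space \<Lambda> (F i) N" "\<lambda>i f. compose (carrier (F (Suc i))) f (d i)"
    "MC.Y {} Ms" "MC.\<delta> Ms" "\<lambda>i f y. f y (e T)"
    by (rule dual_complex_Y[OF Ms(1)])
  show ?thesis
  proof (cases "(S, T) \<in> Upsilon_plus P \<and> p = omega_plus S T")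
    case True
    then have "line_at K (MC.Y {} Ms) (MC.\<delta> Ms) p" using Ms(2) by (simp add: line_complex_def)
    from D.cohomology_line[OF this] True show ?thesis by (simp add: E_def)
  next
    case False
    then have "acyclic_at (MC.Y {} Ms) (MC.\<delta> Ms) p"
      using Ms(2) by (auto simp: line_complex_def acyclic_complex_def split: if_splits)
    from D.cohomology_acyclic[OF this] show ?thesis by (subst if_not_P[OF False]) (simp add: E_def)
  qed
qed

end

theorem corollary5p11:
  fixes K :: "('k, 'x) ring_scheme"
    and P :: "'p::order set"
    and S T :: "'p set"
    and p :: nat
  assumes "field K"
    and "finite P"
    and "connected_poset P"
    and "S \<in> intervals P"
    and "T \<in> intervals P"
  shows "if (S, T) \<in> Upsilon_plus P \<and> p = omega_plus S T
         then Ext (Lam K P) p (simple_L K P S) (costandard K P T)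
                \<simeq>\<^bsub>K\<^esub> det_space K (max_elements (T - S))
         else carrier (Ext (Lam K P) p (simple_L K P S) (costandard K P T)) =
                {\<zero>\<^bsub>Ext (Lam K P) p (simple_L K P S) (costandard K P T)\<^esub>}"
proof -
  interpret interval_algebra K P by (intro interval_algebra.intro interval_algebra_axioms.intro assms)
  let ?L = "simple_L K P S" and ?N = "costandard K P T"
  obtain u where u: "u \<in> carrier ?L" "gen_submodule (Lam K P) ?L {u} = carrier ?L"
    by (rule simple_L_generator[OF assms(4)]) (rule that)
  obtain n0 d0 e0 where "free_resolution (Lam K P) ?L n0 d0 e0"
    by (rule A.exists_free_resolution[of ?L "[u]"]) (use u lmodule_simple_L[OF assms(4)] in simp_all)
  then have ex: "\<exists>r. case r of (n, d, eps) \<Rightarrow> free_resolution (Lam K P) ?L n d eps" by auto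
  obtain n d eps where r: "(SOME (n, d, eps). free_resolution (Lam K P) ?L n d eps) = (n, d, eps)"
    by (metis prod_cases3)
  have "free_resolution (Lam K P) ?L n d eps" using someI_ex[OF ex] unfolding r by simp
  then interpret resolution_setup K P S T n d eps
    by (intro resolution_setup.intro resolution_setup_axioms.intro interval_algebra_axioms assms)
  have Ext_eq: "Ext (Lam K P) p ?L ?N =
      cohomology (\<lambda>i. hom_space (Lam K P) (F i) ?N) (\<lambda>i f. compose (carrier (F (Suc i))) f (d i)) p"
    by (simp add: Ext_def r)
  have "finite (max_elements (T - S))" using interval_finite[OF assms(5)] by (simp add: max_elements_def)
  note det = det_space_iso_regular[OF assms(1) this]
  obtain Ms where Ms: "set Ms = M" using finite_list[of M] interval_finite[OF assms(5)] by (auto simp: max_elements_def)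
  interpret D: dual_complex K "\<lambda>i. hom_space (Lam K P) (F i) ?N" "\<lambda>i f. compose (carrier (F (Suc i))) f (d i)"
    "MC.Y {} Ms" "MC.\<delta> Ms" "\<lambda>i f y. f y (idem K P T)"
    by (rule dual_complex_Y[OF Ms])
  interpret Q: lquotient K "hom_space (Lam K P) (F p) ?N\<lparr>carrier := D.Z p\<rparr>" "D.B p" by (rule D.lquotient_cohomology)
  show ?thesis
  proof (cases "(S, T) \<in> Upsilon_plus P \<and> p = omega_plus S T")
    case True
    from ext_complex[of p] have "Ext (Lam K P) p ?L ?N \<simeq>\<^bsub>K\<^esub> regular K" unfolding if_P[OF True] Ext_eq .
    \<comment> \<open>Both sides are lines, so they are compared through
      \<open>regular K\<close>.\<close>
    then have "Ext (Lam K P) p ?L ?N \<simeq>\<^bsub>K\<^esub> det_space K (max_elements (T - S))"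
      using mod_iso_trans[OF Q.lmodule_quot[folded D.cohomology_eq] _ mod_iso_sym[OF det]] unfolding Ext_eq by blast
    then show ?thesis unfolding if_P[OF True] .
  next
    case False
    from ext_complex[of p] show ?thesis unfolding if_not_P[OF False] Ext_eq .
  qed
qed

end
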